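(* Let $G$ be a simple algebraic group of type $C_{\ell}$ (adjoint or simply connected) over an algebraically closed field $K$ of characteristic two, with Lie algebra $\mathfrak{g}$. Let $u \in G$ be a regular unipotent element and $e \in \mathfrak{g}$ a regular nilpotent element. Then $\dim \mathfrak{g}^u = \ell+1$ and $\dim \mathfrak{g}^e = 2\ell$.
   Context: An element $x \in G$ or $x \in \mathfrak{g}$ is regular if $\dim C_G(x) = \mathrm{rank}\, G$ (with $G$ acting on itself by conjugation and on $\mathfrak{g}$ by $\mathrm{Ad}$). Here $\mathfrak{g}^u = \{X\in\mathfrak{g} : \mathrm{Ad}(u)X = X\}$ and $\mathfrak{g}^e = \{X \in \mathfrak{g} : [e,X]=0\}$. *)

theory Defs
  imports "HOL-Analysis.Analysis" "HOL-Computational_Algebra.Computational_Algebra"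
begin

text \<open>
  Linear algebraic groups over an algebraically closed field, in the classical language: they are
  Zariski closed subgroups of some general linear group, identified with their rational points.
  As the field is infinite, polynomials and regular functions are represented by the functions
  they induce.
\<close>

subsection \<open>Matrices over a field\<close>

definition mat_scale :: "'k::field \<Rightarrow> 'k^'m^'n \<Rightarrow> 'k^'m^'n" where
  "mat_scale c A = (\<chi> i j. c * A $ i $ j)"

interpretation mat_space: vector_space "mat_scale :: 'k::field \<Rightarrow> 'k^'m^'n \<Rightarrow> 'k^'m^'n"
  by unfold_locales (simp_all add: mat_scale_def vec_eq_iff algebra_simps)

text \<open>The power operation of the type class is entrywise on this type, hence the iteration.\<close>

definition nilpotent_mat :: "'k::field^'m^'m \<Rightarrow> bool" where
  "nilpotent_mat A \<longleftrightarrow> (\<exists>n. (((**) A) ^^ n) (mat 1) = 0)"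

definition unipotent_mat :: "'k::field^'m^'m \<Rightarrow> bool" where
  "unipotent_mat A \<longleftrightarrow> nilpotent_mat (A - mat 1)"


subsection \<open>Regular functions, Zariski closed sets, dimension\<close>

text \<open>The algebra of functions generated by a set \<open>C\<close> of functions.\<close>

inductive_set fun_alg :: "('x \<Rightarrow> 'k::field) set \<Rightarrow> ('x \<Rightarrow> 'k) set"
  for C :: "('x \<Rightarrow> 'k) set" where
  gen: "f \<in> C \<Longrightarrow> f \<in> fun_alg C"
| const: "(\<lambda>_. c) \<in> fun_alg C"
| add: "f \<in> fun_alg C \<Longrightarrow> g \<in> fun_alg C \<Longrightarrow> (\<lambda>x. f x + g x) \<in> fun_alg C"
| mult: "f \<in> fun_alg C \<Longrightarrow> g \<in> fun_alg C \<Longrightarrow> (\<lambda>x. f x * g x) \<in> fun_alg C"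

definition mat_entries :: "('k::field^'m^'m \<Rightarrow> 'k) set" where
  "mat_entries = {\<lambda>A. A $ i $ j | i j. True}"

definition GL :: "('k::field^'m^'m) set" where
  "GL = {A. invertible A}"

text \<open>The coordinate ring \<open>K[x\<^sub>i\<^sub>j, 1/det]\<close> of the general linear group.\<close>

definition GL_regular :: "('k::field^'m^'m \<Rightarrow> 'k) set" where
  "GL_regular = fun_alg (mat_entries \<union> {\<lambda>A. inverse (det A)})"

definition zariski_closed :: "('k::field^'m^'m) set \<Rightarrow> bool" where
  "zariski_closed Z \<longleftrightarrow> (\<exists>F \<subseteq> GL_regular. Z = {A \<in> GL. \<forall>f\<in>F. f A = 0})"

definition zariski_connected :: "('k::field^'m^'m) set \<Rightarrow> bool" where
  "zariski_connected X \<longleftrightarrow>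
     \<not> (\<exists>Y Z. zariski_closed Y \<and> zariski_closed Z \<and> X \<subseteq> Y \<union> Z \<and> Y \<inter> Z \<inter> X = {}
            \<and> Y \<inter> X \<noteq> {} \<and> Z \<inter> X \<noteq> {})"

definition alg_indep_on :: "'x set \<Rightarrow> nat \<Rightarrow> (nat \<Rightarrow> 'x \<Rightarrow> 'k::field) \<Rightarrow> bool" where
  "alg_indep_on X d f \<longleftrightarrow>
     (\<forall>p \<in> fun_alg {\<lambda>y. y i | i. i < d}. (\<forall>x\<in>X. p (\<lambda>i. f i x) = 0) \<longrightarrow> (\<forall>y. p y = 0))"

text \<open>
  The dimension of a closed set \<open>X\<close> is the maximal number of algebraically independent
  elements of its coordinate ring \<open>K[X]\<close>. For irreducible \<open>X\<close> this is the transcendence degree of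
  \<open>K(X)\<close>, in general it is the largest dimension of an irreducible component.
\<close>

definition alg_dim :: "('k::field^'m^'m) set \<Rightarrow> enat" where
  "alg_dim X = Sup {enat d | d. \<exists>f. (\<forall>i<d. f i \<in> GL_regular) \<and> alg_indep_on X d f}"


subsection \<open>Linear algebraic groups\<close>

definition algebraic_group :: "('k::field^'m^'m) set \<Rightarrow> bool" where
  "algebraic_group G \<longleftrightarrow> zariski_closed G \<and> mat 1 \<in> G
     \<and> (\<forall>A\<in>G. \<forall>B\<in>G. A ** B \<in> G) \<and> (\<forall>A\<in>G. matrix_inv A \<in> G)"

definition simple_algebraic_group :: "('k::field^'m^'m) set \<Rightarrow> bool" where
  "simple_algebraic_group G \<longleftrightarrow> algebraic_group G \<and> zariski_connected G
     \<and> (\<exists>A\<in>G. \<exists>B\<in>G. A ** B \<noteq> B ** A)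
     \<and> (\<forall>N \<subseteq> G. algebraic_group N \<and> zariski_connected N
           \<and> (\<forall>A\<in>G. \<forall>B\<in>N. A ** B ** matrix_inv A \<in> N) \<longrightarrow> N = {mat 1} \<or> N = G)"

text \<open>
  Morphisms are the maps pulling back regular functions to regular functions. Here \<open>X\<close> and \<open>Y\<close>
  are sets whose regular functions are the restrictions of the members of \<open>R\<close> and \<open>S\<close>.
\<close>

definition regular_map ::
  "('x \<Rightarrow> 'k::field) set \<Rightarrow> 'x set \<Rightarrow> ('y \<Rightarrow> 'k) set \<Rightarrow> 'y set \<Rightarrow> ('x \<Rightarrow> 'y) \<Rightarrow> bool" where
  "regular_map R X S Y \<phi> \<longleftrightarrow>
     \<phi> ` X \<subseteq> Y \<and> (\<forall>g\<in>S. \<exists>f\<in>R. \<forall>x\<in>X. g (\<phi> x) = f x)"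

text \<open>
  The inverse has to be a morphism as well: in characteristic two the bijective morphism from the
  simply connected to the adjoint group of type \<open>C\<^sub>l\<close> is not an isomorphism.
\<close>

definition group_var_iso ::
  "('x \<Rightarrow> 'k::field) set \<Rightarrow> ('x \<Rightarrow> 'x \<Rightarrow> 'x) \<Rightarrow> 'x set \<Rightarrow>
   ('y \<Rightarrow> 'k) set \<Rightarrow> ('y \<Rightarrow> 'y \<Rightarrow> 'y) \<Rightarrow> 'y set \<Rightarrow> bool" where
  "group_var_iso R mX X S mY Y \<longleftrightarrow>
     (\<exists>\<phi> \<psi>. regular_map R X S Y \<phi> \<and> regular_map S Y R X \<psi>
        \<and> (\<forall>x\<in>X. \<psi> (\<phi> x) = x) \<and> (\<forall>y\<in>Y. \<phi> (\<psi> y) = y)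
        \<and> (\<forall>x\<in>X. \<forall>x'\<in>X. \<phi> (mX x x') = mY (\<phi> x) (\<phi> x')))"

definition alg_group_iso :: "('k::field^'m^'m) set \<Rightarrow> ('k^'n^'n) set \<Rightarrow> bool" where
  "alg_group_iso G H \<longleftrightarrow> group_var_iso GL_regular (**) G GL_regular (**) H"

text \<open>The \<open>r\<close>-fold product of the multiplicative group; coordinates beyond \<open>r\<close> are set to 1.\<close>

definition Gm_pow :: "nat \<Rightarrow> (nat \<Rightarrow> 'k::field) set" where
  "Gm_pow r = {x. (\<forall>i<r. x i \<noteq> 0) \<and> (\<forall>i\<ge>r. x i = 1)}"

definition Gm_regular :: "nat \<Rightarrow> ((nat \<Rightarrow> 'k::field) \<Rightarrow> 'k) set" where
  "Gm_regular r = fun_alg ({\<lambda>x. x i | i. i < r} \<union> {\<lambda>x. inverse (x i) | i. i < r})"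

definition torus :: "nat \<Rightarrow> ('k::field^'m^'m) set \<Rightarrow> bool" where
  "torus r T \<longleftrightarrow> algebraic_group T
     \<and> group_var_iso (Gm_regular r) (\<lambda>x y i. x i * y i) (Gm_pow r) GL_regular (**) T"

text \<open>The rank is the dimension of a maximal torus.\<close>

definition alg_rank :: "('k::field^'m^'m) set \<Rightarrow> enat" where
  "alg_rank G = Sup {enat r | r. \<exists>T \<subseteq> G. torus r T}"

text \<open>
  The Lie algebra is the tangent space at the identity, as a subalgebra of the algebra of all
  matrices with the commutator bracket; the adjoint action of the group is then conjugation.
  For a polynomial \<open>f\<close>, the coefficient of \<open>t\<close> in \<open>f (1 + t X)\<close> is the differential
  of \<open>f\<close> at \<open>1\<close> in direction \<open>X\<close>.
\<close>

definition lie_algebra :: "('k::field^'m^'m) set \<Rightarrow> ('k^'m^'m) set" where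
  "lie_algebra G = {X. \<forall>f \<in> fun_alg mat_entries. (\<forall>A\<in>G. f A = 0) \<longrightarrow>
     (\<exists>q. (\<forall>t. poly q t = f (mat 1 + mat_scale t X)) \<and> coeff q 1 = 0)}"

text \<open>
  For \<open>x\<close> in \<open>G\<close> and for \<open>x\<close> in the Lie algebra of \<open>G\<close>, the centralizer is taken with
  respect to conjugation.
\<close>

definition centralizer :: "('k::field^'m^'m) set \<Rightarrow> 'k^'m^'m \<Rightarrow> ('k^'m^'m) set" where
  "centralizer G x = {A \<in> G. A ** x ** matrix_inv A = x}"

definition regular_element :: "('k::field^'m^'m) set \<Rightarrow> 'k^'m^'m \<Rightarrow> bool" where
  "regular_element G x \<longleftrightarrow> alg_dim (centralizer G x) = alg_rank G"


subsection \<open>Type \<open>C\<^sub>l\<close>\<close>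

definition symp_form :: "'k::field^('n::finite + 'n)^('n + 'n)" where
  "symp_form = (\<chi> i j. case (i, j) of
      (Inl a, Inr b) \<Rightarrow> if a = b then 1 else 0
    | (Inr a, Inl b) \<Rightarrow> if a = b then -1 else 0
    | _ \<Rightarrow> 0)"

definition Sp :: "('k::field^('n::finite + 'n)^('n + 'n)) set" where
  "Sp = {A. transpose A ** symp_form ** A = symp_form}"

text \<open>The matrix of the linear map \<open>X \<mapsto> A X A\<^sup>-\<^sup>1\<close> in the basis of matrix units.\<close>

definition conj_rep :: "'k::field^'i^'i \<Rightarrow> 'k^('i \<times> 'i)^('i \<times> 'i)" where
  "conj_rep A = (\<chi> p q. A $ fst p $ fst q * matrix_inv A $ snd q $ snd p)"

text \<open>
  The scheme-theoretic kernel of the conjugation representation of \<open>Sp\<close> on all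
  matrices is the centre \<open>\<mu>\<^sub>2\<close>, also in characteristic two, so its image is the quotient
  \<open>Sp / \<mu>\<^sub>2\<close> as an algebraic group.
\<close>

definition PSp :: "('k::field^(('n::finite + 'n) \<times> ('n + 'n))^(('n + 'n) \<times> ('n + 'n))) set" where
  "PSp = conj_rep ` Sp"

text \<open>
  Up to isomorphism of algebraic groups, the simply connected simple group of type \<open>C\<^sub>l\<close> is the
  symplectic group \<open>Sp\<close> of degree \<open>2 l\<close>, and the adjoint one is its quotient \<open>PSp\<close> by the
  scheme-theoretic centre. The index \<open>l\<close> is the cardinality of the finite type in the first argument.
\<close>

definition simply_connected_type_C :: "'n::finite itself \<Rightarrow> ('k::field^'m^'m) set \<Rightarrow> bool" where
  "simply_connected_type_C (_ :: 'n itself) G \<longleftrightarrow> simple_algebraic_group G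
     \<and> alg_group_iso G (Sp :: ('k^('n + 'n)^('n + 'n)) set)"

definition adjoint_type_C :: "'n::finite itself \<Rightarrow> ('k::field^'m^'m) set \<Rightarrow> bool" where
  "adjoint_type_C (_ :: 'n itself) G \<longleftrightarrow> simple_algebraic_group G
     \<and> alg_group_iso G (PSp :: ('k^(('n + 'n) \<times> ('n + 'n))^(('n + 'n) \<times> ('n + 'n))) set)"

end

theory Submission
  imports Defs
begin

text \<open>
  Both groups have rank at most \<open>l\<close>: a torus of rank \<open>r\<close> contains \<open>3\<^sup>r\<close> commuting elements of
  exponent three, and in the symplectic group these are simultaneously diagonalised by hyperbolic
  pairs, so that there are at most \<open>3\<^sup>l\<close> of them. Hence it suffices to exhibit a family with
  \<open>l + 1\<close> independent parameters in the centralizer of every element which is not cyclic, and to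
  compute with the cyclic ones.

  Let \<open>star\<close> be the adjoint involution of the symplectic form. For a unipotent isometry \<open>u = 1 + N\<close>
  one has \<open>y = N + star N = N * star N\<close>, and the quadratic forms \<open>x \<mapsto> B(y\<^sup>i N x, x)\<close> decide, by
  a Hensel argument, whether the module splits off a pair of dual isotropic submodules or a cyclic
  module; on both of them the centralizer contains explicit families of polynomials in \<open>N\<close>. For a nilpotent
  \<open>e\<close> with a kernel of dimension at least two the family consists of the \<open>1 + X\<close> with \<open>X\<close>
  a symmetric tensor on an \<open>e\<close>-stable Lagrangian.

  In the cyclic case the elements of the Lie algebra of \<open>Sp\<close> fixed by \<open>u\<close> are the self-adjoint
  elements of \<open>K[u]\<close>, a space of dimension \<open>l + 1\<close>, while all of \<open>K[e]\<close> is self-adjoint, which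
  gives \<open>2 l\<close>. The Lie algebra of \<open>PSp\<close> is the algebra of similitudes modulo scalars. There the
  scalars are lost, but one dimension is gained again, since differentiation of polynomials is a well
  defined operator \<open>D\<close> on the cyclic module in characteristic two and \<open>e D - D e = 1\<close>.
\<close>

text \<open>The group G is known only up to isomorphism, so the hypotheses and both conclusions have
  to be carried along a regular map. Its differential is defined through extensions of the matrix
  entries to GL, and it has to respect nilpotency and commutation in the Lie algebra. In
  characteristic two both follow from compatibility with squaring, because squaring polarises to the
  bracket, and squaring in turn comes from the square of a left invariant derivation. The Lie
  algebras of \<open>Sp\<close> and \<open>PSp\<close> are determined from both sides:
  differentiated equations bound them from above, tangents of explicit rational curves fill them. A
  further obstacle is that \<open>Sp\<close> and \<open>PSp\<close> have the same points in
  characteristic two but different coordinate rings: conjugation can be inverted as a map of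
  abstract groups, not as a morphism. Hence group elements and tori are lifted to \<open>Sp\<close>
  abstractly, Lie algebra elements are lifted modulo scalars, and independence of functions survives
  the passage to \<open>PSp\<close> because every element of K is a square.\<close>

no_notation fps_nth (infixl "$" 75)

text \<open>Over a finite field \<open>1 + ?q\<close> would be a nonconstant polynomial with the
  value 1 everywhere, as \<open>?q\<close> vanishes at every element.\<close>

lemma infinite_UNIV_alg_closed: "infinite (UNIV :: 'k::alg_closed_field set)"
proof
  assume fin: "finite (UNIV :: 'k set)"
  let ?q = "\<Prod>a\<in>(UNIV :: 'k set). [:- a, 1:]"
  have "degree ?q = (\<Sum>a\<in>(UNIV :: 'k set). degree [:- a, 1:])"
    by (rule degree_prod_eq_sum_degree) simp
  hence d: "degree ?q > 0" using fin by (simp add: card_gt_0_iff)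
  hence "degree (1 + ?q) > 0" by (subst degree_add_eq_right) simp_all
  then obtain x where "poly (1 + ?q) x = 0" using alg_closed_imp_poly_has_root by blast
  moreover have "poly ?q x = 0" using fin by (simp add: poly_prod prod_zero_iff)
  ultimately show False by simp
qed

lemma poly_eq_if_cofinite:
  fixes p q r :: "'k::alg_closed_field poly"
  assumes "r \<noteq> 0" and "\<And>t. poly r t \<noteq> 0 \<Longrightarrow> poly p t = poly q t"
  shows "p = q"
proof (rule ccontr)
  assume "p \<noteq> q"
  hence "(p - q) * r \<noteq> 0" using assms(1) by simp
  hence "finite {t. poly ((p - q) * r) t = 0}" by (rule poly_roots_finite)
  moreover have "{t. poly ((p - q) * r) t = 0} = UNIV" using assms(2) by auto
  ultimately show False using infinite_UNIV_alg_closed by metis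
qed

subsection \<open>A lower bound for the dimension\<close>

lemma fun_alg_slice:
  fixes p :: "(nat \<Rightarrow> 'k::field) \<Rightarrow> 'k"
  assumes "p \<in> fun_alg {\<lambda>y. y i | i. i < d}"
  shows "\<exists>q. \<forall>t. p (y(j := t)) = poly q t"
  using assms
proof induction
  case (gen f)
  then obtain i where f: "f = (\<lambda>y. y i)" by auto
  show ?case
  proof (cases "i = j")
    case True thus ?thesis by (intro exI[of _ "[:0, 1:]"]) (simp add: f)
  next
    case False thus ?thesis by (intro exI[of _ "[:y i:]"]) (simp add: f)
  qed
next
  case (const c)
  show ?case by (intro exI[of _ "[:c:]"]) simp
next
  case (add f g)
  then obtain a b where "\<forall>t. f (y(j := t)) = poly a t" "\<forall>t. g (y(j := t)) = poly b t" by blast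
  thus ?case by (intro exI[of _ "a + b"]) (simp only: poly_add simp_thms)
next
  case (mult f g)
  then obtain a b where "\<forall>t. f (y(j := t)) = poly a t" "\<forall>t. g (y(j := t)) = poly b t" by blast
  thus ?case by (intro exI[of _ "a * b"]) (simp only: poly_mult simp_thms)
qed

lemma fun_alg_coords_cong:
  fixes p :: "(nat \<Rightarrow> 'k::field) \<Rightarrow> 'k"
  assumes "p \<in> fun_alg {\<lambda>y. y i | i. i < d}" and "\<And>i. i < d \<Longrightarrow> y i = y' i"
  shows "p y = p y'"
  using assms(1) by induction (use assms(2) in auto)

text \<open>Coordinates are freed one at a time: on a slice in direction \<open>j\<close> the
  function is a univariate polynomial vanishing at every nonzero argument, hence
  identically.\<close>

lemma fun_alg_zero_if_zero_on_units:
  fixes p :: "(nat \<Rightarrow> 'k::alg_closed_field) \<Rightarrow> 'k"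
  assumes p: "p \<in> fun_alg {\<lambda>y. y i | i. i < d}"
    and zero: "\<And>y. (\<And>i. i < d \<Longrightarrow> y i \<noteq> 0) \<Longrightarrow> p y = 0"
  shows "p y = 0"
proof -
  have "\<forall>y. (\<forall>i. j \<le> i \<and> i < d \<longrightarrow> y i \<noteq> 0) \<longrightarrow> p y = 0" for j
  proof (induction j)
    case 0 thus ?case using zero by simp
  next
    case (Suc j)
    show ?case
    proof (intro allI impI)
      fix y :: "nat \<Rightarrow> 'k" assume y: "\<forall>i. Suc j \<le> i \<and> i < d \<longrightarrow> y i \<noteq> 0"
      obtain q where q: "\<And>t. p (y(j := t)) = poly q t" using fun_alg_slice[OF p] by metis
      have "poly q t = 0" if "poly [:0, 1:] t \<noteq> 0" for t
        using Suc.IH[rule_format, of "y(j := t)"] y that by (auto simp: q Suc_le_eq)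
      hence "q = 0" by (intro poly_eq_if_cofinite[of "[:0, 1:]"]) auto
      thus "p y = 0" using q[of "y j"] by simp
    qed
  qed
  from this[of d] show ?thesis by auto
qed

text \<open>The values of the functions on \<open>X\<close> cover the open torus of affine
  \<open>d\<close>-space, on which only the zero polynomial vanishes. Asking for nonzero values only
  leaves room for families parametrised by units.\<close>

lemma alg_dim_geI:
  fixes X :: "('k::alg_closed_field^'m^'m) set"
  assumes reg: "\<And>i. i < d \<Longrightarrow> f i \<in> GL_regular"
    and fat: "\<And>c. (\<And>i. i < d \<Longrightarrow> c i \<noteq> 0) \<Longrightarrow> \<exists>A\<in>X. \<forall>i<d. f i A = c i"
  shows "enat d \<le> alg_dim X"
  unfolding alg_dim_def
proof (rule Sup_upper, rule CollectI, rule exI[of _ d], rule conjI[OF refl], rule exI[of _ f], rule conjI)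
  show "\<forall>i<d. f i \<in> GL_regular" using reg by blast
  show "alg_indep_on X d f"
    unfolding alg_indep_on_def
  proof (intro ballI impI allI)
    fix p :: "(nat \<Rightarrow> 'k) \<Rightarrow> 'k" and y
    assume p: "p \<in> fun_alg {\<lambda>y. y i |i. i < d}" and z: "\<forall>x\<in>X. p (\<lambda>i. f i x) = 0"
    show "p y = 0"
    proof (rule fun_alg_zero_if_zero_on_units[OF p])
      fix c :: "nat \<Rightarrow> 'k" assume "\<And>i. i < d \<Longrightarrow> c i \<noteq> 0"
      then obtain A where "A \<in> X" "\<forall>i<d. f i A = c i" using fat by blast
      moreover have "p (\<lambda>i. f i A) = p c"
        using \<open>\<forall>i<d. f i A = c i\<close> by (intro fun_alg_coords_cong[OF p]) simp
      ultimately show "p c = 0" using z by metis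
    qed
  qed
qed

lemma alg_dim_mono:
  fixes X Y :: "('k::field^'m^'m) set"
  assumes "X \<subseteq> Y" shows "alg_dim X \<le> alg_dim Y"
proof -
  have "alg_indep_on Y d f" if "alg_indep_on X d f" for d f
    using that assms unfolding alg_indep_on_def by (meson subsetD)
  thus ?thesis unfolding alg_dim_def 
    by (intro Sup_subset_mono Collect_mono impI) (elim exE conjE, intro exI conjI)
qed

subsection \<open>Differentials of regular functions\<close>

text \<open>The value \<open>d\<close> is the derivative at \<open>0\<close> of a function of one variable which agrees near \<open>0\<close>
  with the rational function \<open>p / q\<close>, normalised by \<open>q(0) = 1\<close>.\<close>

definition has_D :: "('k::field \<Rightarrow> 'k) \<Rightarrow> 'k \<Rightarrow> bool" where
  "has_D g d \<longleftrightarrow> (\<exists>p q. coeff q 0 = 1 \<and> (\<forall>t. poly q t \<noteq> 0 \<longrightarrow> g t * poly q t = poly p t)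
      \<and> d = coeff p 1 - coeff p 0 * coeff q 1)"

lemma has_D_unique:
  fixes g :: "'k::alg_closed_field \<Rightarrow> 'k"
  assumes "has_D g d" and "has_D g e"
  shows "d = e"
proof -
  obtain p q where p: "coeff q 0 = 1" "\<And>t. poly q t \<noteq> 0 \<Longrightarrow> g t * poly q t = poly p t"
    "d = coeff p 1 - coeff p 0 * coeff q 1" using assms(1) unfolding has_D_def by blast
  obtain r s where r: "coeff s 0 = 1" "\<And>t. poly s t \<noteq> 0 \<Longrightarrow> g t * poly s t = poly r t"
    "e = coeff r 1 - coeff r 0 * coeff s 1" using assms(2) unfolding has_D_def by blast
  \<comment> \<open>Cross-multiplied, the two representations agree off the finitely many zeros of
    the denominators, which suffices over an infinite field. The two lowest coefficients then
    determine the derivative.\<close>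
  have "p * s = r * q"
  proof (rule poly_eq_if_cofinite[of "q * s"])
    show "q * s \<noteq> 0" using p(1) r(1) by auto
    fix t assume "poly (q * s) t \<noteq> 0"
    hence "g t * poly q t = poly p t" "g t * poly s t = poly r t" using p(2) r(2) by auto
    moreover have "g t * poly q t * poly s t = g t * poly s t * poly q t" by (simp add: ac_simps)
    ultimately show "poly (p * s) t = poly (r * q) t" by simp
  qed
  hence "coeff (p * s) 0 = coeff (r * q) 0" "coeff (p * s) 1 = coeff (r * q) 1" by simp_all
  hence "coeff p 0 = coeff r 0"
    "coeff p 1 + coeff p 0 * coeff s 1 = coeff r 1 + coeff r 0 * coeff q 1"
    using p(1) r(1) by (auto simp: coeff_mult atMost_Suc algebra_simps)
  hence "d - e = 0" unfolding p(3) r(3) by (simp add: algebra_simps)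
  thus ?thesis by simp
qed

lemma has_D_cong:
  assumes "has_D g d" and "poly r 0 \<noteq> 0" and "\<And>t. poly r t \<noteq> 0 \<Longrightarrow> g t = h t"
  shows "has_D h d"
proof -
  obtain p q where p: "coeff q 0 = 1" "\<And>t. poly q t \<noteq> 0 \<Longrightarrow> g t * poly q t = poly p t"
    "d = coeff p 1 - coeff p 0 * coeff q 1" using assms(1) unfolding has_D_def by blast
  define s where "s = smult (inverse (poly r 0)) r"
  have s0: "coeff s 0 = 1" using assms(2) by (simp add: s_def poly_0_coeff_0)
  show ?thesis unfolding has_D_def
  proof (intro exI conjI allI impI)
    show "coeff (q * s) 0 = 1" using s0 p(1) by (simp add: coeff_mult)
    fix t assume "poly (q * s) t \<noteq> 0"
    hence "g t * poly q t = poly p t" "g t = h t" using p(2)[of t] assms(3)[of t] by (auto simp: s_def)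
    thus "h t * poly (q * s) t = poly (p * s) t" by (simp add: ac_simps)
  next
    show "d = coeff (p * s) 1 - coeff (p * s) 0 * coeff (q * s) 1"
      using p s0 by (simp add: coeff_mult atMost_Suc algebra_simps)
  qed
qed

lemma has_D_poly: "has_D (poly p) (coeff p 1)"
  unfolding has_D_def by (intro exI[of _ p] exI[of _ 1]) simp

lemma has_D_const: "has_D (\<lambda>_. c) 0"
proof -
  have "poly [:c:] = (\<lambda>_. c)" by (rule ext) simp
  thus ?thesis using has_D_poly[of "[:c:]"] by simp
qed

lemma has_D_affine: "has_D (\<lambda>t. a + t * b) b"
proof -
  have "poly [:a, b:] = (\<lambda>t. a + t * b)" by (rule ext) simp
  thus ?thesis using has_D_poly[of "[:a, b:]"] by simp
qed

lemma has_D_add: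
  assumes "has_D g d" and "has_D h e" shows "has_D (\<lambda>t. g t + h t) (d + e)"
proof -
  obtain p q where p: "coeff q 0 = 1" "\<And>t. poly q t \<noteq> 0 \<Longrightarrow> g t * poly q t = poly p t"
    "d = coeff p 1 - coeff p 0 * coeff q 1" using assms(1) unfolding has_D_def by blast
  obtain r s where r: "coeff s 0 = 1" "\<And>t. poly s t \<noteq> 0 \<Longrightarrow> h t * poly s t = poly r t"
    "e = coeff r 1 - coeff r 0 * coeff s 1" using assms(2) unfolding has_D_def by blast
  show ?thesis unfolding has_D_def
  proof (intro exI conjI allI impI)
    show "coeff (q * s) 0 = 1" using r p(1) by (simp add: coeff_mult)
    fix t assume "poly (q * s) t \<noteq> 0"
    hence "g t * poly q t = poly p t" "h t * poly s t = poly r t" using p(2) r(2) by auto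
    moreover have "(g t + h t) * poly (q * s) t = (g t * poly q t) * poly s t + (h t * poly s t) * poly q t"
      by (simp add: algebra_simps)
    ultimately show "(g t + h t) * poly (q * s) t = poly (p * s + r * q) t" by simp
  next
    show "d + e = coeff (p * s + r * q) 1 - coeff (p * s + r * q) 0 * coeff (q * s) 1"
      unfolding p(3) r(3) using p(1) r(1) by (simp add: coeff_mult atMost_Suc algebra_simps)
  qed
qed

lemma has_D_mult:
  assumes "has_D g d" and "has_D h e" shows "has_D (\<lambda>t. g t * h t) (d * h 0 + g 0 * e)"
proof -
  obtain p q where p: "coeff q 0 = 1" "\<And>t. poly q t \<noteq> 0 \<Longrightarrow> g t * poly q t = poly p t"
    "d = coeff p 1 - coeff p 0 * coeff q 1" using assms(1) unfolding has_D_def by blast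
  obtain r s where r: "coeff s 0 = 1" "\<And>t. poly s t \<noteq> 0 \<Longrightarrow> h t * poly s t = poly r t"
    "e = coeff r 1 - coeff r 0 * coeff s 1" using assms(2) unfolding has_D_def by blast
  have gh: "g 0 = coeff p 0" "h 0 = coeff r 0" using p(2)[of 0] r(2)[of 0] p(1) r(1)
    by (auto simp: poly_0_coeff_0)
  show ?thesis unfolding has_D_def
  proof (intro exI conjI allI impI)
    show "coeff (q * s) 0 = 1" using r p(1) by (simp add: coeff_mult)
    fix t assume "poly (q * s) t \<noteq> 0"
    hence "g t * poly q t = poly p t" "h t * poly s t = poly r t" using p(2) r(2) by auto
    moreover have "(g t * h t) * poly (q * s) t = (g t * poly q t) * (h t * poly s t)"
      by (simp add: algebra_simps)
    ultimately show "(g t * h t) * poly (q * s) t = poly (p * r) t" by simp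
  next
    show "d * h 0 + g 0 * e = coeff (p * r) 1 - coeff (p * r) 0 * coeff (q * s) 1"
      unfolding p(3) r(3) gh using p(1) r(1) by (simp add: coeff_mult atMost_Suc algebra_simps)
  qed
qed

lemma has_D_inverse:
  assumes "has_D g d" and "g 0 \<noteq> 0"
  shows "has_D (\<lambda>t. inverse (g t)) (- d * (inverse (g 0))\<^sup>2)"
proof -
  obtain p q where p: "coeff q 0 = 1" "\<And>t. poly q t \<noteq> 0 \<Longrightarrow> g t * poly q t = poly p t"
    "d = coeff p 1 - coeff p 0 * coeff q 1" using assms(1) unfolding has_D_def by blast
  have g: "g 0 = coeff p 0" using p(2)[of 0] p(1) by (auto simp: poly_0_coeff_0)
  define i where "i = inverse (coeff p 0)"
  have i: "i * coeff p 0 = 1" using assms(2) g by (simp add: i_def)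
  show ?thesis unfolding has_D_def
  proof (intro exI conjI allI impI)
    \<comment> \<open>The denominator is a multiple of \<open>p * q\<close> rather than of
      \<open>p\<close> alone: where it is nonzero, \<open>q\<close> is nonzero too, so that the
      relation between \<open>g\<close>, \<open>p\<close> and \<open>q\<close> may be used.\<close>
    show "coeff (smult i (p * q)) 0 = 1" using p i by (simp add: coeff_mult)
    fix t assume "poly (smult i (p * q)) t \<noteq> 0"
    moreover from this have gt: "g t * poly q t = poly p t" using p(2)[of t] by simp
    ultimately have "g t \<noteq> 0" by auto
    with gt have gt: "g t * poly q t = poly p t" "g t \<noteq> 0" by simp_all
    have "poly (smult i (p * q)) t = i * (g t * poly q t) * poly q t" using gt(1) by (simp add: mult.assoc)
    thus "inverse (g t) * poly (smult i (p * q)) t = poly (smult i (q * q)) t"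
      using gt(2) by (simp add: field_simps)
  next
    have "coeff (smult i (q * q)) 1 - coeff (smult i (q * q)) 0 * coeff (smult i (p * q)) 1
       = i * (coeff q 1 + coeff q 1) - i * i * (coeff p 1 + coeff p 0 * coeff q 1)"
      using p by (simp add: coeff_mult atMost_Suc algebra_simps)
    also have "i * (coeff q 1 + coeff q 1) = i * i * coeff p 0 * (coeff q 1 + coeff q 1)"
      using i by (simp add: mult.assoc)
    finally show "- d * (inverse (g 0))\<^sup>2 = coeff (smult i (q * q)) 1
         - coeff (smult i (q * q)) 0 * coeff (smult i (p * q)) 1"
      unfolding p(3) g i_def[symmetric] by (simp add: power2_eq_square algebra_simps)
  qed
qed

section \<open>Closure and induction rules for regular functions\<close>

lemma fun_alg_mono: "C \<subseteq> C' \<Longrightarrow> fun_alg C \<subseteq> fun_alg C'"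
proof
  fix f assume "C \<subseteq> C'" "f \<in> fun_alg C"
  from this(2,1) show "f \<in> fun_alg C'"
    by induction (auto intro: fun_alg.intros)
qed

lemma fun_alg_sum: "finite S \<Longrightarrow> (\<And>i. i \<in> S \<Longrightarrow> f i \<in> fun_alg C) \<Longrightarrow> (\<lambda>x. \<Sum>i\<in>S. f i x) \<in> fun_alg C"
proof (induction S rule: finite_induct)
  case empty
  show ?case using fun_alg.const[of 0 C] by simp
next
  case (insert a S)
  thus ?case using fun_alg.add[of "f a" C "\<lambda>x. \<Sum>i\<in>S. f i x"] by simp
qed

lemma fun_alg_prod: "finite S \<Longrightarrow> (\<And>i. i \<in> S \<Longrightarrow> f i \<in> fun_alg C) \<Longrightarrow> (\<lambda>x. \<Prod>i\<in>S. f i x) \<in> fun_alg C"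
proof (induction S rule: finite_induct)
  case empty
  show ?case using fun_alg.const[of 1 C] by simp
next
  case (insert a S)
  thus ?case using fun_alg.mult[of "f a" C "\<lambda>x. \<Prod>i\<in>S. f i x"] by simp
qed

lemma fun_alg_cmult: "f \<in> fun_alg C \<Longrightarrow> (\<lambda>x. c * f x) \<in> fun_alg C"
  using fun_alg.mult[OF fun_alg.const] .

lemma fun_alg_diff: "f \<in> fun_alg C \<Longrightarrow> g \<in> fun_alg C \<Longrightarrow> (\<lambda>x. f x - g x) \<in> fun_alg C"
  using fun_alg.add[of f C "\<lambda>x. (-1) * g x"] fun_alg_cmult[of g C "-1"] by simp

lemma fun_alg_power: "f \<in> fun_alg C \<Longrightarrow> (\<lambda>x. f x ^ n) \<in> fun_alg C"
  by (induction n) (auto intro: fun_alg.intros)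

lemma entry_in_poly: "(\<lambda>A. A $ i $ j) \<in> fun_alg mat_entries"
  by (rule fun_alg.gen) (auto simp: mat_entries_def)

lemma poly_subset_regular: "fun_alg mat_entries \<subseteq> (GL_regular :: ('k::field^'m^'m \<Rightarrow> 'k) set)"
  unfolding GL_regular_def by (rule fun_alg_mono) blast

lemma det_in_poly: "det \<in> fun_alg (mat_entries :: ('k::field^'m^'m \<Rightarrow> 'k) set)"
proof -
  have "(\<lambda>A :: 'k^'m^'m. \<Sum>p\<in>{p. p permutes (UNIV :: 'm set)}. of_int (sign p) * (\<Prod>i\<in>UNIV. A $ i $ p i))
      \<in> fun_alg mat_entries"
    by (intro fun_alg_sum fun_alg_cmult fun_alg_prod entry_in_poly) (simp_all add: finite_permutations)
  thus ?thesis by (simp add: det_def[abs_def])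
qed

lemma inverse_det_in_regular: "(\<lambda>A. inverse (det A)) \<in> GL_regular"
  unfolding GL_regular_def by (rule fun_alg.gen) simp

lemma GL_regular_induct [consumes 1, case_names entry det const add mult]:
  fixes P :: "('k::field^'m^'m \<Rightarrow> 'k) \<Rightarrow> bool"
  assumes "f \<in> GL_regular"
    and "\<And>i j. P (\<lambda>A. A $ i $ j)" and "P (\<lambda>A. inverse (det A))" and "\<And>c. P (\<lambda>_. c)"
    and "\<And>f g. f \<in> GL_regular \<Longrightarrow> g \<in> GL_regular \<Longrightarrow> P f \<Longrightarrow> P g \<Longrightarrow> P (\<lambda>A. f A + g A)"
    and "\<And>f g. f \<in> GL_regular \<Longrightarrow> g \<in> GL_regular \<Longrightarrow> P f \<Longrightarrow> P g \<Longrightarrow> P (\<lambda>A. f A * g A)"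
  shows "P f"
  using assms(1) unfolding GL_regular_def
  by induction (use assms in \<open>auto simp: mat_entries_def GL_regular_def\<close>)

lemma poly_induct [consumes 1, case_names entry const add mult]:
  fixes P :: "('k::field^'m^'m \<Rightarrow> 'k) \<Rightarrow> bool"
  assumes "f \<in> fun_alg mat_entries"
    and "\<And>i j. P (\<lambda>A. A $ i $ j)" and "\<And>c. P (\<lambda>_. c)"
    and "\<And>f g. f \<in> fun_alg mat_entries \<Longrightarrow> g \<in> fun_alg mat_entries \<Longrightarrow> P f \<Longrightarrow> P g \<Longrightarrow> P (\<lambda>A. f A + g A)"
    and "\<And>f g. f \<in> fun_alg mat_entries \<Longrightarrow> g \<in> fun_alg mat_entries \<Longrightarrow> P f \<Longrightarrow> P g \<Longrightarrow> P (\<lambda>A. f A * g A)"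
  shows "P f"
  using assms(1) by induction (use assms in \<open>auto simp: mat_entries_def\<close>)

section \<open>Directional derivatives and the chain rule along curves\<close>

definition path_D :: "('k::field \<Rightarrow> 'k^'m^'n) \<Rightarrow> 'k^'m^'n \<Rightarrow> bool" where
  "path_D \<gamma> B \<longleftrightarrow> (\<forall>i j. has_D (\<lambda>t. \<gamma> t $ i $ j) (B $ i $ j))"

definition DD :: "('k::field^'m^'m \<Rightarrow> 'k) \<Rightarrow> 'k^'m^'m \<Rightarrow> 'k^'m^'m \<Rightarrow> 'k" where
  "DD f A B = (THE d. has_D (\<lambda>t. f (A + mat_scale t B)) d)"

lemma path_D_line: "path_D (\<lambda>t. A + mat_scale t B) B"
  unfolding path_D_def by (auto simp: mat_scale_def intro: has_D_affine)

text \<open>The function \<open>f'\<close> is chosen before the curve, so the derivative along a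
  curve depends only on its starting point and velocity. Polynomials are treated first, because the
  inverse of \<open>det\<close> needs the derivative of \<open>det\<close>.\<close>

lemma regular_has_D_ex:
  fixes f :: "'k::alg_closed_field^'m^'m \<Rightarrow> 'k"
  assumes "f \<in> GL_regular"
  shows "\<exists>f'. \<forall>\<gamma> B. path_D \<gamma> B \<longrightarrow> det (\<gamma> 0) \<noteq> 0 \<longrightarrow> has_D (\<lambda>t. f (\<gamma> t)) (f' (\<gamma> 0) B)"
proof -
  have poly: "\<exists>f'. \<forall>\<gamma> B. path_D \<gamma> B \<longrightarrow> has_D (\<lambda>t. f (\<gamma> t)) (f' (\<gamma> 0) B)"
    if "f \<in> fun_alg mat_entries" for f :: "'k^'m^'m \<Rightarrow> 'k"
    using that
  proof (induction rule: poly_induct)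
    case (entry i j)
    show ?case by (intro exI[of _ "\<lambda>A B. B $ i $ j"]) (simp add: path_D_def)
  next
    case (const c)
    show ?case by (intro exI[of _ "\<lambda>A B. 0"]) (simp add: has_D_const)
  next
    case (add f g)
    then obtain f' g' where "\<forall>\<gamma> B. path_D \<gamma> B \<longrightarrow> has_D (\<lambda>t. f (\<gamma> t)) (f' (\<gamma> 0) B)"
      "\<forall>\<gamma> B. path_D \<gamma> B \<longrightarrow> has_D (\<lambda>t. g (\<gamma> t)) (g' (\<gamma> 0) B)" by blast
    thus ?case by (intro exI[of _ "\<lambda>A B. f' A B + g' A B"]) (auto intro: has_D_add)
  next
    case (mult f g)
    then obtain f' g' where "\<forall>\<gamma> B. path_D \<gamma> B \<longrightarrow> has_D (\<lambda>t. f (\<gamma> t)) (f' (\<gamma> 0) B)"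
      "\<forall>\<gamma> B. path_D \<gamma> B \<longrightarrow> has_D (\<lambda>t. g (\<gamma> t)) (g' (\<gamma> 0) B)" by blast
    thus ?case by (intro exI[of _ "\<lambda>A B. f' A B * g A + f A * g' A B"])
        (auto intro: has_D_mult)
  qed
  from assms show ?thesis
  proof (induction rule: GL_regular_induct)
    case (entry i j)
    show ?case by (intro exI[of _ "\<lambda>A B. B $ i $ j"]) (simp add: path_D_def)
  next
    case det
    obtain f' where "\<forall>\<gamma> B. path_D \<gamma> B \<longrightarrow> has_D (\<lambda>t. det (\<gamma> t :: 'k^'m^'m)) (f' (\<gamma> 0) B)"
      using poly[OF det_in_poly] by blast
    thus ?case
      by (intro exI[of _ "\<lambda>A B. - f' A B * (inverse (det A))\<^sup>2"] allI impI has_D_inverse) simp_all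
  next
    case (const c)
    show ?case by (intro exI[of _ "\<lambda>A B. 0"]) (simp add: has_D_const)
  next
    case (add f g)
    then obtain f' g' where "\<forall>\<gamma> B. path_D \<gamma> B \<longrightarrow> det (\<gamma> 0) \<noteq> 0 \<longrightarrow> has_D (\<lambda>t. f (\<gamma> t)) (f' (\<gamma> 0) B)"
      "\<forall>\<gamma> B. path_D \<gamma> B \<longrightarrow> det (\<gamma> 0) \<noteq> 0 \<longrightarrow> has_D (\<lambda>t. g (\<gamma> t)) (g' (\<gamma> 0) B)" by blast
    thus ?case by (intro exI[of _ "\<lambda>A B. f' A B + g' A B"]) (auto intro: has_D_add)
  next
    case (mult f g)
    then obtain f' g' where "\<forall>\<gamma> B. path_D \<gamma> B \<longrightarrow> det (\<gamma> 0) \<noteq> 0 \<longrightarrow> has_D (\<lambda>t. f (\<gamma> t)) (f' (\<gamma> 0) B)"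
      "\<forall>\<gamma> B. path_D \<gamma> B \<longrightarrow> det (\<gamma> 0) \<noteq> 0 \<longrightarrow> has_D (\<lambda>t. g (\<gamma> t)) (g' (\<gamma> 0) B)" by blast
    thus ?case by (intro exI[of _ "\<lambda>A B. f' A B * g A + f A * g' A B"])
        (auto intro: has_D_mult)
  qed
qed

lemma GL_iff_det: "A \<in> GL \<longleftrightarrow> det (A :: 'k::field^'m^'m) \<noteq> 0"
  by (simp add: GL_def invertible_det_nz)

lemma regular_has_D:
  fixes f :: "'k::alg_closed_field^'m^'m \<Rightarrow> 'k"
  assumes f: "f \<in> GL_regular" and \<gamma>: "path_D \<gamma> B" "\<gamma> 0 \<in> GL"
  shows "has_D (\<lambda>t. f (\<gamma> t)) (DD f (\<gamma> 0) B)"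
proof -
  obtain f' where f': "\<And>\<gamma> B. path_D \<gamma> B \<Longrightarrow> det (\<gamma> 0) \<noteq> 0 \<Longrightarrow> has_D (\<lambda>t. f (\<gamma> t)) (f' (\<gamma> 0) B)"
    using regular_has_D_ex[OF f] by blast
  have "has_D (\<lambda>t. f (\<gamma> 0 + mat_scale t B)) (f' (\<gamma> 0) B)"
    using f'[OF path_D_line[of "\<gamma> 0" B]] \<gamma> by (simp add: GL_iff_det)
  hence "DD f (\<gamma> 0) B = f' (\<gamma> 0) B" unfolding DD_def by (blast intro: has_D_unique)
  thus ?thesis using f'[OF \<gamma>(1)] \<gamma>(2) by (simp add: GL_iff_det)
qed

lemma DD_unique:
  fixes f :: "'k::alg_closed_field^'m^'m \<Rightarrow> 'k"
  assumes "f \<in> GL_regular" and "path_D \<gamma> B" "\<gamma> 0 \<in> GL" and "has_D (\<lambda>t. f (\<gamma> t)) d"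
  shows "DD f (\<gamma> 0) B = d"
  using regular_has_D[OF assms(1-3)] assms(4) by (rule has_D_unique)

lemma DD_line:
  fixes f :: "'k::alg_closed_field^'m^'m \<Rightarrow> 'k"
  shows "f \<in> GL_regular \<Longrightarrow> A \<in> GL \<Longrightarrow> has_D (\<lambda>t. f (A + mat_scale t B)) (DD f A B)"
  using regular_has_D[OF _ path_D_line[of A B]] by simp

lemma DD_eqI:
  fixes f :: "'k::alg_closed_field^'m^'m \<Rightarrow> 'k"
  shows "f \<in> GL_regular \<Longrightarrow> A \<in> GL \<Longrightarrow> has_D (\<lambda>t. f (A + mat_scale t B)) d \<Longrightarrow> DD f A B = d"
  using DD_unique[OF _ path_D_line[of A B]] by simp

lemma regular_intros:
  "f \<in> GL_regular \<Longrightarrow> g \<in> GL_regular \<Longrightarrow> (\<lambda>A. f A + g A) \<in> GL_regular"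
  "f \<in> GL_regular \<Longrightarrow> g \<in> GL_regular \<Longrightarrow> (\<lambda>A. f A * g A) \<in> GL_regular"
  "f \<in> GL_regular \<Longrightarrow> g \<in> GL_regular \<Longrightarrow> (\<lambda>A. f A - g A) \<in> GL_regular"
  "f \<in> GL_regular \<Longrightarrow> (\<lambda>A. c * f A) \<in> GL_regular"
  "f \<in> GL_regular \<Longrightarrow> (\<lambda>A. f A ^ n) \<in> GL_regular"
  "(\<lambda>A. c) \<in> GL_regular"
  "(\<lambda>A. A $ i $ j) \<in> GL_regular"
  "(\<lambda>A. inverse (det A)) \<in> GL_regular"
  subgoal unfolding GL_regular_def by (rule fun_alg.add)
  subgoal unfolding GL_regular_def by (rule fun_alg.mult)
  subgoal unfolding GL_regular_def by (rule fun_alg_diff)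
  subgoal unfolding GL_regular_def by (rule fun_alg_cmult)
  subgoal unfolding GL_regular_def by (rule fun_alg_power)
  subgoal unfolding GL_regular_def by (rule fun_alg.const)
  subgoal by (rule subsetD[OF poly_subset_regular entry_in_poly])
  subgoal by (rule inverse_det_in_regular)
  done

lemma regular_sum: "finite S \<Longrightarrow> (\<And>i. i \<in> S \<Longrightarrow> f i \<in> GL_regular) \<Longrightarrow> (\<lambda>x. \<Sum>i\<in>S. f i x) \<in> GL_regular"
  unfolding GL_regular_def by (rule fun_alg_sum)

lemma poly_line:
  fixes f :: "'k::field^'m^'m \<Rightarrow> 'k"
  assumes "f \<in> fun_alg mat_entries"
  shows "\<exists>r. \<forall>t. f (A + mat_scale t B) = poly r t"
  using assms
proof (induction rule: poly_induct)
  case (entry i j)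
  show ?case by (intro exI[of _ "[:A $ i $ j, B $ i $ j:]"]) (simp add: mat_scale_def)
next
  case (const c)
  show ?case by (intro exI[of _ "[:c:]"]) simp
next
  case (add f g)
  then obtain a b where "\<forall>t. f (A + mat_scale t B) = poly a t" "\<forall>t. g (A + mat_scale t B) = poly b t"
    by blast
  thus ?case by (intro exI[of _ "a + b"]) (simp only: poly_add simp_thms)
next
  case (mult f g)
  then obtain a b where "\<forall>t. f (A + mat_scale t B) = poly a t" "\<forall>t. g (A + mat_scale t B) = poly b t"
    by blast
  thus ?case by (intro exI[of _ "a * b"]) (simp only: poly_mult simp_thms)
qed

text \<open>A line through a point of GL leaves GL only at the zeros of a polynomial that is nonzero
  at 0, so values off GL are invisible to \<open>DD\<close>.\<close>

lemma DD_cong: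
  fixes f g :: "'k::alg_closed_field^'m^'m \<Rightarrow> 'k"
  assumes "f \<in> GL_regular" "g \<in> GL_regular" "A \<in> GL" and eq: "\<And>A. A \<in> GL \<Longrightarrow> f A = g A"
  shows "DD f A B = DD g A B"
proof -
  obtain r where r: "\<And>t. det (A + mat_scale t B) = poly r t" using poly_line[OF det_in_poly] by blast
  have z: "A + mat_scale 0 B = A" by (simp add: mat_scale_def vec_eq_iff)
  show ?thesis
  proof (rule DD_eqI[OF assms(1,3)], rule has_D_cong[of _ _ r])
    show "has_D (\<lambda>t. g (A + mat_scale t B)) (DD g A B)" using assms by (intro DD_line)
    show "poly r 0 \<noteq> 0" using r[of 0] assms(3) by (simp add: z GL_iff_det)
    fix t assume "poly r t \<noteq> 0"
    thus "g (A + mat_scale t B) = f (A + mat_scale t B)" using eq r[of t] by (simp add: GL_iff_det)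
  qed
qed

lemma DD_rules:
  fixes f g :: "'k::alg_closed_field^'m^'m \<Rightarrow> 'k"
  assumes A: "A \<in> GL"
  shows DD_const: "DD (\<lambda>_. c) A B = 0"
    and DD_entry: "DD (\<lambda>A. A $ i $ j) A B = B $ i $ j"
    and DD_add: "f \<in> GL_regular \<Longrightarrow> g \<in> GL_regular \<Longrightarrow> DD (\<lambda>A. f A + g A) A B = DD f A B + DD g A B"
    and DD_mult: "f \<in> GL_regular \<Longrightarrow> g \<in> GL_regular \<Longrightarrow>
      DD (\<lambda>A. f A * g A) A B = DD f A B * g A + f A * DD g A B"
    and DD_cmult: "f \<in> GL_regular \<Longrightarrow> DD (\<lambda>A. c * f A) A B = c * DD f A B"
    and DD_diff: "f \<in> GL_regular \<Longrightarrow> g \<in> GL_regular \<Longrightarrow> DD (\<lambda>A. f A - g A) A B = DD f A B - DD g A B"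
proof -
  have z: "A + mat_scale 0 B = A" by (simp add: mat_scale_def vec_eq_iff)
  show c: "DD (\<lambda>_. c) A B = 0" for c
    by (rule DD_eqI[OF _ A]) (auto intro: regular_intros has_D_const)
  show "DD (\<lambda>A. A $ i $ j) A B = B $ i $ j"
    by (rule DD_eqI[OF _ A]) (auto intro: regular_intros has_D_affine simp: mat_scale_def)
  show add: "DD (\<lambda>A. f A + g A) A B = DD f A B + DD g A B" if "f \<in> GL_regular" "g \<in> GL_regular" for f g
    by (rule DD_eqI[OF _ A]) (use that A in \<open>auto intro: regular_intros has_D_add DD_line\<close>)
  show mult: "DD (\<lambda>A. f A * g A) A B = DD f A B * g A + f A * DD g A B"
    if "f \<in> GL_regular" "g \<in> GL_regular" for f g
    using has_D_mult[OF DD_line[OF that(1) A, of B] DD_line[OF that(2) A, of B]]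
    by (intro DD_eqI[OF _ A]) (use that in \<open>auto intro: regular_intros simp: z\<close>)
  show cm: "DD (\<lambda>A. c * f A) A B = c * DD f A B" if "f \<in> GL_regular" for f c
    using mult[OF _ that, of "\<lambda>_. c"] by (simp add: c regular_intros)
  show "DD (\<lambda>A. f A - g A) A B = DD f A B - DD g A B" if "f \<in> GL_regular" "g \<in> GL_regular"
    using add[OF that(1), of "\<lambda>A. (-1) * g A"] cm[OF that(2), of "-1"] that
      regular_intros(4)[OF that(2), of "-1"] by simp
qed

lemma DD_sum:
  fixes f :: "'i \<Rightarrow> 'k::alg_closed_field^'m^'m \<Rightarrow> 'k"
  assumes A: "A \<in> GL" and "finite S" and "\<And>i. i \<in> S \<Longrightarrow> f i \<in> GL_regular"
  shows "DD (\<lambda>A. \<Sum>i\<in>S. f i A) A B = (\<Sum>i\<in>S. DD (f i) A B)"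
  using assms(2,3) by (induction S rule: finite_induct) (simp_all add: DD_const[OF A] DD_add[OF A] regular_sum)

lemma det_in_regular: "det \<in> GL_regular"
  by (rule subsetD[OF poly_subset_regular det_in_poly])

lemma DD_inverse_det:
  fixes A :: "'k::alg_closed_field^'m^'m"
  assumes A: "A \<in> GL"
  shows "DD (\<lambda>A. inverse (det A)) A B = - DD det A B * (inverse (det A))\<^sup>2"
proof (rule DD_eqI[OF _ A])
  show "has_D (\<lambda>t. inverse (det (A + mat_scale t B))) (- DD det A B * (inverse (det A))\<^sup>2)"
    using has_D_inverse[OF DD_line[OF det_in_regular A, of B]] A by (simp add: GL_iff_det mat_space.scale_zero_left)
qed (rule regular_intros)

lemma DD_linear:
  fixes f :: "'k::alg_closed_field^'m^'m \<Rightarrow> 'k"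
  assumes f: "f \<in> GL_regular" and A: "A \<in> GL"
  shows "DD f A (B + C) = DD f A B + DD f A C" and "DD f A (mat_scale c B) = c * DD f A B"
proof -
  have "(\<forall>B C. DD f A (B + C) = DD f A B + DD f A C) \<and> (\<forall>c B. DD f A (mat_scale c B) = c * DD f A B)"
    using f
  proof (induction rule: GL_regular_induct)
    case (entry i j)
    show ?case by (simp add: DD_entry[OF A] mat_scale_def)
  next
    case (const c)
    show ?case by (simp add: DD_const[OF A])
  next
    case (add f g)
    thus ?case by (simp add: DD_add[OF A] algebra_simps)
  next
    case (mult f g)
    thus ?case by (simp add: DD_mult[OF A] algebra_simps)
  next
    case det
    have "(\<forall>B C. DD f A (B + C) = DD f A B + DD f A C) \<and> (\<forall>c B. DD f A (mat_scale c B) = c * DD f A B)"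
      if "f \<in> fun_alg mat_entries" for f :: "'k^'m^'m \<Rightarrow> 'k"
      using that
    proof (induction rule: poly_induct)
      case (entry i j)
      show ?case by (simp add: DD_entry[OF A] mat_scale_def)
    next
      case (const c)
      show ?case by (simp add: DD_const[OF A])
    next
      case (add f g)
      thus ?case by (simp add: DD_add[OF A] subsetD[OF poly_subset_regular] algebra_simps)
    next
      case (mult f g)
      thus ?case by (simp add: DD_mult[OF A] subsetD[OF poly_subset_regular] algebra_simps)
    qed
    from this[OF det_in_poly] have lin: "DD det A (B + C) = DD det A B + DD det A C"
      "DD det A (mat_scale c B) = c * DD det A B" for B C c by blast+
    show ?case by (simp add: DD_inverse_det[OF A] lin algebra_simps)
  qed
  thus "DD f A (B + C) = DD f A B + DD f A C" "DD f A (mat_scale c B) = c * DD f A B" by blast+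
qed

text \<open>In characteristic two the square of the derivation \<open>f \<mapsto> (A \<mapsto> df\<^sub>A(A X))\<close> is again a derivation,
  hence the one belonging to \<open>X\<^sup>2\<close>.\<close>

lemma second_derivative:
  fixes f :: "'k::alg_closed_field^'m^'m \<Rightarrow> 'k"
  assumes two: "(2 :: 'k) = 0" and f: "f \<in> GL_regular"
  shows "\<exists>f1\<in>GL_regular. \<exists>f2\<in>GL_regular. \<forall>A\<in>GL. DD f A (A ** X) = f1 A \<and>
     DD f1 A (A ** X) = f2 A \<and> DD f A (A ** X ** X) = f2 A"
proof -
  let ?P = "\<lambda>f f1 f2. \<forall>A\<in>GL. DD f A (A ** X) = f1 A \<and>
     DD f1 A (A ** X) = f2 A \<and> DD f A (A ** X ** X) = f2 A"
  have two': "a + a = 0" for a :: 'k using two by (metis mult_2 mult_zero_left)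
  have neg: "- a = a" for a :: 'k using two'[of a] by (simp add: eq_neg_iff_add_eq_0 flip: neg_eq_iff_add_eq_0)
  have entryr: "\<exists>f1\<in>GL_regular. \<exists>f2\<in>GL_regular. ?P (\<lambda>A. A $ i $ j) f1 f2" for i j
  proof (rule bexI[of _ "\<lambda>A. \<Sum>k\<in>UNIV. X $ k $ j * A $ i $ k"],
      rule bexI[of _ "\<lambda>A. \<Sum>k\<in>UNIV. (X ** X) $ k $ j * A $ i $ k"], intro ballI conjI)
    fix A :: "'k^'m^'m" assume A: "A \<in> GL"
    show d: "DD (\<lambda>A. A $ i $ j) A (A ** X) = (\<Sum>k\<in>UNIV. X $ k $ j * A $ i $ k)"
      by (simp add: DD_entry[OF A] matrix_matrix_mult_def mult.commute)
    have "DD (\<lambda>A. \<Sum>k\<in>UNIV. X $ k $ j * A $ i $ k) A (A ** X) = (\<Sum>k\<in>UNIV. X $ k $ j * (A ** X) $ i $ k)"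
      by (subst DD_sum[OF A]) (auto simp: DD_cmult[OF A] DD_entry[OF A] regular_intros)
    also have e: "\<dots> = (A ** X ** X) $ i $ j" by (simp add: matrix_matrix_mult_def mult.commute)
    also have "\<dots> = (A ** (X ** X)) $ i $ j" by (simp add: matrix_mul_assoc)
    also have e2: "\<dots> = (\<Sum>k\<in>UNIV. (X ** X) $ k $ j * A $ i $ k)"
      by (subst matrix_matrix_mult_def) (simp add: mult.commute)
    finally show "DD (\<lambda>A. \<Sum>k\<in>UNIV. X $ k $ j * A $ i $ k) A (A ** X) = (\<Sum>k\<in>UNIV. (X ** X) $ k $ j * A $ i $ k)" .
    show "DD (\<lambda>A. A $ i $ j) A (A ** X ** X) = (\<Sum>k\<in>UNIV. (X ** X) $ k $ j * A $ i $ k)"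
      by (simp add: DD_entry[OF A] e2[symmetric] matrix_mul_assoc)
  qed (intro regular_sum regular_intros finite)+
  have constr: "\<exists>f1\<in>GL_regular. \<exists>f2\<in>GL_regular. ?P (\<lambda>_. c) f1 f2" for c
    by (intro bexI[of _ "\<lambda>_. 0"]) (auto simp: DD_const regular_intros)
  have addr: "\<exists>h1\<in>GL_regular. \<exists>h2\<in>GL_regular. ?P (\<lambda>A. f A + g A) h1 h2"
    if fg: "f \<in> GL_regular" "g \<in> GL_regular"
      "\<exists>f1\<in>GL_regular. \<exists>f2\<in>GL_regular. ?P f f1 f2" "\<exists>g1\<in>GL_regular. \<exists>g2\<in>GL_regular. ?P g g1 g2" for f g
  proof -
    obtain f1 f2 g1 g2 where 1: "f1 \<in> GL_regular" "f2 \<in> GL_regular" "?P f f1 f2"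
      "g1 \<in> GL_regular" "g2 \<in> GL_regular" "?P g g1 g2" using fg(3,4) by blast
    show ?thesis
      by (rule bexI[of _ "\<lambda>A. f1 A + g1 A"], rule bexI[of _ "\<lambda>A. f2 A + g2 A"])
         (use fg(1,2) 1 in \<open>auto simp: DD_add intro: regular_intros\<close>)
  qed
  have multr: "\<exists>h1\<in>GL_regular. \<exists>h2\<in>GL_regular. ?P (\<lambda>A. f A * g A) h1 h2"
    if fg: "f \<in> GL_regular" "g \<in> GL_regular"
      "\<exists>f1\<in>GL_regular. \<exists>f2\<in>GL_regular. ?P f f1 f2" "\<exists>g1\<in>GL_regular. \<exists>g2\<in>GL_regular. ?P g g1 g2" for f g
  proof -
    obtain f1 f2 g1 g2 where 1: "f1 \<in> GL_regular" "f2 \<in> GL_regular" "?P f f1 f2"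
      "g1 \<in> GL_regular" "g2 \<in> GL_regular" "?P g g1 g2" using fg(3,4) by blast
    show ?thesis
    proof (rule bexI[of _ "\<lambda>A. f1 A * g A + f A * g1 A"], rule bexI[of _ "\<lambda>A. f2 A * g A + f A * g2 A"], intro ballI conjI)
      fix A :: "'k^'m^'m" assume A: "A \<in> GL"
      show "DD (\<lambda>A. f A * g A) A (A ** X) = f1 A * g A + f A * g1 A"
        using A fg 1 by (simp add: DD_mult)
      show "DD (\<lambda>A. f A * g A) A (A ** X ** X) = f2 A * g A + f A * g2 A"
        using A fg 1 by (simp add: DD_mult)
      \<comment> \<open>The mixed term \<open>f1 A * g1 A\<close> arises twice and cancels; this is
        where characteristic two makes the square of a derivation a derivation.\<close>
      have "DD (\<lambda>A. f1 A * g A + f A * g1 A) A (A ** X) =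
         f2 A * g A + f A * g2 A + (f1 A * g1 A + f1 A * g1 A)"
        using A fg 1 by (simp add: DD_mult DD_add regular_intros algebra_simps)
      thus "DD (\<lambda>A. f1 A * g A + f A * g1 A) A (A ** X) = f2 A * g A + f A * g2 A"
        by (simp add: two')
    qed (use fg 1 in \<open>auto intro: regular_intros\<close>)
  qed
  have "\<exists>f1\<in>GL_regular. \<exists>f2\<in>GL_regular. ?P f f1 f2" if "f \<in> fun_alg mat_entries" for f :: "'k^'m^'m \<Rightarrow> 'k"
    using that
  proof (induction rule: poly_induct)
    case (add f g) thus ?case by (intro addr subsetD[OF poly_subset_regular])
  next
    case (mult f g) thus ?case by (intro multr subsetD[OF poly_subset_regular])
  qed (rule entryr constr)+
  from this[OF det_in_poly] obtain f1 f2 where 1: "f1 \<in> GL_regular" "f2 \<in> GL_regular" "?P det f1 f2" by blast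
  let ?i = "\<lambda>A :: 'k^'m^'m. inverse (det A)"
  have DDi: "DD ?i A B = DD det A B * ?i A * ?i A" if A: "A \<in> GL" for A B
    by (simp add: DD_inverse_det[OF A] neg power2_eq_square mult.assoc)
  have invdet: "\<exists>h1\<in>GL_regular. \<exists>h2\<in>GL_regular. ?P ?i h1 h2"
  proof (rule bexI[of _ "\<lambda>A. f1 A * ?i A * ?i A"], rule bexI[of _ "\<lambda>A. f2 A * ?i A * ?i A"], intro ballI conjI)
    fix A :: "'k^'m^'m" assume A: "A \<in> GL"
    show "DD ?i A (A ** X) = f1 A * ?i A * ?i A" using A 1 by (simp add: DDi)
    show "DD ?i A (A ** X ** X) = f2 A * ?i A * ?i A" using A 1 by (simp add: DDi)
    have "DD (\<lambda>A. f1 A * ?i A * ?i A) A (A ** X) =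
       f2 A * ?i A * ?i A + (f1 A * f1 A * ?i A * ?i A * ?i A + f1 A * f1 A * ?i A * ?i A * ?i A)"
      using A 1 by (simp add: DD_mult DDi regular_intros algebra_simps)
    thus "DD (\<lambda>A. f1 A * ?i A * ?i A) A (A ** X) = f2 A * ?i A * ?i A" by (simp add: two')
  qed (intro regular_intros 1)+
  from f show ?thesis
  proof (induction rule: GL_regular_induct)
    case (add f g) thus ?case by (rule addr)
  next
    case (mult f g) thus ?case by (rule multr)
  qed (rule entryr constr invdet)+
qed

subsection \<open>Lie algebras and morphisms\<close>

lemma GL_1 [simp]: "mat 1 \<in> GL" and GL_mult: "A \<in> GL \<Longrightarrow> B \<in> GL \<Longrightarrow> A ** B \<in> GL"
  by (auto simp: GL_iff_det det_mul)

lemma lie_algebra_iff: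
  fixes G :: "('k::alg_closed_field^'m^'m) set"
  shows "X \<in> lie_algebra G \<longleftrightarrow> (\<forall>f \<in> fun_alg mat_entries. (\<forall>A\<in>G. f A = 0) \<longrightarrow> DD f (mat 1) X = 0)"
proof -
  have "(\<exists>q. (\<forall>t. poly q t = f (mat 1 + mat_scale t X)) \<and> coeff q 1 = 0) \<longleftrightarrow> DD f (mat 1) X = 0"
    if f: "f \<in> fun_alg mat_entries" for f :: "'k^'m^'m \<Rightarrow> 'k"
  proof -
    have *: "DD f (mat 1) X = coeff q 1" if "\<forall>t. poly q t = f (mat 1 + mat_scale t X)" for q
    proof -
      have "(\<lambda>t. f (mat 1 + mat_scale t X)) = poly q" using that by auto
      thus ?thesis using has_D_poly[of q] subsetD[OF poly_subset_regular f] by (intro DD_eqI) auto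
    qed
    obtain r where "\<forall>t. poly r t = f (mat 1 + mat_scale t X)" using poly_line[OF f, of "mat 1" X] by metis
    thus ?thesis using * by metis
  qed
  thus ?thesis unfolding lie_algebra_def by auto
qed

lemma regular_eq_poly_div_det:
  fixes f :: "'k::alg_closed_field^'m^'m \<Rightarrow> 'k"
  assumes "f \<in> GL_regular"
  shows "\<exists>P\<in>fun_alg mat_entries. \<exists>k. \<forall>A\<in>GL. f A * det A ^ k = P A"
  using assms
proof (induction rule: GL_regular_induct)
  case (entry i j)
  show ?case by (rule bexI[OF _ entry_in_poly[of i j]]) (rule exI[of _ 0], simp)
next
  case det
  show ?case by (rule bexI[OF _ fun_alg.const[of 1]]) (rule exI[of _ 1], simp add: GL_iff_det)
next
  case (const c)
  show ?case by (rule bexI[OF _ fun_alg.const[of c]]) (rule exI[of _ 0], simp)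
next
  case (add f g)
  then obtain P k Q l where 1: "P \<in> fun_alg mat_entries" "\<forall>A\<in>GL. f A * det A ^ k = P A"
    "Q \<in> fun_alg mat_entries" "\<forall>A\<in>GL. g A * det A ^ l = Q A" by blast
  show ?case
  proof (intro bexI exI ballI)
    fix A :: "'k^'m^'m" assume "A \<in> GL"
    hence "f A * det A ^ k = P A" "g A * det A ^ l = Q A" using 1 by auto
    thus "(f A + g A) * det A ^ (k + l) = P A * det A ^ l + Q A * det A ^ k"
      by (simp add: algebra_simps power_add flip: \<open>f A * det A ^ k = P A\<close> \<open>g A * det A ^ l = Q A\<close>)
  qed (intro fun_alg.add fun_alg.mult fun_alg_power det_in_poly 1)
next
  case (mult f g)
  then obtain P k Q l where 1: "P \<in> fun_alg mat_entries" "\<forall>A\<in>GL. f A * det A ^ k = P A"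
    "Q \<in> fun_alg mat_entries" "\<forall>A\<in>GL. g A * det A ^ l = Q A" by blast
  show ?case
  proof (intro bexI exI ballI)
    fix A :: "'k^'m^'m" assume "A \<in> GL"
    hence "f A * det A ^ k = P A" "g A * det A ^ l = Q A" using 1 by auto
    thus "(f A * g A) * det A ^ (k + l) = P A * Q A"
      by (simp add: algebra_simps power_add flip: \<open>f A * det A ^ k = P A\<close> \<open>g A * det A ^ l = Q A\<close>)
  qed (intro fun_alg.add fun_alg.mult fun_alg_power det_in_poly 1)
qed

text \<open>The definition of the Lie algebra tests polynomials only. Multiplying by a power of
  \<open>det\<close> clears denominators and does not change the derivative at 1, where
  \<open>f\<close> vanishes and \<open>det\<close> is 1.\<close>

lemma lie_algebra_regular:
  fixes G :: "('k::alg_closed_field^'m^'m) set"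
  assumes X: "X \<in> lie_algebra G" and G: "G \<subseteq> GL" "mat 1 \<in> G"
    and f: "f \<in> GL_regular" "\<And>A. A \<in> G \<Longrightarrow> f A = 0"
  shows "DD f (mat 1) X = 0"
proof -
  obtain P k where P: "P \<in> fun_alg mat_entries" "\<And>A. A \<in> GL \<Longrightarrow> f A * det A ^ k = P A"
    using regular_eq_poly_div_det[OF f(1)] by blast
  have d: "(\<lambda>A. det A ^ k) \<in> (GL_regular :: ('k^'m^'m \<Rightarrow> 'k) set)"
    by (rule subsetD[OF poly_subset_regular fun_alg_power[OF det_in_poly]])
  have "P A = 0" if "A \<in> G" for A using P(2)[of A] f(2)[of A] G(1) that by auto
  hence "DD P (mat 1) X = 0" using X P(1) by (auto simp: lie_algebra_iff)
  moreover have "DD P (mat 1) X = DD (\<lambda>A. f A * det A ^ k) (mat 1) X"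
    using P f d by (intro DD_cong regular_intros(2)) (auto dest: subsetD[OF poly_subset_regular])
  moreover have "\<dots> = DD f (mat 1) X"
    using f(2)[OF G(2)] by (simp add: DD_mult[OF GL_1 f(1) d])
  ultimately show ?thesis by simp
qed

lemma lie_algebra_subspace: "mat_space.subspace (lie_algebra (G :: ('k::alg_closed_field^'m^'m) set))"
proof (rule mat_space.subspaceI)
  have reg: "f \<in> GL_regular" if "f \<in> fun_alg mat_entries" for f :: "'k^'m^'m \<Rightarrow> 'k"
    using that poly_subset_regular by blast
  have "DD f (mat 1) 0 = 0" if "f \<in> fun_alg mat_entries" for f :: "'k^'m^'m \<Rightarrow> 'k"
    using DD_linear(2)[OF reg[OF that] GL_1, of 0 0] by simp
  thus "0 \<in> lie_algebra G" by (simp add: lie_algebra_iff)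
  fix X Y :: "'k^'m^'m" and c
  assume "X \<in> lie_algebra G"
  thus "Y \<in> lie_algebra G \<Longrightarrow> X + Y \<in> lie_algebra G" "mat_scale c X \<in> lie_algebra G"
    using DD_linear[OF reg GL_1] by (auto simp: lie_algebra_iff)
qed

lemma regular_mult_left:
  fixes f :: "'k::alg_closed_field^'m^'m \<Rightarrow> 'k"
  assumes "f \<in> GL_regular"
  shows "(\<lambda>B. f (A ** B)) \<in> GL_regular"
  using assms
proof (induction rule: GL_regular_induct)
  case (entry i j)
  show ?case by (simp add: matrix_matrix_mult_def) (intro regular_sum regular_intros, simp)
next
  case det
  show ?case using regular_intros(4)[OF inverse_det_in_regular, of "inverse (det A)"] by (simp add: det_mul mult.commute)
qed (auto intro: regular_intros)

lemma regular_mult_right: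
  fixes f :: "'k::alg_closed_field^'m^'m \<Rightarrow> 'k"
  assumes "f \<in> GL_regular"
  shows "(\<lambda>B. f (B ** A)) \<in> GL_regular"
  using assms
proof (induction rule: GL_regular_induct)
  case (entry i j)
  have "(\<lambda>B. \<Sum>k\<in>UNIV. A $ k $ j * B $ i $ k) \<in> GL_regular" by (intro regular_sum regular_intros) simp
  thus ?case by (simp add: matrix_matrix_mult_def mult.commute)
next
  case det
  show ?case using regular_intros(4)[OF inverse_det_in_regular, of "inverse (det A)"] by (simp add: det_mul mult.commute)
qed (auto intro: regular_intros)

lemma mat_scale_mult [simp]:
  fixes A B :: "'k::field^'m^'m"
  shows "mat_scale c A ** B = mat_scale c (A ** B)" "A ** mat_scale c B = mat_scale c (A ** B)"
  by (auto simp: mat_scale_def matrix_matrix_mult_def vec_eq_iff sum_distrib_left ac_simps intro!: sum.cong)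

lemma matrix_add_rdistrib: "((B + C) ** A) = (B ** A) + (C ** A :: 'k::semiring_1^'m^'n)"
  by (simp add: matrix_matrix_mult_def vec_eq_iff algebra_simps sum.distrib)

text \<open>The left translate of \<open>f\<close> by an element of \<open>G\<close> vanishes on
  \<open>G\<close> as well. Thus the left invariant vector field of \<open>X\<close> preserves the
  ideal of \<open>G\<close>, which makes it possible to differentiate twice.\<close>

lemma lie_algebra_ideal:
  fixes G :: "('k::alg_closed_field^'m^'m) set"
  assumes X: "X \<in> lie_algebra G" and G: "G \<subseteq> GL" "mat 1 \<in> G" "\<And>A B. A \<in> G \<Longrightarrow> B \<in> G \<Longrightarrow> A ** B \<in> G"
    and f: "f \<in> GL_regular" "\<And>A. A \<in> G \<Longrightarrow> f A = 0" and A: "A \<in> G"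
  shows "DD f A (A ** X) = 0"
proof -
  have "DD (\<lambda>B. f (A ** B)) (mat 1) X = 0"
    using f A G by (intro lie_algebra_regular[OF X G(1,2)] regular_mult_left) auto
  moreover have "DD f A (A ** X) = DD (\<lambda>B. f (A ** B)) (mat 1) X"
    using DD_line[OF regular_mult_left[OF f(1), of A] GL_1, of X] A G(1)
    by (intro DD_eqI f(1)) (auto simp: matrix_add_ldistrib)
  ultimately show ?thesis by simp
qed

text \<open>The entries of \<open>\<phi>\<close> are only given on \<open>G\<close>; the functions \<open>\<Phi>\<close> extend them to the
  general linear group, where they can be differentiated in all directions.\<close>

locale group_morphism =
  fixes G :: "('k::alg_closed_field^'m^'m) set" and H :: "('k^'n^'n) set"
    and \<phi> :: "'k^'m^'m \<Rightarrow> 'k^'n^'n" and \<Phi> :: "'n \<Rightarrow> 'n \<Rightarrow> 'k^'m^'m \<Rightarrow> 'k"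
  assumes G: "G \<subseteq> GL" "mat 1 \<in> G" and G_mult: "\<And>A B. A \<in> G \<Longrightarrow> B \<in> G \<Longrightarrow> A ** B \<in> G"
    and H: "H \<subseteq> GL"
    and regular: "regular_map GL_regular G GL_regular H \<phi>"
    and hom: "\<And>A B. A \<in> G \<Longrightarrow> B \<in> G \<Longrightarrow> \<phi> (A ** B) = \<phi> A ** \<phi> B"
    and \<Phi>: "\<And>i j. \<Phi> i j \<in> GL_regular" "\<And>i j A. A \<in> G \<Longrightarrow> \<Phi> i j A = \<phi> A $ i $ j"
begin

lemma image: "A \<in> G \<Longrightarrow> \<phi> A \<in> H"
  using regular by (auto simp: regular_map_def)

lemma pullback_regular: "g \<in> GL_regular \<Longrightarrow> \<exists>f\<in>GL_regular. \<forall>A\<in>G. g (\<phi> A) = f A"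
  using regular by (simp add: regular_map_def)

lemma \<phi>_1: "\<phi> (mat 1) = mat 1"
proof -
  have "\<phi> (mat 1) ** \<phi> (mat 1) = \<phi> (mat 1)" using hom[of "mat 1" "mat 1"] G by simp
  moreover have "invertible (\<phi> (mat 1))" using image[OF G(2)] H by (auto simp: GL_def)
  ultimately show ?thesis by (metis invertible_def matrix_mul_assoc matrix_mul_lid)
qed

definition d\<phi> :: "'k^'m^'m \<Rightarrow> 'k^'n^'n" where
  "d\<phi> X = (\<chi> i j. DD (\<Phi> i j) (mat 1) X)"

lemma d\<phi>_linear: "d\<phi> (X + Y) = d\<phi> X + d\<phi> Y" "d\<phi> (mat_scale c X) = mat_scale c (d\<phi> X)"
  by (auto simp: d\<phi>_def vec_eq_iff mat_scale_def DD_linear[OF \<Phi>(1) GL_1, unfolded mat_scale_def])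

text \<open>The chain rule for one suitable extension \<open>f\<close> of the pullback of
  \<open>g\<close>. This weak form is stable under the induction over regular functions;
  \<open>DD_pullback\<close> then passes to arbitrary extensions.\<close>

definition pulls_back :: "('k^'n^'n \<Rightarrow> 'k) \<Rightarrow> bool" where
  "pulls_back g \<longleftrightarrow> (\<exists>f\<in>GL_regular. (\<forall>A\<in>G. f A = g (\<phi> A)) \<and>
     (\<forall>X\<in>lie_algebra G. DD f (mat 1) X = DD g (mat 1) (d\<phi> X)))"

lemma pulls_back_poly:
  assumes "g \<in> fun_alg mat_entries" shows "pulls_back g"
  using assms
proof (induction rule: poly_induct)
  case (entry i j)
  show ?case unfolding pulls_back_def
    by (intro bexI[of _ "\<Phi> i j"]) (auto simp: \<Phi> DD_entry d\<phi>_def)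
next
  case (const c)
  show ?case unfolding pulls_back_def
    by (intro bexI[of _ "\<lambda>_. c"]) (auto simp: DD_const regular_intros)
next
  case (add g h)
  have "g \<in> GL_regular" "h \<in> GL_regular" using add.hyps poly_subset_regular by auto
  moreover obtain a b where "a \<in> GL_regular" "\<forall>A\<in>G. a A = g (\<phi> A)"
     "\<forall>X\<in>lie_algebra G. DD a (mat 1) X = DD g (mat 1) (d\<phi> X)"
     "b \<in> GL_regular" "\<forall>A\<in>G. b A = h (\<phi> A)"
     "\<forall>X\<in>lie_algebra G. DD b (mat 1) X = DD h (mat 1) (d\<phi> X)"
    using add.IH unfolding pulls_back_def by blast
  ultimately show ?case unfolding pulls_back_def
    by (intro bexI[of _ "\<lambda>A. a A + b A"] conjI ballI) (auto simp: DD_add regular_intros)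
next
  case (mult g h)
  have "g \<in> GL_regular" "h \<in> GL_regular" using mult.hyps poly_subset_regular by auto
  moreover obtain a b where "a \<in> GL_regular" "\<forall>A\<in>G. a A = g (\<phi> A)"
     "\<forall>X\<in>lie_algebra G. DD a (mat 1) X = DD g (mat 1) (d\<phi> X)"
     "b \<in> GL_regular" "\<forall>A\<in>G. b A = h (\<phi> A)"
     "\<forall>X\<in>lie_algebra G. DD b (mat 1) X = DD h (mat 1) (d\<phi> X)"
    using mult.IH unfolding pulls_back_def by blast
  ultimately show ?case unfolding pulls_back_def using G(2)
    by (intro bexI[of _ "\<lambda>A. a A * b A"] conjI ballI) (auto simp: DD_mult regular_intros \<phi>_1)
qed

lemma pulls_back_regular:
  assumes "g \<in> GL_regular" shows "pulls_back g"
  using assms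
proof (induction rule: GL_regular_induct)
  case (entry i j)
  show ?case by (rule pulls_back_poly[OF entry_in_poly])
next
  case (const c)
  show ?case by (rule pulls_back_poly[OF fun_alg.const])
next
  case det
  obtain D where D: "D \<in> GL_regular" "\<forall>A\<in>G. D A = det (\<phi> A)"
     "\<forall>X\<in>lie_algebra G. DD D (mat 1) X = DD det (mat 1) (d\<phi> X)"
    using pulls_back_poly[OF det_in_poly] unfolding pulls_back_def by blast
  obtain e where e: "e \<in> GL_regular" "\<forall>A\<in>G. inverse (det (\<phi> A)) = e A"
    using pullback_regular[OF inverse_det_in_regular] by blast
  have one: "D (mat 1) = 1" "e (mat 1) = 1" using D(2) e(2) G(2) \<phi>_1 by force+
  have "DD e (mat 1) X = - DD det (mat 1) (d\<phi> X)" if X: "X \<in> lie_algebra G" for X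
  proof -
    \<comment> \<open>The extension \<open>e\<close> of the pulled back inverse determinant is known
      only on \<open>G\<close>; its derivative is extracted from the relation
      \<open>e A * D A = 1\<close> holding there.\<close>
    have "DD (\<lambda>A. e A * D A - 1) (mat 1) X = 0"
    proof (rule lie_algebra_regular[OF X G])
      fix A assume A: "A \<in> G"
      hence "det (\<phi> A) \<noteq> 0" using image H GL_iff_det by blast
      thus "e A * D A - 1 = 0" using A D(2) e(2) by (metis cancel_comm_monoid_add_class.diff_cancel left_inverse)
    qed (intro regular_intros e D)
    moreover have "DD (\<lambda>A. e A * D A - 1) (mat 1) X = DD e (mat 1) X + DD D (mat 1) X"
      using D(1) e(1) by (simp add: DD_diff DD_mult DD_const regular_intros one)
    ultimately show ?thesis using D(3) X by (simp add: add_eq_0_iff2)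
  qed
  thus ?case unfolding pulls_back_def using e
    by (intro bexI[of _ e]) (auto simp: DD_inverse_det)
next
  case (add g h)
  moreover obtain a b where "a \<in> GL_regular" "\<forall>A\<in>G. a A = g (\<phi> A)"
     "\<forall>X\<in>lie_algebra G. DD a (mat 1) X = DD g (mat 1) (d\<phi> X)"
     "b \<in> GL_regular" "\<forall>A\<in>G. b A = h (\<phi> A)"
     "\<forall>X\<in>lie_algebra G. DD b (mat 1) X = DD h (mat 1) (d\<phi> X)"
    using add.IH unfolding pulls_back_def by blast
  ultimately show ?case unfolding pulls_back_def
    by (intro bexI[of _ "\<lambda>A. a A + b A"] conjI ballI) (auto simp: DD_add regular_intros)
next
  case (mult g h)
  moreover obtain a b where "a \<in> GL_regular" "\<forall>A\<in>G. a A = g (\<phi> A)"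
     "\<forall>X\<in>lie_algebra G. DD a (mat 1) X = DD g (mat 1) (d\<phi> X)"
     "b \<in> GL_regular" "\<forall>A\<in>G. b A = h (\<phi> A)"
     "\<forall>X\<in>lie_algebra G. DD b (mat 1) X = DD h (mat 1) (d\<phi> X)"
    using mult.IH unfolding pulls_back_def by blast
  ultimately show ?case unfolding pulls_back_def using G(2)
    by (intro bexI[of _ "\<lambda>A. a A * b A"] conjI ballI) (auto simp: DD_mult regular_intros \<phi>_1)
qed

text \<open>Two extensions of one function on \<open>G\<close> differ by a function vanishing on
  \<open>G\<close>, and tangent vectors do not see the difference.\<close>

lemma DD_pullback:
  assumes g: "g \<in> GL_regular" and f: "f \<in> GL_regular" "\<And>A. A \<in> G \<Longrightarrow> f A = g (\<phi> A)"
    and X: "X \<in> lie_algebra G"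
  shows "DD f (mat 1) X = DD g (mat 1) (d\<phi> X)"
proof -
  obtain h where h: "h \<in> GL_regular" "\<forall>A\<in>G. h A = g (\<phi> A)" "DD h (mat 1) X = DD g (mat 1) (d\<phi> X)"
    using pulls_back_regular[OF g] X unfolding pulls_back_def by blast
  have "DD (\<lambda>A. f A - h A) (mat 1) X = 0"
    using f h by (intro lie_algebra_regular[OF X G] regular_intros) auto
  thus ?thesis using h f by (simp add: DD_diff)
qed

lemma d\<phi>_lie_algebra: "X \<in> lie_algebra G \<Longrightarrow> d\<phi> X \<in> lie_algebra H"
  unfolding lie_algebra_iff[of "d\<phi> X" H]
proof (intro ballI impI)
  fix f assume X: "X \<in> lie_algebra G" and f: "f \<in> fun_alg mat_entries" "\<forall>A\<in>H. f A = 0"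
  have "DD (\<lambda>_. 0) (mat 1) X = DD f (mat 1) (d\<phi> X)"
    using f image by (intro DD_pullback[OF _ _ _ X] regular_intros) (auto dest: subsetD[OF poly_subset_regular])
  thus "DD f (mat 1) (d\<phi> X) = 0" by (simp add: DD_const)
qed

text \<open>By homomorphy, \<open>\<Phi> i j (A ** C ** B)\<close> as a function of \<open>C\<close>
  extends the pullback of an entry of \<open>\<phi> A ** D ** \<phi> B\<close> as a function of
  \<open>D\<close>; the claim is the chain rule for it.\<close>

lemma d\<phi>_conj:
  assumes A: "A \<in> G" "B \<in> G" "A ** B = mat 1" and X: "X \<in> lie_algebra G"
  shows "d\<phi> (A ** X ** B) = \<phi> A ** d\<phi> X ** \<phi> B"
proof (simp add: vec_eq_iff, intro allI)
  fix i j
  have "A ** (mat 1 + mat_scale t X) ** B = mat 1 + mat_scale t (A ** X ** B)" for t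
    by (simp add: matrix_add_ldistrib matrix_add_rdistrib A)
  hence "has_D (\<lambda>t. \<Phi> i j (A ** (mat 1 + mat_scale t X) ** B)) (DD (\<Phi> i j) (mat 1) (A ** X ** B))"
    using DD_line[OF \<Phi>(1) GL_1, of i j "A ** X ** B"] by simp
  hence l: "DD (\<lambda>C. \<Phi> i j (A ** C ** B)) (mat 1) X = DD (\<Phi> i j) (mat 1) (A ** X ** B)"
    by (intro DD_eqI GL_1 regular_mult_left[OF regular_mult_right] \<Phi>)
  have r: "(\<lambda>C. (\<phi> A ** C ** \<phi> B) $ i $ j) \<in> GL_regular"
    using regular_mult_left[OF regular_mult_right[OF regular_intros(7)]] .
  have "DD (\<lambda>C. \<Phi> i j (A ** C ** B)) (mat 1) X = DD (\<lambda>C. (\<phi> A ** C ** \<phi> B) $ i $ j) (mat 1) (d\<phi> X)"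
    using A by (intro DD_pullback[OF r _ _ X] regular_mult_left[OF regular_mult_right] \<Phi>)
      (auto simp: \<Phi> hom G_mult)
  also have "\<dots> = (\<phi> A ** d\<phi> X ** \<phi> B) $ i $ j"
  proof (rule DD_eqI[OF r GL_1])
    have "\<phi> A ** \<phi> B = mat 1" using hom[OF A(1,2)] A(3) \<phi>_1 by simp
    hence "\<phi> A ** (mat 1 + mat_scale t (d\<phi> X)) ** \<phi> B = mat 1 + mat_scale t (\<phi> A ** d\<phi> X ** \<phi> B)" for t
      by (simp add: matrix_add_ldistrib matrix_add_rdistrib)
    thus "has_D (\<lambda>t. (\<phi> A ** (mat 1 + mat_scale t (d\<phi> X)) ** \<phi> B) $ i $ j) ((\<phi> A ** d\<phi> X ** \<phi> B) $ i $ j)"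
      by (simp add: mat_scale_def has_D_affine)
  qed
  finally show "d\<phi> (A ** X ** B) $ i $ j = (\<phi> A ** d\<phi> X ** \<phi> B) $ i $ j" by (simp add: d\<phi>_def l)
qed

text \<open>\<open>X\<close> acts on functions as the derivation in direction \<open>A ** X\<close>
  at \<open>A\<close>, whose square belongs to \<open>X ** X\<close>. On \<open>G\<close> the map
  \<open>\<phi>\<close> intertwines the derivations of \<open>X\<close> and
  \<open>d\<phi> X\<close>, hence also their squares.\<close>

lemma d\<phi>_square:
  assumes two: "(2 :: 'k) = 0" and X: "X \<in> lie_algebra G"
  shows "d\<phi> (X ** X) = d\<phi> X ** d\<phi> X" and "X ** X \<in> lie_algebra G"
proof -
  note ideal = lie_algebra_ideal[OF X G G_mult]
  show "X ** X \<in> lie_algebra G" unfolding lie_algebra_iff[of "X ** X" G]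
  proof (intro ballI impI)
    fix f :: "'k^'m^'m \<Rightarrow> 'k" assume f: "f \<in> fun_alg mat_entries" "\<forall>A\<in>G. f A = 0"
    have f': "f \<in> GL_regular" using f(1) poly_subset_regular by blast
    obtain f1 f2 where 1: "f1 \<in> GL_regular" "\<And>A. A \<in> GL \<Longrightarrow> DD f A (A ** X) = f1 A \<and>
       DD f1 A (A ** X) = f2 A \<and> DD f A (A ** X ** X) = f2 A"
      using second_derivative[OF two f', of X] by blast
    have "f1 A = 0" if A: "A \<in> G" for A
      using 1(2)[of A] ideal[OF _ _ f' _ A] f(2) A G(1) by auto
    hence "DD f1 (mat 1) (mat 1 ** X) = 0" by (intro ideal 1 G) auto
    thus "DD f (mat 1) (X ** X) = 0" using 1(2)[OF GL_1] by simp
  qed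
  show "d\<phi> (X ** X) = d\<phi> X ** d\<phi> X"
  proof (simp add: vec_eq_iff, intro allI)
    fix i j
    obtain f1 f2 where 1: "f1 \<in> GL_regular" "\<And>A. A \<in> GL \<Longrightarrow> DD (\<Phi> i j) A (A ** X) = f1 A \<and>
       DD f1 A (A ** X) = f2 A \<and> DD (\<Phi> i j) A (A ** X ** X) = f2 A"
      using second_derivative[OF two \<Phi>(1), of i j X] by blast
    \<comment> \<open>On \<open>G\<close> this is an entry of \<open>\<phi> A ** d\<phi> X\<close>,
      the first derivative of a coordinate. It is again a combination of the
      \<open>\<Phi> i k\<close> and can be differentiated once more.\<close>
    let ?h = "\<lambda>A. \<Sum>k\<in>UNIV. d\<phi> X $ k $ j * \<Phi> i k A"
    have r: "?h \<in> GL_regular" by (intro regular_sum regular_intros \<Phi>) simp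
    have f1: "f1 A = ?h A" if A: "A \<in> G" for A
    proof -
      have "A \<in> GL" using A G by blast
      have "has_D (\<lambda>t. \<Phi> i j (A ** (mat 1 + mat_scale t X))) (DD (\<Phi> i j) A (A ** X))"
        using DD_line[OF \<Phi>(1) \<open>A \<in> GL\<close>, of i j "A ** X"] by (simp add: matrix_add_ldistrib)
      hence "DD (\<lambda>C. \<Phi> i j (A ** C)) (mat 1) X = DD (\<Phi> i j) A (A ** X)"
        by (intro DD_eqI GL_1 regular_mult_left \<Phi>)
      moreover have "DD (\<lambda>C. \<Phi> i j (A ** C)) (mat 1) X = DD (\<lambda>C. (\<phi> A ** C) $ i $ j) (mat 1) (d\<phi> X)"
        using A by (intro DD_pullback[OF _ _ _ X] regular_mult_left \<Phi> regular_intros) (auto simp: \<Phi> hom G_mult)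
      moreover have "\<dots> = (\<phi> A ** d\<phi> X) $ i $ j"
      proof (rule DD_eqI[OF regular_mult_left[OF regular_intros(7)] GL_1])
        show "has_D (\<lambda>t. (\<phi> A ** (mat 1 + mat_scale t (d\<phi> X))) $ i $ j) ((\<phi> A ** d\<phi> X) $ i $ j)"
          by (simp add: matrix_add_ldistrib) (simp add: mat_scale_def has_D_affine)
      qed
      moreover have "(\<phi> A ** d\<phi> X) $ i $ j = ?h A" by (simp add: matrix_matrix_mult_def \<Phi>(2)[OF A] mult.commute)
      ultimately show ?thesis using 1(2)[OF \<open>A \<in> GL\<close>] by simp
    qed
    have "DD (\<lambda>A. f1 A - ?h A) (mat 1) X = 0"
      using f1 by (intro lie_algebra_regular[OF X G] regular_intros 1 r) auto
    hence "DD f1 (mat 1) X = DD ?h (mat 1) X" by (simp add: DD_diff 1 r)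
    moreover have "DD ?h (mat 1) X = (\<Sum>k\<in>UNIV. d\<phi> X $ k $ j * d\<phi> X $ i $ k)"
      by (subst DD_sum) (auto simp: DD_cmult regular_intros \<Phi> d\<phi>_def)
    moreover have "\<dots> = (d\<phi> X ** d\<phi> X) $ i $ j" by (simp add: matrix_matrix_mult_def mult.commute)
    moreover have "DD f1 (mat 1) X = f2 (mat 1)" using 1(2)[OF GL_1] by simp
    ultimately have "f2 (mat 1) = (d\<phi> X ** d\<phi> X) $ i $ j" by metis
    thus "d\<phi> (X ** X) $ i $ j = (d\<phi> X ** d\<phi> X) $ i $ j"
      using 1(2)[OF GL_1] by (simp add: d\<phi>_def)
  qed
qed

text \<open>Independent functions on the image pull back to independent functions on
  \<open>C\<close>, because a relation between the pullbacks holds at every point of the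
  image.\<close>

lemma alg_dim_image_ge:
  assumes C: "C \<subseteq> G"
  shows "alg_dim (\<phi> ` C) \<le> alg_dim C"
  unfolding alg_dim_def
proof (intro Sup_subset_mono Collect_mono impI, elim exE conjE)
  fix x d f assume x: "x = enat d" and f: "\<forall>i<d. f i \<in> GL_regular" "alg_indep_on (\<phi> ` C) d f"
  have "\<forall>i. \<exists>h. i < d \<longrightarrow> h \<in> GL_regular \<and> (\<forall>A\<in>G. f i (\<phi> A) = h A)"
    using f(1) pullback_regular by meson
  then obtain h where h: "\<And>i. i < d \<Longrightarrow> h i \<in> GL_regular" "\<And>i A. i < d \<Longrightarrow> A \<in> G \<Longrightarrow> f i (\<phi> A) = h i A"
    by metis
  have "alg_indep_on C d h"
    unfolding alg_indep_on_def
  proof (intro ballI impI)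
    fix p :: "(nat \<Rightarrow> 'k) \<Rightarrow> 'k" assume p: "p \<in> fun_alg {\<lambda>y. y i |i. i < d}" and z: "\<forall>x\<in>C. p (\<lambda>i. h i x) = 0"
    have "p (\<lambda>i. f i (\<phi> A)) = p (\<lambda>i. h i A)" if "A \<in> C" for A
      using h(2) that C by (intro fun_alg_coords_cong[OF p]) auto
    hence "\<forall>x\<in>\<phi> ` C. p (\<lambda>i. f i x) = 0" using z by simp
    thus "\<forall>y. p y = 0" using f(2)[unfolded alg_indep_on_def, THEN bspec, OF p] by (rule mp[rotated])
  qed
  thus "\<exists>d. x = enat d \<and> (\<exists>f. (\<forall>i<d. f i \<in> GL_regular) \<and> alg_indep_on C d f)"
    by (intro exI conjI) (use x h(1) in auto)
qed

end

text \<open>Since \<open>\<psi>\<close> undoes \<open>\<phi>\<close>, the coordinates of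
  \<open>G\<close> extend the pullbacks of the \<open>\<Psi> i j\<close>, and the chain rule
  applies.\<close>

lemma group_morphism_inverse:
  assumes "group_morphism G H \<phi> \<Phi>" and "group_morphism H G \<psi> \<Psi>"
    and inv: "\<And>A. A \<in> G \<Longrightarrow> \<psi> (\<phi> A) = A" and X: "X \<in> lie_algebra G"
  shows "group_morphism.d\<phi> \<Psi> (group_morphism.d\<phi> \<Phi> X) = X"
proof -
  interpret p: group_morphism G H \<phi> \<Phi> by fact
  interpret q: group_morphism H G \<psi> \<Psi> by fact
  show ?thesis
  proof (simp add: vec_eq_iff, intro allI)
    fix i j
    have "DD (\<lambda>A. A $ i $ j) (mat 1) X = DD (\<Psi> i j) (mat 1) (p.d\<phi> X)"
      by (intro p.DD_pullback[OF _ _ _ X] regular_intros q.\<Phi>) (simp add: q.\<Phi> p.image inv)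
    thus "q.d\<phi> (p.d\<phi> X) $ i $ j = X $ i $ j" by (simp add: DD_entry q.d\<phi>_def)
  qed
qed

subsection \<open>The ring of square matrices\<close>

text \<open>A copy of the square matrices on which ring multiplication and powers mean the matrix
  product; on the vector type itself they are entrywise.\<close>

typedef ('a, 'n) sqm = "UNIV :: ('a^'n::finite^'n) set" morphisms mat_of sqm_of ..

lemma mat_of_sqm_of [simp]: "mat_of (sqm_of A) = A"
  by (simp add: sqm_of_inverse)

lemma sqm_eq_iff: "A = B \<longleftrightarrow> mat_of A = mat_of B"
  by (simp add: mat_of_inject)

instantiation sqm :: (field, finite) ab_group_add
begin

definition "0 = sqm_of 0"
definition "A + B = sqm_of (mat_of A + mat_of B)"
definition "A - B = sqm_of (mat_of A - mat_of B)"
definition "- A = sqm_of (- mat_of A)"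

instance
  by standard (simp_all add: zero_sqm_def plus_sqm_def minus_sqm_def uminus_sqm_def sqm_eq_iff)

end

instantiation sqm :: (field, finite) ring_1
begin

definition "1 = sqm_of (mat 1)"
definition "A * B = sqm_of (mat_of A ** mat_of B)"

instance
proof
  fix a b c :: "('a, 'b) sqm"
  have "mat 1 \<noteq> (0 :: 'a^'b^'b)" by (auto simp: mat_def vec_eq_iff)
  thus "(0 :: ('a, 'b) sqm) \<noteq> 1" by (simp add: zero_sqm_def one_sqm_def sqm_eq_iff)
qed (simp_all add: one_sqm_def times_sqm_def plus_sqm_def sqm_eq_iff matrix_mul_assoc
  matrix_add_ldistrib matrix_add_rdistrib)

end

definition app :: "('a::field, 'n::finite) sqm \<Rightarrow> 'a^'n \<Rightarrow> 'a^'n" where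
  "app A x = mat_of A *v x"

definition cst :: "'a \<Rightarrow> ('a::field, 'n::finite) sqm" where
  "cst c = sqm_of (mat c)"

lemma mat_of_simps: "mat_of 0 = 0" "mat_of 1 = mat 1" "mat_of (A + B) = mat_of A + mat_of B"
  "mat_of (A - B) = mat_of A - mat_of B" "mat_of (- A) = - mat_of A" "mat_of (A * B) = mat_of A ** mat_of B"
  "mat_of (cst c) = mat c"
  by (simp_all add: zero_sqm_def one_sqm_def plus_sqm_def minus_sqm_def uminus_sqm_def times_sqm_def cst_def)

lemma app_simps [simp]:
  "app (A + B) x = app A x + app B x" "app (A - B) x = app A x - app B x" "app (- A) x = - app A x"
  "app 0 x = 0" "app 1 x = x" "app (cst c) x = c *s x" "app (A * B) x = app A (app B x)"
  "app A (x + z) = app A x + app A z" "app A (x - z) = app A x - app A z" "app A 0 = 0"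
  "app A (c *s x) = c *s app A x"
proof -
  show "app (cst c) x = c *s x"
    by (simp add: app_def mat_of_simps matrix_vector_mult_def vec_eq_iff mat_def
        if_distrib[of "\<lambda>x. x * _"] cong: if_cong)
  show "app (A * B) x = app A (app B x)" by (simp add: app_def mat_of_simps matrix_vector_mul_assoc)
  show "app 1 x = x" by (simp add: app_def mat_of_simps)
qed (simp_all add: app_def mat_of_simps matrix_vector_mult_def vec_eq_iff algebra_simps sum.distrib
   sum_subtractf sum_negf sum_distrib_left)

lemma app_sum: "app (sum f S) x = (\<Sum>i\<in>S. app (f i) x)"
  by (induction S rule: infinite_finite_induct) auto

lemma sqm_eqI: "(\<And>x. app A x = app B x) \<Longrightarrow> A = B"
  by (simp add: app_def sqm_eq_iff matrix_eq)

lemma app_eqD: "A = B \<Longrightarrow> app A x = app B x" by simp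

lemma cst_simps [simp]: "cst (a + b) = cst a + cst b" "cst (a * b) = cst a * cst b"
  "cst 0 = 0" "cst 1 = 1"
  by (rule sqm_eqI; simp add: vec_eq_iff algebra_simps)+

lemma cst_commute: "cst a * A = A * cst a"
  by (rule sqm_eqI) simp

text \<open>Substitution of a matrix into a polynomial with scalar coefficients; \<open>poly\<close>
  evaluates only inside the coefficient ring.\<close>

definition ev :: "('a::field, 'n::finite) sqm \<Rightarrow> 'a poly \<Rightarrow> ('a, 'n) sqm" where
  "ev N p = (\<Sum>i\<le>degree p. cst (coeff p i) * N ^ i)"

lemma ev_altdef: "degree p \<le> n \<Longrightarrow> ev N p = (\<Sum>i\<le>n. cst (coeff p i) * N ^ i)"
  unfolding ev_def by (rule sum.mono_neutral_left) (auto simp: coeff_eq_0)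

lemma ev_0 [simp]: "ev N 0 = 0" by (simp add: ev_def)

lemma ev_pCons [simp]: "ev N (pCons a p) = cst a + N * ev N p"
proof -
  have "ev N (pCons a p) = (\<Sum>i\<le>Suc (degree p). cst (coeff (pCons a p) i) * N ^ i)"
    by (rule ev_altdef) (rule degree_pCons_le)
  also have "\<dots> = cst a + (\<Sum>i\<le>degree p. N * (cst (coeff p i) * N ^ i))"
    by (subst sum.atMost_Suc_shift) (simp add: cst_commute mult.assoc power_commutes flip: power_Suc2)
  finally show ?thesis by (simp add: ev_def sum_distrib_left)
qed

lemma ev_add [simp]: "ev N (p + q) = ev N p + ev N q"
proof -
  let ?n = "max (degree p) (degree q)"
  have "ev N (p + q) = (\<Sum>i\<le>?n. cst (coeff (p + q) i) * N ^ i)"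
    by (rule ev_altdef) (rule degree_add_le_max)
  thus ?thesis by (simp add: ev_altdef[of p ?n] ev_altdef[of q ?n] distrib_right sum.distrib)
qed

lemma ev_smult [simp]: "ev N (smult c p) = cst c * ev N p"
  by (induction p) (auto simp: distrib_left mult.assoc[symmetric] cst_commute[of c N])

lemma ev_commute: "A * N = N * A \<Longrightarrow> A * ev N p = ev N p * A"
  by (induction p) (auto simp: distrib_left distrib_right cst_commute mult.assoc simp flip: mult.assoc[of A N])

lemma ev_mult [simp]: "ev N (p * q) = ev N p * ev N q"
  by (induction p) (auto simp: distrib_right mult.assoc)

lemma ev_1 [simp]: "ev N 1 = 1" by (simp add: ev_def)

lemma ev_X: "ev N [:0, 1:] = N" by simp

lemma ev_power [simp]: "ev N (p ^ n) = ev N p ^ n" by (induction n) auto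

lemma ev_monom: "ev N (monom c n) = cst c * N ^ n"
  by (simp add: monom_altdef)

lemma ev_commute_ev: "A * N = N * A \<Longrightarrow> ev A p * ev N q = ev N q * ev A p"
  by (metis ev_commute)

text \<open>Newton iteration: an approximate inverse \<open>G\<close> with error \<open>E\<close> is
  improved to \<open>G * (1 - E)\<close>, whose error is \<open>- E * E\<close>, so the precision
  doubles.\<close>

lemma poly_inverse_mod:
  fixes F :: "'a::field poly"
  assumes "coeff F 0 \<noteq> 0"
  shows "\<exists>G H. F * G = 1 + [:0, 1:] ^ (2 ^ n) * H"
proof (induction n)
  case 0
  define a where "a = coeff F 0"
  obtain E where E: "F = pCons a E" unfolding a_def by (cases F) auto
  have "F * [:inverse a:] = 1 + [:0, 1:] * smult (inverse a) E"
    using assms by (simp add: E a_def[symmetric] one_pCons)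
  thus ?case by (metis power_0 power_one_right)
next
  case (Suc n)
  then obtain G H where GH: "F * G = 1 + [:0, 1:] ^ (2 ^ n) * H" by blast
  have "F * (G * (1 - [:0, 1:] ^ (2 ^ n) * H)) = (1 + [:0, 1:] ^ (2 ^ n) * H) * (1 - [:0, 1:] ^ (2 ^ n) * H)"
    by (simp add: GH flip: mult.assoc)
  also have "\<dots> = 1 + [:0, 1:] ^ (2 ^ Suc n) * (- H * H)"
    by (simp add: algebra_simps power_add mult_2)
  finally show ?case by blast
qed

lemma ev_inverse:
  assumes "coeff F 0 \<noteq> 0" and "N ^ r = 0"
  shows "\<exists>G. ev N F * ev N G = 1"
proof -
  have "r < 2 ^ r" by simp
  hence z: "N ^ (2 ^ r) = 0" using assms(2)
    by (metis le_add_diff_inverse less_imp_le mult_zero_left power_add)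
  obtain G H where "F * G = 1 + [:0, 1:] ^ (2 ^ r) * H" using poly_inverse_mod[OF assms(1)] by blast
  from arg_cong[OF this, of "ev N"] show ?thesis using z by (auto simp: ev_X simp del: ev_pCons)
qed

text \<open>Read backwards from \<open>m\<close>, the sequence is a power series with nonzero
  constant term, and \<open>g\<close> consists of the coefficients of its inverse.\<close>

lemma hankel_inverse:
  fixes a :: "nat \<Rightarrow> 'a::field"
  assumes "a m \<noteq> 0" and "\<And>s. s > m \<Longrightarrow> a s = 0"
  shows "\<exists>g. \<forall>j. (\<Sum>i\<le>m. g i * a (i + j)) = (if j = m then 1 else 0)"
proof -
  define A where "A = Abs_fps (\<lambda>s. if s \<le> m then a (m - s) else 0)"
  define g where "g = fps_nth (inverse A)"
  have "inverse A * A = 1" using assms(1) by (intro inverse_mult_eq_1) (simp add: A_def)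
  hence *: "(\<Sum>i\<le>s. g i * fps_nth A (s - i)) = (if s = 0 then 1 else 0)" for s
    using fps_mult_nth[of "inverse A" A s] by (simp add: g_def atLeast0AtMost)
  show ?thesis
  proof (intro exI allI)
    fix j
    show "(\<Sum>i\<le>m. g i * a (i + j)) = (if j = m then 1 else 0)"
    proof (cases "j \<le> m")
      case True
      have "(\<Sum>i\<le>m. g i * a (i + j)) = (\<Sum>i\<le>m - j. g i * a (i + j))"
        using assms(2) by (intro sum.mono_neutral_right) auto
      also have "\<dots> = (\<Sum>i\<le>m - j. g i * fps_nth A (m - j - i))"
        using True by (intro sum.cong) (auto simp: A_def add.commute)
      also have "\<dots> = (if m - j = 0 then 1 else 0)" by (rule *)
      finally show ?thesis using True by auto
    next
      case False
      thus ?thesis using assms(2) by simp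
    qed
  qed
qed

lemma vec_char2:
  assumes "(2 :: 'k::field) = 0"
  shows "(x :: 'k) + x = 0" "- x = x" "(v :: 'k^'i) + v = 0" "- v = v"
    "(A :: ('k, 'i::finite) sqm) + A = 0" "- A = A"
proof -
  show 1: "x + x = 0" for x :: 'k using assms by (metis mult_2 mult_zero_left)
  show 2: "- x = x" for x :: 'k using 1[of x] by (simp add: neg_eq_iff_add_eq_0)
  show 3: "v + v = 0" "- v = v" for v :: "'k^'i" by (simp_all only: vec_eq_iff vector_add_component vector_uminus_component 1 2 zero_index) simp_all
  show "A + A = 0" "- A = A" by (rule sqm_eqI; simp add: 3)+
qed

section \<open>The symplectic form and its adjoint involution\<close>

definition sw :: "'n + 'n \<Rightarrow> 'n + 'n" where "sw i = (case i of Inl a \<Rightarrow> Inr a | Inr a \<Rightarrow> Inl a)"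

lemma sw_sw [simp]: "sw (sw i) = i" by (cases i) (auto simp: sw_def)

lemma sw_eq_iff [simp]: "sw i = sw j \<longleftrightarrow> i = j" by (metis sw_sw)

lemma sum_sw: "(\<Sum>i\<in>UNIV. f (sw i)) = (\<Sum>i\<in>(UNIV :: ('n::finite + 'n) set). f i)"
  by (rule sum.reindex_bij_witness[of _ sw sw]) auto

text \<open>In characteristic two the symplectic form is symmetric and its matrix is the permutation
  matrix of \<open>sw\<close>.\<close>

definition form :: "'k::field^('n::finite + 'n) \<Rightarrow> 'k^('n + 'n) \<Rightarrow> 'k" where
  "form x z = (\<Sum>i\<in>UNIV. x $ i * z $ sw i)"

text \<open>In matrix terms \<open>J * transpose A * J\<close>, where \<open>J\<close> is the
  permutation matrix of \<open>sw\<close> and its own inverse.\<close>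

definition star :: "('k::field, 'n::finite + 'n) sqm \<Rightarrow> ('k, 'n + 'n) sqm" where
  "star A = sqm_of (\<chi> i j. mat_of A $ sw j $ sw i)"

text \<open>The rank one operator sending \<open>v\<close> to \<open>form v z *s x\<close>; the swap
  in the column index comes from the form.\<close>

definition rk :: "'k::field^('n::finite + 'n) \<Rightarrow> 'k^('n + 'n) \<Rightarrow> ('k, 'n + 'n) sqm" where
  "rk x z = sqm_of (\<chi> i j. x $ i * z $ sw j)"

lemma form_simps [simp]: "form (x + x') z = form x z + form x' z" "form (x - x') z = form x z - form x' z"
   "form (c *s x) z = c * form x z"
   "form z (x + x') = form z x + form z x'"  "form z (x - x') = form z x - form z x'" "form z (c *s x) = c * form z x"
   "form 0 z = 0" "form z 0 = 0"
  by (simp_all add: form_def algebra_simps sum.distrib sum_subtractf sum_distrib_left)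

lemma form_sum: "form (sum f S) z = (\<Sum>i\<in>S. form (f i) z)" "form z (sum f S) = (\<Sum>i\<in>S. form z (f i))"
  by (induction S rule: infinite_finite_induct) auto

lemma form_sym: "form x z = form z x"
  unfolding form_def by (subst sum_sw[symmetric]) (simp add: mult.commute)

lemma form_app: "form (app A x) z = form x (app (star A) z)"
proof -
  have "form (app A x) z = (\<Sum>i\<in>UNIV. \<Sum>j\<in>UNIV. mat_of A $ i $ j * x $ j * z $ sw i)"
    by (simp add: form_def app_def matrix_vector_mult_def sum_distrib_right)
  also have "\<dots> = (\<Sum>j\<in>UNIV. \<Sum>i\<in>UNIV. mat_of A $ i $ j * x $ j * z $ sw i)" by (rule sum.swap)
  also have "\<dots> = (\<Sum>j\<in>UNIV. \<Sum>i\<in>UNIV. mat_of A $ sw i $ j * x $ j * z $ i)"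
    by (subst sum_sw[symmetric, where f = "\<lambda>i. mat_of A $ i $ _ * x $ _ * z $ sw i"]) simp
  also have "\<dots> = form x (app (star A) z)"
    by (simp add: form_def app_def star_def matrix_vector_mult_def sum_distrib_left ac_simps)
  finally show ?thesis .
qed

lemma form_nondegenerate:
  assumes "\<And>x. form x z = 0" shows "z = 0"
proof -
  have "z $ i = 0" for i
  proof -
    have "form (axis (sw i) 1) z = (\<Sum>j\<in>UNIV. (if j = sw i then 1 else 0) * z $ sw j)"
      unfolding form_def axis_def by (intro sum.cong) auto
    also have "\<dots> = z $ i" by (simp add: if_distrib[of "\<lambda>x. x * _"] cong: if_cong)
    finally show ?thesis using assms by simp
  qed
  thus ?thesis by (simp add: vec_eq_iff)
qed

lemma form_dual: "z \<noteq> 0 \<Longrightarrow> \<exists>x. form x z = 1"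
proof -
  assume "z \<noteq> 0"
  then obtain x where "form x z \<noteq> 0" using form_nondegenerate by blast
  thus ?thesis by (intro exI[of _ "inverse (form x z) *s x"]) simp
qed

lemma star_eqI: "(\<And>x z. form (app A x) z = form x (app B z)) \<Longrightarrow> star A = B"
proof (rule sqm_eqI)
  fix z assume *: "\<And>x z. form (app A x) z = form x (app B z)"
  have "form x (app (star A) z - app B z) = 0" for x using * by (simp flip: form_app)
  from form_nondegenerate[OF this] show "app (star A) z = app B z" by simp
qed

lemma star_simps [simp]: "star (A + B) = star A + star B" "star (A - B) = star A - star B" "star (A * B) = star B * star A"
   "star (cst c) = cst c" "star 1 = 1" "star 0 = 0"
  by (rule star_eqI; simp add: form_app)+

lemma star_star [simp]: "star (star A) = A"
proof (rule star_eqI)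
  fix x z
  have "form (app (star A) x) z = form z (app (star A) x)" by (rule form_sym)
  also have "\<dots> = form (app A z) x" by (rule form_app[symmetric])
  also have "\<dots> = form x (app A z)" by (rule form_sym)
  finally show "form (app (star A) x) z = form x (app A z)" .
qed

lemma star_sum: "star (sum f S) = (\<Sum>i\<in>S. star (f i))"
  by (induction S rule: infinite_finite_induct) auto

lemma star_power: "star (A ^ n) = star A ^ n"
  by (induction n) (auto simp: power_commutes)

lemma star_ev: "star (ev N p) = ev (star N) p"
  by (induction p) (auto simp: ev_commute)

lemma app_rk [simp]: "app (rk x z) v = form v z *s x"
  by (simp add: form_def app_def rk_def matrix_vector_mult_def vec_eq_iff sum_distrib_left sum_distrib_right ac_simps)

lemma star_rk [simp]: "star (rk x z) = rk z x"
  by (rule star_eqI) (simp add: form_sym mult.commute)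

lemma mult_rk: "A * rk x z = rk (app A x) z" "rk x z * A = rk x (app (star A) z)"
  by (rule sqm_eqI; simp add: form_app)+

lemma rk_mult_rk: "rk x z * rk x' z' = cst (form x' z) * rk x z'"
  by (rule sqm_eqI) (simp add: mult.commute)

lemma sqm_left_right_inverse: "A * B = 1 \<longleftrightarrow> B * (A :: ('k::field, 'n::finite) sqm) = 1"
  by (simp add: sqm_eq_iff mat_of_simps) (rule matrix_left_right_inverse)

section \<open>Arithmetic in characteristic two\<close>

locale char2 =
  fixes K :: "'k::alg_closed_field itself"
  assumes two: "(2 :: 'k) = 0"
begin

lemma add_self [simp]: "(x :: 'k) + x = 0" "(v :: 'k^'i) + v = 0" "(A :: ('k, 'i::finite) sqm) + A = 0"
  using vec_char2[OF two] by blast+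

lemma add_self_left [simp]: "(x :: 'k) + (x + z) = z" "(v :: 'k^'i) + (v + w) = w"
  "(A :: ('k, 'i::finite) sqm) + (A + B) = B"
  by (simp_all flip: add.assoc)

lemma uminus_eq [simp]: "- (x :: 'k) = x" "- (v :: 'k^'i) = v" "- (A :: ('k, 'i::finite) sqm) = A"
  using vec_char2[OF two] by blast+

lemma diff_eq_add [simp]: "(x :: 'k) - z = x + z" "(v :: 'k^'i) - w = v + w" "(A :: ('k, 'i::finite) sqm) - B = A + B"
  by (simp_all add: diff_conv_add_uminus del: add_uminus_conv_diff)

lemma add_eq_0 [simp]: "(x :: 'k) + z = 0 \<longleftrightarrow> x = z" "(v :: 'k^'i) + w = 0 \<longleftrightarrow> v = w" "(A :: ('k, 'i::finite) sqm) + B = 0 \<longleftrightarrow> A = B"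
  by (auto simp: add_eq_0_iff)

lemma form_self [simp]: "form x x = (0 :: 'k)"
proof -
  have "form x x = (\<Sum>i\<in>range Inl. x $ i * x $ sw i) + (\<Sum>i\<in>range Inr. x $ i * x $ sw i)"
    unfolding form_def UNIV_sum by (rule sum.union_disjoint) auto
  also have "(\<Sum>i\<in>range Inr. x $ i * x $ sw i) = (\<Sum>i\<in>range Inl. x $ i * x $ sw i)"
    by (rule sum.reindex_bij_witness[of _ sw sw]) (auto simp: sw_def)
  finally show ?thesis by simp
qed

lemma poly_add_self [simp]: "(p :: 'k poly) + p = 0" "p + (p + q) = q"
proof -
  show "p + p = 0" for p :: "'k poly" by (rule poly_eqI) (simp only: coeff_add add_self coeff_0)
  thus "p + (p + q) = q" by (simp flip: add.assoc)
qed

text \<open>The equation says that \<open>ev y p + ev y q * N\<close> is an isometry wherever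
  \<open>y ^ m\<close> vanishes, because \<open>N + star N\<close> and \<open>N * star N\<close>
  both equal \<open>y\<close>. It is solved by successive approximation: a correction of
  \<open>q\<close> in positive degree \<open>n\<close> changes the left side first in degree
  \<open>n + 1\<close>, linearly with coefficient \<open>coeff p 0 = 1\<close>.\<close>

lemma poly_unitary:
  fixes p :: "'k poly"
  assumes p: "coeff p 0 = 1" and m: "m \<ge> 1"
  shows "\<exists>q h. p * p + [:0, 1:] * (p * q) + [:0, 1:] * (q * q) = 1 + [:0, 1:] ^ m * h \<and> coeff q (m - 1) = c"
proof -
  define X where "X = [:0, 1 :: 'k:]"
  define F where "F q = p * p + X * (p * q) + X * (q * q) + 1" for q
  have F_add: "F (q + smult d (X ^ n)) = F q + X ^ Suc n * (smult d p + smult (d * d) (X ^ n))" for q d n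
  proof -
    have "F (q + smult d (X ^ n)) = F q + X ^ Suc n * (smult d p + smult (d * d) (X ^ n))
       + (X * (q * smult d (X ^ n)) + X * (q * smult d (X ^ n)))"
      by (simp add: F_def algebra_simps)
    thus ?thesis by simp
  qed
  have Xdvd: "X ^ n dvd r \<longleftrightarrow> (\<forall>i<n. coeff r i = 0)" for n r
    using monom_1_dvd_iff'[of n r] by (simp add: X_def monom_altdef)
  have coeff_X: "coeff (X ^ n * r) i = (if i < n then 0 else coeff r (i - n))" for n r i
    using coeff_monom_mult[of 1 n r i] by (simp add: X_def monom_altdef)
  have "\<exists>q. X ^ Suc (Suc n) dvd F q" for n
  proof (induction n)
    case 0
    \<comment> \<open>Odd coefficients of a square vanish in characteristic two, so
      \<open>q = 0\<close> is already correct modulo the square of \<open>X\<close>.\<close>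
    have "coeff (p * p) 1 = 0" using p by (simp add: coeff_mult atMost_Suc)
    moreover have "coeff (p * p) 0 = 1" using p by (simp add: coeff_mult)
    ultimately have "\<forall>i<Suc (Suc 0). coeff (F 0) i = 0" by (auto simp: F_def less_Suc_eq)
    thus ?case using Xdvd by metis
  next
    case (Suc n)
    then obtain q where q: "\<forall>i<Suc (Suc n). coeff (F q) i = 0" using Xdvd by blast
    define d where "d = coeff (F q) (Suc (Suc n))"
    have "coeff (F (q + smult d (X ^ Suc n))) i = 0" if "i < Suc (Suc (Suc n))" for i
    proof -
      have "coeff (X ^ Suc n) 0 = (0 :: 'k)" by (simp add: X_def)
      thus ?thesis using that q p d_def
        by (auto simp: F_add coeff_X less_Suc_eq simp del: power_Suc)
    qed
    thus ?case using Xdvd by blast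
  qed
  then obtain q where "X ^ Suc (Suc m) dvd F q" by blast
  moreover have "X ^ m dvd X ^ Suc (Suc m)" by (rule le_imp_power_dvd) simp
  ultimately have q: "X ^ m dvd F q" by (rule dvd_trans[rotated])
  \<comment> \<open>Changing \<open>q\<close> in degree \<open>m - 1\<close> affects the equation
    only by multiples of \<open>X ^ m\<close>, so this coefficient is a free parameter.\<close>
  define d where "d = coeff q (m - 1) + c"
  have "F (q + smult d (X ^ (m - 1))) = F q + X ^ m * (smult d p + smult (d * d) (X ^ (m - 1)))"
    using F_add[of q d "m - 1"] m by simp
  moreover have "X ^ m dvd F q + X ^ m * (smult d p + smult (d * d) (X ^ (m - 1)))"
    by (intro dvd_add q dvd_triv_left)
  ultimately obtain h where h: "F (q + smult d (X ^ (m - 1))) = X ^ m * h" by (metis dvdE)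
  have "coeff (q + smult d (X ^ (m - 1))) (m - 1) = c"
    using coeff_X[of "m - 1" 1 "m - 1"] by (simp add: d_def)
  moreover have "p * p + X * (p * r) + X * (r * r) = 1 + X ^ m * h" if "F r = X ^ m * h" for r
    using arg_cong[OF that, of "\<lambda>r. r + 1"] by (simp add: F_def ac_simps)
  ultimately show ?thesis using h unfolding X_def by blast
qed

end

lemma power_mult_commuting: "x * z = z * x \<Longrightarrow> (x * z) ^ n = x ^ n * (z :: 'a::monoid_mult) ^ n"
proof (induction n)
  case (Suc n)
  have "x ^ n * z = z * x ^ n" using Suc.prems by (rule power_commuting_commutes)
  thus ?case using Suc by (simp add: mult.assoc) (metis mult.assoc)
qed simp

text \<open>Pairing with a vector dual to the top of the chain extracts one coefficient of
  \<open>p\<close>; in this way the parameters of the families below are read off by linear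
  functionals.\<close>

lemma form_ev_dual:
  assumes "\<And>j. form (app (M ^ j) v) w = (if j = k then 1 else 0)"
  shows "form (app (ev M p) (app (M ^ i) v)) w = (if i \<le> k then coeff p (k - i) else 0)"
proof (induction p arbitrary: i)
  case (pCons a p)
  have "app (M * ev M p) (app (M ^ i) v) = app (ev M p) (app (M ^ Suc i) v)"
    using ev_commute[of M M p] by (metis app_simps(7) power_Suc)
  hence "form (app (ev M (pCons a p)) (app (M ^ i) v)) w = a * (if i = k then 1 else 0) + (if Suc i \<le> k then coeff p (k - Suc i) else 0)"
    using assms pCons.IH[of "Suc i"] by (simp del: power_Suc)
  thus ?case by (auto simp: coeff_pCons split: nat.split) (metis Suc_diff_Suc diff_Suc_Suc less_eq_Suc_le nat.inject order.not_eq_order_implies_strict)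
qed simp

subsection \<open>Unipotent elements of the symplectic group\<close>

lemma cst_left: "A * (cst c * B) = cst c * (A * B)"
  by (simp only: cst_commute[of c A] mult.assoc[symmetric])

locale unip = char2 K for K :: "'k::alg_closed_field itself" +
  fixes u :: "('k, 'n::finite + 'n) sqm"
  assumes isom: "star u * u = 1" and nil: "\<exists>r. (u + 1) ^ r = 0"
begin

definition N :: "('k, 'n + 'n) sqm" where "N = u + 1"
definition M :: "('k, 'n + 'n) sqm" where "M = star N"
definition y :: "('k, 'n + 'n) sqm" where "y = N + M"

lemma isom': "u * star u = 1" using isom sqm_left_right_inverse by blast

lemma M_eq: "M = star u + 1" by (simp add: M_def N_def)
lemma y_eq: "y = u + star u" by (simp add: y_def M_eq N_def ac_simps)
lemma star_N [simp]: "star N = M" "star M = N" by (simp_all add: M_def)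
lemma star_y [simp]: "star y = y" by (simp add: y_def ac_simps)
lemma NM: "N * M = y" "M * N = y"
  by (simp_all add: y_eq M_eq N_def distrib_left distrib_right isom isom' ac_simps)
lemma u_eq: "u = N + 1" by (simp add: N_def)
lemma M_y_N: "M = N + y" by (simp add: y_def)
lemma yN: "y * N = N * y" by (simp add: y_def distrib_left distrib_right NM)
lemma NN: "N * N = y + y * N"
proof -
  have "N = M + y" by (simp add: y_def ac_simps)
  hence "N * N = N * (M + y)" by metis
  thus ?thesis by (simp add: distrib_left NM yN)
qed
lemma commute_star_u:
  assumes "A * u = u * A" shows "A * star u = star u * A"
proof -
  have "A * star u = star u * (u * A) * star u" by (simp add: isom mult.assoc[symmetric])
  also have "\<dots> = star u * A" by (simp add: assms[symmetric] mult.assoc isom')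
  finally show ?thesis .
qed

lemma commute_N: "A * u = u * A \<Longrightarrow> A * N = N * A"
  and commute_M: "A * u = u * A \<Longrightarrow> A * M = M * A"
  and commute_y: "A * u = u * A \<Longrightarrow> A * y = y * A"
  using commute_star_u by (simp_all add: N_def M_eq y_eq distrib_left distrib_right)

lemma yM: "y * M = M * y" by (simp add: y_def distrib_left distrib_right NM)

lemma form_shift: "form x (app B z) = form (app (star B) x) (z :: 'k^('n + 'n))"
  by (simp add: form_app)

text \<open>This is \<open>K[u]\<close>, written as a module over \<open>K[y]\<close> with
  generators 1 and \<open>N\<close>, which is possible because \<open>N * N = y + y * N\<close>. In
  this form the involution is explicit: it fixes \<open>K[y]\<close> and sends \<open>N\<close> to
  \<open>N + y\<close>.\<close>

definition alg :: "('k, 'n + 'n) sqm set" where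
  "alg = {ev y a + ev y b * N | a b. True}"

lemma algI: "A = ev y a + ev y b * N \<Longrightarrow> A \<in> alg" by (auto simp: alg_def)

lemma alg_mult: assumes "A \<in> alg" "B \<in> alg" shows "A * B \<in> alg"
proof -
  obtain a b c d where A: "A = ev y a + ev y b * N" and B: "B = ev y c + ev y d * N"
    using assms by (auto simp: alg_def)
  have com: "ev y p * N = N * ev y p" for p using ev_commute[of N y p] yN by metis
  have com': "N * (ev y p * B) = ev y p * (N * B)" for p B using com[of p] by (simp flip: mult.assoc)
  have "A * B = ev y a * ev y c + (ev y a * ev y d + ev y b * ev y c) * N + ev y b * ev y d * (N * N)"
    unfolding A B by (simp add: distrib_left distrib_right mult.assoc com' com[symmetric] add.assoc)
  also have "ev y b * ev y d * (N * N) = y * (ev y b * ev y d) + y * (ev y b * ev y d) * N"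
    using ev_commute[of y y "b * d"] by (simp add: NN distrib_left mult.assoc[symmetric])
  also have "ev y a * ev y c + (ev y a * ev y d + ev y b * ev y c) * N + (y * (ev y b * ev y d) + y * (ev y b * ev y d) * N)
     = ev y (a * c + [:0, 1:] * (b * d)) + ev y (a * d + b * c + [:0, 1:] * (b * d)) * N"
    by (simp add: distrib_left distrib_right ac_simps)
  finally show ?thesis by (rule algI)
qed

lemma alg_basic: "N \<in> alg" "1 \<in> alg" "ev y a \<in> alg" "y \<in> alg" "A \<in> alg \<Longrightarrow> B \<in> alg \<Longrightarrow> A + B \<in> alg"
proof -
  show "N \<in> alg" by (rule algI[of _ 0 1]) simp
  show "1 \<in> alg" by (rule algI[of _ 1 0]) simp
  show "ev y a \<in> alg" for a by (rule algI[of _ a 0]) simp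
  from this[of "[:0, 1:]"] show "y \<in> alg" by simp
  assume "A \<in> alg" "B \<in> alg"
  then obtain a b c d where "A = ev y a + ev y b * N" "B = ev y c + ev y d * N" by (auto simp: alg_def)
  thus "A + B \<in> alg" by (intro algI[of _ "a + c" "b + d"]) (simp add: distrib_right ac_simps)
qed

lemma alg_M: "M \<in> alg" unfolding M_y_N by (intro alg_basic)

lemma alg_cst: "cst c \<in> alg" using alg_basic(3)[of "[:c:]"] by simp

lemma alg_power: "A \<in> alg \<Longrightarrow> A ^ n \<in> alg" by (induction n) (auto intro: alg_mult alg_basic)

lemma alg_sum: "(\<And>i. i \<in> S \<Longrightarrow> f i \<in> alg) \<Longrightarrow> sum f S \<in> alg"
  using alg_basic(3)[of 0] by (induction S rule: infinite_finite_induct) (auto intro: alg_basic)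

lemma alg_ev: "A \<in> alg \<Longrightarrow> ev A p \<in> alg"
  unfolding ev_def by (intro alg_sum alg_mult alg_cst alg_power)

lemma alg_star: assumes "A \<in> alg" shows "star A \<in> alg"
proof -
  obtain a b where A: "A = ev y a + ev y b * N" using assms by (auto simp: alg_def)
  have "star A = ev y a + M * ev y b" by (simp add: A star_ev)
  thus ?thesis by (simp only: alg_basic alg_mult alg_M)
qed

lemma alg_commute: "A \<in> alg \<Longrightarrow> B * u = u * B \<Longrightarrow> A * B = B * A"
proof -
  assume "A \<in> alg" and B: "B * u = u * B"
  then obtain a b where A: "A = ev y a + ev y b * N" by (auto simp: alg_def)
  have "B * ev y p = ev y p * B" for p by (rule ev_commute[OF commute_y[OF B]])
  moreover from this[of b] have "B * (ev y b * N) = ev y b * N * B"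
    by (simp add: mult.assoc commute_N[OF B, symmetric]) (simp add: mult.assoc[symmetric])
  ultimately show "A * B = B * A" unfolding A by (simp add: distrib_left distrib_right)
qed

lemma alg_u: "u \<in> alg"
  using alg_basic(5)[OF alg_basic(1,2)] by (simp only: u_eq[symmetric])

lemma alg_commute_alg: "A \<in> alg \<Longrightarrow> B \<in> alg \<Longrightarrow> A * B = B * A"
  using alg_commute[OF _ alg_commute[OF _ refl]] .

section \<open>The quadratic forms and totally isotropic submodules\<close>

definition Q :: "nat \<Rightarrow> 'k^('n + 'n) \<Rightarrow> 'k" where "Q i x = form (app (y ^ i * N) x) x"

text \<open>Every power of \<open>y\<close> has the shape \<open>star B * B\<close>, with
  \<open>B\<close> a power of \<open>y\<close> or \<open>M\<close> times one, and the form is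
  alternating. Hence only the component of \<open>A\<close> at \<open>N\<close> contributes to
  \<open>form (app A x) x\<close>, and the \<open>Q i\<close> carry the whole information.\<close>

lemma form_y_self [simp]: "form (app (y ^ i) x) x = 0"
proof -
  define j where "j = i div 2"
  have "i = 2 * j \<or> i = Suc (2 * j)" unfolding j_def by presburger
  thus ?thesis
  proof
    assume "i = 2 * j"
    hence "y ^ i = y ^ j * y ^ j" by (simp add: mult_2 power_add)
    hence "form (app (y ^ i) x) x = form (app (y ^ j) x) (app (y ^ j) x)"
      by (simp only: form_shift star_power star_y app_simps)
    thus ?thesis by simp
  next
    assume "i = Suc (2 * j)"
    hence "y ^ i = y ^ j * (N * M) * y ^ j" by (simp add: NM mult_2 power_add power_commutes mult.assoc)
    hence "y ^ i = star (M * y ^ j) * (M * y ^ j)" by (simp add: star_power mult.assoc)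
    hence "form (app (y ^ i) x) x = form (app (M * y ^ j) x) (app (M * y ^ j) x)"
      by (simp only: form_shift[of _ "M * y ^ j"] app_simps(7)[of "star _"])
    thus ?thesis by simp
  qed
qed

lemma form_ev_y_self [simp]: "form (app (ev y p) x) x = 0"
  by (simp add: ev_def app_sum form_sum)

text \<open>The two mixed terms combine to \<open>y ^ i * (N + M)\<close>, so the polar form of
  \<open>Q i\<close> is the form twisted by \<open>y ^ Suc i\<close>.\<close>

lemma Q_add: "Q i (x + z) = Q i x + Q i z + form (app (y ^ Suc i) x) z"
proof -
  have "form (app (y ^ i * N) z) x = form z (app (M * y ^ i) x)"
    by (simp only: form_app star_simps star_power star_y star_N)
  also have "\<dots> = form (app (M * y ^ i) x) z" by (rule form_sym)
  finally have "form (app (y ^ i * N) z) x = form (app (M * y ^ i) x) z" .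
  moreover have "M * y ^ i = y ^ i * M" using power_commuting_commutes[OF yM] by metis
  ultimately have "form (app (y ^ i * N) z) x + form (app (y ^ i * N) x) z = form (app (y ^ i * (N + M)) x) z"
    by (simp add: add.commute)
  also have "y ^ i * (N + M) = y ^ Suc i" by (simp add: y_def[symmetric] power_commutes)
  finally show ?thesis unfolding Q_def by (simp del: app_simps(7) power_Suc add: ac_simps)
qed

lemma Q_scale: "Q i (c *s x) = c * c * Q i x" by (simp add: Q_def)

lemma Q_pow: "Q i (app (y ^ r) x) = Q (i + 2 * r) x"
proof -
  have "Q i (app (y ^ r) x) = form (app (y ^ r * (y ^ i * N) * y ^ r) x) x"
    by (simp add: Q_def form_shift star_power)
  also have "y ^ r * (y ^ i * N) * y ^ r = y ^ (i + 2 * r) * N"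
  proof -
    have "y ^ r * (y ^ i * N) * y ^ r = y ^ r * y ^ i * (y ^ r * N)"
      using power_commuting_commutes[OF yN, of r] by (simp only: mult.assoc)
    also have "\<dots> = y ^ (r + i + r) * N" by (simp only: power_add mult.assoc)
    also have "r + i + r = i + 2 * r" by simp
    finally show ?thesis .
  qed
  finally show ?thesis by (simp only: Q_def)
qed

lemma Q_zero: "app (y ^ m) x = 0 \<Longrightarrow> m \<le> i \<Longrightarrow> Q i x = 0"
proof -
  assume "app (y ^ m) x = 0" "m \<le> i"
  moreover have "y ^ i * N = (N * y ^ (i - m)) * y ^ m" using \<open>m \<le> i\<close> power_commuting_commutes[OF yN]
    by (simp add: mult.assoc flip: power_add)
  ultimately show ?thesis by (simp add: Q_def)
qed

text \<open>Moving \<open>B\<close> across leaves \<open>form (app C v) v\<close> with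
  \<open>C = star B * A\<close> in \<open>alg\<close>. The part of \<open>C\<close> in
  \<open>K[y]\<close> contributes nothing for any vector, the rest is a combination of the values
  \<open>Q i v\<close>.\<close>

lemma isotropic:
  assumes "\<And>i. Q i v = 0" and "A \<in> alg" "B \<in> alg"
  shows "form (app A v) (app B v) = 0"
proof -
  have *: "form (app A v) v = 0" if A: "A \<in> alg" for A
  proof -
    obtain a b where "A = ev y a + ev y b * N" using A by (auto simp: alg_def)
    thus ?thesis using assms(1) by (simp add: ev_def[of y b] app_sum form_sum Q_def)
  qed
  have "form (app A v) (app B v) = form (app (star B * A) v) v" by (simp add: form_shift)
  thus ?thesis using * assms by (simp add: alg_star alg_mult del: app_simps(7))
qed

text \<open>The \<open>Q i\<close> are made zero for decreasing \<open>i\<close>. A multiple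
  \<open>c\<close> of \<open>app (y ^ r) w\<close> changes the next form by a polynomial in
  \<open>c\<close> of degree at most two whose linear coefficient is the pairing 1, so a suitable
  \<open>c\<close> exists over an algebraically closed field. The forms of larger index keep their
  value 0.\<close>

lemma hensel:
  assumes m: "m \<ge> 1" and v: "app (y ^ m) v = 0" and w: "app (y ^ m) w = 0"
    and vw: "form (app (y ^ (m - 1)) v) w = 1" and Q: "Q (m - 1) v = 0" "Q (m - 1) w = 0"
  shows "\<exists>p. \<forall>i. Q i (v + app (ev y p) w) = 0"
proof -
  have Qz: "Q i v = 0" "Q i w = 0" if "i \<ge> m - 1" for i
    using that Q Q_zero[OF v] Q_zero[OF w] by (cases "i = m - 1"; auto)+
  have "\<exists>p. \<forall>i\<ge>m - 1 - k. Q i (v + app (ev y p) w) = 0" for k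
  proof (induction k)
    case 0
    show ?case by (rule exI[of _ 0]) (simp add: Qz)
  next
    case (Suc k)
    show ?case
    proof (cases "m - 1 - k = 0")
      case True thus ?thesis using Suc.IH by auto
    next
      case False
      define i0 where "i0 = m - 1 - Suc k"
      have i0: "m - 1 - k = Suc i0" "i0 + 2 \<le> m" using False by (auto simp: i0_def)
      \<comment> \<open>Chosen such that \<open>r + Suc i0 = m - 1\<close>: the polar form of
        \<open>Q i0\<close> then meets the normalised pairing.\<close>
      define r where "r = m - 2 - i0"
      obtain p where p: "\<And>i. i \<ge> Suc i0 \<Longrightarrow> Q i (v + app (ev y p) w) = 0" using Suc.IH i0 by auto
      define v1 where "v1 = v + app (ev y p) w"
      have v1m: "app (y ^ m) v1 = 0"
      proof -
        have "y ^ m * ev y p = ev y p * y ^ m" by (rule ev_commute) (rule power_commutes)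
        from arg_cong[OF this, of "\<lambda>A. app A w"] show ?thesis by (simp add: v1_def v w)
      qed
      have "app (y ^ (m - 1)) (app (ev y p) w) = app (ev y ([:0, 1:] ^ (m - 1) * p)) w"
        by (simp add: ev_X del: ev_pCons)
      hence "form (app (y ^ (m - 1)) (app (ev y p) w)) w = 0" by (simp only: form_ev_y_self)
      hence v1w: "form (app (y ^ (m - 1)) v1) w = 1" using vw by (simp add: v1_def)
      obtain c where "poly [:Q i0 v1, 1, Q (i0 + 2 * r) w:] c = 0"
        using alg_closed_imp_poly_has_root[of "[:Q i0 v1, 1, Q (i0 + 2 * r) w:]"] by auto
      hence c: "Q i0 v1 + c * c * Q (i0 + 2 * r) w + c = 0" by (simp add: algebra_simps)
      define q where "q = p + smult c ([:0, 1:] ^ r)"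
      have "v + app (ev y q) w = v1 + c *s app (y ^ r) w"
        by (simp add: q_def v1_def ev_X add.assoc del: ev_pCons)
      hence Qi: "Q i (v + app (ev y q) w) = Q i v1 + c * c * Q (i + 2 * r) w + c * form (app (y ^ (r + Suc i)) v1) w" for i
        by (simp only: Q_add Q_scale Q_pow form_simps form_shift[of _ "y ^ r"] star_power star_y
            power_add[of y r "Suc i"] app_simps)
      have "Q i (v + app (ev y q) w) = 0" if "i \<ge> i0" for i
      proof (cases "i = i0")
        case True
        moreover have "r + Suc i0 = m - 1" using i0 by (simp add: r_def)
        ultimately show ?thesis using c by (simp only: Qi v1w mult_1_right)
      next
        case False
        hence i: "i \<ge> Suc i0" using that by simp
        have "m \<le> r + Suc i" using i i0 by (simp add: r_def)
        then obtain s where "r + Suc i = s + m" by (metis le_add_diff_inverse2)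
        hence "app (y ^ (r + Suc i)) v1 = 0" by (simp only: power_add app_simps v1m)
        moreover have "Q (i + 2 * r) w = 0" using i i0 by (intro Qz) (simp add: r_def)
        ultimately show ?thesis using p[OF i] by (simp add: Qi v1_def)
      qed
      thus ?thesis unfolding i0_def by blast
    qed
  qed
  from this[of "m - 1"] show ?thesis by simp
qed

section \<open>Orthogonal summands, encoded by their projections, and families of isometries on
  them\<close>

definition prj :: "('k, 'n + 'n) sqm \<Rightarrow> bool" where
  "prj \<pi> \<longleftrightarrow> \<pi> * \<pi> = \<pi> \<and> star \<pi> = \<pi> \<and> \<pi> * u = u * \<pi>"

text \<open>A \<open>d\<close>-parameter family in the centralizer of \<open>u\<close>, supported on the image of \<open>\<pi>\<close>. The common
  eigenvector \<open>w\<close> is there to glue the families of two orthogonal summands: mixing their eigenvectors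
  gains one more parameter.\<close>

definition fat :: "('k, 'n + 'n) sqm \<Rightarrow> nat \<Rightarrow> 'k^('n + 'n) \<Rightarrow> bool" where
  "fat \<pi> d w \<longleftrightarrow> (\<exists>x z. (\<forall>i<d. app \<pi> (x i) = x i \<and> app \<pi> (z i) = z i) \<and>
     (\<forall>c. (\<forall>i<d. c i \<noteq> 0) \<longrightarrow> (\<exists>A. star A * A = 1 \<and> A * u = u * A \<and> A * \<pi> = \<pi> * A \<and>
        A * (1 + \<pi>) = 1 + \<pi> \<and> (\<exists>\<gamma>. \<gamma> \<noteq> 0 \<and> app A w = \<gamma> *s w) \<and>
        (\<forall>i<d. form (app A (x i)) (z i) = c i))))"

lemma prjD: assumes "prj \<pi>" shows "\<pi> * \<pi> = \<pi>" "star \<pi> = \<pi>" "\<pi> * u = u * \<pi>"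
  "\<And>x. app \<pi> (app \<pi> x) = app \<pi> x"
  using assms by (auto simp: prj_def simp flip: app_simps(7))

lemma prj_alg: "prj \<pi> \<Longrightarrow> A \<in> alg \<Longrightarrow> A * \<pi> = \<pi> * A"
  using alg_commute prjD(3) by blast

lemma prj_app: "prj \<pi> \<Longrightarrow> A \<in> alg \<Longrightarrow> app \<pi> x = x \<Longrightarrow> app \<pi> (app A x) = app A x"
  using prj_alg[of \<pi> A] by (metis app_simps(7))

lemma fat_mono: "fat \<pi> d w \<Longrightarrow> d' \<le> d \<Longrightarrow> fat \<pi> d' 0"
proof -
  assume f: "fat \<pi> d w" and d: "d' \<le> d"
  obtain x z where xz: "\<forall>i<d. app \<pi> (x i) = x i \<and> app \<pi> (z i) = z i"
    "\<And>c. \<forall>i<d. c i \<noteq> 0 \<Longrightarrow> \<exists>A. star A * A = 1 \<and> A * u = u * A \<and> A * \<pi> = \<pi> * A \<and>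
        A * (1 + \<pi>) = 1 + \<pi> \<and> (\<exists>\<gamma>. \<gamma> \<noteq> 0 \<and> app A w = \<gamma> *s w) \<and>
        (\<forall>i<d. form (app A (x i)) (z i) = c i)" using f unfolding fat_def by blast
  show ?thesis unfolding fat_def
  proof (rule exI[of _ x], rule exI[of _ z], rule conjI, intro allI impI conjI)
    fix i assume "i < d'" thus "app \<pi> (x i) = x i" "app \<pi> (z i) = z i" using xz(1) d by auto
  next
    show "\<forall>c. (\<forall>i<d'. c i \<noteq> 0) \<longrightarrow> (\<exists>A. star A * A = 1 \<and> A * u = u * A \<and> A * \<pi> = \<pi> * A \<and>
        A * (1 + \<pi>) = 1 + \<pi> \<and> (\<exists>\<gamma>. \<gamma> \<noteq> 0 \<and> app A 0 = \<gamma> *s 0) \<and>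
        (\<forall>i<d'. form (app A (x i)) (z i) = c i))"
    proof (intro allI impI)
    fix c :: "nat \<Rightarrow> 'k" assume c: "\<forall>i<d'. c i \<noteq> 0"
    have "\<forall>i<d. (if i < d' then c i else 1) \<noteq> 0" using c by simp
    from xz(2)[OF this] obtain A where A: "star A * A = 1" "A * u = u * A" "A * \<pi> = \<pi> * A"
        "A * (1 + \<pi>) = 1 + \<pi>" "\<forall>i<d. form (app A (x i)) (z i) = (if i < d' then c i else 1)" by blast
    have "app A 0 = 1 *s 0" by simp
    moreover have "\<forall>i<d'. form (app A (x i)) (z i) = c i" using A(5) d by simp
    ultimately show "\<exists>A. star A * A = 1 \<and> A * u = u * A \<and> A * \<pi> = \<pi> * A \<and>
        A * (1 + \<pi>) = 1 + \<pi> \<and> (\<exists>\<gamma>. \<gamma> \<noteq> 0 \<and> app A 0 = \<gamma> *s 0) \<and>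
        (\<forall>i<d'. form (app A (x i)) (z i) = c i)" using A(1-4) one_neq_zero by blast
    qed
  qed
qed

text \<open>Products of members of the two families give \<open>d1 + d2\<close> parameters, since
  each member acts trivially on the other summand. The second claim uses an isometry
  \<open>T\<close> that mixes the two eigenvectors; its parameter is read by a vector dual to
  \<open>w1\<close> in the first summand and one dual to \<open>w2\<close> in the second, where the
  products themselves pair to zero.\<close>

lemma fat_combine:
  assumes p: "prj \<pi>1" "prj \<pi>2" "\<pi>1 * \<pi>2 = 0" and f1: "fat \<pi>1 d1 w1" and f2: "fat \<pi>2 d2 w2"
    and w1: "app \<pi>1 w1 = w1" "app N w1 = 0" "w1 \<noteq> 0" and w2: "app \<pi>2 w2 = w2" "app N w2 = 0" "w2 \<noteq> 0"
  shows "fat (\<pi>1 + \<pi>2) (d1 + d2) w1" and "fat (\<pi>1 + \<pi>2) (d1 + d2 + 1) 0"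
proof -
  have p': "\<pi>2 * \<pi>1 = 0" using arg_cong[OF p(3), of star] prjD(2)[OF p(1)] prjD(2)[OF p(2)] by simp
  have orth: "form a b = 0" if "app \<pi>1 a = a" "app \<pi>2 b = b" for a b
  proof -
    have "form a b = form (app \<pi>1 a) (app \<pi>2 b)" using that by simp
    also have "\<dots> = form (app (\<pi>2 * \<pi>1) a) b" using prjD(2)[OF p(2)] by (simp add: form_shift)
    finally show ?thesis by (simp only: p' app_simps form_simps)
  qed
  have im2: "app \<pi>1 b = 0" if "app \<pi>2 b = b" for b
    using arg_cong[OF p(3), of "\<lambda>A. app A b"] that by simp
  have im1: "app \<pi>2 b = 0" if "app \<pi>1 b = b" for b
    using arg_cong[OF p', of "\<lambda>A. app A b"] that by simp
  obtain x1 z1 where 1: "\<And>i. i < d1 \<Longrightarrow> app \<pi>1 (x1 i) = x1 i" "\<And>i. i < d1 \<Longrightarrow> app \<pi>1 (z1 i) = z1 i"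
    "\<And>c. \<forall>i<d1. c i \<noteq> 0 \<Longrightarrow> \<exists>A. star A * A = 1 \<and> A * u = u * A \<and> A * \<pi>1 = \<pi>1 * A \<and>
        A * (1 + \<pi>1) = 1 + \<pi>1 \<and> (\<exists>\<gamma>. \<gamma> \<noteq> 0 \<and> app A w1 = \<gamma> *s w1) \<and>
        (\<forall>i<d1. form (app A (x1 i)) (z1 i) = c i)" using f1 unfolding fat_def by blast
  obtain x2 z2 where 2: "\<And>i. i < d2 \<Longrightarrow> app \<pi>2 (x2 i) = x2 i" "\<And>i. i < d2 \<Longrightarrow> app \<pi>2 (z2 i) = z2 i"
    "\<And>c. \<forall>i<d2. c i \<noteq> 0 \<Longrightarrow> \<exists>A. star A * A = 1 \<and> A * u = u * A \<and> A * \<pi>2 = \<pi>2 * A \<and>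
        A * (1 + \<pi>2) = 1 + \<pi>2 \<and> (\<exists>\<gamma>. \<gamma> \<noteq> 0 \<and> app A w2 = \<gamma> *s w2) \<and>
        (\<forall>i<d2. form (app A (x2 i)) (z2 i) = c i)" using f2 unfolding fat_def by blast
  obtain x' where x': "app \<pi>1 x' = x'" "form x' w1 = 1"
  proof -
    obtain x where "form x w1 = 1" using form_dual[OF w1(3)] by blast
    hence "form (app \<pi>1 x) w1 = 1" using w1(1) prjD(2)[OF p(1)] by (simp add: form_app)
    thus ?thesis using that[of "app \<pi>1 x"] prjD(4)[OF p(1)] by blast
  qed
  obtain z' where z': "app \<pi>2 z' = z'" "form w2 z' = 1"
  proof -
    obtain x where "form w2 x = 1" using form_dual[OF w2(3)] form_sym by metis
    hence "form w2 (app \<pi>2 x) = 1" using w2(1) prjD(2)[OF p(2)] by (simp add: form_shift)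
    thus ?thesis using that[of "app \<pi>2 x"] prjD(4)[OF p(2)] by blast
  qed
  define x where "x i = (if i < d1 then x1 i else if i < d1 + d2 then x2 (i - d1) else x')" for i
  define z where "z i = (if i < d1 then z1 i else if i < d1 + d2 then z2 (i - d1) else z')" for i
  have s1: "app (\<pi>1 + \<pi>2) b = b" if "app \<pi>1 b = b" for b using im1[OF that] that by simp
  have s2: "app (\<pi>1 + \<pi>2) b = b" if "app \<pi>2 b = b" for b using im2[OF that] that by simp
  have xz: "app (\<pi>1 + \<pi>2) (x i) = x i" "app (\<pi>1 + \<pi>2) (z i) = z i" for i
    using s1[OF 1(1)] s1[OF 1(2)] s2[OF 2(1)] s2[OF 2(2)] s1[OF x'(1)] s2[OF z'(1)]
    unfolding x_def z_def by (simp_all del: app_simps)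
  have main: "\<exists>A1 A2 \<gamma>1 \<gamma>2. let A = A1 * A2 in star A * A = 1 \<and> A * u = u * A \<and> A * (\<pi>1 + \<pi>2) = (\<pi>1 + \<pi>2) * A \<and>
        A * (1 + (\<pi>1 + \<pi>2)) = 1 + (\<pi>1 + \<pi>2) \<and> \<gamma>1 \<noteq> 0 \<and> \<gamma>2 \<noteq> 0 \<and> app A w1 = \<gamma>1 *s w1 \<and> app A w2 = \<gamma>2 *s w2 \<and>
        (\<forall>b. app \<pi>1 b = b \<longrightarrow> app \<pi>1 (app A b) = app A b) \<and> 
        (\<forall>b. app \<pi>2 b = b \<longrightarrow> app \<pi>2 (app A b) = app A b) \<and> 
        (\<forall>i<d1 + d2. form (app A (x i)) (z i) = c i)" if c: "\<forall>i<d1 + d2. c i \<noteq> 0" for c :: "nat \<Rightarrow> 'k"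
  proof -
    have "\<forall>i<d1. c i \<noteq> 0" using c by simp
    from 1(3)[OF this] obtain A1 \<gamma>1 where A1: "star A1 * A1 = 1" "A1 * u = u * A1" "A1 * \<pi>1 = \<pi>1 * A1"
        "A1 * (1 + \<pi>1) = 1 + \<pi>1" "\<gamma>1 \<noteq> 0" "app A1 w1 = \<gamma>1 *s w1"
        "\<forall>i<d1. form (app A1 (x1 i)) (z1 i) = c i" by blast
    have "\<forall>i<d2. c (d1 + i) \<noteq> 0" using c by simp
    from 2(3)[OF this] obtain A2 \<gamma>2 where A2: "star A2 * A2 = 1" "A2 * u = u * A2" "A2 * \<pi>2 = \<pi>2 * A2"
        "A2 * (1 + \<pi>2) = 1 + \<pi>2" "\<gamma>2 \<noteq> 0" "app A2 w2 = \<gamma>2 *s w2"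
        "\<forall>i<d2. form (app A2 (x2 i)) (z2 i) = c (d1 + i)" by blast
    have A12: "A1 * \<pi>2 = \<pi>2"
    proof -
      have "A1 * \<pi>2 = A1 * (1 + \<pi>1) * \<pi>2" by (simp add: mult.assoc distrib_right p(3))
      thus ?thesis by (simp add: A1(4) distrib_right p(3))
    qed
    have A21: "A2 * \<pi>1 = \<pi>1"
    proof -
      have "A2 * \<pi>1 = A2 * (1 + \<pi>2) * \<pi>1" by (simp add: mult.assoc distrib_right p')
      thus ?thesis by (simp add: A2(4) distrib_right p')
    qed
    have A12': "\<pi>2 * A1 = \<pi>2"
    proof -
      have "\<pi>2 * A1 = \<pi>2 * ((1 + \<pi>1) * A1)" by (simp add: mult.assoc[symmetric] distrib_left p')
      also have "(1 + \<pi>1) * A1 = A1 * (1 + \<pi>1)" by (simp add: distrib_left distrib_right A1(3))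
      also note A1(4)
      finally show ?thesis by (simp only: distrib_left p' mult_1_right add_0_right)
    qed
    have A21': "\<pi>1 * A2 = \<pi>1"
    proof -
      have "\<pi>1 * A2 = \<pi>1 * ((1 + \<pi>2) * A2)" by (simp add: mult.assoc[symmetric] distrib_left p(3))
      also have "(1 + \<pi>2) * A2 = A2 * (1 + \<pi>2)" by (simp add: distrib_left distrib_right A2(3))
      also note A2(4)
      finally show ?thesis by (simp only: distrib_left p(3) mult_1_right add_0_right)
    qed
    define A where "A = A1 * A2"
    have a1: "app A b = app A1 b" "app \<pi>1 (app A1 b) = app A1 b" if "app \<pi>1 b = b" for b
      using arg_cong[OF A21, of "\<lambda>A. app A b"] arg_cong[OF A1(3), of "\<lambda>A. app A b"] that by (simp_all add: A_def)
    have a2: "app A b = app A2 b" "app \<pi>2 (app A2 b) = app A2 b" if "app \<pi>2 b = b" for b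
    proof -
      show *: "app \<pi>2 (app A2 b) = app A2 b" using arg_cong[OF A2(3), of "\<lambda>A. app A b"] that by simp
      have "app A1 (app \<pi>2 (app A2 b)) = app \<pi>2 (app A2 b)" using arg_cong[OF A12, of "\<lambda>A. app A (app A2 b)"] by simp
      thus "app A b = app A2 b" by (simp add: A_def *)
    qed
    have "star A * A = star A2 * (star A1 * A1) * A2" by (simp add: A_def mult.assoc)
    hence "star A * A = 1" using A1(1) A2(1) by simp
    moreover have "A * u = u * A"
    proof -
      have "A * u = A1 * (A2 * u)" by (simp add: A_def mult.assoc)
      also have "\<dots> = (A1 * u) * A2" by (simp add: A2(2) mult.assoc)
      finally show ?thesis by (simp add: A1(2) A_def mult.assoc)
    qed
    moreover have "A * (\<pi>1 + \<pi>2) = A1 * \<pi>1 + \<pi>2 * A2" 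
    proof -
      have "A1 * (A2 * \<pi>2) = (A1 * \<pi>2) * A2" by (simp add: A2(3) mult.assoc)
      thus ?thesis by (simp add: A_def distrib_left mult.assoc A21 A12)
    qed
    moreover have "(\<pi>1 + \<pi>2) * A = A1 * \<pi>1 + \<pi>2 * A2"
    proof -
      have "\<pi>1 * (A1 * A2) = A1 * (\<pi>1 * A2)" by (simp add: A1(3)[symmetric] mult.assoc[symmetric])
      moreover have "\<pi>2 * (A1 * A2) = \<pi>2 * A2" by (simp add: A12' mult.assoc[symmetric])
      ultimately show ?thesis by (simp add: A_def distrib_right A21')
    qed
    moreover have "A * (1 + (\<pi>1 + \<pi>2)) = 1 + (\<pi>1 + \<pi>2)"
    proof -
      have "A2 * (1 + \<pi>2 + \<pi>1) = 1 + \<pi>2 + \<pi>1" by (simp only: distrib_left[of A2 _ \<pi>1] A2(4) A21)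
      hence "A * (1 + (\<pi>1 + \<pi>2)) = A1 * (1 + (\<pi>1 + \<pi>2))" by (simp add: A_def mult.assoc ac_simps)
      also have "\<dots> = A1 * (1 + \<pi>1) + A1 * \<pi>2" by (simp add: distrib_left add.assoc)
      finally show ?thesis by (simp add: A1(4) A12 add.assoc)
    qed
    moreover have "app A w1 = \<gamma>1 *s w1" "app A w2 = \<gamma>2 *s w2" using a1(1)[OF w1(1)] a2(1)[OF w2(1)] A1(6) A2(6) by auto
    moreover have "\<forall>i<d1 + d2. form (app A (x i)) (z i) = c i"
      using a1(1)[OF 1(1)] a2(1)[OF 2(1)] A1(7) A2(7) by (auto simp: x_def z_def)
    ultimately show ?thesis unfolding Let_def A_def[symmetric]
      using A1(5) A2(5) a1 a2 by (intro exI[of _ A1] exI[of _ A2] exI[of _ \<gamma>1] exI[of _ \<gamma>2]) (simp add: A_def[symmetric])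
  qed
  show "fat (\<pi>1 + \<pi>2) (d1 + d2) w1" unfolding fat_def
  proof (rule exI[of _ x], rule exI[of _ z], intro conjI allI impI)
    fix i show "app (\<pi>1 + \<pi>2) (x i) = x i" "app (\<pi>1 + \<pi>2) (z i) = z i" by (rule xz)+
  next
    fix c :: "nat \<Rightarrow> 'k" assume "\<forall>i<d1 + d2. c i \<noteq> 0"
    from main[OF this] show "\<exists>A. star A * A = 1 \<and> A * u = u * A \<and> A * (\<pi>1 + \<pi>2) = (\<pi>1 + \<pi>2) * A \<and>
       A * (1 + (\<pi>1 + \<pi>2)) = 1 + (\<pi>1 + \<pi>2) \<and> (\<exists>\<gamma>. \<gamma> \<noteq> 0 \<and> app A w1 = \<gamma> *s w1) \<and>
       (\<forall>i<d1 + d2. form (app A (x i)) (z i) = c i)" unfolding Let_def by blast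
  qed
  show "fat (\<pi>1 + \<pi>2) (d1 + d2 + 1) 0" unfolding fat_def
  proof (rule exI[of _ x], rule exI[of _ z], intro conjI allI impI)
    fix i show "app (\<pi>1 + \<pi>2) (x i) = x i" "app (\<pi>1 + \<pi>2) (z i) = z i" by (rule xz)+
  next
    fix c :: "nat \<Rightarrow> 'k" assume c: "\<forall>i<d1 + d2 + 1. c i \<noteq> 0"
    hence "\<forall>i<d1 + d2. c i \<noteq> 0" by simp
    from main[OF this] obtain A \<gamma>1 \<gamma>2 where A: "star A * A = 1" "A * u = u * A" "A * (\<pi>1 + \<pi>2) = (\<pi>1 + \<pi>2) * A"
       "A * (1 + (\<pi>1 + \<pi>2)) = 1 + (\<pi>1 + \<pi>2)" "\<gamma>1 \<noteq> 0" "\<gamma>2 \<noteq> 0" "app A w1 = \<gamma>1 *s w1" "app A w2 = \<gamma>2 *s w2"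
       "\<And>b. app \<pi>1 b = b \<Longrightarrow> app \<pi>1 (app A b) = app A b" 
       "\<And>b. app \<pi>2 b = b \<Longrightarrow> app \<pi>2 (app A b) = app A b"
       "\<And>i. i < d1 + d2 \<Longrightarrow> form (app A (x i)) (z i) = c i" unfolding Let_def by blast
    \<comment> \<open>\<open>L\<close> squares to zero because \<open>w1\<close> and
      \<open>w2\<close> are orthogonal and the form is alternating, and it commutes with
      \<open>u\<close> because both are fixed vectors. The parameter is divided by
      \<open>\<gamma>2\<close> since \<open>A\<close> rescales \<open>w2\<close>.\<close>
    define L where "L = rk w1 w2 + rk w2 w1"
    define e where "e = c (d1 + d2) / \<gamma>2"
    define T where "T = 1 + cst e * L"
    have w12: "form w1 w2 = 0" "form w2 w1 = 0" using orth[OF w1(1) w2(1)] form_sym by metis+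
    have LL: "L * L = 0" by (simp add: L_def distrib_left distrib_right rk_mult_rk w12)
    have sL: "star L = L" by (simp add: L_def add.commute)
    have sT: "star T = T" by (simp add: T_def sL cst_commute)
    have "cst e * L * (cst e * L) = cst e * cst e * (L * L)" by (simp only: mult.assoc cst_commute[of e "L * _"] cst_commute[of e L])
    hence TT: "T * T = 1" by (simp add: T_def distrib_left distrib_right LL)
    have uw: "app u w1 = w1" "app u w2 = w2" using w1(2) w2(2) by (simp_all add: N_def)
    have suw: "app (star u) w1 = w1" "app (star u) w2 = w2"
      using arg_cong[OF isom, of "\<lambda>A. app A w1"] arg_cong[OF isom, of "\<lambda>A. app A w2"] uw by simp_all
    have "L * u = u * L" by (simp add: L_def distrib_left distrib_right mult_rk uw suw)
    hence Tu: "T * u = u * T" by (simp add: T_def distrib_left distrib_right mult.assoc cst_left)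
    define \<pi> where "\<pi> = \<pi>1 + \<pi>2"
    have pw: "app \<pi> w1 = w1" "app \<pi> w2 = w2" using s1[OF w1(1)] s2[OF w2(1)] by (simp_all add: \<pi>_def)
    have sp: "star \<pi> = \<pi>" using p prjD(2) by (simp add: \<pi>_def)
    have L\<pi>: "L * \<pi> = L" "\<pi> * L = L" by (simp_all add: L_def distrib_left distrib_right mult_rk pw sp)
    have T\<pi>: "T * \<pi> = \<pi> * T" by (simp add: T_def distrib_left distrib_right mult.assoc L\<pi> cst_left)
    have T1: "T * (1 + \<pi>) = 1 + \<pi>" by (simp add: T_def distrib_left distrib_right mult.assoc L\<pi> add.assoc)
    have 1: "star (A * T) * (A * T) = 1"
    proof -
      have "star (A * T) * (A * T) = T * (star A * A) * T" by (simp add: sT mult.assoc)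
      thus ?thesis by (simp add: A TT)
    qed
    have 2: "A * T * u = u * (A * T)"
    proof -
      have "A * T * u = (A * u) * T" by (simp add: mult.assoc Tu)
      thus ?thesis by (simp add: A mult.assoc)
    qed
    have 3: "A * T * \<pi> = \<pi> * (A * T)"
    proof -
      have "A * T * \<pi> = (A * \<pi>) * T" by (simp add: mult.assoc T\<pi>)
      thus ?thesis using A(3) by (simp add: mult.assoc \<pi>_def)
    qed
    have 4: "A * T * (1 + \<pi>) = 1 + \<pi>" using A(4) by (simp only: mult.assoc T1 \<pi>_def[symmetric])
    have 5: "form (app (A * T) (x i)) (z i) = c i" if i: "i < d1 + d2 + 1" for i
    proof -
      have val: "app (A * T) b = app A b + (e * form b w2 * \<gamma>1) *s w1 + (e * form b w1 * \<gamma>2) *s w2" for b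
        by (simp add: T_def L_def A(7,8) vec_eq_iff algebra_simps)
      consider "i < d1" | "d1 \<le> i" "i < d1 + d2" | "i = d1 + d2" using i by linarith
      thus ?thesis
      proof cases
        case 1
        hence "app \<pi>1 (x i) = x i" "app \<pi>1 (z i) = z i" using \<open>\<And>i. i < d1 \<Longrightarrow> app \<pi>1 (x1 i) = x1 i\<close>
          \<open>\<And>i. i < d1 \<Longrightarrow> app \<pi>1 (z1 i) = z1 i\<close> by (auto simp: x_def z_def)
        hence "form (x i) w2 = 0" "form w2 (z i) = 0" using orth w2(1) form_sym by metis+
        thus ?thesis using A(11)[of i] 1 by (simp add: val del: app_simps(7))
      next
        case 2
        hence "app \<pi>2 (x i) = x i" "app \<pi>2 (z i) = z i" using \<open>\<And>i. i < d2 \<Longrightarrow> app \<pi>2 (x2 i) = x2 i\<close>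
          \<open>\<And>i. i < d2 \<Longrightarrow> app \<pi>2 (z2 i) = z2 i\<close> by (auto simp: x_def z_def)
        hence "form (x i) w1 = 0" "form w1 (z i) = 0" using orth w1(1) form_sym by metis+
        thus ?thesis using A(11)[of i] 2 by (simp add: val del: app_simps(7))
      next
        case 3
        hence xi: "x i = x'" "z i = z'" by (auto simp: x_def z_def)
        have "form (app A x') z' = 0" "form w1 z' = 0" using orth A(9)[OF x'(1)] z'(1) w1(1) by blast+
        thus ?thesis unfolding xi val using 3 A(6) x' z' by (simp add: e_def)
      qed
    qed
    have "app (A * T) 0 = 1 *s 0" by simp
    thus "\<exists>A. star A * A = 1 \<and> A * u = u * A \<and> A * (\<pi>1 + \<pi>2) = (\<pi>1 + \<pi>2) * A \<and>
       A * (1 + (\<pi>1 + \<pi>2)) = 1 + (\<pi>1 + \<pi>2) \<and> (\<exists>\<gamma>. \<gamma> \<noteq> 0 \<and> app A 0 = \<gamma> *s 0) \<and>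
       (\<forall>i<d1 + d2 + 1. form (app A (x i)) (z i) = c i)"
      using 1 2 3 4 5 one_neq_zero unfolding \<pi>_def by blast
  qed
qed

end

lemma rk_0 [simp]: "rk 0 z = 0" "rk x 0 = 0"
  by (rule sqm_eqI; simp)+

lemma app_sum_right: "app A (sum f S) = (\<Sum>i\<in>S. app A (f i))"
  by (induction S rule: infinite_finite_induct) auto

lemma mult_swap_middle:
  fixes P :: "'a::monoid_mult"
  assumes "R * X = X * R" shows "(P * X) * (R * Z) = (P * R) * (X * Z)"
proof -
  have "(P * X) * (R * Z) = P * (X * R) * Z" by (simp only: mult.assoc)
  thus ?thesis by (simp only: assms[symmetric] mult.assoc)
qed

lemma dim_range_le_span:
  assumes "\<And>x. app A x \<in> vec.span S" "finite S"
  shows "vec.dim (range (app A)) \<le> card S"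
  using assms by (intro vec.dim_le_card) auto

lemma dim_range_add: "vec.dim (range (app (A + B))) \<le> vec.dim (range (app A)) + vec.dim (range (app B))"
proof -
  obtain S where S: "S \<subseteq> range (app A)" "vec.independent S" "range (app A) \<subseteq> vec.span S" "card S = vec.dim (range (app A))"
    using vec.basis_exists by blast
  obtain T where T: "T \<subseteq> range (app B)" "vec.independent T" "range (app B) \<subseteq> vec.span T" "card T = vec.dim (range (app B))"
    using vec.basis_exists by blast
  have fin: "finite (S \<union> T)" using S(2) T(2) vec.finiteI_independent by blast
  have "app (A + B) x \<in> vec.span (S \<union> T)" for x
    using S(3) T(3) vec.span_mono[of S "S \<union> T"] vec.span_mono[of T "S \<union> T"] by (auto intro!: vec.span_add)
  from dim_range_le_span[OF this fin] have "vec.dim (range (app (A + B))) \<le> card (S \<union> T)" .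
  also have "\<dots> \<le> card S + card T" by (rule card_Un_le)
  finally show ?thesis using S(4) T(4) by simp
qed

lemma subspace_range_app: "vec.subspace (range (app A))"
proof (rule vec.subspaceI)
  show "0 \<in> range (app A)" using app_simps(10)[of A] by (metis rangeI)
  fix x z c assume "x \<in> range (app A)"
  then obtain a where a: "x = app A a" by blast
  thus "c *s x \<in> range (app A)" using app_simps(11)[of A c a] by (metis rangeI)
  assume "z \<in> range (app A)"
  then obtain b where "z = app A b" by blast
  thus "x + z \<in> range (app A)" using app_simps(8)[of A a b] a by (metis rangeI)
qed

section \<open>Splitting off cyclic and hyperbolic summands\<close>

context unip
begin

lemma fixed_by_u: "app N z = 0 \<Longrightarrow> app (u ^ k) z = z" "app N z = 0 \<Longrightarrow> app (star u ^ k) z = z"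
proof -
  assume "app N z = 0"
  hence u: "app u z = z" by (simp add: N_def)
  hence s: "app (star u) z = z" using arg_cong[OF isom, of "\<lambda>A. app A z"] by simp
  show "app (u ^ k) z = z" by (induction k) (simp_all add: u)
  show "app (star u ^ k) z = z" by (induction k) (simp_all add: s)
qed

lemma y_NN: "y = star u * (N * N)" "N * N = u * y"
proof -
  show *: "N * N = u * y"
  proof -
    have "N + 1 = u" by (simp add: N_def add.assoc)
    hence "u * y = (N + 1) * y" by metis
    thus ?thesis by (simp add: NN distrib_right yN add.commute)
  qed
  show "y = star u * (N * N)" by (simp add: * mult.assoc[symmetric] isom)
qed

text \<open>\<open>N * N\<close> and \<open>y\<close> differ by the unit \<open>u\<close>, so powers
  of \<open>y\<close> and even powers of \<open>N\<close> translate into each other.\<close>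

lemma N_even: "N ^ (2 * s) = u ^ s * y ^ s" "y ^ s = star u ^ s * N ^ (2 * s)"
proof -
  have N2: "N ^ (2 * s) = (N * N) ^ s" by (simp add: power_mult power2_eq_square)
  have "u * y = y * u" using alg_commute_alg alg_u alg_basic by blast
  thus "N ^ (2 * s) = u ^ s * y ^ s" unfolding N2 y_NN(2) by (rule power_mult_commuting)
  have "star u * (N * N) = N * N * star u"
    using alg_commute_alg[OF alg_star[OF alg_u] alg_mult[OF alg_basic(1) alg_basic(1)]] .
  from power_mult_commuting[OF this, of s] show "y ^ s = star u ^ s * N ^ (2 * s)" by (simp only: N2 y_NN(1)[symmetric])
qed

text \<open>The vector \<open>app (N ^ (2 * s)) x\<close> is annihilated by \<open>N\<close>, hence
  fixed by \<open>u\<close>, and the unit in \<open>N_even\<close> acts on it trivially.\<close>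

lemma y_top: assumes "app (N ^ (2 * s + 1)) x = 0" shows "app (y ^ s) x = app (N ^ (2 * s)) x"
proof -
  have "app N (app (N ^ (2 * s)) x) = 0" using assms by (simp del: power_mult)
  from fixed_by_u(2)[OF this, of s] show ?thesis by (simp only: N_even(2)[of s] app_simps)
qed

lemma N_zero: assumes "y ^ m * \<pi> = 0" shows "N ^ (2 * m) * \<pi> = 0"
  using assms by (simp only: N_even(1) mult.assoc mult_zero_right)

text \<open>With \<open>w\<close> dual to the chain of \<open>v\<close>, the vectors
  \<open>N ^ j v\<close> and \<open>M ^ (n - 1 - j) w\<close> form dual bases, and this is the
  projection onto the cyclic module of \<open>v\<close> along the orthogonal complement of that of
  \<open>w\<close>.\<close>

definition proj :: "nat \<Rightarrow> 'k^('n + 'n) \<Rightarrow> 'k^('n + 'n) \<Rightarrow> ('k, 'n + 'n) sqm" where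
  "proj n v w = (\<Sum>j<n. rk (app (N ^ j) v) (app (M ^ (n - 1 - j)) w))"

lemma proj:
  assumes n: "n \<ge> 1" and vw: "app (N ^ n) v = 0" "app (M ^ n) w = 0"
    and dual: "\<And>j. form (app (N ^ j) v) w = (if j = n - 1 then 1 else 0)"
  shows proj_commute: "proj n v w * u = u * proj n v w"
    and proj_v: "app (proj n v w) v = v"
    and proj_alg_v: "A \<in> alg \<Longrightarrow> app (proj n v w) (app A v) = app A v"
    and star_proj_w: "app (star (proj n v w)) w = w"
    and star_proj_alg_w: "A \<in> alg \<Longrightarrow> app (star (proj n v w)) (app A w) = app A w"
    and proj_idem: "proj n v w * proj n v w = proj n v w"
    and dim_proj: "vec.dim (range (app (proj n v w))) \<le> n"
    and dim_star_proj: "vec.dim (range (app (star (proj n v w)))) \<le> n"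
proof -
  let ?\<theta> = "proj n v w"
  define f where "f j = rk (app (N ^ j) v) (app (M ^ (n - j)) w)" for j
  have NT: "N * ?\<theta> = (\<Sum>j<n. f (Suc j))"
    by (simp add: proj_def f_def sum_distrib_left mult_rk)
  have TN: "?\<theta> * N = (\<Sum>j<n. f j)"
    unfolding proj_def sum_distrib_right
  proof (rule sum.cong[OF refl])
    fix j assume "j \<in> {..<n}"
    hence "n - j = Suc (n - 1 - j)" by auto
    thus "rk (app (N ^ j) v) (app (M ^ (n - 1 - j)) w) * N = f j" by (simp add: f_def mult_rk)
  qed
  \<comment> \<open>Multiplication by \<open>N\<close> on the left and on the right gives the same
    sum up to a shift of the index; the boundary terms vanish because the chains of \<open>v\<close>
    and \<open>w\<close> end at \<open>n\<close>.\<close>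
  have "f 0 = 0" "f n = 0" by (simp_all add: f_def vw)
  hence "(\<Sum>j<n. f (Suc j)) = (\<Sum>j<n. f j)"
    using sum.lessThan_Suc_shift[of f n] sum.lessThan_Suc[of f n] by simp
  hence comN: "?\<theta> * N = N * ?\<theta>" using NT TN by simp
  have "u = N + 1" by (rule u_eq)
  hence "?\<theta> * u = ?\<theta> * (N + 1)" "u * ?\<theta> = (N + 1) * ?\<theta>" by metis+
  thus com: "?\<theta> * u = u * ?\<theta>" using comN by (simp add: distrib_left distrib_right)
  have "app ?\<theta> v = (\<Sum>j<n. (if j = 0 then 1 else 0) *s app (N ^ j) v)"
    unfolding proj_def app_sum
  proof (rule sum.cong[OF refl])
    fix j assume j: "j \<in> {..<n}"
    have "form v (app (M ^ (n - 1 - j)) w) = form (app (N ^ (n - 1 - j)) v) w"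
      by (simp add: form_shift star_power)
    thus "app (rk (app (N ^ j) v) (app (M ^ (n - 1 - j)) w)) v = (if j = 0 then 1 else 0) *s app (N ^ j) v"
      using j dual[of "n - 1 - j"] by auto
  qed
  also have "\<dots> = (\<Sum>j<n. if j = 0 then v else 0)" by (intro sum.cong) auto
  also have "\<dots> = v" using n by simp
  finally show v: "app ?\<theta> v = v" .
  show algv: "app ?\<theta> (app A v) = app A v" if "A \<in> alg" for A
    using arg_cong[OF alg_commute[OF that com], of "\<lambda>A. app A v"] v by simp
  have st: "star ?\<theta> = (\<Sum>j<n. rk (app (M ^ (n - 1 - j)) w) (app (N ^ j) v))"
    by (simp add: proj_def star_sum)
  have "app (star ?\<theta>) w = (\<Sum>j<n. (if j = n - 1 then 1 else 0) *s app (M ^ (n - 1 - j)) w)"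
    unfolding st app_sum app_rk by (intro sum.cong) (auto simp: form_sym[of w] dual)
  also have "\<dots> = (\<Sum>j<n. if j = n - 1 then w else 0)" by (intro sum.cong) auto
  also have "\<dots> = w" using n by simp
  finally show w: "app (star ?\<theta>) w = w" .
  have "star u * star ?\<theta> = star ?\<theta> * star u" using arg_cong[OF com, of star] by simp
  from commute_star_u[of "star ?\<theta>"] have "star ?\<theta> * u = u * star ?\<theta>"
  proof -
    have "star ?\<theta> * u = u * (star u * star ?\<theta>) * u" by (simp add: mult.assoc[symmetric] isom')
    also have "\<dots> = u * star ?\<theta>" by (simp add: \<open>star u * star ?\<theta> = star ?\<theta> * star u\<close> mult.assoc isom)
    finally show ?thesis .
  qed
  from alg_commute[OF _ this] show "app (star ?\<theta>) (app A w) = app A w" if "A \<in> alg"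
    using that w by (metis app_simps(7))
  show "?\<theta> * ?\<theta> = ?\<theta>"
  proof (rule sqm_eqI)
    fix x
    have "app ?\<theta> (app ?\<theta> x) = app ?\<theta> x"
      by (subst (2 3) proj_def) (simp add: app_sum app_sum_right algv alg_power alg_basic)
    thus "app (?\<theta> * ?\<theta>) x = app ?\<theta> x" by simp
  qed
  let ?S = "(\<lambda>j. app (N ^ j) v) ` {..<n}" let ?T = "(\<lambda>j. app (M ^ (n - 1 - j)) w) ` {..<n}"
  have "app ?\<theta> x \<in> vec.span ?S" for x
    unfolding proj_def app_sum app_rk by (intro vec.span_sum vec.span_scale vec.span_base) auto
  from dim_range_le_span[OF this] show "vec.dim (range (app ?\<theta>)) \<le> n"
    using card_image_le[of "{..<n}" "\<lambda>j. app (N ^ j) v"] by simp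
  have "app (star ?\<theta>) x \<in> vec.span ?T" for x
    unfolding st app_sum app_rk by (intro vec.span_sum vec.span_scale vec.span_base) auto
  from dim_range_le_span[OF this] show "vec.dim (range (app (star ?\<theta>))) \<le> n"
    using card_image_le[of "{..<n}" "\<lambda>j. app (M ^ (n - 1 - j)) w"] by simp
qed

lemma nilpotent_N: "\<exists>r. N ^ r = 0" using nil by (simp add: N_def)

text \<open>The numbers \<open>form (app (N ^ s) v) w\<close> vanish from \<open>s = n\<close> on
  but not at \<open>n - 1\<close>. Inverting this triangular Hankel system replaces \<open>w\<close>
  by a combination of the vectors \<open>M ^ i w\<close>.\<close>

lemma dual_exists:
  assumes n: "n \<ge> 1" and "app (N ^ n) v = 0" and w: "form (app (N ^ (n - 1)) v) w \<noteq> 0"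
  shows "\<exists>A\<in>alg. \<forall>j. form (app (N ^ j) v) (app A w) = (if j = n - 1 then 1 else 0)"
proof -
  define a where "a s = form (app (N ^ s) v) w" for s
  have "a s = 0" if "s > n - 1" for s
  proof -
    have "N ^ s = N ^ (s - n) * N ^ n" using that n by (simp flip: power_add)
    thus ?thesis using assms(2) by (simp add: a_def)
  qed
  then obtain g where g: "\<And>j. (\<Sum>i\<le>n - 1. g i * a (i + j)) = (if j = n - 1 then 1 else 0)"
    using hankel_inverse[of a "n - 1"] w by (auto simp: a_def)
  define A where "A = (\<Sum>i\<le>n - 1. cst (g i) * M ^ i)"
  have "A \<in> alg" unfolding A_def by (intro alg_sum alg_mult alg_cst alg_power alg_M)
  moreover have "form (app (N ^ j) v) (app A w) = (if j = n - 1 then 1 else 0)" for j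
    unfolding g[symmetric] by (simp add: A_def app_sum form_sum form_shift[of _ "M ^ _"] star_power a_def power_add)
  ultimately show ?thesis by blast
qed

text \<open>The image of \<open>proj n v w + star (proj n v w)\<close> is a sum of two cyclic totally isotropic
  submodules in duality, on which every unit of \<open>K[N]\<close> acts.\<close>

lemma fat_hyperbolic:
  assumes n: "n \<ge> 1" and vw: "app (N ^ n) v = 0" "app (M ^ n) w = 0"
    and dual: "\<And>j. form (app (N ^ j) v) w = (if j = n - 1 then 1 else 0)"
    and iso: "\<And>i. Q i v = 0" "\<And>i. Q i w = 0"
  defines "\<theta> \<equiv> proj n v w"
  defines "\<pi> \<equiv> \<theta> + star \<theta>" and "w0 \<equiv> app (N ^ (n - 1)) v"
  shows "prj \<pi>" "vec.dim (range (app \<pi>)) \<le> 2 * n" "w0 \<noteq> 0" "app \<pi> w0 = w0" "app N w0 = 0"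
    "fat \<pi> n w0" "fat \<pi> (n + 1) 0"
proof -
  note P = proj[OF n vw dual, folded \<theta>_def]
  have tt: "\<theta> * \<theta> = \<theta>" by (rule P)
  have sts: "star \<theta> * star \<theta> = star \<theta>" using arg_cong[OF tt, of star] by simp
  have st: "star \<theta> = (\<Sum>j<n. rk (app (M ^ (n - 1 - j)) w) (app (N ^ j) v))"
    by (simp add: \<theta>_def proj_def star_sum)
  have N_alg: "N ^ i \<in> alg" "M ^ i \<in> alg" for i by (intro alg_power alg_basic alg_M)+
  have st_t: "star \<theta> * \<theta> = 0"
    by (subst st) (simp add: \<theta>_def proj_def sum_product rk_mult_rk isotropic[OF iso(1)] N_alg)
  have t_st: "\<theta> * star \<theta> = 0"
    by (subst st) (simp add: \<theta>_def proj_def sum_product rk_mult_rk isotropic[OF iso(2)] N_alg)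
  have tu: "\<theta> * u = u * \<theta>" by (rule P)
  have stu: "star \<theta> * u = u * star \<theta>"
  proof -
    have "star \<theta> * u = u * (star u * star \<theta>) * u" by (simp add: mult.assoc[symmetric] isom')
    also have "star u * star \<theta> = star \<theta> * star u" using arg_cong[OF tu, of star] by simp
    finally show ?thesis by (simp add: mult.assoc isom)
  qed
  show prj: "prj \<pi>" unfolding prj_def
    by (simp add: \<pi>_def distrib_left distrib_right tt sts st_t t_st tu stu add.commute)
  have "vec.dim (range (app \<pi>)) \<le> vec.dim (range (app \<theta>)) + vec.dim (range (app (star \<theta>)))"
    unfolding \<pi>_def by (rule dim_range_add)
  thus "vec.dim (range (app \<pi>)) \<le> 2 * n" using P(7,8) by simp
  have w0w: "form w0 w = 1" by (simp add: w0_def dual)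
  thus "w0 \<noteq> 0" by auto
  have tw0: "app \<theta> w0 = w0" unfolding w0_def by (rule P(3)[OF N_alg(1)])
  have stw0: "app (star \<theta>) w0 = 0" using arg_cong[OF st_t, of "\<lambda>A. app A w0"] tw0 by simp
  show pw0: "app \<pi> w0 = w0" by (simp add: \<pi>_def tw0 stw0)
  have "N * N ^ (n - 1) = N ^ n" using n by (simp flip: power_Suc)
  thus Nw0: "app N w0 = 0" unfolding w0_def using vw(1) by (metis app_simps(7))
  have \<theta>v: "app \<theta> v = v" "app (star \<theta>) v = 0" using P(2) arg_cong[OF st_t, of "\<lambda>A. app A v"] by simp_all
  have pv: "app \<pi> v = v" by (simp add: \<pi>_def \<theta>v)
  have w': "app (star \<theta>) (app A w) = app A w" "app \<theta> (app A w) = 0" if "A \<in> alg" for A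
    using P(5)[OF that] arg_cong[OF t_st, of "\<lambda>B. app B (app A w)"] by simp_all
  \<comment> \<open>Pairing with \<open>M ^ (n - 1 - i) w\<close> reads the coefficient of degree
    \<open>i\<close>; the extra pair \<open>w\<close>, \<open>w\<close> at index \<open>n\<close>
    reads the transvection added for the second family.\<close>
  define z where "z i = (if i < n then app (M ^ (n - 1 - i)) w else w)" for i
  define x where "x i = (if i < n then v else w)" for i
  have pz: "app \<pi> (z i) = z i" and px: "app \<pi> (x i) = x i" for i
    using w'[OF N_alg(2)] w'[OF alg_basic(2)] pv by (auto simp: z_def x_def \<pi>_def)
  obtain r where r: "N ^ r = 0" using nilpotent_N by blast
  have main: "\<exists>A. star A * A = 1 \<and> A * u = u * A \<and> A * \<pi> = \<pi> * A \<and> A * (1 + \<pi>) = 1 + \<pi> \<and>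
      app A w0 = c 0 *s w0 \<and> (\<forall>i<n. form (app A (x i)) (z i) = c i) \<and> form (app A w) w = 0"
    if c: "\<forall>i<n. c i \<noteq> 0" for c :: "nat \<Rightarrow> 'k"
  proof -
    define p where "p = (\<Sum>i<n. monom (c i) i)"
    have pc: "coeff p i = (if i < n then c i else 0)" for i
      by (simp add: p_def coeff_sum) 
    have "coeff p 0 \<noteq> 0" using c n by (simp add: pc)
    then obtain G where FG: "ev N p * ev N G = 1" using ev_inverse r by blast
    define F where "F = ev N p" define H where "H = ev N G"
    have FHa: "F \<in> alg" "H \<in> alg" unfolding F_def H_def by (intro alg_ev alg_basic)+
    have HF: "H * F = 1" using FG alg_commute_alg[OF FHa] by (simp add: F_def H_def)
    have FH: "F * H = 1" using FG by (simp add: F_def H_def)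
    note com = alg_commute[OF _ tu] alg_commute[OF _ stu]
    have s: "star F \<in> alg" "star H \<in> alg" using FHa by (auto intro: alg_star)
    define \<rho> where "\<rho> = 1 + \<pi>"
    have pt: "\<pi> * \<theta> = \<theta>" "\<theta> * \<pi> = \<theta>" "\<pi> * star \<theta> = star \<theta>" "star \<theta> * \<pi> = star \<theta>" "\<pi> * \<pi> = \<pi>"
      by (simp_all add: \<pi>_def distrib_left distrib_right tt sts st_t t_st)
    have \<rho>: "\<rho> * \<theta> = 0" "\<theta> * \<rho> = 0" "\<rho> * star \<theta> = 0" "star \<theta> * \<rho> = 0" "\<rho> * \<rho> = \<rho>" "star \<rho> = \<rho>"
      using prjD(2)[OF prj] by (simp_all add: \<rho>_def distrib_left distrib_right pt)
    \<comment> \<open>The unit \<open>F\<close> acts on one isotropic module and the inverse of its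
      adjoint on the dual one, which preserves their pairing; the complement stays fixed.\<close>
    define A where "A = F * \<theta> + star H * star \<theta> + \<rho>"
    have sA: "star A = star F * star \<theta> + H * \<theta> + \<rho>"
      using com(1)[OF FHa(2)] com(2)[OF s(1)] by (simp add: A_def \<rho> add.assoc)
    have "star F * star \<theta> * (F * \<theta>) = star F * F * (star \<theta> * \<theta>)"
      by (rule mult_swap_middle) (rule com(2)[OF FHa(1)])
    moreover have "star F * star \<theta> * (star H * star \<theta>) = star F * star H * (star \<theta> * star \<theta>)"
      by (rule mult_swap_middle) (rule com(2)[OF s(2)])
    moreover have "star F * star H = 1" using arg_cong[OF HF, of star] by simp
    moreover have "H * \<theta> * (F * \<theta>) = H * F * (\<theta> * \<theta>)"
      by (rule mult_swap_middle) (rule com(1)[OF FHa(1)])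
    moreover have "H * \<theta> * (star H * star \<theta>) = H * star H * (\<theta> * star \<theta>)"
      by (rule mult_swap_middle) (rule com(1)[OF s(2)])
    moreover have "\<rho> * (F * \<theta>) = 0" "\<rho> * (star H * star \<theta>) = 0"
      using com(1)[OF FHa(1)] com(2)[OF s(2)] by (simp_all add: mult.assoc[symmetric] \<rho>)
    moreover have "star F * star \<theta> * \<rho> = 0" "H * \<theta> * \<rho> = 0" by (simp_all add: mult.assoc \<rho>)
    ultimately have "star A * A = \<theta> + star \<theta> + \<rho>"
      unfolding sA by (simp only: A_def distrib_left distrib_right st_t t_st tt sts HF \<rho>(5)) (simp add: ac_simps)
    hence 1: "star A * A = 1" by (simp add: \<rho>_def \<pi>_def ac_simps)
    have pu: "\<pi> * u = u * \<pi>" using prj prjD by blast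
    have Fu: "F * u = u * F" "star H * u = u * star H" using FHa s alg_commute[OF _ refl] by blast+
    have 2: "A * u = u * A"
      by (simp add: A_def \<rho>_def distrib_left distrib_right mult.assoc tu stu pu)
        (simp add: mult.assoc[symmetric] Fu)
    have A\<pi>: "A * \<pi> = F * \<theta> + star H * star \<theta>"
      by (simp add: A_def \<rho>_def distrib_left distrib_right mult.assoc pt)
    moreover have "\<pi> * A = F * \<theta> + star H * star \<theta>"
    proof -
      have "\<pi> * (F * \<theta>) = F * (\<pi> * \<theta>)" "\<pi> * (star H * star \<theta>) = star H * (\<pi> * star \<theta>)"
        by (simp_all only: mult.assoc[symmetric] alg_commute[OF FHa(1) pu] alg_commute[OF s(2) pu])
      thus ?thesis by (simp add: A_def \<rho>_def distrib_left pt)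
    qed
    ultimately have 3: "A * \<pi> = \<pi> * A" by simp
    have 4: "A * (1 + \<pi>) = 1 + \<pi>"
      by (simp add: distrib_left A\<pi>) (simp add: A_def \<rho>_def ac_simps)
    have ev: "form (app F (app (N ^ i) v)) w = (if i \<le> n - 1 then coeff p (n - 1 - i) else 0)" for i
      unfolding F_def by (rule form_ev_dual) (rule dual)
    have Av: "app A (app B v) = app (F * B) v" if "B \<in> alg" for B
      using P(3)[OF that] arg_cong[OF st_t, of "\<lambda>C. app C (app B v)"]
      by (simp add: A_def \<rho>_def \<pi>_def)
    have 5: "app A w0 = c 0 *s w0"
    proof -
      obtain q where p: "p = pCons (c 0) q" using pc[of 0] n by (cases p) auto
      have "N * ev N q = ev N q * N" by (rule ev_commute) (rule refl)
      from arg_cong[OF this, of "\<lambda>B. app B w0"] have "app F w0 = c 0 *s w0" by (simp add: F_def p Nw0)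
      thus ?thesis using Av[OF N_alg(1)] by (simp add: w0_def)
    qed
    have 6: "form (app A (x i)) (z i) = c i" if i: "i < n" for i
    proof -
      have "form (app A v) (app (M ^ (n - 1 - i)) w) = form (app (N ^ (n - 1 - i) * F) v) w"
        using Av[OF alg_basic(2)] by (simp add: form_shift[of _ "M ^ _"] star_power)
      also have "N ^ (n - 1 - i) * F = F * N ^ (n - 1 - i)" by (rule alg_commute_alg) (intro N_alg FHa)+
      finally show ?thesis using ev[of "n - 1 - i"] i n by (simp add: x_def z_def pc)
    qed
    have "app A w = app (star H) w" using w'[OF alg_basic(2)] by (simp add: A_def \<rho>_def \<pi>_def)
    hence 7: "form (app A w) w = 0" using isotropic[OF iso(2) s(2) alg_basic(2)] by simp
    show ?thesis using 1 2 3 4 5 6 7 by blast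
  qed
  have xz: "\<forall>i<d. app \<pi> (x i) = x i \<and> app \<pi> (z i) = z i" for d using px pz by blast
  show "fat \<pi> n w0" unfolding fat_def
    apply (rule exI[of _ x], rule exI[of _ z], rule conjI[OF xz], intro allI impI)
    subgoal premises c for c
    proof -
      have "c 0 \<noteq> 0" using c n by simp
      thus ?thesis using main[OF c] by blast
    qed
    done
  show "fat \<pi> (n + 1) 0" unfolding fat_def
    apply (rule exI[of _ x], rule exI[of _ z], rule conjI[OF xz], intro allI impI)
    subgoal premises c for c
    proof -
      have c0: "c 0 \<noteq> 0" and c': "\<forall>i<n. c i \<noteq> 0" using c by simp_all
      obtain A where A: "star A * A = 1" "A * u = u * A" "A * \<pi> = \<pi> * A" "A * (1 + \<pi>) = 1 + \<pi>"
        "app A w0 = c 0 *s w0" "\<And>i. i < n \<Longrightarrow> form (app A (x i)) (z i) = c i" "form (app A w) w = 0"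
        using main[OF c'] by blast
      \<comment> \<open>A transvection at the fixed vector \<open>w0\<close> brings the additional
        parameter; the division compensates the factor \<open>c 0\<close> by which \<open>A\<close>
        scales \<open>w0\<close>.\<close>
      define e where "e = c n / c 0"
      define L where "L = rk w0 w0"
      define T where "T = 1 + cst e * L"
      have "cst e * L * (cst e * L) = cst e * cst e * (L * L)" by (rule mult_swap_middle) (rule cst_commute)
      hence TT: "T * T = 1" by (simp add: T_def distrib_left distrib_right L_def rk_mult_rk)
      have sT: "star T = T" by (simp add: T_def L_def cst_commute)
      have "app u w0 = w0" "app (star u) w0 = w0" using fixed_by_u[OF Nw0, of 1] by simp_all
      hence Lu: "L * u = u * L" by (simp add: L_def mult_rk)
      have L\<pi>: "L * \<pi> = L" "\<pi> * L = L" using prjD(2)[OF prj] by (simp_all add: L_def mult_rk pw0)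
      have Tu: "T * u = u * T" by (simp add: T_def distrib_left distrib_right mult.assoc Lu cst_left)
      have T\<pi>: "T * \<pi> = \<pi> * T" by (simp add: T_def distrib_left distrib_right mult.assoc L\<pi> cst_left)
      have T1: "T * (1 + \<pi>) = 1 + \<pi>" by (simp add: T_def distrib_left distrib_right mult.assoc L\<pi> add.assoc)
      have "star (A * T) * (A * T) = T * (star A * A) * T" by (simp add: sT mult.assoc)
      hence 1: "star (A * T) * (A * T) = 1" by (simp add: A TT)
      have "A * T * u = (A * u) * T" by (simp add: mult.assoc Tu)
      hence 2: "A * T * u = u * (A * T)" by (simp add: A mult.assoc)
      have "A * T * \<pi> = (A * \<pi>) * T" by (simp add: mult.assoc T\<pi>)
      hence 3: "A * T * \<pi> = \<pi> * (A * T)" by (simp add: A mult.assoc)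
      have 4: "A * T * (1 + \<pi>) = 1 + \<pi>" using A(4) by (simp only: mult.assoc T1)
      have val: "app (A * T) b = app A b + (e * form b w0 * c 0) *s w0" for b
        by (simp add: T_def L_def A(5) vec_eq_iff algebra_simps)
      have vw0: "form v w0 = 0" using isotropic[OF iso(1) alg_basic(2) N_alg(1)] by (simp add: w0_def)
      have 5: "form (app (A * T) (x i)) (z i) = c i" if "i < n + 1" for i
      proof (cases "i < n")
        case True
        thus ?thesis unfolding val using A(6)[OF True] by (simp add: x_def vw0)
      next
        case False
        hence "i = n" using that by simp
        thus ?thesis unfolding val using A(7) c0 w0w form_sym[of w w0] by (simp add: x_def z_def e_def)
      qed
      have "app (A * T) 0 = 1 *s 0" by simp
      thus ?thesis using 1 2 3 4 5 one_neq_zero by blast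
    qed
    done
qed

lemma form_ev_ev [simp]: "form (app (ev y p) x) (app (ev y q) x) = 0"
proof -
  have "form (app (ev y p) x) (app (ev y q) x) = form (app (ev y (q * p)) x) x"
    by (simp add: form_shift star_ev)
  thus ?thesis by (simp only: form_ev_y_self)
qed

lemma N_top: assumes "app (y ^ m) v = 0" "m \<ge> 1"
  shows "app (N ^ (2 * m)) v = 0" "app (N ^ (2 * m - 1)) v = app (y ^ (m - 1) * N) v"
proof -
  show z: "app (N ^ (2 * m)) v = 0" using assms by (simp only: N_even(1) app_simps)
  have 2: "2 * (m - 1) + 1 + 1 = 2 * m" "2 * (m - 1) + 1 = 2 * m - 1" using assms(2) by simp_all
  have N1: "N ^ k * N = N ^ (k + 1)" for k by (simp only: power_add power_one_right)
  have "N ^ (2 * (m - 1) + 1) * N = N ^ (2 * m)" by (simp only: N1 2(1))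
  hence "app (N ^ (2 * (m - 1) + 1)) (app N v) = 0" using z by (metis app_simps(7))
  from y_top[OF this] have "app (y ^ (m - 1) * N) v = app (N ^ (2 * (m - 1)) * N) v" by simp
  also have "N ^ (2 * (m - 1)) * N = N ^ (2 * m - 1)" by (simp only: N1 2(2))
  finally show "app (N ^ (2 * m - 1)) v = app (y ^ (m - 1) * N) v" by simp
qed

lemma M_top: assumes "app (y ^ m) v = 0" "A \<in> alg" shows "app (M ^ (2 * m)) (app A v) = 0"
proof -
  have "M ^ (2 * m) = y ^ m * star u ^ m"
    using arg_cong[OF N_even(1)[of m], of star] by (simp only: star_power star_simps star_N star_y)
  hence "M ^ (2 * m) * A = y ^ m * (star u ^ m * A)" by (simp add: mult.assoc)
  also have "\<dots> = (star u ^ m * A) * y ^ m"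
    by (rule alg_commute_alg) (intro alg_mult alg_power alg_basic alg_star alg_u assms)+
  finally have "M ^ (2 * m) * A = (star u ^ m * A) * y ^ m" .
  from arg_cong[OF this, of "\<lambda>B. app B v"] show ?thesis by (simp add: assms(1))
qed

text \<open>As \<open>Q (m - 1) v\<close> is the pairing of the last vector of the chain with
  \<open>v\<close>, the module of \<open>v\<close> is nondegenerate and dual to itself. On it the
  isometries in \<open>K[u]\<close> are given by the solutions of \<open>poly_unitary\<close>:
  \<open>m - 1\<close> coefficients of \<open>p\<close> and one of \<open>q\<close> are free, one
  parameter fewer than on a hyperbolic summand of the same dimension.\<close>

lemma fat_cyclic:
  assumes m: "m \<ge> 1" and ym: "app (y ^ m) v = 0" and Q: "Q (m - 1) v \<noteq> 0"
  shows "\<exists>\<pi> w0. prj \<pi> \<and> (\<forall>x. \<exists>A\<in>alg. app \<pi> x = app A v) \<and> app \<pi> v = v \<and> vec.dim (range (app \<pi>)) \<le> 2 * m \<and>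
    w0 \<noteq> 0 \<and> app \<pi> w0 = w0 \<and> app N w0 = 0 \<and> fat \<pi> m w0"
proof -
  have n: "2 * m \<ge> 1" using m by simp
  note Nv = N_top[OF ym m]
  have Q': "form (app (N ^ (2 * m - 1)) v) v \<noteq> 0" using Q unfolding Nv(2) Q_def .
  obtain B where B: "B \<in> alg" and dual: "\<And>j. form (app (N ^ j) v) (app B v) = (if j = 2 * m - 1 then 1 else 0)"
    using dual_exists[OF n Nv(1) Q'] by blast
  define w where "w = app B v"
  define \<pi> where "\<pi> = proj (2 * m) v w"
  note P = proj[OF n Nv(1) M_top[OF ym B] dual, folded w_def, folded \<pi>_def]
  have N_alg: "N ^ i \<in> alg" "M ^ i \<in> alg" "y ^ i \<in> alg" for i by (intro alg_power alg_basic alg_M)+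
  \<comment> \<open>The dual vector \<open>w\<close> lies in the module generated by
    \<open>v\<close>, so \<open>\<pi>\<close> fixes the image of \<open>star \<pi>\<close>. Applying
    \<open>star\<close> to this identity gives self-adjointness.\<close>
  have "\<pi> * star \<pi> = star \<pi>"
  proof -
    have st: "star \<pi> = (\<Sum>j<2 * m. rk (app (M ^ (2 * m - 1 - j)) w) (app (N ^ j) v))"
      by (simp add: \<pi>_def proj_def star_sum)
    have "app \<pi> (app (M ^ i) w) = app (M ^ i) w" for i
      using P(3)[OF alg_mult[OF N_alg(2)[of i] B]] by (simp add: w_def)
    thus ?thesis by (simp add: st sum_distrib_left mult_rk)
  qed
  hence "star (\<pi> * star \<pi>) = star (star \<pi>)" by metis
  hence "\<pi> * star \<pi> = \<pi>" by simp
  with \<open>\<pi> * star \<pi> = star \<pi>\<close> have st: "star \<pi> = \<pi>" by metis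
  have prj: "prj \<pi>" unfolding prj_def using P(1,6) st by simp
  define w0 where "w0 = app (N ^ (2 * m - 1)) v"
  have "form w0 v \<noteq> 0" using Q' by (simp add: w0_def)
  hence w0: "w0 \<noteq> 0" by auto
  have pw0: "app \<pi> w0 = w0" unfolding w0_def by (rule P(3)[OF N_alg(1)])
  have "Suc (2 * m - 1) = 2 * m" using m by simp
  hence "N * N ^ (2 * m - 1) = N ^ (2 * m)" by (metis power_Suc)
  hence Nw0: "app N w0 = 0" unfolding w0_def using Nv(1) by (metis app_simps(7))
  have range: "\<exists>A\<in>alg. app \<pi> x = app A v" for x
  proof -
    have "app \<pi> x = app (\<Sum>j<2 * m. cst (form x (app (M ^ (2 * m - 1 - j)) w)) * N ^ j) v"
      by (simp add: \<pi>_def proj_def app_sum)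
    moreover have "(\<Sum>j<2 * m. cst (form x (app (M ^ (2 * m - 1 - j)) w)) * N ^ j) \<in> alg"
      by (intro alg_sum alg_mult alg_cst N_alg)
    ultimately show ?thesis by blast
  qed
  have "Q s v = 0" if "s > m - 1" for s using Q_zero[OF ym] that by simp
  then obtain h where h: "\<And>j. (\<Sum>i\<le>m - 1. h i * Q (i + j) v) = (if j = m - 1 then 1 else 0)"
    using hankel_inverse[of "\<lambda>i. Q i v" "m - 1"] Q by auto
  \<comment> \<open>The polynomial \<open>e\<close> inverts the Hankel system of the values
    \<open>Q i v\<close>: it makes \<open>a\<close> and \<open>b\<close> pair to 1 with
    \<open>y ^ (m - 1) v\<close> and \<open>y ^ (m - 1) N v\<close> respectively, and to 0 with the
    other powers.\<close>
  define e where "e = (\<Sum>i\<le>m - 1. monom (h i) i)"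
  have eve: "ev y e = (\<Sum>i\<le>m - 1. cst (h i) * y ^ i)" 
  proof -
    have "ev y (\<Sum>i\<in>S. monom (h i) i) = (\<Sum>i\<in>S. cst (h i) * y ^ i)" for S
      by (induction S rule: infinite_finite_induct) (auto simp: ev_monom)
    thus ?thesis by (simp add: e_def)
  qed
  define a where "a = app (ev y e) (app N v)"
  define b where "b = app (ev y e) v"
  have Qf: "form (app (y ^ j) v) (app (y ^ i) (app N v)) = Q (i + j) v"
     "form (app (y ^ j) (app N v)) (app (y ^ i) v) = Q (i + j) v" for i j
  proof -
    show 2: "form (app (y ^ j) (app N v)) (app (y ^ i) v) = Q (i + j) v" for i j
      by (simp add: form_shift[of _ "y ^ i"] star_power Q_def power_add)
    show "form (app (y ^ j) v) (app (y ^ i) (app N v)) = Q (i + j) v"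
      using 2[of i j] form_sym by (metis add.commute)
  qed
  have da: "form (app (y ^ j) v) a = (if j = m - 1 then 1 else 0)" for j
    unfolding h[symmetric] by (simp add: a_def eve app_sum form_sum Qf)
  have db: "form (app (y ^ j) (app N v)) b = (if j = m - 1 then 1 else 0)" for j
    unfolding h[symmetric] by (simp add: b_def eve app_sum form_sum Qf)
  define z where "z i = (if i < m - 1 then app (y ^ (m - 2 - i)) a else b)" for i
  have z: "app \<pi> (z i) = z i" for i
  proof -
    have eq: "z i = app (if i < m - 1 then y ^ (m - 2 - i) * (ev y e * N) else ev y e) v"
      by (simp add: z_def a_def b_def)
    have "(if i < m - 1 then y ^ (m - 2 - i) * (ev y e * N) else ev y e) \<in> alg"
      by (simp add: alg_mult alg_basic N_alg)
    from P(3)[OF this] show ?thesis by (simp only: eq)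
  qed
  have "fat \<pi> m w0" unfolding fat_def
    apply (rule exI[of _ "\<lambda>_. v"], rule exI[of _ z], rule conjI)
    subgoal using z P(2) by blast
    apply (intro allI impI)
    subgoal premises c for c
    proof -
      \<comment> \<open>The parameters \<open>c 0\<close> to \<open>c (m - 2)\<close> become the
        coefficients of \<open>p\<close> in degrees 1 to \<open>m - 1\<close>, above the constant
        term 1 demanded by \<open>poly_unitary\<close>. The last parameter is the coefficient of
        \<open>q\<close> in degree \<open>m - 1\<close>.\<close>
      define p where "p = pCons 1 (\<Sum>i<m - 1. monom (c i) i)"
      have pc: "coeff p 0 = 1" "i < m - 1 \<Longrightarrow> coeff p (Suc i) = c i" for i
        by (simp_all add: p_def coeff_sum)
      obtain q g where q: "p * p + [:0, 1:] * (p * q) + [:0, 1:] * (q * q) = 1 + [:0, 1:] ^ m * g" "coeff q (m - 1) = c (m - 1)"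
        using poly_unitary[OF pc(1) m] by blast
      define F where "F = ev y p + ev y q * N"
      have F: "F \<in> alg" unfolding F_def by (intro alg_basic alg_mult)
      have sF: "star F = ev y p + M * ev y q" by (simp add: F_def star_ev)
      have qN: "ev y q * N = N * ev y q" "ev y p * N = N * ev y p" "ev y q * ev y p = ev y p * ev y q"
        by (rule alg_commute_alg; intro alg_basic)+
      have "star F * F = ev y p * ev y p + (N + M) * (ev y p * ev y q) + M * N * (ev y q * ev y q)"
      proof -
        have "ev y p * (ev y q * N) = N * (ev y p * ev y q)" by (simp only: qN mult.assoc[symmetric]) 
        moreover have "M * ev y q * ev y p = M * (ev y p * ev y q)" by (simp only: qN mult.assoc)
        moreover have "M * ev y q * (ev y q * N) = M * N * (ev y q * ev y q)"
          by (simp only: qN(1)) (simp only: mult.assoc[symmetric], simp only: mult.assoc qN(1)[symmetric])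
        moreover have "star F * F = (ev y p + M * ev y q) * (ev y p + ev y q * N)"
          by (simp only: sF) (simp only: F_def)
        ultimately show ?thesis by (simp add: distrib_left distrib_right ac_simps)
      qed
      also have "\<dots> = ev y (p * p + [:0, 1:] * (p * q) + [:0, 1:] * (q * q))"
        by (simp add: NM y_def[symmetric])
      also have "\<dots> = 1 + y ^ m * ev y g" unfolding q(1) by (simp add: ev_X del: ev_pCons) 
      finally have FF: "star F * F = 1 + y ^ m * ev y g" .
      have "y ^ m * \<pi> = 0"
      proof -
        have "app (y ^ m) (app (N ^ j) v) = 0" for j
          using arg_cong[OF alg_commute_alg[OF N_alg(3)[of m] N_alg(1)[of j]], of "\<lambda>B. app B v"] ym by simp
        thus ?thesis by (simp add: \<pi>_def proj_def sum_distrib_left mult_rk)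
      qed
      moreover have "y ^ m * ev y g = ev y g * y ^ m" by (rule alg_commute_alg) (intro N_alg alg_basic)+
      ultimately have FF\<pi>: "star F * F * \<pi> = \<pi>" by (simp add: FF distrib_right mult.assoc)
      have com: "B \<in> alg \<Longrightarrow> B * \<pi> = \<pi> * B" for B using prj_alg[OF prj] by blast
      define A where "A = F * \<pi> + (1 + \<pi>)"
      have pp: "\<pi> * \<pi> = \<pi>" "\<pi> * (1 + \<pi>) = 0" "(1 + \<pi>) * \<pi> = 0" "(1 + \<pi>) * (1 + \<pi>) = 1 + \<pi>"
        using prjD(1)[OF prj] by (simp_all add: distrib_left distrib_right)
      have sA: "star A = star F * \<pi> + (1 + \<pi>)" using com[OF alg_star[OF F]] by (simp add: A_def st)
      have "star F * \<pi> * (F * \<pi>) = star F * F * (\<pi> * \<pi>)" by (rule mult_swap_middle) (rule com[OF F])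
      hence a: "star F * \<pi> * (F * \<pi>) = \<pi>" by (simp only: pp FF\<pi>)
      have b: "star F * \<pi> * (1 + \<pi>) = 0" by (simp only: mult.assoc pp mult_zero_right)
      have c': "(1 + \<pi>) * (F * \<pi>) = 0" by (simp only: com[OF F] mult.assoc[symmetric] pp mult_zero_left)
      have "star A * A = star F * \<pi> * (F * \<pi>) + star F * \<pi> * (1 + \<pi>) + ((1 + \<pi>) * (F * \<pi>) + (1 + \<pi>) * (1 + \<pi>))"
        unfolding sA unfolding A_def by (simp only: distrib_left[of _ "F * \<pi>" "1 + \<pi>"] distrib_right[of "star F * \<pi>" "1 + \<pi>"]) (simp only: ac_simps)
      hence 1: "star A * A = 1" by (simp add: a b c' pp(4)) 
      have 2: "A * u = u * A"
      proof -
        have "F * \<pi> * u = F * u * \<pi>" using prjD(3)[OF prj] by (simp only: mult.assoc)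
        also have "F * u = u * F" by (rule alg_commute[OF F refl])
        finally show ?thesis using prjD(3)[OF prj] by (simp add: A_def distrib_left distrib_right mult.assoc)
      qed
      have A\<pi>: "A * \<pi> = F * \<pi>" by (simp add: A_def distrib_right[of "F * \<pi>"] mult.assoc pp)
      have 3: "A * \<pi> = \<pi> * A"
      proof -
        have "\<pi> * A = \<pi> * (F * \<pi>) + \<pi> * (1 + \<pi>)" by (simp only: A_def distrib_left[of \<pi> "F * \<pi>" "1 + \<pi>"])
        also have "\<pi> * (F * \<pi>) = (F * \<pi>) * \<pi>" by (simp only: mult.assoc[symmetric] com[OF F, symmetric])
        finally show ?thesis by (simp only: A\<pi> pp add_0_right mult.assoc)
      qed
      have 4: "A * (1 + \<pi>) = 1 + \<pi>"
        by (simp only: A_def distrib_right[of "F * \<pi>"] mult.assoc pp mult_zero_right add_0_left)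
      have A_app: "app A x = app F x" if "app \<pi> x = x" for x using that by (simp add: A_def)
      have 5: "app A w0 = 1 *s w0"
      proof -
        have yw0: "app y w0 = 0" by (simp add: y_NN(1) Nw0)
        have "y * ev y r = ev y r * y" for r by (rule ev_commute) (rule refl)
        from arg_cong[OF this, of "\<lambda>B. app B w0"] have "app F w0 = w0"
          by (simp add: F_def Nw0 p_def yw0)
        thus ?thesis using A_app[OF pw0] by simp
      qed
      have 6: "form (app A v) (z i) = c i" if i: "i < m" for i
      proof (cases "i < m - 1")
        case True
        have "form (app (ev y p) v) (app (y ^ (m - 2 - i)) a) = form (app (ev y p) (app (y ^ (m - 2 - i)) v)) a"
          using arg_cong[OF alg_commute_alg[OF N_alg(3)[of "m - 2 - i"] alg_basic(3)[of p]], of "\<lambda>B. app B v"]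
          by (simp add: form_shift[of _ "y ^ _"] star_power)
        also have "\<dots> = coeff p (Suc i)" using form_ev_dual[OF da, of p "m - 2 - i"] True by (simp add: Suc_diff_Suc numeral_2_eq_2)
        also have "\<dots> = c i" using pc(2) True by simp
        finally have 1: "form (app (ev y p) v) (app (y ^ (m - 2 - i)) a) = c i" .
        have "form (app (ev y q) (app N v)) (app (y ^ (m - 2 - i)) a)
           = form (app (ev y q) (app N v)) (app (ev y ([:0, 1:] ^ (m - 2 - i) * e)) (app N v))"
          by (simp add: a_def ev_X del: ev_pCons)
        hence "form (app (ev y q) (app N v)) (app (y ^ (m - 2 - i)) a) = 0" by (simp only: form_ev_ev)
        thus ?thesis using 1 True A_app[OF P(2)] by (simp add: z_def F_def)
      next
        case False
        hence i: "i = m - 1" using i by simp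
        have "form (app (ev y q) (app (y ^ 0) (app N v))) b = c (m - 1)"
          using form_ev_dual[OF db, of q 0] q(2) by simp
        moreover have "form (app (ev y p) v) b = 0" by (simp add: b_def)
        ultimately show ?thesis using A_app[OF P(2)] i by (simp add: z_def F_def)
      qed
      show ?thesis using 1 2 3 4 5 6 one_neq_zero by blast
    qed
    done
  thus ?thesis using prj range P(2) P(7) w0 pw0 Nw0 by blast
qed

text \<open>Vanishing of the top form \<open>Q (m - 1)\<close> on the summand is exactly what
  \<open>hensel\<close> asks of its two vectors. It is applied twice, to a vector of maximal order
  and to its partner, and produces the hyperbolic pair of \<open>fat_hyperbolic\<close>.\<close>

lemma fat_noncyclic:
  assumes \<pi>: "prj \<pi>" and m: "m \<ge> 1" and ym: "y ^ m * \<pi> = 0" "y ^ (m - 1) * \<pi> \<noteq> 0"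
    and Q0: "\<And>x. app \<pi> x = x \<Longrightarrow> Q (m - 1) x = 0"
  shows "\<exists>\<pi>' n w0. prj \<pi>' \<and> \<pi> * \<pi>' = \<pi>' \<and> vec.dim (range (app \<pi>')) \<le> 2 * n \<and>
    w0 \<noteq> 0 \<and> app \<pi>' w0 = w0 \<and> app N w0 = 0 \<and> fat \<pi>' n w0 \<and> fat \<pi>' (n + 1) 0"
proof -
  have N_alg: "N ^ i \<in> alg" "M ^ i \<in> alg" "y ^ i \<in> alg" for i by (intro alg_power alg_basic alg_M)+
  have ym0: "app (y ^ m) x = 0" if "app \<pi> x = x" for x using arg_cong[OF ym(1), of "\<lambda>A. app A x"] that by simp
  note im = prj_app[OF \<pi>]
  \<comment> \<open>The order \<open>n\<close> of \<open>N\<close> on the summand is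
    \<open>2 * m - 1\<close> or \<open>2 * m\<close>. Accordingly \<open>Z\<close> is 1 or
    \<open>N\<close>, and it converts the pairing at \<open>N ^ (n - 1)\<close> into the one at
    \<open>y ^ (m - 1)\<close> that \<open>hensel\<close> works with.\<close>
  obtain n Z where n: "n \<ge> 1" and Nn: "N ^ n * \<pi> = 0" "N ^ (n - 1) * \<pi> \<noteq> 0" and Z: "Z \<in> alg"
    and yZ: "\<And>x. app \<pi> x = x \<Longrightarrow> app (y ^ (m - 1)) (app Z x) = app (N ^ (n - 1)) x"
  proof (cases "N ^ (2 * m - 1) * \<pi> = 0")
    case True
    have e: "2 * m - 1 - 1 = 2 * (m - 1)" "2 * (m - 1) + 1 = 2 * m - 1" using m by simp_all
    have top: "app (y ^ (m - 1)) x = app (N ^ (2 * (m - 1))) x" if "app \<pi> x = x" for x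
      using arg_cong[OF True, of "\<lambda>A. app A x"] that by (intro y_top) (simp only: e app_simps)
    have "N ^ (2 * (m - 1)) * \<pi> \<noteq> 0"
    proof
      assume *: "N ^ (2 * (m - 1)) * \<pi> = 0"
      have "y ^ (m - 1) * \<pi> = star u ^ (m - 1) * (N ^ (2 * (m - 1)) * \<pi>)"
        by (subst N_even(2)) (simp only: mult.assoc)
      thus False using ym(2) * by simp
    qed
    thus thesis using that[of "2 * m - 1" 1] True m top alg_basic(2) by (simp only: e) simp
  next
    case False
    have "N ^ (2 * m) * \<pi> = 0" by (rule N_zero[OF ym(1)])
    thus thesis using that[of "2 * m" N] False m N_top(2)[OF ym0 m] alg_basic(1) by simp
  qed
  have N0: "app (N ^ n) x = 0" "app (M ^ n) x = 0" if "app \<pi> x = x" for x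
  proof -
    show "app (N ^ n) x = 0" using arg_cong[OF Nn(1), of "\<lambda>A. app A x"] that by simp
    have "\<pi> * M ^ n = 0" using arg_cong[OF Nn(1), of star] prjD(2)[OF \<pi>] by (simp add: star_power)
    hence "M ^ n * \<pi> = 0" using prj_alg[OF \<pi> N_alg(2)] by simp
    from arg_cong[OF this, of "\<lambda>A. app A x"] show "app (M ^ n) x = 0" using that by simp
  qed
  obtain v0 where v0: "app \<pi> v0 = v0" "app (N ^ (n - 1)) v0 \<noteq> 0"
  proof -
    obtain x where "app (N ^ (n - 1) * \<pi>) x \<noteq> 0" using Nn(2) by (metis app_simps(4) sqm_eqI)
    thus thesis using that[of "app \<pi> x"] prjD(4)[OF \<pi>] by simp
  qed
  obtain w1 where w1: "app \<pi> w1 = w1" "form (app (N ^ (n - 1)) v0) w1 = 1"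
  proof -
    obtain x where "form x (app (N ^ (n - 1)) v0) = 1" using form_dual[OF v0(2)] by blast
    hence "form (app (N ^ (n - 1)) v0) x = 1" by (simp add: form_sym)
    moreover have "form (app (N ^ (n - 1)) v0) (app \<pi> x) = form (app \<pi> (app (N ^ (n - 1)) v0)) x"
      using prjD(2)[OF \<pi>] by (simp add: form_shift)
    ultimately show thesis using that[of "app \<pi> x"] prjD(4)[OF \<pi>] im[OF N_alg(1) v0(1)] by simp
  qed
  define w where "w = app (star Z) w1"
  have w: "app \<pi> w = w" unfolding w_def by (rule im[OF alg_star[OF Z] w1(1)])
  have shiftZ: "form (app B x) (app (star Z) w1) = form (app B (app Z x)) w1" if "B \<in> alg" for B x
    using arg_cong[OF alg_commute_alg[OF that Z], of "\<lambda>A. app A x"] by (simp add: form_shift)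
  have "form (app (y ^ (m - 1)) v0) w = 1"
    unfolding w_def shiftZ[OF N_alg(3)] yZ[OF v0(1)] by (rule w1)
  from hensel[OF m ym0[OF v0(1)] ym0[OF w] this Q0[OF v0(1)] Q0[OF w]]
  obtain p where p: "\<And>i. Q i (v0 + app (ev y p) w) = 0" by blast
  define v where "v = v0 + app (ev y p) w"
  have v: "app \<pi> v = v" using v0(1) im[OF alg_basic(3) w] by (simp add: v_def)
  have vQ: "Q i v = 0" for i using p by (simp add: v_def)
  \<comment> \<open>The correction of \<open>v0\<close> lies in \<open>K[y] w\<close>, which pairs
    to zero with \<open>w\<close>; so \<open>v\<close> still has the full order.\<close>
  have "form (app (N ^ (n - 1)) v) w1 = form (app (y ^ (m - 1)) v) w"
    unfolding w_def shiftZ[OF N_alg(3)] yZ[OF v] ..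
  also have "\<dots> = form (app (y ^ (m - 1)) v0) w + form (app (ev y ([:0, 1:] ^ (m - 1) * p)) w) w"
    by (simp add: v_def ev_X del: ev_pCons)
  also have "\<dots> = 1" by (simp only: form_ev_y_self \<open>form (app (y ^ (m - 1)) v0) w = 1\<close> add_0_right)
  finally have "form (app (N ^ (n - 1)) v) w1 \<noteq> 0" by simp
  from dual_exists[OF n N0(1)[OF v] this] obtain B where B: "B \<in> alg"
    "\<And>j. form (app (N ^ j) v) (app B w1) = (if j = n - 1 then 1 else 0)" by blast
  define w2 where "w2 = app B w1"
  have w2: "app \<pi> w2 = w2" unfolding w2_def by (rule im[OF B(1) w1(1)])
  have Zv: "app \<pi> (app Z v) = app Z v" by (rule im[OF Z v])
  have "form (app (y ^ (m - 1)) w2) (app Z v) = form w2 (app (N ^ (n - 1)) v)"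
    by (simp only: form_app[of "y ^ (m - 1)"] star_power star_y yZ[OF v])
  also have "\<dots> = form (app (N ^ (n - 1)) v) w2" by (rule form_sym)
  also have "\<dots> = 1" by (simp add: w2_def B(2))
  finally have "form (app (y ^ (m - 1)) w2) (app Z v) = 1" .
  from hensel[OF m ym0[OF w2] ym0[OF Zv] this Q0[OF w2] Q0[OF Zv]]
  obtain q where q: "\<And>i. Q i (w2 + app (ev y q) (app Z v)) = 0" by blast
  define w3 where "w3 = w2 + app (ev y q) (app Z v)"
  have w3: "app \<pi> w3 = w3" using w2 im[OF alg_basic(3) Zv] by (simp add: w3_def)
  \<comment> \<open>The second correction lies in the isotropic module generated by
    \<open>v\<close>, so the duality with \<open>v\<close> survives it.\<close>
  have dual: "form (app (N ^ j) v) w3 = (if j = n - 1 then 1 else 0)" for j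
    using isotropic[OF vQ N_alg(1) alg_mult[OF alg_basic(3) Z]] B(2)[of j] by (simp add: w3_def w2_def)
  note F = fat_hyperbolic[OF n N0(1)[OF v] N0(2)[OF w3] dual vQ q[folded w3_def]]
  let ?\<theta> = "proj n v w3"
  have "\<pi> * ?\<theta> = ?\<theta>" "\<pi> * star ?\<theta> = star ?\<theta>"
    by (simp_all add: proj_def star_sum sum_distrib_left mult_rk im[OF N_alg(1) v] im[OF N_alg(2) w3])
  hence "\<pi> * (?\<theta> + star ?\<theta>) = ?\<theta> + star ?\<theta>" by (simp add: distrib_left)
  thus ?thesis using F by blast
qed

text \<open>The complement \<open>\<pi> + \<pi>1\<close> is again an orthogonal summand. It misses
  \<open>w1\<close>, so its dimension is smaller and \<open>IH\<close> covers it.\<close>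

lemma fat_split:
  assumes \<pi>: "prj \<pi>" "prj \<pi>1" "\<pi> * \<pi>1 = \<pi>1" "\<pi>1 \<noteq> \<pi>" and d1: "vec.dim (range (app \<pi>1)) \<le> 2 * d1"
    and w1: "w1 \<noteq> 0" "app \<pi>1 w1 = w1" "app N w1 = 0" and f1: "fat \<pi>1 d1 w1"
    and IH: "\<And>\<pi>2. prj \<pi>2 \<Longrightarrow> \<pi>2 \<noteq> 0 \<Longrightarrow> vec.dim (range (app \<pi>2)) < vec.dim (range (app \<pi>)) \<Longrightarrow>
      \<exists>d w. w \<noteq> 0 \<and> app \<pi>2 w = w \<and> app N w = 0 \<and> vec.dim (range (app \<pi>2)) \<le> 2 * d \<and> fat \<pi>2 d w"
  shows "\<exists>d. vec.dim (range (app \<pi>)) \<le> 2 * d \<and> fat \<pi> d w1 \<and> fat \<pi> (d + 1) 0 \<and> app \<pi> w1 = w1"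
proof -
  define \<pi>2 where "\<pi>2 = \<pi> + \<pi>1"
  have p1p: "\<pi>1 * \<pi> = \<pi>1" using arg_cong[OF \<pi>(3), of star] prjD(2)[OF \<pi>(1)] prjD(2)[OF \<pi>(2)] by simp
  note sq = prjD(1)[OF \<pi>(1)] prjD(1)[OF \<pi>(2)]
  have p2: "prj \<pi>2" using prjD(2,3)[OF \<pi>(1)] prjD(2,3)[OF \<pi>(2)]
    by (simp add: prj_def \<pi>2_def distrib_left distrib_right sq \<pi>(3) p1p)
  have p12: "\<pi>1 * \<pi>2 = 0" by (simp add: \<pi>2_def distrib_left sq p1p)
  have pp2: "\<pi> * \<pi>2 = \<pi>2" by (simp add: \<pi>2_def distrib_left sq \<pi>(3))
  have "\<pi>2 \<noteq> 0" using \<pi>(4) by (simp add: \<pi>2_def)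
  have sum: "\<pi>1 + \<pi>2 = \<pi>" by (simp add: \<pi>2_def add.left_commute)
  have pw1: "app \<pi> w1 = w1" using arg_cong[OF \<pi>(3), of "\<lambda>A. app A w1"] w1(2) by simp
  have "range (app \<pi>2) \<subseteq> range (app \<pi>)"
  proof
    fix x assume "x \<in> range (app \<pi>2)"
    then obtain z where "x = app \<pi>2 z" by blast
    hence "x = app \<pi> (app \<pi>2 z)" using arg_cong[OF pp2, of "\<lambda>A. app A z"] by simp
    thus "x \<in> range (app \<pi>)" by blast
  qed
  moreover have "w1 \<in> range (app \<pi>)" using pw1 by (metis rangeI)
  moreover have "w1 \<notin> range (app \<pi>2)"
  proof
    assume "w1 \<in> range (app \<pi>2)"
    then obtain z where "w1 = app \<pi>2 z" by blast
    hence "app \<pi>1 w1 = 0" using arg_cong[OF p12, of "\<lambda>A. app A z"] by simp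
    thus False using w1 by simp
  qed
  ultimately have "range (app \<pi>2) \<subset> range (app \<pi>)" by blast
  hence "vec.dim (range (app \<pi>2)) < vec.dim (range (app \<pi>))"
    by (intro vec.dim_psubset) (simp add: vec.span_eq_iff[THEN iffD2, OF subspace_range_app])
  from IH[OF p2 \<open>\<pi>2 \<noteq> 0\<close> this] obtain d2 w2 where 2: "w2 \<noteq> 0" "app \<pi>2 w2 = w2" "app N w2 = 0"
    "vec.dim (range (app \<pi>2)) \<le> 2 * d2" "fat \<pi>2 d2 w2" by blast
  note F = fat_combine[OF \<pi>(2) p2 p12 f1 2(5) w1(2,3,1) 2(2,3,1), unfolded sum]
  have "vec.dim (range (app \<pi>)) \<le> 2 * (d1 + d2)"
    using dim_range_add[of \<pi>1 \<pi>2] d1 2(4) by (simp add: sum)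
  thus ?thesis using F pw1 by blast
qed

text \<open>Induction on the dimension of the summand. Gluing two pieces always gains the extra
  parameter and a hyperbolic piece brings its own, so it can be missing only if a single cyclic
  piece fills the summand.\<close>

lemma fat_or_cyclic_aux:
  assumes "prj \<pi>" "\<pi> \<noteq> 0"
  shows "\<exists>d w. w \<noteq> 0 \<and> app \<pi> w = w \<and> app N w = 0 \<and> vec.dim (range (app \<pi>)) \<le> 2 * d \<and> fat \<pi> d w \<and>
    (fat \<pi> (d + 1) 0 \<or> (\<exists>v m. m \<ge> 1 \<and> y ^ m * \<pi> = 0 \<and> Q (m - 1) v \<noteq> 0 \<and> (\<forall>x. \<exists>A\<in>alg. app \<pi> x = app A v)))"
  using assms
proof (induction "vec.dim (range (app \<pi>))" arbitrary: \<pi> rule: less_induct)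
  case less
  note \<pi> = less.prems(1)
  have IH: "\<exists>d w. w \<noteq> 0 \<and> app \<pi>2 w = w \<and> app N w = 0 \<and> vec.dim (range (app \<pi>2)) \<le> 2 * d \<and> fat \<pi>2 d w"
    if "prj \<pi>2" "\<pi>2 \<noteq> 0" "vec.dim (range (app \<pi>2)) < vec.dim (range (app \<pi>))" for \<pi>2
    using less.hyps[OF that(3,1,2)] by blast
  obtain r where r: "N ^ r = 0" using nilpotent_N by blast
  have "N ^ (2 * r) = 0" using r by (simp add: mult_2 power_add)
  hence "y ^ r = 0" by (subst N_even(2)) simp
  hence ex: "\<exists>m. y ^ m * \<pi> = 0" by (metis mult_zero_left)
  define m where "m = (LEAST m. y ^ m * \<pi> = 0)"
  have ym: "y ^ m * \<pi> = 0" unfolding m_def by (rule LeastI_ex[OF ex])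
  have m: "m \<ge> 1" using ym less.prems(2) by (cases m) auto
  have ym': "y ^ (m - 1) * \<pi> \<noteq> 0" using not_less_Least[of "m - 1" "\<lambda>m. y ^ m * \<pi> = 0"] m by (simp add: m_def)
  show ?case
  proof (cases "\<exists>v. app \<pi> v = v \<and> Q (m - 1) v \<noteq> 0")
    case True
    then obtain v where v: "app \<pi> v = v" "Q (m - 1) v \<noteq> 0" by blast
    have "app (y ^ m) v = 0" using arg_cong[OF ym, of "\<lambda>A. app A v"] v(1) by simp
    from fat_cyclic[OF m this v(2)] obtain \<pi>1 w0 where 1: "prj \<pi>1" "\<And>x. \<exists>A\<in>alg. app \<pi>1 x = app A v"
      "vec.dim (range (app \<pi>1)) \<le> 2 * m" "w0 \<noteq> 0" "app \<pi>1 w0 = w0" "app N w0 = 0" "fat \<pi>1 m w0" by blast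
    show ?thesis
    proof (cases "\<pi>1 = \<pi>")
      case True
      thus ?thesis using 1 m ym v(2) by blast
    next
      case False
      have "\<pi> * \<pi>1 = \<pi>1"
      proof (rule sqm_eqI)
        fix x
        obtain A where "A \<in> alg" "app \<pi>1 x = app A v" using 1(2) by blast
        thus "app (\<pi> * \<pi>1) x = app \<pi>1 x" using prj_app[OF \<pi> _ v(1)] by simp
      qed
      from fat_split[OF \<pi> 1(1) this False 1(3-7) IH] show ?thesis using 1(4,6) by blast
    qed
  next
    case False
    hence "\<And>x. app \<pi> x = x \<Longrightarrow> Q (m - 1) x = 0" by blast
    from fat_noncyclic[OF \<pi> m ym ym' this] obtain \<pi>1 n w0 where 1: "prj \<pi>1" "\<pi> * \<pi>1 = \<pi>1"
      "vec.dim (range (app \<pi>1)) \<le> 2 * n" "w0 \<noteq> 0" "app \<pi>1 w0 = w0" "app N w0 = 0" "fat \<pi>1 n w0" "fat \<pi>1 (n + 1) 0"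
      by blast
    show ?thesis
    proof (cases "\<pi>1 = \<pi>")
      case True
      thus ?thesis using 1 by blast
    next
      case False
      from fat_split[OF \<pi> 1(1,2) False 1(3-7) IH] show ?thesis using 1(4,6) by blast
    qed
  qed
qed

lemma fat_or_cyclic:
  "fat 1 (CARD('n) + 1) 0 \<or>
   (\<exists>v m. m \<ge> 1 \<and> y ^ m = 0 \<and> Q (m - 1) v \<noteq> 0 \<and> (\<forall>x. \<exists>A\<in>alg. x = app A v))"
proof -
  have "prj 1" by (simp add: prj_def)
  from fat_or_cyclic_aux[OF this] obtain d w where d: "vec.dim (range (app (1 :: ('k, 'n + 'n) sqm))) \<le> 2 * d"
    "fat 1 (d + 1) 0 \<or> (\<exists>v m. m \<ge> 1 \<and> y ^ m = 0 \<and> Q (m - 1) v \<noteq> 0 \<and> (\<forall>x. \<exists>A\<in>alg. x = app A v))" by auto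
  have "range (app (1 :: ('k, 'n + 'n) sqm)) = UNIV" by auto
  hence "CARD('n) \<le> d" using d(1) vec_dim_card[where 'a = 'k and 'n = "'n + 'n"] by simp
  thus ?thesis using d(2) fat_mono[of 1 "d + 1" 0 "CARD('n) + 1"] by auto
qed

end

subsection \<open>Dimensions\<close>

lemma (in finite_dimensional_vector_space_pair_1) dim_image_kernel:
  assumes f: "Vector_Spaces.linear s1 s2 f" and S: "vs1.subspace S"
  shows "vs1.dim S = vs1.dim {x \<in> S. f x = 0} + vs2.dim (f ` S)"
proof -
  interpret f: Vector_Spaces.linear s1 s2 f by fact
  define L where "L = {x \<in> S. f x = 0}"
  have L: "vs1.subspace L" unfolding L_def
    by (rule vs1.subspaceI) (use S in \<open>auto simp: vs1.subspace_def f.add f.scale f.zero\<close>)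
  obtain B where B: "B \<subseteq> L" "vs1.independent B" "L \<subseteq> vs1.span B" "card B = vs1.dim L"
    using vs1.basis_exists by blast
  have "B \<subseteq> S" using B(1) by (auto simp: L_def)
  then obtain C where C: "B \<subseteq> C" "C \<subseteq> S" "vs1.independent C" "S \<subseteq> vs1.span C"
    using vs1.maximal_independent_subset_extend[OF _ B(2)] by metis
  have fin: "finite C" using C(3) by (rule vs1.finiteI_independent)
  have sC: "card C = vs1.dim S" using C by (intro vs1.basis_card_eq_dim) auto
  define D where "D = C - B"
  have indD: "vs1.independent D" using C(3) by (rule vs1.independent_mono) (simp add: D_def)
  have SC: "S = vs1.span C" using C(2,4) vs1.span_minimal[OF C(2) S] by auto
  have zero: "x = 0" if x: "x \<in> vs1.span D" "f x = 0" for x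
  proof -
    have "x \<in> S" using x(1) vs1.span_mono[of D C] SC by (auto simp: D_def)
    hence "x \<in> vs1.span B" using x(2) B(3) by (auto simp: L_def)
    hence "vs1.representation C x = vs1.representation B x" "vs1.representation C x = vs1.representation D x"
      using vs1.representation_extend[OF C(3) _ C(1)] vs1.representation_extend[OF C(3) x(1)] by (auto simp: D_def)
    hence "vs1.representation C x b = 0" for b
      using vs1.representation_ne_zero[of B x b] vs1.representation_ne_zero[of D x b] by (auto simp: D_def)
    thus ?thesis using vs1.sum_nonzero_representation_eq[OF C(3)] \<open>x \<in> S\<close> SC by force
  qed
  have inj: "inj_on f (vs1.span D)"
  proof (rule inj_onI)
    fix x z assume xz: "x \<in> vs1.span D" "z \<in> vs1.span D" "f x = f z"
    hence "x - z \<in> vs1.span D" "f (x - z) = 0" by (auto intro: vs1.span_diff simp: f.diff)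
    from zero[OF this] show "x = z" by simp
  qed
  have "f ` S = f ` vs1.span D"
  proof
    show "f ` S \<subseteq> f ` vs1.span D"
    proof
      fix z assume "z \<in> f ` S"
      then obtain x where x: "x \<in> S" "z = f x" by blast
      have "C = B \<union> D" using C(1) by (auto simp: D_def)
      then obtain b d where "x = b + d" "b \<in> vs1.span B" "d \<in> vs1.span D"
        using x(1) SC vs1.span_Un[of B D] by auto
      moreover have "vs1.span B \<subseteq> L" using B(1) L by (rule vs1.span_minimal)
      ultimately show "z \<in> f ` vs1.span D" using x(2) by (auto simp: f.add L_def)
    qed
    show "f ` vs1.span D \<subseteq> f ` S" using SC vs1.span_mono[of D C] by (auto simp: D_def)
  qed
  also have "vs2.dim \<dots> = vs1.dim (vs1.span D)"
    using dim_image_eq[OF f, of "vs1.span D"] inj by (simp add: vs1.span_span)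
  also have "\<dots> = card D" using indD by (rule vs1.dim_span_eq_card_independent)
  also have "card D = card C - card B" unfolding D_def using fin C(1) by (intro card_Diff_subset finite_subset[OF C(1)])
  finally show ?thesis using sC B(4) card_mono[OF fin C(1)] by (simp add: L_def)
qed

section \<open>Matrix spaces and their linear functionals\<close>

definition mat_unit :: "'i \<Rightarrow> 'j \<Rightarrow> 'k::field^'j^'i" where
  "mat_unit a b = (\<chi> i j. if i = a \<and> j = b then 1 else 0)"

definition mat_basis :: "('k::field^'j::finite^'i::finite) set" where
  "mat_basis = range (\<lambda>(a, b). mat_unit a b)"

lemma mat_expand: "(A :: 'k::field^'j::finite^'i::finite) = (\<Sum>p\<in>UNIV. mat_scale (A $ fst p $ snd p) (mat_unit (fst p) (snd p)))"
proof -
  have "(\<Sum>p\<in>UNIV. mat_scale (A $ fst p $ snd p) (mat_unit (fst p) (snd p))) $ i $ j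
     = (\<Sum>p\<in>UNIV. if p = (i, j) then A $ i $ j else 0)" for i j
    unfolding sum_component by (intro sum.cong) (auto simp: mat_scale_def mat_unit_def)
  thus ?thesis by (simp add: vec_eq_iff)
qed

lemma inj_mat_unit: "inj (\<lambda>(a, b). mat_unit a b :: 'k::field^'j::finite^'i::finite)"
proof (rule injI, clarify)
  fix a c :: 'i and b d :: 'j assume "mat_unit a b = (mat_unit c d :: 'k^'j^'i)"
  hence "(mat_unit a b :: 'k^'j^'i) $ a $ b = mat_unit c d $ a $ b" by simp
  thus "a = c \<and> b = d" by (simp add: mat_unit_def split: if_splits)
qed

interpretation mat_space: finite_dimensional_vector_space
  "mat_scale :: 'k::field \<Rightarrow> 'k^'j::finite^'i::finite \<Rightarrow> _" mat_basis
proof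
  show "finite (mat_basis :: ('k^'j^'i) set)" by (simp add: mat_basis_def)
  show "mat_space.span (mat_basis :: ('k^'j^'i) set) = UNIV"
  proof -
    have "A \<in> mat_space.span mat_basis" for A :: "'k^'j^'i"
    proof -
      have "mat_unit a b \<in> (mat_basis :: ('k^'j^'i) set)" for a :: 'i and b :: 'j by (force simp: mat_basis_def)
      hence "(\<Sum>p\<in>UNIV. mat_scale (A $ fst p $ snd p) (mat_unit (fst p) (snd p))) \<in> mat_space.span mat_basis"
        by (intro mat_space.span_sum mat_space.span_scale) (rule mat_space.span_base)
      thus ?thesis by (simp only: mat_expand[symmetric])
    qed
    thus ?thesis by blast
  qed
  show "\<not> mat_space.dependent (mat_basis :: ('k^'j^'i) set)"
  proof (rule mat_space.independent_if_scalars_zero)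
    show "finite (mat_basis :: ('k^'j^'i) set)" by (simp add: mat_basis_def)
    fix f :: "'k^'j^'i \<Rightarrow> 'k" and x :: "'k^'j^'i" assume s: "(\<Sum>x\<in>mat_basis. mat_scale (f x) x) = 0" and "x \<in> mat_basis"
    then obtain a :: 'i and b :: 'j where x: "x = mat_unit a b" by (auto simp: mat_basis_def)
    have "(\<Sum>x\<in>mat_basis. mat_scale (f x) x) = (\<Sum>p\<in>UNIV. mat_scale (f (mat_unit (fst p) (snd p))) (mat_unit (fst p) (snd p) :: 'k^'j^'i))"
      unfolding mat_basis_def using inj_mat_unit by (subst sum.reindex) (auto simp: case_prod_beta)
    also have "\<dots> $ a $ b = (\<Sum>p\<in>UNIV. if p = (a, b) then f x else 0)"
      unfolding sum_component by (intro sum.cong) (auto simp: mat_scale_def mat_unit_def x)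
    finally show "f x = 0" using s by simp
  qed
qed

interpretation mat_mat: finite_dimensional_vector_space_pair_1
  "mat_scale :: 'k::field \<Rightarrow> 'k^'j::finite^'i::finite \<Rightarrow> _" mat_basis "mat_scale :: 'k \<Rightarrow> 'k^'b::finite^'a::finite \<Rightarrow> _" ..

interpretation mat_vec: finite_dimensional_vector_space_pair_1
  "mat_scale :: 'k::field \<Rightarrow> 'k^'j::finite^'i::finite \<Rightarrow> _" mat_basis "(*s) :: 'k \<Rightarrow> 'k^'a::finite \<Rightarrow> _" ..

interpretation mat_field: vector_space_pair
  "mat_scale :: 'k::field \<Rightarrow> 'k^'j::finite^'i::finite \<Rightarrow> _" "(*) :: 'k \<Rightarrow> 'k \<Rightarrow> 'k" ..

interpretation vec_field: vector_space_pair
  "(*s) :: 'k::field \<Rightarrow> 'k^'a::finite \<Rightarrow> _" "(*) :: 'k \<Rightarrow> 'k \<Rightarrow> 'k" ..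

definition pair_mat :: "'k::field^'j::finite^'i::finite \<Rightarrow> 'k^'j^'i \<Rightarrow> 'k" where
  "pair_mat C A = (\<Sum>a\<in>UNIV. \<Sum>b\<in>UNIV. C $ a $ b * A $ a $ b)"

lemma pair_mat_simps [simp]: "pair_mat C (A + B) = pair_mat C A + pair_mat C B" "pair_mat C (mat_scale c A) = c * pair_mat C A"
  "pair_mat C 0 = 0"
  by (simp_all add: pair_mat_def mat_scale_def sum.distrib algebra_simps sum_distrib_left)

lemma pair_mat_sum: "pair_mat C (sum f S) = (\<Sum>i\<in>S. pair_mat C (f i))"
  by (induction S rule: infinite_finite_induct) auto

lemma mat_functional:
  assumes "Vector_Spaces.linear mat_scale (*) (f :: 'k::field^'j::finite^'i::finite \<Rightarrow> 'k)"
  shows "f A = pair_mat (\<chi> a b. f (mat_unit a b)) A"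
proof -
  interpret f: Vector_Spaces.linear mat_scale "(*)" f by fact
  have "f A = (\<Sum>p\<in>UNIV. A $ fst p $ snd p * f (mat_unit (fst p) (snd p)))"
    by (subst mat_expand) (simp add: f.sum f.scale)
  also have "\<dots> = (\<Sum>a\<in>UNIV. \<Sum>b\<in>UNIV. A $ a $ b * f (mat_unit a b))"
    by (simp add: sum.cartesian_product case_prod_beta)
  finally show ?thesis by (simp add: pair_mat_def mult.commute)
qed

lemma subspace_coordinates:
  fixes S :: "('k::field^'j::finite^'i::finite) set"
  assumes S: "mat_space.subspace S" and d: "d \<le> mat_space.dim S"
  shows "\<exists>\<kappa>. \<forall>c :: nat \<Rightarrow> 'k. \<exists>A\<in>S. \<forall>i<d. pair_mat (\<kappa> i) A = c i"
proof -
  obtain B where B: "B \<subseteq> S" "mat_space.independent B" "card B = mat_space.dim S" using mat_space.basis_exists by metis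
  have "finite B" using B(2) by (rule mat_space.finiteI_independent)
  then obtain g where g: "bij_betw g {..<card B} B" using ex_bij_betw_nat_finite by (metis atLeast0LessThan)
  have "\<exists>f. Vector_Spaces.linear mat_scale (*) f \<and> (\<forall>b\<in>B. f b = (if b = g i then 1 else 0))" for i
    by (rule mat_field.linear_independent_extend[OF B(2)])
  then obtain f where f: "\<And>i. Vector_Spaces.linear mat_scale (*) (f i)" "\<And>i b. b \<in> B \<Longrightarrow> f i b = (if b = g i then 1 else 0)"
    by metis
  define \<kappa> where "\<kappa> i = (\<chi> a b. f i (mat_unit a b))" for i
  have \<kappa>: "f i A = pair_mat (\<kappa> i) A" for i A unfolding \<kappa>_def by (rule mat_functional[OF f(1)])
  have "\<exists>A\<in>S. \<forall>i<d. pair_mat (\<kappa> i) A = c i" for c :: "nat \<Rightarrow> 'k"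
  proof (intro bexI allI impI)
    have gB: "j < d \<Longrightarrow> g j \<in> B" for j using g d B(3) by (auto simp: bij_betw_def)
    show "(\<Sum>j<d. mat_scale (c j) (g j)) \<in> S"
      using gB B(1) by (intro mat_space.subspace_sum S mat_space.subspace_scale) auto
    fix i assume i: "i < d"
    have "pair_mat (\<kappa> i) (\<Sum>j<d. mat_scale (c j) (g j)) = (\<Sum>j<d. c j * f i (g j))"
      by (simp add: pair_mat_sum \<kappa>)
    also have "\<dots> = (\<Sum>j<d. if j = i then c j else 0)"
    proof (rule sum.cong[OF refl])
      fix j assume "j \<in> {..<d}"
      hence "j < d" "g j = g i \<longleftrightarrow> j = i" using g d B(3) i by (auto simp: bij_betw_def inj_on_def)
      thus "c j * f i (g j) = (if j = i then c j else 0)" using f(2)[OF gB[of j]] by simp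
    qed
    finally show "pair_mat (\<kappa> i) (\<Sum>j<d. mat_scale (c j) (g j)) = c i" using i by simp
  qed
  thus ?thesis by blast
qed

lemma vec_functional:
  assumes "Vector_Spaces.linear (*s) (*) (f :: 'k::field^'i::finite \<Rightarrow> 'k)"
  shows "f v = (\<Sum>i\<in>UNIV. v $ i * f (axis i 1))"
proof -
  interpret f: Vector_Spaces.linear "(*s)" "(*)" f by fact
  have "v = (\<Sum>i\<in>UNIV. v $ i *s axis i 1)" by (rule basis_expansion[symmetric])
  hence "f v = f (\<Sum>i\<in>UNIV. v $ i *s axis i 1)" by metis
  thus ?thesis by (simp add: f.sum f.scale)
qed

lemma form_riesz:
  assumes "Vector_Spaces.linear (*s) (*) (f :: 'k::field^('n::finite + 'n) \<Rightarrow> 'k)"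
  shows "\<exists>x. \<forall>v. f v = form v x"
proof (intro exI allI)
  fix v
  show "f v = form v (\<chi> i. f (axis (sw i) 1))" by (subst vec_functional[OF assms]) (simp add: form_def)
qed

lemma form_dual_basis:
  fixes w :: "'i \<Rightarrow> 'k::field^('n::finite + 'n)"
  assumes w: "inj w" "vec.independent (range w)"
  shows "\<exists>x. \<forall>i j. form (w i) (x j) = (if i = j then 1 else 0)"
proof -
  have "\<exists>x. \<forall>i. form (w i) x = (if i = j then 1 else 0)" for j
  proof -
    obtain f where f: "Vector_Spaces.linear (*s) (*) f" "\<forall>b\<in>range w. f b = (if b = w j then 1 else 0 :: 'k)"
      using vec_field.linear_independent_extend[OF w(2), of "\<lambda>b. if b = w j then 1 else 0"] by blast
    obtain x where "\<And>v. f v = form v x" using form_riesz[OF f(1)] by blast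
    moreover have "f (w i) = (if i = j then 1 else 0)" for i using f(2) w(1) by (simp add: inj_eq)
    ultimately have "\<forall>i. form (w i) x = (if i = j then 1 else 0)" by metis
    thus ?thesis by blast
  qed
  thus ?thesis by metis
qed

lemma linear_matI:
  assumes "vector_space s2" "\<And>A B. f (A + B) = f A + f B" "\<And>c A. f (mat_scale c A) = s2 c (f A)"
  shows "Vector_Spaces.linear (mat_scale :: 'k::field \<Rightarrow> 'k^'j::finite^'i::finite \<Rightarrow> _) s2 f"
  using assms mat_space.vector_space_axioms by (simp add: Vector_Spaces.linear_iff)

lemma linear_vecI:
  assumes "vector_space s2" "\<And>A B. f (A + B) = f A + f B" "\<And>c A. f (c *s A) = s2 c (f A)"
  shows "Vector_Spaces.linear ((*s) :: 'k::field \<Rightarrow> 'k^'j::finite \<Rightarrow> _) s2 f"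
  using assms vec.vector_space_axioms by (simp add: Vector_Spaces.linear_iff)

text \<open>The solutions \<open>s\<close> of \<open>n s + s n\<^sup>T = 0\<close> among the symmetric matrices: the left hand side is
  alternating, and it is killed by a further functional if \<open>n\<close> has corank at least two.\<close>

lemma symmetric_solutions:
  fixes n :: "'k::field^'n::finite^'n"
  assumes two: "(2 :: 'k) = 0" and ker: "vec.dim {x. n *v x = 0} \<ge> 2"
  defines "L \<equiv> {s. transpose s = s \<and> n ** s + s ** transpose n = 0}"
  shows "mat_space.subspace L" "mat_space.dim L \<ge> CARD('n) + 1"
proof -
  note c2 = vec_char2[OF two]
  define Sym where "Sym = {s :: 'k^'n^'n. transpose s = s}"
  define Alt where "Alt = {s \<in> Sym. (\<chi> i. s $ i $ i) = 0}"
  have tr: "transpose (A + B) = transpose A + transpose B" "transpose (mat_scale c A) = mat_scale c (transpose A)"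
    for A B :: "'k^'n^'n" and c by (simp_all add: transpose_def mat_scale_def vec_eq_iff)
  have t0: "transpose (0 :: 'k^'n^'n) = 0" by (simp add: transpose_def vec_eq_iff)
  have Sym: "mat_space.subspace Sym" unfolding Sym_def by (rule mat_space.subspaceI) (simp_all add: tr t0)
  define F where "F s = n ** s + s ** transpose n" for s :: "'k^'n^'n"
  have F: "Vector_Spaces.linear mat_scale mat_scale F"
    by (rule linear_matI[OF mat_space.vector_space_axioms])
      (simp_all add: F_def matrix_add_ldistrib matrix_add_rdistrib mat_space.scale_right_distrib add_ac)
  have L: "L = {s \<in> Sym. F s = 0}" by (auto simp: L_def Sym_def F_def)
  have lin: "F (A + B) = F A + F B" "F (mat_scale c A) = mat_scale c (F A)" for A B c
    using F by (simp_all add: Vector_Spaces.linear_iff)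
  have F0: "F 0 = 0" using lin(2)[of 0 0] by simp
  show "mat_space.subspace L" unfolding L
    by (rule mat_space.subspaceI) (use Sym in \<open>auto simp: mat_space.subspace_def lin F0\<close>)
  define g where "g s = (\<chi> i. s $ i $ i)" for s :: "'k^'n^'n"
  have g: "Vector_Spaces.linear mat_scale (*s) g"
    by (rule linear_matI[OF vec.vector_space_axioms]) (simp_all add: g_def mat_scale_def vec_eq_iff)
  have Alt: "Alt = {s \<in> Sym. g s = 0}" by (simp add: Alt_def g_def)
  have Alt_sub: "mat_space.subspace Alt" unfolding Alt
    by (rule mat_space.subspaceI) (use Sym g in \<open>auto simp: mat_space.subspace_def Vector_Spaces.linear_iff g_def vec_eq_iff\<close>)
  have gS: "g ` Sym = UNIV"
  proof -
    have "v \<in> g ` Sym" for v :: "'k^'n"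
      by (rule image_eqI[of _ _ "\<chi> i j. if i = j then v $ i else 0"]) (auto simp: g_def Sym_def transpose_def vec_eq_iff)
    thus ?thesis by blast
  qed
  have dS: "mat_space.dim Sym = mat_space.dim Alt + CARD('n)"
    using mat_vec.dim_image_kernel[OF g Sym] by (simp only: Alt gS vec_dim_card)
  have dL: "mat_space.dim Sym = mat_space.dim L + mat_space.dim (F ` Sym)"
    using mat_mat.dim_image_kernel[OF F Sym] by (simp add: L)
  define R where "R = range ((*v) n)"
  have "Vector_Spaces.linear (*s) (*s) ((*v) n)" ..
  from vec.dim_image_kernel[OF this vec.subspace_UNIV]
  have "vec.dim {x. n *v x = 0} + vec.dim R = CARD('n)" by (simp add: R_def card_cart_basis)
  hence dR: "vec.dim R + 2 \<le> CARD('n)" using ker by simp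
  obtain B where B: "B \<subseteq> R" "vec.independent B" "R \<subseteq> vec.span B" "card B = vec.dim R" using vec.basis_exists by blast
  have fin: "finite B" using B(2) by (rule vec.finiteI_independent)
  obtain b1 where b1: "b1 \<notin> vec.span B"
    using dR B(4) vec.dim_span_eq_card_independent[OF B(2)] vec_dim_card[where 'a = 'k and 'n = 'n] by (metis UNIV_eq_I add_leD2 not_numeral_le_zero add_le_same_cancel1)
  have B1: "vec.independent (insert b1 B)" using b1 B(2) by (rule vec.independent_insertI)
  have b1B: "b1 \<notin> B" using b1 vec.span_base by blast
  obtain b2 where b2: "b2 \<notin> vec.span (insert b1 B)"
  proof -
    have "vec.dim (vec.span (insert b1 B)) = Suc (vec.dim R)"
      using vec.dim_span_eq_card_independent[OF B1] b1B fin B(4) by simp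
    moreover have "vec.dim (UNIV :: ('k^'n) set) = CARD('n)" by (rule vec_dim_card)
    ultimately have "vec.span (insert b1 B) \<noteq> UNIV" using dR by (intro notI) (simp only:)
    thus thesis using that by blast
  qed
  have B2: "vec.independent (insert b2 (insert b1 B))" using b2 B1 by (rule vec.independent_insertI)
  have b2B: "b2 \<notin> insert b1 B" using b2 vec.span_base by blast
  obtain f1 where f1: "Vector_Spaces.linear (*s) (*) f1" "\<forall>b\<in>insert b2 (insert b1 B). f1 b = (if b = b1 then 1 else 0 :: 'k)"
    using vec_field.linear_independent_extend[OF B2, of "\<lambda>b. if b = b1 then 1 else 0"] by blast
  obtain f2 where f2: "Vector_Spaces.linear (*s) (*) f2" "\<forall>b\<in>insert b2 (insert b1 B). f2 b = (if b = b2 then 1 else 0 :: 'k)"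
    using vec_field.linear_independent_extend[OF B2, of "\<lambda>b. if b = b2 then 1 else 0"] by blast
  have fR: "f v = 0" if f: "Vector_Spaces.linear (*s) (*) f" "\<And>b. b \<in> B \<Longrightarrow> f b = (0 :: 'k)" and v: "v \<in> R" for f v
  proof -
    interpret f: Vector_Spaces.linear "(*s)" "(*)" f by (rule f(1))
    show ?thesis using f.eq_0_on_span[of B v] f(2) v B(3) by blast
  qed
  \<comment> \<open>\<open>f1\<close> and \<open>f2\<close> vanish on the range of \<open>n\<close>,
    so \<open>y\<close> and \<open>z\<close> are left null vectors of \<open>n\<close>. The
    functional with matrix \<open>C\<close> multiplies by \<open>y\<close> from the left and
    \<open>z\<close> from the right, and kills both \<open>n ** s\<close> and
    \<open>s ** transpose n\<close>.\<close>
  define y where "y i = f1 (axis i 1)" for i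
  define z where "z i = f2 (axis i 1)" for i
  have yv: "f1 v = (\<Sum>i\<in>UNIV. y i * v $ i)" "f2 v = (\<Sum>i\<in>UNIV. z i * v $ i)" for v
    by (subst vec_functional[OF f1(1)] vec_functional[OF f2(1)], simp add: y_def z_def mult.commute)+
  have "n *v axis k 1 = (\<chi> i. n $ i $ k)" for k
    by (simp add: vec_eq_iff matrix_vector_mult_def axis_def if_distrib[of "\<lambda>x. _ * x"] cong: if_cong)
  hence col: "(\<chi> i. n $ i $ k) \<in> R" for k unfolding R_def by (metis rangeI)
  have yn: "(\<Sum>i\<in>UNIV. y i * n $ i $ k) = 0" "(\<Sum>i\<in>UNIV. z i * n $ i $ k) = 0" for k
  proof -
    have "f1 b = 0" "f2 b = 0" if "b \<in> B" for b using f1(2) f2(2) b1B b2B that by auto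
    from fR[OF f1(1) this(1) col[of k]] fR[OF f2(1) this(2) col[of k]]
    show "(\<Sum>i\<in>UNIV. y i * n $ i $ k) = 0" "(\<Sum>i\<in>UNIV. z i * n $ i $ k) = 0" unfolding yv by simp_all
  qed
  define C where "C = (\<chi> i j. y i * z j)"
  define Alt' where "Alt' = {a \<in> Alt. pair_mat C a = 0}"
  have Alt'_sub: "mat_space.subspace Alt'" unfolding Alt'_def
    by (rule mat_space.subspaceI) (use Alt_sub in \<open>auto simp: mat_space.subspace_def\<close>)
  have "F ` Sym \<subseteq> Alt'"
  proof
    fix a assume "a \<in> F ` Sym"
    then obtain s where s: "s \<in> Sym" "a = F s" by blast
    have st: "transpose (n ** s) = s ** transpose n" using s(1) by (simp add: Sym_def matrix_transpose_mul)
    hence ts: "transpose (s ** transpose n) = n ** s" by (metis transpose_transpose)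
    have "transpose a = a" by (simp add: s(2) F_def tr st ts add.commute)
    moreover have "(s ** transpose n) $ i $ i = (n ** s) $ i $ i" for i
      unfolding st[symmetric] by (simp add: transpose_def)
    hence "g a = 0" by (simp only: s(2) F_def g_def vec_eq_iff vec_lambda_beta vector_add_component c2 zero_index) simp
    moreover have "pair_mat C (n ** s) = 0"
    proof -
      have "pair_mat C (n ** s) = (\<Sum>a\<in>UNIV. \<Sum>b\<in>UNIV. \<Sum>k\<in>UNIV. (y a * n $ a $ k) * (z b * s $ k $ b))"
        by (simp add: pair_mat_def C_def matrix_matrix_mult_def sum_distrib_left ac_simps)
      also have "\<dots> = (\<Sum>b\<in>UNIV. \<Sum>k\<in>UNIV. \<Sum>a\<in>UNIV. (y a * n $ a $ k) * (z b * s $ k $ b))"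
        by (subst sum.swap, rule sum.cong[OF refl], subst sum.swap, rule refl)
      also have "\<dots> = 0" by (simp add: sum_distrib_right[symmetric] yn)
      finally show ?thesis .
    qed
    moreover have "pair_mat C (s ** transpose n) = 0"
    proof -
      have "pair_mat C (s ** transpose n) = (\<Sum>a\<in>UNIV. \<Sum>b\<in>UNIV. \<Sum>k\<in>UNIV. (z b * n $ b $ k) * (y a * s $ a $ k))"
        by (simp add: pair_mat_def C_def matrix_matrix_mult_def transpose_def sum_distrib_left ac_simps)
      also have "\<dots> = (\<Sum>a\<in>UNIV. \<Sum>k\<in>UNIV. \<Sum>b\<in>UNIV. (z b * n $ b $ k) * (y a * s $ a $ k))"
        by (rule sum.cong[OF refl], subst sum.swap, rule refl)
      also have "\<dots> = 0" by (simp add: sum_distrib_right[symmetric] yn)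
      finally show ?thesis .
    qed
    ultimately show "a \<in> Alt'" by (simp add: Alt'_def Alt Sym_def) (simp add: s(2) F_def)
  qed
  hence "mat_space.dim (F ` Sym) \<le> mat_space.dim Alt'" by (rule mat_space.dim_subset)
  moreover have "mat_space.dim Alt' < mat_space.dim Alt"
  proof (rule mat_space.dim_psubset)
    \<comment> \<open>As \<open>b1\<close> and \<open>b2\<close> are dual to \<open>f1\<close> and
      \<open>f2\<close>, the functional takes the value 1 on this alternating matrix. So the image
      of \<open>F\<close> lies in a proper subspace of \<open>Alt\<close>, which gains the dimension
      beyond the \<open>CARD('n)\<close> coming from the diagonals.\<close>
    define a where "a = (\<chi> i j. b1 $ i * b2 $ j + b2 $ i * b1 $ j)"
    have "a \<in> Alt" by (simp add: Alt Sym_def a_def g_def transpose_def vec_eq_iff ac_simps c2(1)[of "_ * _"] flip: mult_2)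
       (use two in simp)
    moreover have "pair_mat C a = 1"
    proof -
      have "pair_mat C a = (\<Sum>i\<in>UNIV. \<Sum>j\<in>UNIV. (y i * b1 $ i) * (z j * b2 $ j)) + (\<Sum>i\<in>UNIV. \<Sum>j\<in>UNIV. (y i * b2 $ i) * (z j * b1 $ j))"
        by (simp add: pair_mat_def C_def a_def algebra_simps sum.distrib)
      also have "\<dots> = f1 b1 * f2 b2 + f1 b2 * f2 b1" by (simp add: yv sum_product)
      also have "\<dots> = 1" using f1(2) f2(2) b2B by auto
      finally show ?thesis .
    qed
    hence "a \<notin> Alt'" by (simp add: Alt'_def)
    moreover have "Alt' \<subseteq> Alt" by (auto simp: Alt'_def)
    ultimately have "Alt' \<subset> Alt" by blast
    thus "mat_space.span Alt' \<subset> mat_space.span Alt"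
      using Alt_sub Alt'_sub by (simp add: mat_space.span_eq_iff[THEN iffD2])
  qed
  ultimately show "mat_space.dim L \<ge> CARD('n) + 1" using dS dL by linarith
qed

subsection \<open>Nilpotent elements of the symplectic Lie algebra\<close>

lemma form_pair_mat: "form (app A p) q = pair_mat (\<chi> a b. p $ b * q $ sw a) (mat_of A)"
  by (simp add: form_def app_def matrix_vector_mult_def pair_mat_def sum_distrib_right sum_distrib_left ac_simps)

locale nilp = char2 K for K :: "'k::alg_closed_field itself" +
  fixes e :: "('k, 'n::finite + 'n) sqm"
  assumes self_adjoint: "star e = e" and nil: "\<exists>r. e ^ r = 0"
begin

definition isotropic_stable :: "('k^('n + 'n)) set \<Rightarrow> bool" where
  "isotropic_stable W \<longleftrightarrow> vec.subspace W \<and> (\<forall>x\<in>W. app e x \<in> W) \<and> (\<forall>x\<in>W. \<forall>z\<in>W. form x z = 0)"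

lemma form_e: "form (app e x) z = form x (app e z)"
  by (simp add: form_app self_adjoint)

text \<open>Take \<open>W\<close> of greatest dimension. If a vector orthogonal to \<open>W\<close>
  lay outside, its last image under powers of \<open>e\<close> still outside, \<open>x'\<close>,
  would satisfy \<open>app e x' \<in> W\<close>; then \<open>W\<close> could be enlarged by
  \<open>x'\<close>, which is orthogonal to itself because the form is alternating.\<close>

lemma lagrangian_exists:
  assumes "isotropic_stable W0"
  shows "\<exists>W. W0 \<subseteq> W \<and> isotropic_stable W \<and> (\<forall>x. (\<forall>z\<in>W. form x z = 0) \<longrightarrow> x \<in> W)"
proof -
  let ?P = "\<lambda>W. W0 \<subseteq> W \<and> isotropic_stable W"
  have "\<forall>W. ?P W \<longrightarrow> vec.dim W < Suc (CARD('n + 'n))"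
    using vec.dim_subset_UNIV vec_dim_card by (metis dim_subset_UNIV_cart_gen less_Suc_eq_le)
  from ex_has_greatest_nat[of ?P W0 vec.dim, OF _ this] assms
  obtain W where W: "?P W" and max: "\<And>W'. ?P W' \<Longrightarrow> vec.dim W' \<le> vec.dim W" by blast
  have sub: "vec.subspace W" and st: "\<And>x. x \<in> W \<Longrightarrow> app e x \<in> W" and iso: "\<And>x z. x \<in> W \<Longrightarrow> z \<in> W \<Longrightarrow> form x z = 0"
    using W unfolding isotropic_stable_def by auto
  have "x \<in> W" if x: "\<forall>z\<in>W. form x z = 0" for x
  proof (rule ccontr)
    assume "x \<notin> W"
    obtain r where "e ^ r = 0" using nil by blast
    hence "app (e ^ r) x \<in> W" using vec.subspace_0[OF sub] by simp
    hence ex: "\<exists>r. app (e ^ r) x \<in> W" by blast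
    define r where "r = (LEAST r. app (e ^ r) x \<in> W)"
    have r: "app (e ^ r) x \<in> W" unfolding r_def by (rule LeastI_ex[OF ex])
    have "r \<noteq> 0" using r \<open>x \<notin> W\<close> by (intro notI) simp
    then obtain s where s: "r = Suc s" by (cases r) auto
    define x' where "x' = app (e ^ s) x"
    have x': "x' \<notin> W" "app e x' \<in> W" using not_less_Least[of s "\<lambda>r. app (e ^ r) x \<in> W"] r
      by (simp_all add: x'_def s r_def[symmetric])
    have orth: "form x' z = 0" if "z \<in> W" for z
      using that unfolding x'_def
    proof (induction s arbitrary: z)
      case 0 thus ?case using x by simp
    next
      case (Suc s) thus ?case using st by (simp add: form_e)
    qed
    define W' where "W' = vec.span (insert x' W)"
    have W': "z \<in> W' \<longleftrightarrow> (\<exists>c. z - c *s x' \<in> W)" for z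
      unfolding W'_def vec.span_insert using sub by (simp add: vec.span_eq_iff[THEN iffD2])
    have "isotropic_stable W'"
      unfolding isotropic_stable_def
    proof (intro conjI ballI)
      show "vec.subspace W'" unfolding W'_def by (rule vec.subspace_span)
      fix a assume "a \<in> W'"
      then obtain c where a: "a - c *s x' \<in> W" using W' by blast
      have "app e a = app e (a - c *s x') + c *s app e x'" by (simp only: app_simps diff_add_cancel)
      also have "\<dots> \<in> W" by (intro vec.subspace_add vec.subspace_scale sub st a x')
      finally show "app e a \<in> W'" unfolding W'_def by (intro vec.span_base) simp
      fix b assume "b \<in> W'"
      then obtain d where b: "b - d *s x' \<in> W" using W' by blast
      have "form (a - c *s x') (b - d *s x') = 0" using iso a b by blast
      moreover have "form x' (b - d *s x') = 0" "form x' (a - c *s x') = 0" using orth a b by blast+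
      ultimately show "form a b = 0" using form_sym[of x' a] by simp
    qed
    moreover have "W0 \<subseteq> W'" "W \<subset> W'" using W x' vec.span_superset[of "insert x' W"] by (auto simp: W'_def)
    ultimately have "vec.dim W' \<le> vec.dim W" using max by blast
    moreover have "vec.dim W < vec.dim W'"
      using \<open>W \<subset> W'\<close> sub by (intro vec.dim_psubset) (simp add: vec.span_eq_iff[THEN iffD2] W'_def)
    ultimately show False by simp
  qed
  thus ?thesis using W by blast
qed

text \<open>The operator \<open>T\<close> has image \<open>W\<close>, and its kernel is the
  orthogonal complement, which is \<open>W\<close> again. Rank and nullity therefore give half of
  the full dimension.\<close>

lemma lagrangian_basis:
  assumes sub: "vec.subspace W" and iso: "\<And>x z. x \<in> W \<Longrightarrow> z \<in> W \<Longrightarrow> form x z = (0 :: 'k)"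
    and max: "\<And>x. (\<And>z. z \<in> W \<Longrightarrow> form x z = 0) \<Longrightarrow> x \<in> (W :: ('k^('n + 'n)) set)"
  shows "\<exists>w :: 'n \<Rightarrow> 'k^('n + 'n). inj w \<and> vec.independent (range w) \<and> W = vec.span (range w)"
proof -
  obtain B where B: "B \<subseteq> W" "vec.independent B" "W \<subseteq> vec.span B" "card B = vec.dim W" using vec.basis_exists by blast
  have fin: "finite B" using B(2) by (rule vec.finiteI_independent)
  have WB: "W = vec.span B" using B vec.span_minimal[OF B(1) sub] by blast
  define T where "T = (\<Sum>b\<in>B. rk b b)"
  have T: "app T x = (\<Sum>b\<in>B. form x b *s b)" for x by (simp add: T_def app_sum)
  have "Vector_Spaces.linear (*s) (*s) (app T)"
    by (rule linear_vecI[OF vec.vector_space_axioms]) simp_all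
  from vec.dim_image_kernel[OF this vec.subspace_UNIV]
  have d: "CARD('n + 'n) = vec.dim {x. app T x = 0} + vec.dim (range (app T))" by (simp add: card_cart_basis)
  have "{x. app T x = 0} = W"
  proof
    show "W \<subseteq> {x. app T x = 0}" using iso B(1) by (auto simp: T intro!: sum.neutral)
    show "{x. app T x = 0} \<subseteq> W"
    proof
      fix x assume "x \<in> {x. app T x = 0}"
      hence "(\<Sum>b\<in>B. form x b *s b) = 0" by (simp add: T)
      hence 0: "form x b = 0" if "b \<in> B" for b
        using vec.independentD[OF B(2) fin, of "\<lambda>b. form x b"] that by blast
      show "x \<in> W"
      proof (rule max)
        fix z assume "z \<in> W"
        hence "z \<in> vec.span B" using WB by simp
        thus "form x z = 0"
          by (induction rule: vec.span_induct_alt) (simp_all add: 0)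
      qed
    qed
  qed
  moreover have "range (app T) = W"
  proof
    show "range (app T) \<subseteq> W" using B(1) by (auto simp: T intro!: vec.subspace_sum[OF sub] vec.subspace_scale[OF sub])
    show "W \<subseteq> range (app T)"
    proof -
      have "b \<in> range (app T)" if b: "b \<in> B" for b
      proof -
        obtain f where f: "Vector_Spaces.linear (*s) (*) f" "\<forall>c\<in>B. f c = (if c = b then 1 else 0 :: 'k)"
          using vec_field.linear_independent_extend[OF B(2), of "\<lambda>c. if c = b then 1 else 0"] by blast
        obtain x where x: "\<And>v. f v = form v x" using form_riesz[OF f(1)] by blast
        have "app T x = (\<Sum>c\<in>B. if c = b then b else 0)"
          unfolding T using f(2) by (intro sum.cong refl) (auto simp: form_sym[of x] x[symmetric])
        also have "\<dots> = b" using b fin by simp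
        finally show ?thesis by (metis rangeI)
      qed
      hence "vec.span B \<subseteq> range (app T)" by (intro vec.span_minimal subspace_range_app) blast
      thus ?thesis using WB by simp
    qed
  qed
  ultimately have "card B = CARD('n)" using d B(4) by simp
  then obtain w :: "'n \<Rightarrow> 'k^('n + 'n)" where "bij_betw w UNIV B"
    using fin finite_same_card_bij[of "UNIV :: 'n set" B] by auto
  thus ?thesis using B(2) WB by (intro exI[of _ w]) (auto simp: bij_betw_def)
qed

text \<open>The Lagrangian is chosen to contain two independent kernel vectors, so that
  \<open>e\<close> has corank at least two on it and \<open>symmetric_solutions\<close> applies.
  Since \<open>W\<close> is isotropic, \<open>X s\<close> squares to zero; with \<open>s\<close>
  symmetric it is self-adjoint, and \<open>1 + X s\<close> is an isometry.\<close>

lemma nilpotent_fat: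
  assumes e0: "e \<noteq> 0" and ker: "vec.dim {x. app e x = 0} \<ge> 2"
  shows "\<exists>\<kappa>. \<forall>c. \<exists>A. star A * A = 1 \<and> A * e = e * A \<and> (\<forall>i<CARD('n) + 1. pair_mat (\<kappa> i) (mat_of A) = (c i :: 'k))"
proof -
  have ex: "\<exists>r. e ^ r = 0" by (rule nil)
  define r where "r = (LEAST r. e ^ r = 0)"
  have r: "e ^ r = 0" unfolding r_def by (rule LeastI_ex[OF ex])
  have "r \<noteq> 0" using r by (cases r) simp_all
  moreover have "r \<noteq> 1" using r e0 by (intro notI) simp
  ultimately obtain s where s: "r = Suc (Suc s)" by (metis One_nat_def not0_implies_Suc)
  have "e ^ Suc s \<noteq> 0" using not_less_Least[of "Suc s" "\<lambda>r. e ^ r = 0"] by (simp add: r_def[symmetric] s)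
  then obtain z where z: "app (e ^ Suc s) z \<noteq> 0" by (metis app_simps(4) sqm_eqI)
  \<comment> \<open>\<open>w1\<close> lies in the kernel and in the image of \<open>e\<close>. The
    latter makes it orthogonal to the kernel, so it spans an isotropic subspace with any further
    kernel vector.\<close>
  define w1 where "w1 = app (e ^ Suc s) z"
  have w1: "w1 \<noteq> 0" "app e w1 = 0" using z arg_cong[OF r, of "\<lambda>A. app A z"] by (simp_all add: w1_def s)
  have w1_orth: "form w1 x = 0" if "app e x = 0" for x
    using that by (simp add: w1_def form_e)
  obtain w2 where w2: "app e w2 = 0" "w2 \<notin> vec.span {w1}"
  proof -
    have "\<not> {x. app e x = 0} \<subseteq> vec.span {w1}"
    proof
      assume "{x. app e x = 0} \<subseteq> vec.span {w1}"
      from vec.dim_le_card[OF this] ker show False by simp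
    qed
    thus thesis using that by blast
  qed
  have ind: "vec.independent {w2, w1}" using w1(1) w2(2) by (intro vec.independent_insertI) (simp_all add: vec.independent_empty)
  define W0 where "W0 = vec.span {w2, w1}"
  have W0: "\<exists>a b. x = a *s w2 + b *s w1" if xW: "x \<in> W0" for x
  proof -
    obtain a where "x - a *s w2 \<in> vec.span {w1}"
      using iffD1[OF vec.span_breakdown_eq xW[unfolded W0_def]] by blast
    then obtain b where "x - a *s w2 = b *s w1" by (auto simp: vec.span_singleton)
    hence "x = a *s w2 + b *s w1" by (simp only: diff_eq_eq add.commute)
    thus ?thesis by blast
  qed
  have "isotropic_stable W0" unfolding isotropic_stable_def
  proof (intro conjI ballI)
    show sub: "vec.subspace W0" unfolding W0_def by (rule vec.subspace_span)
    fix x assume "x \<in> W0"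
    then obtain a b where x: "x = a *s w2 + b *s w1" using W0 by blast
    have "app e x = 0" by (simp add: x w1 w2)
    thus "app e x \<in> W0" using vec.subspace_0[OF sub] by simp
    fix x' assume "x' \<in> W0"
    then obtain a' b' where x': "x' = a' *s w2 + b' *s w1" using W0 by blast
    have "form w1 w2 = 0" using w1_orth w2(1) by blast
    thus "form x x' = 0" by (simp add: x x' form_sym[of w2 w1])
  qed
  from lagrangian_exists[OF this] obtain W where W: "W0 \<subseteq> W" "isotropic_stable W" "\<And>x. (\<And>z. z \<in> W \<Longrightarrow> form x z = 0) \<Longrightarrow> x \<in> W"
    by metis
  have sub: "vec.subspace W" and st: "\<And>x. x \<in> W \<Longrightarrow> app e x \<in> W" and iso: "\<And>x z. x \<in> W \<Longrightarrow> z \<in> W \<Longrightarrow> form x z = 0"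
    using W(2) unfolding isotropic_stable_def by auto
  from lagrangian_basis[OF sub iso W(3)] obtain w :: "'n \<Rightarrow> 'k^('n + 'n)"
    where w: "inj w" "vec.independent (range w)" "W = vec.span (range w)" by blast
  obtain x where x: "\<And>i j. form (w i) (x j) = (if i = j then 1 else 0)" using form_dual_basis[OF w(1,2)] by blast
  have expand: "v = (\<Sum>k\<in>UNIV. form v (x k) *s w k)" if "v \<in> W" for v
  proof -
    have "v \<in> vec.span (range w)" using that w(3) by simp
    thus ?thesis
    proof (induction rule: vec.span_induct_alt)
      case base show ?case by simp
    next
      case (step c a y)
      then obtain i where a: "a = w i" by blast
      have "(\<Sum>k\<in>UNIV. form a (x k) *s w k) = (\<Sum>k\<in>UNIV. if k = i then w i else 0)"
        unfolding a x by (intro sum.cong) auto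
      hence a': "a = (\<Sum>k\<in>UNIV. form a (x k) *s w k)" by (simp add: a)
      have "c *s a + y = c *s (\<Sum>k\<in>UNIV. form a (x k) *s w k) + (\<Sum>k\<in>UNIV. form y (x k) *s w k)"
        by (rule arg_cong2[where f = "(+)"], rule arg_cong[where f = "(*s) c"], rule a', rule step.IH)
      also have "\<dots> = (\<Sum>k\<in>UNIV. form (c *s a + y) (x k) *s w k)"
        by (simp add: vec.scale_sum_right sum.distrib[symmetric] vec.scale_left_distrib)
      finally show ?case .
    qed
  qed
  have wW: "w i \<in> W" for i by (simp add: w(3) vec.span_base)
  define n where "n = (\<chi> k i. form (app e (w i)) (x k))"
  have en: "app e (w i) = (\<Sum>k\<in>UNIV. n $ k $ i *s w k)" for i
    using expand[OF st[OF wW[of i]]] by (simp add: n_def)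
  define \<phi> where "\<phi> c = (\<Sum>i\<in>UNIV. c $ i *s w i)" for c :: "'k^'n"
  have \<phi>: "Vector_Spaces.linear (*s) (*s) \<phi>"
    by (rule linear_vecI[OF vec.vector_space_axioms])
      (simp_all add: \<phi>_def vec.scale_left_distrib sum.distrib vec.scale_sum_right)
  have "{w2, w1} \<subseteq> \<phi> ` {c. n *v c = 0}"
  proof -
    have "v \<in> \<phi> ` {c. n *v c = 0}" if "v \<in> W" "app e v = 0" for v
    proof (rule image_eqI)
      show v: "v = \<phi> (\<chi> k. form v (x k))" using expand[OF that(1)] by (simp add: \<phi>_def)
      have "(n *v (\<chi> k. form v (x k))) $ j = 0" for j
      proof -
        have "0 = form (app e (\<phi> (\<chi> k. form v (x k)))) (x j)" using that(2) v by simp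
        also have "\<dots> = (\<Sum>i\<in>UNIV. form v (x i) * form (app e (w i)) (x j))"
          by (simp add: \<phi>_def app_sum_right form_sum)
        finally show ?thesis by (simp add: matrix_vector_mult_def n_def mult.commute)
      qed
      thus "(\<chi> k. form v (x k)) \<in> {c. n *v c = 0}" by (simp add: vec_eq_iff)
    qed
    moreover have "w1 \<in> W" "w2 \<in> W" using W(1) vec.span_base[of _ "{w2, w1}"] by (auto simp: W0_def)
    ultimately show ?thesis using w1 w2 by blast
  qed
  from vec.independent_card_le_dim[OF this ind] have "2 \<le> vec.dim (\<phi> ` {c. n *v c = 0})"
    using w2(2) vec.span_base[of w1 "{w1}"] by (auto simp: card_insert_if split: if_splits)
  also have "\<dots> \<le> vec.dim {c. n *v c = 0}" by (rule vec.dim_image_le[OF \<phi>])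
  finally have kn: "vec.dim {c. n *v c = 0} \<ge> 2" .
  define L where "L = {s. transpose s = s \<and> n ** s + s ** transpose n = 0}"
  note sol = symmetric_solutions[OF two kn, folded L_def]
  obtain \<kappa>0 where \<kappa>0: "\<And>c :: nat \<Rightarrow> 'k. \<exists>s\<in>L. \<forall>i<CARD('n) + 1. pair_mat (\<kappa>0 i) s = c i"
    using subspace_coordinates[OF sol] by blast
  define X where "X s = (\<Sum>i\<in>UNIV. \<Sum>j\<in>UNIV. cst (s $ i $ j) * rk (w i) (w j))" for s :: "'k^'n^'n"
  have X_app: "app (X s) v = (\<Sum>i\<in>UNIV. \<Sum>j\<in>UNIV. (s $ i $ j * form v (w j)) *s w i)" for s v
    by (simp add: X_def app_sum mult.commute)
  have X_add: "X (s + t) = X s + X t" for s t by (simp add: X_def distrib_right sum.distrib)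
  have X_0: "X 0 = 0" by (simp add: X_def)
  have star_X: "star (X s) = X (transpose s)" for s
  proof -
    have "star (X s) = (\<Sum>i\<in>UNIV. \<Sum>j\<in>UNIV. cst (s $ i $ j) * rk (w j) (w i))"
      by (simp add: X_def star_sum cst_commute)
    also have "\<dots> = X (transpose s)" unfolding X_def by (subst sum.swap) (simp add: transpose_def)
    finally show ?thesis .
  qed
  have XX: "X s * X t = 0" for s t
  proof (rule sqm_eqI)
    fix v
    have "form (app (X t) v) (w j) = 0" for j by (simp add: X_def app_sum form_sum iso[OF wW wW])
    thus "app (X s * X t) v = app 0 v" by (simp add: X_def[of s] app_sum)
  qed
  have eX: "e * X s = X (n ** s)" for s
  proof (rule sqm_eqI)
    fix v
    have "app (e * X s) v = (\<Sum>i\<in>UNIV. \<Sum>j\<in>UNIV. \<Sum>k\<in>UNIV. (n $ k $ i * s $ i $ j * form v (w j)) *s w k)"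
      by (simp add: X_def app_sum app_sum_right en vec.scale_sum_right ac_simps)
    also have "\<dots> = (\<Sum>i\<in>UNIV. \<Sum>k\<in>UNIV. \<Sum>j\<in>UNIV. (n $ k $ i * s $ i $ j * form v (w j)) *s w k)"
      by (rule sum.cong[OF refl], rule sum.swap)
    also have "\<dots> = (\<Sum>k\<in>UNIV. \<Sum>i\<in>UNIV. \<Sum>j\<in>UNIV. (n $ k $ i * s $ i $ j * form v (w j)) *s w k)"
      by (rule sum.swap)
    also have "\<dots> = (\<Sum>k\<in>UNIV. \<Sum>j\<in>UNIV. \<Sum>i\<in>UNIV. (n $ k $ i * s $ i $ j * form v (w j)) *s w k)"
      by (rule sum.cong[OF refl], rule sum.swap)
    also have "\<dots> = app (X (n ** s)) v"
      by (simp add: X_app matrix_matrix_mult_def sum_distrib_right vec.scale_sum_left)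
    finally show "app (e * X s) v = app (X (n ** s)) v" .
  qed
  have Xe: "X s * e = X (s ** transpose n)" for s
  proof -
    have "star (X s * e) = e * X (transpose s)" by (simp add: star_X self_adjoint)
    also have "\<dots> = X (transpose (s ** transpose n))" by (simp add: eX matrix_transpose_mul)
    also have "\<dots> = star (X (s ** transpose n))" by (simp add: star_X)
    finally have "star (star (X s * e)) = star (star (X (s ** transpose n)))" by metis
    thus ?thesis by (simp only: star_star)
  qed
  have Xx: "form (app (X s) (x b)) (x a) = s $ a $ b" for s a b
  proof -
    have "form (app (X s) (x b)) (x a) = (\<Sum>i\<in>UNIV. \<Sum>j\<in>UNIV. s $ i $ j * form (x b) (w j) * form (w i) (x a))"
      by (simp add: X_app form_sum mult.assoc)
    also have "\<dots> = (\<Sum>i\<in>UNIV. \<Sum>j\<in>UNIV. if j = b then (if i = a then s $ i $ j else 0) else 0)"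
      by (intro sum.cong refl) (simp add: form_sym[of "x b"] x)
    finally show ?thesis by simp
  qed
  \<comment> \<open>\<open>F i\<close> recovers \<open>s\<close> from \<open>X s\<close> through the
    dual vectors \<open>x\<close>, and so turns the coordinates on \<open>L\<close> into linear
    functionals on all matrices.\<close>
  define F where "F i A = pair_mat (\<kappa>0 i) (\<chi> a b. form (app (sqm_of A) (x b)) (x a))" for i and A :: "'k^('n + 'n)^('n + 'n)"
  have "Vector_Spaces.linear mat_scale (*) (F i)" for i
  proof (rule linear_matI)
    show "vector_space ((*) :: 'k \<Rightarrow> 'k \<Rightarrow> 'k)" by (rule vector_space_over_itself.vector_space_axioms)
    fix A B :: "'k^('n + 'n)^('n + 'n)" and c
    have "sqm_of (A + B) = sqm_of A + sqm_of B" "sqm_of (mat_scale c A) = cst c * sqm_of A"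
      by (simp_all add: sqm_eq_iff mat_of_simps mat_scale_def matrix_matrix_mult_def mat_def vec_eq_iff
        if_distrib[of "\<lambda>x. x * _"] cong: if_cong)
    hence "(\<chi> a b. form (app (sqm_of (A + B)) (x b)) (x a)) = (\<chi> a b. form (app (sqm_of A) (x b)) (x a)) + (\<chi> a b. form (app (sqm_of B) (x b)) (x a))"
      "(\<chi> a b. form (app (sqm_of (mat_scale c A)) (x b)) (x a)) = mat_scale c (\<chi> a b. form (app (sqm_of A) (x b)) (x a))"
      by (simp_all add: vec_eq_iff mat_scale_def)
    thus "F i (A + B) = F i A + F i B" "F i (mat_scale c A) = c * F i A" by (simp_all only: F_def pair_mat_simps)
  qed
  note F = mat_functional[OF this]
  show ?thesis
  proof (rule exI[of _ "\<lambda>i. \<chi> a b. F i (mat_unit a b)"], rule allI)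
    fix c :: "nat \<Rightarrow> 'k"
    \<comment> \<open>The identity in \<open>1 + X s\<close> contributes \<open>F i (mat 1)\<close>,
      which is therefore added to the target value in advance.\<close>
    obtain s where s: "s \<in> L" "\<And>i. i < CARD('n) + 1 \<Longrightarrow> pair_mat (\<kappa>0 i) s = c i + F i (mat 1)"
      using \<kappa>0[of "\<lambda>i. c i + F i (mat 1)"] by blast
    have sX: "star (X s) = X s" using s(1) by (simp add: star_X L_def)
    have "e * X s + X s * e = 0" using s(1) by (simp only: eX Xe X_add[symmetric]) (simp add: L_def X_0)
    hence "e * X s = X s * e" by simp
    hence 2: "(1 + X s) * e = e * (1 + X s)" by (simp add: distrib_left distrib_right)
    have 1: "star (1 + X s) * (1 + X s) = 1" by (simp add: sX distrib_left distrib_right XX)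
    have 3: "pair_mat (\<chi> a b. F i (mat_unit a b)) (mat_of (1 + X s)) = c i" if "i < CARD('n) + 1" for i
    proof -
      have "pair_mat (\<chi> a b. F i (mat_unit a b)) (mat_of (1 + X s)) = F i (mat_of (1 + X s))" by (rule F[symmetric])
      also have "\<dots> = F i (mat 1) + F i (mat_of (X s))"
        using \<open>\<And>i. Vector_Spaces.linear mat_scale (*) (F i)\<close>[of i] by (simp add: mat_of_simps Vector_Spaces.linear_iff)
      also have "F i (mat_of (X s)) = pair_mat (\<kappa>0 i) s" by (simp add: F_def mat_of_inverse Xx)
      finally show ?thesis using s(2)[OF that] two by simp
    qed
    show "\<exists>A. star A * A = 1 \<and> A * e = e * A \<and> (\<forall>i<CARD('n) + 1. pair_mat (\<chi> a b. F i (mat_unit a b)) (mat_of A) = c i)"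
      using 1 2 3 by blast
  qed
qed

text \<open>From \<open>e ^ i\<close> to \<open>e ^ Suc i\<close> the kernel grows by at most the
  dimension of the kernel of \<open>e\<close>, so the whole space is not exhausted before the last
  possible power.\<close>

lemma cyclic_vector:
  assumes ker: "vec.dim {x. app e x = 0} \<le> 1"
  shows "\<exists>v. app (e ^ (2 * CARD('n) - 1)) v \<noteq> 0"
proof (rule ccontr)
  assume neg: "\<not> ?thesis"
  have lin: "Vector_Spaces.linear (*s) (*s) (app A)" for A :: "('k, 'n + 'n) sqm"
    by (rule linear_vecI[OF vec.vector_space_axioms]) simp_all
  have "vec.dim {x. app (e ^ i) x = 0} \<le> i" for i
  proof (induction i)
    case (Suc i)
    have sub: "vec.subspace {x. app (e ^ Suc i) x = 0}" by (rule vec.subspaceI) simp_all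
    have "vec.dim {x. app (e ^ Suc i) x = 0} = vec.dim {x \<in> {x. app (e ^ Suc i) x = 0}. app (e ^ i) x = 0}
       + vec.dim (app (e ^ i) ` {x. app (e ^ Suc i) x = 0})"
      by (rule vec.dim_image_kernel[OF lin sub])
    also have "{x \<in> {x. app (e ^ Suc i) x = 0}. app (e ^ i) x = 0} = {x. app (e ^ i) x = 0}" by auto
    also have "vec.dim (app (e ^ i) ` {x. app (e ^ Suc i) x = 0}) \<le> vec.dim {x. app e x = 0}"
      by (rule vec.dim_subset) auto
    finally show ?case using Suc.IH ker by simp
  qed simp
  from this[of "2 * CARD('n) - 1"] have "vec.dim (UNIV :: ('k^('n + 'n)) set) \<le> 2 * CARD('n) - 1" using neg by simp
  moreover have "vec.dim (UNIV :: ('k^('n + 'n)) set) = 2 * CARD('n)" by (simp only: vec_dim_card) simp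
  ultimately show False using zero_less_card_finite[where 'a = 'n] by linarith
qed

end

subsection \<open>Centralizers of cyclic elements\<close>

definition sq_subspace :: "('k::field, 'i::finite) sqm set \<Rightarrow> bool" where
  "sq_subspace S \<longleftrightarrow> 0 \<in> S \<and> (\<forall>A\<in>S. \<forall>B\<in>S. A + B \<in> S) \<and> (\<forall>c. \<forall>A\<in>S. cst c * A \<in> S)"

lemma mat_of_cst_mult: "mat_of (cst c * A) = mat_scale c (mat_of A)"
  by (simp add: mat_of_simps mat_scale_def matrix_matrix_mult_def mat_def vec_eq_iff
        if_distrib[of "\<lambda>x. x * _"] cong: if_cong)

lemma sqm_of_mat_of [simp]: "sqm_of (mat_of A) = A" by (simp add: mat_of_inverse)

lemma subspace_mat_of: "sq_subspace S \<Longrightarrow> mat_space.subspace (mat_of ` S)"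
proof (rule mat_space.subspaceI)
  assume S: "sq_subspace S"
  show "0 \<in> mat_of ` S" using S unfolding sq_subspace_def by (metis mat_of_simps(1) imageI)
  fix A B :: "'a^'b^'b" and c assume "A \<in> mat_of ` S"
  then obtain A' where A: "A' \<in> S" "A = mat_of A'" by blast
  thus "mat_scale c A \<in> mat_of ` S" using S unfolding sq_subspace_def by (metis mat_of_cst_mult imageI)
  assume "B \<in> mat_of ` S"
  then obtain B' where "B' \<in> S" "B = mat_of B'" by blast
  thus "A + B \<in> mat_of ` S" using A S unfolding sq_subspace_def by (metis mat_of_simps(3) imageI)
qed

text \<open>For a cyclic module the elements of the centralizer are determined by their value at the
  generator; their dimension is thus counted inside the module.\<close>

lemma dim_eval:
  assumes S: "sq_subspace S" and inj: "\<And>A. A \<in> S \<Longrightarrow> app A v = 0 \<Longrightarrow> A = 0"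
  shows "mat_space.dim (mat_of ` S) = vec.dim ((\<lambda>A. app A v) ` S)"
proof -
  have lin: "Vector_Spaces.linear mat_scale (*s) (\<lambda>A. A *v v)"
    by (rule linear_matI[OF vec.vector_space_axioms])
      (simp_all add: matrix_vector_mult_def mat_scale_def vec_eq_iff sum.distrib algebra_simps sum_distrib_left)
  have "{A \<in> mat_of ` S. A *v v = 0} = {0}"
  proof -
    have "0 \<in> S" using S by (simp add: sq_subspace_def)
    thus ?thesis using inj by (auto simp: app_def mat_of_simps image_iff sqm_eq_iff) (metis matrix_vector_mult_0 mat_of_simps(1))+
  qed
  hence "mat_space.dim (mat_of ` S) = vec.dim ((\<lambda>A. A *v v) ` mat_of ` S)"
    using mat_vec.dim_image_kernel[OF lin subspace_mat_of[OF S]] by simp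
  also have "(\<lambda>A. A *v v) ` mat_of ` S = (\<lambda>A. app A v) ` S" by (simp add: image_image app_def)
  finally show ?thesis .
qed

lemma vec_independent_indexedD:
  assumes "vec.independent (h ` D)" "inj_on h D" "finite D" "(\<Sum>j\<in>D. c j *s h j) = 0" "j \<in> D"
  shows "c j = 0"
proof -
  have "(\<Sum>x\<in>h ` D. c (the_inv_into D h x) *s x) = (\<Sum>j\<in>D. c (the_inv_into D h (h j)) *s h j)"
    by (simp add: sum.reindex[OF assms(2)])
  also have "\<dots> = (\<Sum>j\<in>D. c j *s h j)" by (rule sum.cong[OF refl]) (simp add: the_inv_into_f_f[OF assms(2)])
  finally have "c (the_inv_into D h (h j)) = 0"
    by (intro vec.independentD[OF assms(1), of "h ` D" "\<lambda>x. c (the_inv_into D h x)"]) (use assms(3-5) in auto)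
  thus ?thesis by (simp add: the_inv_into_f_f[OF assms(2,5)])
qed

text \<open>\<open>A ^ (n - 1 - j)\<close> kills all later vectors of the chain but not the one at
  \<open>j\<close>, which is therefore outside their span.\<close>

lemma nilpotent_chain:
  fixes A :: "('k::field, 'i::finite) sqm"
  assumes "app (A ^ n) v = 0" "app (A ^ (n - 1)) v \<noteq> 0" "j \<le> n"
  shows "vec.independent ((\<lambda>i. app (A ^ i) v) ` {j..<n}) \<and> card ((\<lambda>i. app (A ^ i) v) ` {j..<n}) = n - j"
  using assms(3)
proof (induction rule: inc_induct)
  case base show ?case by (simp add: vec.independent_empty)
next
  case (step j)
  let ?B = "(\<lambda>i. app (A ^ i) v) ` {Suc j..<n}"
  have "{j..<n} = insert j {Suc j..<n}" using step.hyps by auto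
  hence B: "(\<lambda>i. app (A ^ i) v) ` {j..<n} = insert (app (A ^ j) v) ?B" by simp
  have ker: "app (A ^ (n - 1 - j)) x = 0" if "x \<in> vec.span ?B" for x
    using that
  proof (induction rule: vec.span_induct_alt)
    case (step c b z)
    then obtain i where i: "b = app (A ^ i) v" "Suc j \<le> i" "i < n" by auto
    have "n - 1 - j + i = (i - Suc j) + n" using i by simp
    hence "A ^ (n - 1 - j) * A ^ i = A ^ (i - Suc j) * A ^ n" by (simp flip: power_add)
    from arg_cong[OF this, of "\<lambda>B. app B v"] have "app (A ^ (n - 1 - j)) b = 0" by (simp add: i assms(1))
    thus ?case using step.IH by simp
  qed simp
  have "A ^ (n - 1 - j) * A ^ j = A ^ (n - 1)" using step.hyps by (simp flip: power_add)
  from arg_cong[OF this, of "\<lambda>B. app B v"] have "app (A ^ (n - 1 - j)) (app (A ^ j) v) \<noteq> 0" using assms(2) by simp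
  hence notin: "app (A ^ j) v \<notin> vec.span ?B" using ker by blast
  hence 1: "app (A ^ j) v \<notin> ?B" by (rule contrapos_nn) (rule vec.span_base)
  have "card ?B = n - Suc j" "vec.independent ?B" "finite ?B" using step.IH by simp_all
  hence "vec.independent (insert (app (A ^ j) v) ?B)" "card (insert (app (A ^ j) v) ?B) = Suc (n - Suc j)"
    using vec.independent_insertI[OF notin] card_insert_disjoint[OF _ 1] by auto
  moreover have "Suc (n - Suc j) = n - j" using step.hyps by simp
  ultimately show ?case unfolding B by simp
qed

lemma nilpotent_cyclic_span:
  fixes A :: "('k::field, 'i::finite) sqm"
  assumes "app (A ^ CARD('i)) v = 0" "app (A ^ (CARD('i) - 1)) v \<noteq> 0"
  shows "\<exists>p. x = app (ev A p) v"
proof -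
  let ?B = "(\<lambda>i. app (A ^ i) v) ` {0..<CARD('i)}"
  from nilpotent_chain[OF assms, of 0] have B: "vec.independent ?B" "card ?B = CARD('i)" by simp_all
  have "UNIV \<subseteq> vec.span ?B"
    by (rule vec.card_ge_dim_independent) (use B vec_dim_card[where 'a = 'k and 'n = 'i] in auto)
  hence "x \<in> vec.span ?B" by blast
  thus ?thesis
  proof (induction rule: vec.span_induct_alt)
    case base show ?case by (rule exI[of _ 0]) simp
  next
    case (step c b z)
    then obtain i p where "b = app (A ^ i) v" "z = app (ev A p) v" by auto
    thus ?case by (intro exI[of _ "monom c i + p"]) (simp add: ev_monom)
  qed
qed

lemma poly_sum_monom_induct:
  assumes "P 0" "\<And>p q. P p \<Longrightarrow> P q \<Longrightarrow> P (p + q)" "\<And>c i. P (monom c i)"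
  shows "P (p :: 'a::comm_monoid_add poly)"
proof -
  have "P (\<Sum>i\<in>S. monom (coeff p i) i)" for S :: "nat set"
    by (induction S rule: infinite_finite_induct) (simp_all add: assms)
  from this[of "{..degree p}"] show ?thesis by (simp add: poly_as_sum_of_monoms)
qed

text \<open>The operator \<open>d/dA\<close> on the cyclic module \<open>K[A] v\<close>; it is well defined since the
  derivative of \<open>A ^ (2 n)\<close> vanishes in characteristic two.\<close>

lemma derivation_exists:
  fixes A :: "('k::field, 'i::finite) sqm"
  assumes two: "(2 :: 'k) = 0" and n: "CARD('i) = 2 * n"
    and A: "app (A ^ CARD('i)) v = 0" "app (A ^ (CARD('i) - 1)) v \<noteq> 0"
  shows "\<exists>T. \<forall>p. app T (app (ev A p) v) = app (ev A (pderiv p)) v"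
proof -
  let ?B = "(\<lambda>i. app (A ^ i) v) ` {0..<CARD('i)}"
  from nilpotent_chain[OF A, of 0] have B: "vec.independent ?B" "card ?B = CARD('i)" by simp_all
  have inj: "inj_on (\<lambda>i. app (A ^ i) v) {0..<CARD('i)}" using B(2) by (simp add: eq_card_imp_inj_on)
  define g where "g b = (let j = the_inv_into {0..<CARD('i)} (\<lambda>i. app (A ^ i) v) b in of_nat j *s app (A ^ (j - 1)) v)" for b
  obtain f where f: "Vector_Spaces.linear (*s) (*s) f" "\<forall>b\<in>?B. f b = g b"
    using vec.linear_independent_extend[OF B(1), of g] by blast
  define T where "T = sqm_of (matrix f)"
  have T: "app T x = f x" for x unfolding T_def app_def by (simp add: matrix_works[OF f(1)])
  have fj: "app T (app (A ^ j) v) = of_nat j *s app (A ^ (j - 1)) v" for j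
  proof (cases "j < CARD('i)")
    case True
    thus ?thesis using f(2) by (simp add: T g_def the_inv_into_f_f[OF inj])
  next
    case False
    hence "A ^ j = A ^ (j - CARD('i)) * A ^ CARD('i)" by (simp flip: power_add)
    hence l: "app (A ^ j) v = 0" using A(1) by simp
    show ?thesis
    proof (cases "j = CARD('i)")
      case True
      \<comment> \<open>The critical exponent: \<open>A ^ j\<close> kills \<open>v\<close> but
        \<open>A ^ (j - 1)\<close> does not, so the factor \<open>of_nat j\<close> has to vanish, as
        it does because the dimension is even.\<close>
      hence "of_nat j = (0 :: 'k)" using two by (simp add: n)
      thus ?thesis by (simp add: l)
    next
      case False
      hence "A ^ (j - 1) = A ^ (j - 1 - CARD('i)) * A ^ CARD('i)" using \<open>\<not> j < CARD('i)\<close> by (simp flip: power_add)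
      thus ?thesis using A(1) by (simp add: l)
    qed
  qed
  have "app T (app (ev A p) v) = app (ev A (pderiv p)) v" for p
  proof (induction p rule: poly_sum_monom_induct)
    case (3 c i)
    show ?case by (simp add: ev_monom fj pderiv_monom vector_smult_assoc mult.commute)
  qed (simp_all add: pderiv_add)
  thus ?thesis by blast
qed

section \<open>Fixed points of a cyclic unipotent element\<close>

context unip
begin

definition cyclic :: "'k^('n + 'n) \<Rightarrow> nat \<Rightarrow> bool" where
  "cyclic v m \<longleftrightarrow> m \<ge> 1 \<and> y ^ m = 0 \<and> Q (m - 1) v \<noteq> 0 \<and> (\<forall>x. \<exists>A\<in>alg. x = app A v)"

context
  fixes v m assumes cyc: "cyclic v m"
begin

lemma cycD: "m \<ge> 1" "y ^ m = 0" "Q (m - 1) v \<noteq> 0" "\<exists>A\<in>alg. x = app A v"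
  using cyc by (auto simp: cyclic_def)

text \<open>\<open>X\<close> agrees at the generator \<open>v\<close> with some element of
  \<open>alg\<close>, and both commute with \<open>alg\<close>, so they agree everywhere.\<close>

lemma commutant: assumes "X * u = u * X" shows "X \<in> alg"
proof -
  obtain A where A: "A \<in> alg" "app X v = app A v" using cycD(4)[of "app X v"] by metis
  have "X = A"
  proof (rule sqm_eqI)
    fix x
    obtain B where B: "B \<in> alg" "x = app B v" using cycD(4) by blast
    have "app X x = app (B * X) v" using alg_commute[OF B(1) assms] by (simp add: B(2))
    also have "\<dots> = app (B * A) v" using A(2) by simp
    also have "B * A = A * B" using alg_commute_alg B(1) A(1) by blast
    finally show "app X x = app A x" by (simp add: B(2))
  qed
  thus ?thesis using A(1) by simp
qed

lemma alg_eval_inj: "A \<in> alg \<Longrightarrow> app A v = 0 \<Longrightarrow> A = 0"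
proof (rule sqm_eqI)
  fix x assume A: "A \<in> alg" "app A v = 0"
  obtain B where B: "B \<in> alg" "x = app B v" using cycD(4) by blast
  from arg_cong[OF alg_commute_alg[OF A(1) B(1)], of "\<lambda>C. app C v"] show "app A x = app 0 x" by (simp add: A(2) B(2))
qed

lemma ev_trunc: "ev y p = (\<Sum>j<m. cst (coeff p j) * y ^ j)"
proof -
  have "ev y p = (\<Sum>j\<le>degree p + m. cst (coeff p j) * y ^ j)" by (rule ev_altdef) simp
  also have "\<dots> = (\<Sum>j<m. cst (coeff p j) * y ^ j)"
  proof (rule sum.mono_neutral_right)
    show "\<forall>i\<in>{..degree p + m} - {..<m}. cst (coeff p i) * y ^ i = 0"
    proof
      fix i assume "i \<in> {..degree p + m} - {..<m}"
      hence "y ^ i = y ^ (i - m) * y ^ m" by (simp flip: power_add)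
      thus "cst (coeff p i) * y ^ i = 0" by (simp add: cycD)
    qed
  qed auto
  finally show ?thesis .
qed

definition cyc_basis :: "nat \<times> bool \<Rightarrow> 'k^('n + 'n)" where
  "cyc_basis = (\<lambda>(j, b). app (y ^ j) (if b then app N v else v))"

text \<open>These at most \<open>2 * m\<close> vectors span because \<open>y ^ m = 0\<close>, while
  the chain of \<open>N\<close> through \<open>v\<close> provides \<open>2 * m\<close> independent
  vectors. Comparison with the full dimension forces equality throughout.\<close>

lemma cyc_basis: "m = CARD('n)" "inj_on cyc_basis ({..<m} \<times> UNIV)" "vec.independent (cyc_basis ` ({..<m} \<times> UNIV))"
proof -
  let ?I = "{..<m} \<times> (UNIV :: bool set)"
  have "x \<in> vec.span (cyc_basis ` ?I)" for x
  proof -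
    obtain a b where x: "x = app (ev y a + ev y b * N) v" using cycD(4)[of x] by (auto simp: alg_def)
    have eq: "x = (\<Sum>j<m. coeff a j *s cyc_basis (j, False)) + (\<Sum>j<m. coeff b j *s cyc_basis (j, True))"
      by (simp add: x ev_trunc[of a] ev_trunc[of b] app_sum cyc_basis_def)
    show ?thesis unfolding eq
      by (intro vec.span_add vec.span_sum vec.span_scale; rule vec.span_base; auto)
  qed
  hence sp: "UNIV \<subseteq> vec.span (cyc_basis ` ?I)" by blast
  have fin: "finite ?I" by simp
  have U: "vec.dim (UNIV :: ('k^('n + 'n)) set) = 2 * CARD('n)" by (simp only: vec_dim_card) simp
  have "2 * CARD('n) \<le> card (cyc_basis ` ?I)" using vec.dim_le_card[OF sp] U fin by simp
  moreover have "card (cyc_basis ` ?I) \<le> 2 * m" using card_image_le[OF fin, of cyc_basis] by (simp add: card_cartesian_product)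
  moreover have "2 * m \<le> 2 * CARD('n)"
  proof -
    have ym: "app (y ^ m) v = 0" by (simp add: cycD)
    have "app (N ^ (2 * m - 1)) v \<noteq> 0" using cycD(3) N_top(2)[OF ym cycD(1)] by (auto simp: Q_def)
    from nilpotent_chain[OF N_top(1)[OF ym cycD(1)] this, of 0]
    have *: "vec.independent ((\<lambda>i. app (N ^ i) v) ` {0..<2 * m})" "card ((\<lambda>i. app (N ^ i) v) ` {0..<2 * m}) = 2 * m" by simp_all
    thus ?thesis using vec.independent_card_le_dim[OF subset_UNIV *(1)] U by simp
  qed
  ultimately have c: "card (cyc_basis ` ?I) = 2 * m" and m: "m = CARD('n)" by linarith+
  show "m = CARD('n)" by (rule m)
  show "inj_on cyc_basis ?I" using c fin by (intro eq_card_imp_inj_on) (simp_all add: card_cartesian_product)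
  show "vec.independent (cyc_basis ` ?I)"
    by (rule vec.card_le_dim_spanning[OF subset_UNIV sp]) (use fin U c m in auto)
qed

text \<open>For \<open>ev y a + ev y b * N\<close> self-adjointness means
  \<open>(N + M) * ev y b = y * ev y b = 0\<close>, and the annihilator of \<open>y\<close> in
  \<open>K[y]\<close> is the line of \<open>y ^ (m - 1)\<close>.\<close>

lemma alg_self_adjoint:
  assumes "X \<in> alg" "star X = X" shows "\<exists>a c. X = ev y a + cst c * y ^ (m - 1) * N"
proof -
  obtain a b where X: "X = ev y a + ev y b * N" using assms(1) by (auto simp: alg_def)
  have com: "ev y b * N = N * ev y b" using alg_commute_alg alg_basic by blast
  have "M * ev y b = ev y b * N" using assms(2) by (simp add: X star_ev)
  hence "M * ev y b + N * ev y b = 0" using com by simp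
  hence "(N + M) * ev y b = 0" by (simp only: distrib_right add.commute)
  hence "y * ev y b = 0" by (simp add: y_def[symmetric])
  hence "app (y * ev y b) v = 0" by simp
  hence "(\<Sum>j<m. coeff b j *s app (y ^ Suc j) v) = 0" by (simp add: ev_trunc[of b] app_sum app_sum_right)
  moreover have "(\<Sum>j<m. coeff b j *s app (y ^ Suc j) v) = (\<Sum>j<m - 1. coeff b j *s cyc_basis (Suc j, False))"
  proof -
    obtain k where k: "m = Suc k" using cycD(1) by (cases m) auto
    thus ?thesis using cycD(2) by (simp add: cyc_basis_def power_Suc[symmetric] del: power_Suc app_simps(7))
  qed
  ultimately have s: "(\<Sum>j<m - 1. coeff b j *s cyc_basis (Suc j, False)) = 0" by simp
  have z: "coeff b j = 0" if "j < m - 1" for j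
  proof -
    let ?J = "(\<lambda>j. (Suc j, False)) ` {..<m - 1}"
    have J: "?J \<subseteq> {..<m} \<times> UNIV" using cycD(1) by auto
    have "vec.independent (cyc_basis ` ?J)" using cyc_basis(3) image_mono[OF J] by (rule vec.independent_mono)
    hence "vec.independent ((\<lambda>j. cyc_basis (Suc j, False)) ` {..<m - 1})" by (simp add: image_image)
    moreover have "inj_on (\<lambda>j. cyc_basis (Suc j, False)) {..<m - 1}"
    proof (rule inj_onI)
      fix i j assume "i \<in> {..<m - 1}" "j \<in> {..<m - 1}" "cyc_basis (Suc i, False) = cyc_basis (Suc j, False)"
      from inj_onD[OF cyc_basis(2) this(3)] this(1,2) show "i = j" by auto
    qed
    ultimately show ?thesis by (rule vec_independent_indexedD[OF _ _ finite_lessThan s]) (use that in auto)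
  qed
  have "ev y b = cst (coeff b (m - 1)) * y ^ (m - 1)"
  proof -
    obtain k where k: "m = Suc k" using cycD(1) by (cases m) auto
    show ?thesis unfolding ev_trunc using z by (simp add: k)
  qed
  thus ?thesis using X by (metis)
qed

lemma dim_centralizer_unipotent:
  "mat_space.dim (mat_of ` {X. X * u = u * X \<and> star X = X}) = CARD('n) + 1"
proof -
  define S where "S = {X. X * u = u * X \<and> star X = X}"
  have S: "sq_subspace S"
    by (auto simp: sq_subspace_def S_def distrib_left distrib_right mult.assoc cst_left cst_commute)
      (metis cst_commute cst_left)+
  have "mat_space.dim (mat_of ` S) = vec.dim ((\<lambda>A. app A v) ` S)"
    using commutant alg_eval_inj by (intro dim_eval S) (auto simp: S_def)
  also have "(\<lambda>A. app A v) ` S = vec.span (cyc_basis ` (insert (m - 1, True) ({..<m} \<times> {False})))"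
  proof
    show "(\<lambda>A. app A v) ` S \<subseteq> vec.span (cyc_basis ` (insert (m - 1, True) ({..<m} \<times> {False})))"
    proof
      fix x assume "x \<in> (\<lambda>A. app A v) ` S"
      then obtain X where X: "X * u = u * X" "star X = X" "x = app X v" by (auto simp: S_def)
      obtain a c where "X = ev y a + cst c * y ^ (m - 1) * N" using alg_self_adjoint[OF commutant[OF X(1)] X(2)] by blast
      hence "x = (\<Sum>j<m. coeff a j *s cyc_basis (j, False)) + c *s cyc_basis (m - 1, True)"
        by (simp add: X(3) ev_trunc[of a] app_sum cyc_basis_def)
      thus "x \<in> vec.span (cyc_basis ` (insert (m - 1, True) ({..<m} \<times> {False})))"
        by (simp only:) (intro vec.span_add vec.span_sum vec.span_scale; rule vec.span_base; auto)
    qed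
    have sub: "vec.subspace ((\<lambda>A. app A v) ` S)"
    proof (rule vec.subspaceI)
      show "0 \<in> (\<lambda>A. app A v) ` S" using S by (auto simp: sq_subspace_def image_iff intro!: bexI[of _ 0])
      fix x z c assume "x \<in> (\<lambda>A. app A v) ` S"
      then obtain X where X: "X \<in> S" "x = app X v" by blast
      have "app (cst c * X) v \<in> (\<lambda>A. app A v) ` S" using X(1) S by (intro imageI) (auto simp: sq_subspace_def)
      thus "c *s x \<in> (\<lambda>A. app A v) ` S" by (simp add: X)
      assume "z \<in> (\<lambda>A. app A v) ` S"
      then obtain Z where Z: "Z \<in> S" "z = app Z v" by blast
      have "app (X + Z) v \<in> (\<lambda>A. app A v) ` S" using X(1) Z(1) S by (intro imageI) (auto simp: sq_subspace_def)
      thus "x + z \<in> (\<lambda>A. app A v) ` S" by (simp add: X Z)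
    qed
    show "vec.span (cyc_basis ` (insert (m - 1, True) ({..<m} \<times> {False}))) \<subseteq> (\<lambda>A. app A v) ` S"
    proof (rule vec.span_minimal[OF _ sub], rule subsetI)
      fix x assume "x \<in> cyc_basis ` (insert (m - 1, True) ({..<m} \<times> {False}))"
      then consider "x = app (y ^ (m - 1) * N) v" | j where "x = app (y ^ j) v" by (auto simp: cyc_basis_def)
      thus "x \<in> (\<lambda>A. app A v) ` S"
      proof cases
        case 1
        have a: "y ^ (m - 1) * N \<in> alg" by (intro alg_mult alg_power alg_basic)
        have "star (y ^ (m - 1) * N) = M * y ^ (m - 1)" by (simp add: star_power)
        also have "\<dots> = y ^ (m - 1) * M" by (rule alg_commute_alg) (intro alg_power alg_basic alg_M)+
        also have "\<dots> = y ^ (m - 1) * N + y ^ (m - 1) * y" by (simp add: M_y_N distrib_left)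
        \<comment> \<open>The obstruction to self-adjointness of \<open>y ^ (m - 1) * N\<close> is
          \<open>y ^ m\<close>, which is zero. This element accounts for the dimension beyond that
          of \<open>K[y]\<close>.\<close>
        also have "y ^ (m - 1) * y = y ^ m" using cycD(1) by (metis power_minus_mult zero_less_one order_less_le_trans)
        finally have "y ^ (m - 1) * N \<in> S" using alg_commute[OF a refl] cycD(2) by (simp add: S_def)
        thus ?thesis using 1 by blast
      next
        case 2
        have a: "y ^ j \<in> alg" by (intro alg_power alg_basic)
        have "y ^ j \<in> S" using alg_commute[OF a refl] by (simp add: S_def star_power)
        thus ?thesis using 2 by blast
      qed
    qed
  qed
  also have "vec.dim \<dots> = card (cyc_basis ` (insert (m - 1, True) ({..<m} \<times> {False})))"
    using cyc_basis(3) cycD(1) by (intro vec.dim_span_eq_card_independent) (auto elim!: vec.independent_mono)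
  also have "\<dots> = card (insert (m - 1, True) ({..<m} \<times> {False}))"
    by (intro card_image inj_on_subset[OF cyc_basis(2)]) (use cycD(1) in auto)
  also have "\<dots> = m + 1" by (simp add: card_cartesian_product)
  finally show ?thesis using cyc_basis(1) by (simp add: S_def)
qed

end

end

lemma dim_extend:
  assumes S: "sq_subspace S" and Y: "Y \<notin> S"
  shows "mat_space.dim (mat_of ` {X + cst d * Y | X d. X \<in> S}) = mat_space.dim (mat_of ` S) + 1"
proof -
  have S': "mat_space.subspace (mat_of ` S)" using S by (rule subspace_mat_of)
  have sp: "mat_space.span (mat_of ` S) = mat_of ` S" using S' by (simp add: mat_space.span_eq_iff)
  have "mat_of ` {X + cst d * Y | X d. X \<in> S} = mat_space.span (insert (mat_of Y) (mat_of ` S))"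
  proof -
    show ?thesis unfolding mat_space.span_insert sp
    proof (intro set_eqI iffI)
      fix Z assume "Z \<in> mat_of ` {X + cst d * Y | X d. X \<in> S}"
      then obtain X d where "X \<in> S" "Z = mat_of (X + cst d * Y)" by blast
      thus "Z \<in> {x. \<exists>k. x - mat_scale k (mat_of Y) \<in> mat_of ` S}"
        by (intro CollectI exI[of _ d]) (simp add: mat_of_simps(3) mat_of_cst_mult)
    next
      fix Z assume "Z \<in> {x. \<exists>k. x - mat_scale k (mat_of Y) \<in> mat_of ` S}"
      then obtain k X where X: "X \<in> S" "Z - mat_scale k (mat_of Y) = mat_of X" by auto
      hence "Z = mat_of (X + cst k * Y)" by (simp add: mat_of_simps(3) mat_of_cst_mult algebra_simps)
      thus "Z \<in> mat_of ` {X + cst d * Y | X d. X \<in> S}" using X(1) by blast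
    qed
  qed
  moreover have "mat_of Y \<notin> mat_space.span (mat_of ` S)"
    unfolding sp using Y by (auto simp: sqm_eq_iff[symmetric])
  ultimately show ?thesis by (simp add: mat_space.dim_span mat_space.dim_insert)
qed

lemma cst_power: "cst (c ^ n) = cst c ^ n"
  by (induction n) simp_all

lemma form_star_self: "form (app (star A) v) v = form (app A v) v"
  by (subst form_app) (simp add: form_sym[of v])

context char2
begin

lemma form_symmetric_power:
  assumes "star (A :: ('k, 'n::finite + 'n) sqm) = A" shows "form (app (A ^ (2 * j)) v) v = 0"
proof -
  have "form (app (A ^ (2 * j)) v) v = form (app (A ^ j) v) (app (star (A ^ j)) v)"
    by (simp add: mult_2 power_add form_app)
  thus ?thesis by (simp add: star_power assms)
qed

end

context unip
begin

text \<open>The preimage under \<open>ad\<close> of the fixed points of \<open>u\<close> in the Lie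
  algebra of \<open>PSp\<close>: the first condition describes infinitesimal similitudes, the second
  says that conjugation by \<open>u\<close> moves \<open>Y\<close> only by a scalar.\<close>

definition gsp_centralizer :: "('k, 'n + 'n) sqm set" where
  "gsp_centralizer = {Y. (\<exists>c. Y + star Y = cst c) \<and> (\<exists>d. u * Y + Y * u = cst d * u)}"

context
  fixes v m assumes cyc: "cyclic v m"
begin

lemma cyclic_N: "app (N ^ CARD('n + 'n)) v = 0" "app (N ^ (CARD('n + 'n) - 1)) v \<noteq> 0"
proof -
  have m: "m = CARD('n)" by (rule cyc_basis(1)[OF cyc])
  have ym: "app (y ^ m) v = 0" using cycD(2)[OF cyc] by simp
  show "app (N ^ CARD('n + 'n)) v = 0" using N_top(1)[OF ym cycD(1)[OF cyc]] by (simp add: m mult_2)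
  have "app (N ^ (2 * m - 1)) v \<noteq> 0" using cycD(3)[OF cyc] N_top(2)[OF ym cycD(1)[OF cyc]] by (auto simp: Q_def)
  thus "app (N ^ (CARD('n + 'n) - 1)) v \<noteq> 0" by (simp add: m mult_2)
qed

text \<open>Differentiation in \<open>N\<close> yields the commutation relation, but the result need
  not be a similitude. The defect \<open>q\<close> commutes with \<open>u\<close>, so it lies in
  \<open>K[u]\<close> and can be corrected there.\<close>

lemma exists_similitude: "\<exists>Y. (\<exists>c. Y + star Y = cst c) \<and> u * Y + Y * u = u"
proof -
  obtain T where T: "app T (app (ev N p) v) = app (ev N (pderiv p)) v" for p
    using derivation_exists[OF two _ cyclic_N, of "CARD('n)"] by (auto simp: mult_2)
  have TN: "T * N = N * T + 1"
  proof (rule sqm_eqI)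
    fix x
    obtain p where x: "x = app (ev N p) v" using nilpotent_cyclic_span[OF cyclic_N] by blast
    have "app N (app (ev N p) v) = app (ev N (pCons 0 p)) v" by simp
    hence "app (T * N) x = app (ev N (pderiv (pCons 0 p))) v" by (simp only: app_simps(7) x T)
    also have "\<dots> = app (N * T + 1) x" by (simp add: x T pderiv_pCons ac_simps)
    finally show "app (T * N) x = app (N * T + 1) x" .
  qed
  \<comment> \<open>Multiplication by \<open>u\<close> turns the commutator 1 of \<open>T\<close>
    and \<open>N\<close> into \<open>u\<close>, the shape required of an element fixed modulo
    scalars.\<close>
  define D where "D = u * T"
  have "D * N = u * N * T + u" unfolding D_def mult.assoc TN by (simp add: distrib_left mult.assoc)
  also have "u * N = N * u" by (rule commute_N) simp
  finally have DN: "D * N = N * D + u" by (simp add: D_def mult.assoc)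
  have "u * D + D * u = (N + 1) * D + D * (N + 1)" by (simp only: u_eq[symmetric])
  also have "\<dots> = u" by (simp add: distrib_left distrib_right DN ac_simps)
  finally have Du: "u * D + D * u = u" .
  define q where "q = D + star D"
  have "star (u * D + D * u) = star u" by (simp add: Du)
  hence "u * (star D * star u + star u * star D) * u = u * star u * u" by (simp add: add.commute)
  hence "u * star D + star D * u = u"
    by (simp add: distrib_left distrib_right mult.assoc isom) (simp add: isom' flip: mult.assoc)
  hence "u * q + q * u = u + u" using Du unfolding q_def distrib_left distrib_right
    by (metis (no_types, lifting) add.assoc add.commute)
  hence qu: "q * u = u * q" by simp
  have sq: "star q = q" by (simp add: q_def add.commute)
  obtain a c where q: "q = ev y a + cst c * y ^ (m - 1) * N"
    using alg_self_adjoint[OF cyc commutant[OF cyc qu] sq] by blast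
  \<comment> \<open>An operator and its adjoint have the same value here, so it cancels for
    \<open>q\<close>. Since \<open>Q (m - 1) v\<close> is nonzero, the component of \<open>q\<close>
    at \<open>N\<close> disappears.\<close>
  have "form (app q v) v = form (app D v) v + form (app (star D) v) v" by (simp add: q_def)
  also have "form (app (star D) v) v = form (app D v) v" by (rule form_star_self)
  finally have "form (app q v) v = 0" by simp
  moreover have "form (app (ev y a) v) v = 0" by simp
  ultimately have "c * Q (m - 1) v = 0" by (simp add: q Q_def)
  hence "c = 0" using cycD(3)[OF cyc] by simp
  moreover obtain a0 r where a: "a = pCons a0 r" by (cases a)
  ultimately have q': "q = cst a0 + y * ev y r" by (simp add: q)
  \<comment> \<open>The added term and its adjoint sum to \<open>y * ev y r\<close>, the nonscalar
    part of \<open>q\<close>; as it commutes with \<open>u\<close>, the relation for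
    \<open>D\<close> is unchanged.\<close>
  define Y where "Y = D + ev y r * N"
  have R: "ev y r \<in> alg" by (rule alg_basic)
  have "Y + star Y = q + (ev y r * N + M * ev y r)" by (simp add: Y_def q_def star_ev ac_simps)
  also have "M * ev y r = ev y r * M" using R alg_M by (intro alg_commute_alg)
  also have "ev y r * N + ev y r * M = y * ev y r" using alg_commute_alg[OF R alg_basic(4)]
    by (simp add: y_def[symmetric] flip: distrib_left)
  finally have 1: "Y + star Y = cst a0" by (simp add: q')
  have "ev y r * N * u = u * (ev y r * N)" by (intro alg_commute_alg alg_mult alg_basic alg_u)
  hence "u * Y + Y * u = u * D + D * u" by (simp add: Y_def distrib_left distrib_right ac_simps)
  thus ?thesis using 1 Du by auto
qed

text \<open>The self-adjoint centralizer and the line of \<open>Y\<close> together. The scalars are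
  still counted here; passing to \<open>ad\<close> removes that one dimension again.\<close>

lemma dim_gsp_centralizer_unipotent: "mat_space.dim (mat_of ` gsp_centralizer) = CARD('n) + 2"
proof -
  define S where "S = {X. X * u = u * X \<and> star X = X}"
  have S: "sq_subspace S"
    by (auto simp: sq_subspace_def S_def distrib_left distrib_right mult.assoc cst_left cst_commute)
      (metis cst_commute cst_left)+
  obtain Y b where Y: "Y + star Y = cst b" "u * Y + Y * u = u" using exists_similitude by blast
  have "u \<noteq> 0" using isom by auto
  hence "Y \<notin> S" using Y(2) by (auto simp: S_def)
  \<comment> \<open>The scalar \<open>cst c\<close> equals \<open>ev y b * y\<close>, which is
    nilpotent; so a similitude commuting with \<open>u\<close> is already self-adjoint.\<close>
  have scal: "X \<in> S" if X: "X * u = u * X" "X + star X = cst c" for X c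
  proof -
    obtain a b where ab: "X = ev y a + ev y b * N" using commutant[OF cyc X(1)] by (auto simp: alg_def)
    have B: "ev y b \<in> alg" by (rule alg_basic)
    have "X + star X = ev y b * N + M * ev y b" by (simp add: ab star_ev ac_simps)
    also have "M * ev y b = ev y b * M" using B alg_M by (intro alg_commute_alg)
    also have "ev y b * N + ev y b * M = ev y b * y" by (simp add: y_def flip: distrib_left)
    finally have c: "cst c = ev y b * y" using X(2) by simp
    have "cst c ^ m = ev y b ^ m * y ^ m" unfolding c
      using alg_commute_alg[OF B alg_basic(4)] by (rule power_mult_commuting)
    hence "cst (c ^ m) = (0 :: ('k, 'n + 'n) sqm)" using cycD(2)[OF cyc]
by (simp add: cst_power)
    hence "app (cst (c ^ m)) v = 0" by simp
    moreover have "v \<noteq> 0" using cycD(3)[OF cyc] by (auto simp: Q_def)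
    ultimately have "c = 0" by simp
    thus ?thesis using X by (simp add: S_def)
  qed
  have "gsp_centralizer = {X + cst d * Y | X d. X \<in> S}"
  proof (intro set_eqI iffI)
    fix Z assume "Z \<in> gsp_centralizer"
    then obtain c d where Z: "Z + star Z = cst c" "u * Z + Z * u = cst d * u" by (auto simp: gsp_centralizer_def)
    define X where "X = Z + cst d * Y"
    have "u * X + X * u = (u * Z + Z * u) + cst d * (u * Y + Y * u)"
      by (simp add: X_def distrib_left distrib_right mult.assoc cst_left ac_simps)
    hence "X * u = u * X" by (simp add: Z Y(2))
    moreover have "X + star X = (Z + star Z) + cst d * (Y + star Y)"
      by (simp add: X_def distrib_left cst_commute ac_simps)
    hence "X + star X = cst (c + d * b)" by (simp add: Z Y(1))
    ultimately have "X \<in> S" by (rule scal)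
    moreover have "Z = X + cst d * Y" by (simp add: X_def add.assoc)
    ultimately show "Z \<in> {X + cst d * Y | X d. X \<in> S}" by blast
  next
    fix Z assume "Z \<in> {X + cst d * Y | X d. X \<in> S}"
    then obtain X d where X: "X * u = u * X" "star X = X" and Z: "Z = X + cst d * Y" by (auto simp: S_def)
    have "u * Z + Z * u = cst d * (u * Y + Y * u)" using X(1)
      by (simp add: Z distrib_left distrib_right mult.assoc cst_left ac_simps)
    moreover have "Z + star Z = cst d * (Y + star Y)" using X(2)
      by (simp add: Z distrib_left cst_commute ac_simps)
    ultimately have "u * Z + Z * u = cst d * u" "Z + star Z = cst (d * b)" by (simp_all add: Y)
    thus "Z \<in> gsp_centralizer" unfolding gsp_centralizer_def by blast
  qed
  thus ?thesis using dim_extend[OF S \<open>Y \<notin> S\<close>] dim_centralizer_unipotent[OF cyc] by (simp add: S_def)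
qed

end

end

section \<open>Centralizers of a cyclic nilpotent element\<close>

context nilp
begin

text \<open>The preimage under \<open>ad\<close> of the elements commuting with \<open>ad e\<close>,
  as \<open>ad\<close> kills exactly the scalars.\<close>

definition gsp_centralizer :: "('k, 'n + 'n) sqm set" where
  "gsp_centralizer = {Y. (\<exists>c. Y + star Y = cst c) \<and> (\<exists>d. e * Y + Y * e = cst d)}"

context
  fixes v assumes v: "app (e ^ (2 * CARD('n) - 1)) v \<noteq> 0"
begin

lemma cyclic_e: "app (e ^ CARD('n + 'n)) v = 0" "app (e ^ (CARD('n + 'n) - 1)) v \<noteq> 0"
proof -
  have ex: "\<exists>r. app (e ^ r) v = 0" using nil by (metis app_simps(4))
  define r where "r = (LEAST r. app (e ^ r) v = 0)"
  have r: "app (e ^ r) v = 0" unfolding r_def by (rule LeastI_ex[OF ex])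
  have "r \<noteq> 0" using r v by (intro notI) simp
  hence r1: "app (e ^ (r - 1)) v \<noteq> 0" using not_less_Least[of "r - 1" "\<lambda>r. app (e ^ r) v = 0"] by (simp add: r_def)
  from nilpotent_chain[OF r r1, of 0] have *: "vec.independent ((\<lambda>i. app (e ^ i) v) ` {0..<r})" "card ((\<lambda>i. app (e ^ i) v) ` {0..<r}) = r" by simp_all
  have U: "vec.dim (UNIV :: ('k^('n + 'n)) set) = 2 * CARD('n)" by (simp only: vec_dim_card) simp
  have le: "r \<le> 2 * CARD('n)" using vec.independent_card_le_dim[OF subset_UNIV *(1)] U *(2) by simp
  have "e ^ CARD('n + 'n) = e ^ (2 * CARD('n) - r) * e ^ r" using le by (simp add: mult_2 flip: power_add)
  thus "app (e ^ CARD('n + 'n)) v = 0" using r by simp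
  show "app (e ^ (CARD('n + 'n) - 1)) v \<noteq> 0" using v by (simp add: mult_2)
qed

lemma commutant_e: assumes "X * e = e * X" shows "\<exists>p. X = ev e p"
proof -
  obtain p where p: "app X v = app (ev e p) v" using nilpotent_cyclic_span[OF cyclic_e] by blast
  have "X = ev e p"
  proof (rule sqm_eqI)
    fix x
    obtain q where q: "x = app (ev e q) v" using nilpotent_cyclic_span[OF cyclic_e] by blast
    have "app (X * ev e q) v = app (ev e q * X) v" by (simp only: ev_commute[OF assms])
    also have "\<dots> = app (ev e q * ev e p) v" by (simp only: app_simps(7) p)
    also have "ev e q * ev e p = ev e p * ev e q" by (rule ev_commute_ev) simp
    finally show "app X x = app (ev e p) x" by (simp add: q)
  qed
  thus ?thesis by blast
qed

lemma star_ev_e: "star (ev e p) = ev e p" by (simp add: star_ev self_adjoint)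

lemma centralizer_e: "{X. X * e = e * X \<and> star X = X} = range (ev e)"
  using commutant_e star_ev_e ev_commute[of e e] by fastforce

lemma sq_subspace_centralizer_e: "sq_subspace (range (ev e))"
  unfolding sq_subspace_def
  by (auto simp flip: ev_add ev_smult) (metis ev_0 rangeI)

lemma dim_centralizer_nilpotent: "mat_space.dim (mat_of ` {X. X * e = e * X \<and> star X = X}) = 2 * CARD('n)"
proof -
  have "mat_space.dim (mat_of ` range (ev e)) = vec.dim ((\<lambda>A. app A v) ` range (ev e))"
  proof (rule dim_eval[OF sq_subspace_centralizer_e])
    fix A assume "A \<in> range (ev e)" and A0: "app A v = 0"
    then obtain p where A: "A = ev e p" by blast
    show "A = 0"
    proof (rule sqm_eqI)
      fix x
      obtain q where q: "x = app (ev e q) v" using nilpotent_cyclic_span[OF cyclic_e] by blast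
      have "ev e p * ev e q = ev e q * ev e p" by (rule ev_commute_ev) simp
      from arg_cong[OF this, of "\<lambda>A. app A v"] A0 show "app A x = app 0 x" by (simp add: q A)
    qed
  qed
  also have "(\<lambda>A. app A v) ` range (ev e) = UNIV"
    using nilpotent_cyclic_span[OF cyclic_e] by (auto simp: image_image)
  also have "vec.dim (UNIV :: ('k^('n + 'n)) set) = 2 * CARD('n)" by (simp only: vec_dim_card) simp
  finally show ?thesis by (simp only: centralizer_e)
qed

text \<open>Here differentiation is itself self-adjoint: by the product rule the defect is the value
  of \<open>form\<close> at \<open>v\<close> for the derivative of \<open>q * p\<close> in
  \<open>e\<close>. Derivatives in characteristic two contain only even powers, and even powers of a
  self-adjoint operator pair \<open>v\<close> with itself to zero.\<close>

lemma exists_weyl: "\<exists>Y. star Y = Y \<and> e * Y + Y * e = 1"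
proof -
  obtain T where T: "app T (app (ev e p) v) = app (ev e (pderiv p)) v" for p
    using derivation_exists[OF two _ cyclic_e, of "CARD('n)"] by (auto simp: mult_2)
  have "e * T + T * e = 1"
  proof (rule sqm_eqI)
    fix x
    obtain p where x: "x = app (ev e p) v" using nilpotent_cyclic_span[OF cyclic_e] by blast
    have "app e (app (ev e p) v) = app (ev e (pCons 0 p)) v" by simp
    hence "app (T * e) x = app (ev e (pderiv (pCons 0 p))) v" by (simp only: app_simps(7) x T)
    also have "\<dots> = app (e * T + 1) x" by (simp add: x T pderiv_pCons ac_simps)
    finally show "app (e * T + T * e) x = app 1 x" by simp
  qed
  moreover have "star T = T"
  proof (rule star_eqI)
    fix x z
    obtain p where x: "x = app (ev e p) v" using nilpotent_cyclic_span[OF cyclic_e] by blast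
    obtain q where z: "z = app (ev e q) v" using nilpotent_cyclic_span[OF cyclic_e] by blast
    have form_ev: "form (app (ev e r) v) (app (ev e s) v) = form (app (ev e (s * r)) v) v" for r s
      by (simp add: form_app star_ev_e)
    have deriv: "form (app (ev e (pderiv r)) v) v = 0" for r
    proof (induction r rule: poly_sum_monom_induct)
      case (3 c i)
      show ?case
      proof (cases "even i")
        case True
        hence "of_nat i = (0 :: 'k)" using two by (auto elim!: evenE)
        thus ?thesis by (simp add: pderiv_monom)
      next
        case False
        then obtain j where "i = Suc (2 * j)" by (auto elim!: oddE)
        thus ?thesis using form_symmetric_power[OF self_adjoint, of j v] by (simp add: pderiv_monom ev_monom)
      qed
    qed (simp_all add: pderiv_add)
    have "form (app T x) z + form x (app T z) = form (app (ev e (pderiv (q * p))) v) v"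
      by (simp add: x z T form_ev pderiv_mult algebra_simps del: ev_mult)
    thus "form (app T x) z = form x (app T z)" by (simp add: deriv del: ev_mult)
  qed
  ultimately show ?thesis by blast
qed

lemma dim_gsp_centralizer_nilpotent: "mat_space.dim (mat_of ` gsp_centralizer) = 2 * CARD('n) + 1"
proof -
  obtain Y where Y: "star Y = Y" "e * Y + Y * e = 1" using exists_weyl by blast
  have "(1 :: ('k, 'n + 'n) sqm) \<noteq> 0" using v by (metis app_simps(4,5,10))
  hence YS: "Y \<notin> range (ev e)" using Y(2) ev_commute[of e e] by fastforce
  have "gsp_centralizer = {X + cst d * Y | X d. X \<in> range (ev e)}"
  proof (intro set_eqI iffI)
    fix Z assume "Z \<in> gsp_centralizer"
    then obtain d where Z: "e * Z + Z * e = cst d" by (auto simp: gsp_centralizer_def)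
    define X where "X = Z + cst d * Y"
    have "e * X + X * e = (e * Z + Z * e) + cst d * (e * Y + Y * e)"
      by (simp add: X_def distrib_left distrib_right mult.assoc cst_left ac_simps)
    hence "X * e = e * X" by (simp add: Z Y(2))
    moreover have "Z = X + cst d * Y" by (simp add: X_def add.assoc)
    ultimately show "Z \<in> {X + cst d * Y | X d. X \<in> range (ev e)}" using commutant_e by blast
  next
    fix Z assume "Z \<in> {X + cst d * Y | X d. X \<in> range (ev e)}"
    then obtain p d where Z: "Z = ev e p + cst d * Y" by blast
    have "star Z = Z" by (simp add: Z star_ev_e Y(1) cst_commute)
    hence "Z + star Z = cst 0" by simp
    moreover have "e * Z + Z * e = (e * ev e p + ev e p * e) + cst d * (e * Y + Y * e)"
      by (simp add: Z distrib_left distrib_right mult.assoc cst_left ac_simps)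
    hence "e * Z + Z * e = cst d" using ev_commute[of e e p] by (simp add: Y(2))
    ultimately show "Z \<in> gsp_centralizer" unfolding gsp_centralizer_def by blast
  qed
  thus ?thesis using dim_extend[OF sq_subspace_centralizer_e YS] dim_centralizer_nilpotent by (simp add: centralizer_e)
qed

end

end

lemma form_isometry: "star A * A = 1 \<Longrightarrow> form (app A x) (app A z) = form x z"
  by (subst form_app) (metis app_simps(5,7))

subsection \<open>Commuting isometries of exponent three\<close>

context char2
begin

lemma root3_exists: obtains \<omega> :: 'k where "\<omega> * \<omega> + \<omega> + 1 = 0" "\<omega> ^ 3 = 1" "\<omega> \<noteq> 1"
proof -
  obtain \<omega> :: 'k where "poly [:1, 1, 1:] \<omega> = 0" using alg_closed_imp_poly_has_root[of "[:1, 1, 1 :: 'k:]"] by auto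
  hence w: "\<omega> * \<omega> + \<omega> + 1 = 0" by (simp add: algebra_simps)
  hence w2: "\<omega> * \<omega> = \<omega> + 1" by (metis add_eq_0 add.assoc)
  have "\<omega> ^ 3 = \<omega> * (\<omega> * \<omega>)" by (simp add: power3_eq_cube mult.assoc)
  also have "\<dots> = 1" unfolding w2 distrib_left w2 by (simp add: ac_simps)
  finally have "\<omega> ^ 3 = 1" .
  moreover have "\<omega> \<noteq> 1" using w by auto
  ultimately show thesis using that w by blast
qed

lemma cube_root_cases:
  assumes w: "\<omega> * \<omega> + \<omega> + 1 = (0 :: 'k)" and a: "a ^ 3 = (1 :: 'k)"
  shows "a \<in> {1, \<omega>, \<omega> * \<omega>}"
proof -
  have w2: "\<omega> * \<omega> = \<omega> + 1" using w by (metis add_eq_0 add.assoc)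
  have "(a + 1) * ((a + \<omega>) * (a + \<omega> * \<omega>)) = a ^ 3 + 1"
  proof -
    have "(a + \<omega>) * (a + \<omega> * \<omega>) = a * a + a * (\<omega> * \<omega> + \<omega>) + \<omega> * (\<omega> * \<omega>)" by (simp add: algebra_simps)
    also have "\<dots> = a * a + a + 1" unfolding w2 distrib_left[of \<omega>] by (simp add: ac_simps)
    finally show ?thesis by (simp only:) (simp add: algebra_simps power3_eq_cube)
  qed
  thus ?thesis using a by simp
qed

definition isometries3 :: "('k, 'n::finite + 'n) sqm set \<Rightarrow> bool" where
  "isometries3 S \<longleftrightarrow> finite S \<and> (\<forall>A\<in>S. star A * A = 1 \<and> A ^ 3 = 1) \<and> (\<forall>A\<in>S. \<forall>B\<in>S. A * B = B * A)"

text \<open>Since 3 = 1 in characteristic two, \<open>p a\<close> is the projection of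
  \<open>v\<close> to the eigenspace of \<open>A\<close> for the inverse of \<open>a\<close>. The
  three projections add up to \<open>v\<close>, so one of them is nonzero, and it remains an
  eigenvector of the operators treated before.\<close>

lemma common_eigenvector:
  assumes S: "finite S" "\<forall>A\<in>S. A ^ 3 = 1" "\<forall>A\<in>S. \<forall>B\<in>S. A * B = B * A" "\<forall>A\<in>S. A * \<pi> = \<pi> * A"
    and \<pi>: "\<pi> * \<pi> = \<pi>" "\<pi> \<noteq> (0 :: ('k, 'i::finite) sqm)"
  shows "\<exists>v. v \<noteq> 0 \<and> app \<pi> v = v \<and> (\<forall>A\<in>S. \<exists>a. a ^ 3 = 1 \<and> app A v = a *s v)"
proof -
  obtain \<omega> :: 'k where w: "\<omega> * \<omega> + \<omega> + 1 = 0" "\<omega> ^ 3 = 1" by (rule root3_exists)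
  have "\<exists>v. v \<noteq> 0 \<and> app \<pi> v = v \<and> (\<forall>A\<in>F. \<exists>a. a ^ 3 = 1 \<and> app A v = a *s v)" if "F \<subseteq> S" for F
    using finite_subset[OF that S(1)] that
  proof (induction F rule: finite_induct)
    case empty
    obtain x where "app \<pi> x \<noteq> 0" using \<pi>(2) sqm_eqI[of \<pi> 0] by auto
    thus ?case using app_eqD[OF \<pi>(1), of x] by (intro exI[of _ "app \<pi> x"]) simp
  next
    case (insert A F)
    then obtain v where v: "v \<noteq> 0" "app \<pi> v = v" "\<forall>B\<in>F. \<exists>a. a ^ 3 = 1 \<and> app B v = a *s v" by auto
    have AS: "A \<in> S" using insert.prems by blast
    have "A * A * A = 1" using S(2) AS by (simp add: power3_eq_cube)
    from app_eqD[OF this] have A3: "app A (app A (app A x)) = x" for x by simp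
    define p where "p a = v + a *s app A v + (a * a) *s app A (app A v)" for a
    have "p 1 + p \<omega> + p (\<omega> * \<omega>) = v"
    proof -
      have w3: "\<omega> * (\<omega> * \<omega>) = 1" using w(2) by (simp add: power3_eq_cube ac_simps)
      have "p 1 + p \<omega> + p (\<omega> * \<omega>) = v + (\<omega> * \<omega> + \<omega> + 1) *s app A v + (\<omega> * \<omega> + \<omega> + 1) *s app A (app A v)"
        by (simp add: p_def w3 vec_eq_iff algebra_simps)
      thus ?thesis by (simp add: w)
    qed
    hence "\<exists>a\<in>{1, \<omega>, \<omega> * \<omega>}. p a \<noteq> 0" using v(1) by auto
    then obtain a where a: "a \<in> {1, \<omega>, \<omega> * \<omega>}" "p a \<noteq> 0" by blast
    have a3: "a ^ 3 = 1" using a(1) w(2) by (auto simp: power_mult_distrib)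
    have a3': "a * (a * a) = 1" using a3 by (simp add: power3_eq_cube mult.assoc)
    have "(a * a) *s p a = app A (p a)"
    proof -
      have "a * a * (a * a) = a" using a3' by (metis mult.assoc mult.right_neutral)
      thus ?thesis using a3' by (simp add: p_def A3 vec.scale_right_distrib mult.assoc)
    qed
    moreover have "(a * a) ^ 3 = 1" using a3 by (simp add: power_mult_distrib)
    ultimately have "\<exists>b. b ^ 3 = 1 \<and> app A (p a) = b *s p a" by metis
    moreover have "\<exists>b. b ^ 3 = 1 \<and> app B (p a) = b *s p a" if B: "B \<in> F" for B
    proof -
      obtain b where b: "b ^ 3 = 1" "app B v = b *s v" using v(3) B by blast
      have "A * B = B * A" using S(3) AS B insert.prems by blast
      from app_eqD[OF this] have c: "app B (app A x) = app A (app B x)" for x by simp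
      have "app B (p a) = b *s p a" by (simp add: p_def c b(2) vec.scale_right_distrib mult.left_commute mult.commute)
      thus ?thesis using b(1) by blast
    qed
    moreover have "app \<pi> (p a) = p a"
    proof -
      from S(4) AS have "A * \<pi> = \<pi> * A" by blast
      from app_eqD[OF this] have "app \<pi> (app A x) = app A (app \<pi> x)" for x by simp
      thus ?thesis by (simp add: p_def v(2))
    qed
    ultimately show ?case using a(2) by (intro exI[of _ "p a"]) blast
  qed
  thus ?thesis by blast
qed

text \<open>An isometry forces the inverse eigenvalue, here the square, on a dual vector. Any vector
  pairing to 1 with \<open>v\<close> is projected to that eigenspace; the pairing survives because
  each of the three summands contributes 1.\<close>

lemma dual_eigenvector:
  assumes S: "isometries3 S" "\<forall>A\<in>S. A * \<pi> = \<pi> * A"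
    and \<pi>: "\<pi> * \<pi> = \<pi>" "star \<pi> = \<pi>"
    and v: "v \<noteq> 0" "app \<pi> v = v" "\<forall>A\<in>S. a A ^ 3 = 1 \<and> app A v = a A *s v"
  shows "\<exists>w. form v w = 1 \<and> app \<pi> w = w \<and> (\<forall>A\<in>S. app A w = (a A * a A) *s w)"
proof -
  have finS: "finite S" using S(1) by (simp add: isometries3_def)
  have "\<exists>w. form v w = 1 \<and> app \<pi> w = w \<and> (\<forall>A\<in>F. app A w = (a A * a A) *s w)" if "F \<subseteq> S" for F
    using finite_subset[OF that finS] that
  proof (induction F rule: finite_induct)
    case empty
    obtain z where "form z v = 1" using form_dual[OF v(1)] by blast
    hence z: "form v z = 1" by (simp add: form_sym)
    have "form v (app \<pi> z) = form (app \<pi> v) z" by (simp add: form_app \<pi>(2))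
    hence "form v (app \<pi> z) = 1" using z v(2) by simp
    thus ?case using app_eqD[OF \<pi>(1), of z] by (intro exI[of _ "app \<pi> z"]) simp
  next
    case (insert A F)
    then obtain w where w: "form v w = 1" "app \<pi> w = w" "\<forall>B\<in>F. app B w = (a B * a B) *s w" by auto
    have AS: "A \<in> S" using insert.prems by blast
    define c where "c = a A"
    have c: "c * (c * c) = 1" "app A v = c *s v" using v(3) AS by (simp_all add: c_def power3_eq_cube mult.assoc)
    have A: "star A * A = 1" "A ^ 3 = 1" using S(1) AS by (auto simp: isometries3_def)
    have "A * A * A = 1" using A(2) by (simp add: power3_eq_cube)
    from app_eqD[OF this] have A3: "app A (app A (app A x)) = x" for x by simp
    have sh: "form v (app A x) = (c * c) * form v x" for x
    proof -
      have "form v (app A x) = form (app A (app A (app A v))) (app A x)" by (simp add: A3)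
      also have "\<dots> = form (app A (app A v)) x" by (rule form_isometry[OF A(1)])
      also have "app A (app A v) = (c * c) *s v" by (simp add: c(2))
      finally show ?thesis by simp
    qed
    define p where "p = w + c *s app A w + (c * c) *s app A (app A w)"
    have c4: "c * c * (c * c) = c" using c(1) by (metis mult.assoc mult.right_neutral)
    have "form v p = 1" using c(1) by (simp add: p_def sh w(1) mult.assoc c4[unfolded mult.assoc])
    moreover have "app \<pi> p = p"
    proof -
      from S(2) AS have "A * \<pi> = \<pi> * A" by blast
      from app_eqD[OF this] have "app \<pi> (app A x) = app A (app \<pi> x)" for x by simp
      thus ?thesis by (simp add: p_def w(2))
    qed
    moreover have "app A p = (a A * a A) *s p"
      using c(1) c4 unfolding c_def[symmetric]
      by (simp add: p_def A3 vec.scale_right_distrib mult.assoc)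
    moreover have "app B p = (a B * a B) *s p" if B: "B \<in> F" for B
    proof -
      have b: "app B w = (a B * a B) *s w" using w(3) B by blast
      have "A * B = B * A" using S(1) AS B insert.prems by (auto simp: isometries3_def)
      from app_eqD[OF this] have c: "app B (app A x) = app A (app B x)" for x by simp
      show ?thesis by (simp add: p_def c b vec.scale_right_distrib mult.left_commute mult.commute)
    qed
    ultimately show ?case by (intro exI[of _ p]) blast
  qed
  thus ?thesis by blast
qed

text \<open>On the plane of an eigenvector and its dual an isometry is determined by one cube root
  of unity, the two eigenvalues being inverse. Every two dimensions therefore cost at most a factor
  3.\<close>

lemma card_isometries3_aux:
  assumes S: "isometries3 (S :: ('k, 'n::finite + 'n) sqm set)"
  shows "\<pi> * \<pi> = \<pi> \<Longrightarrow> star \<pi> = \<pi> \<Longrightarrow> \<forall>A\<in>S. A * \<pi> = \<pi> * A \<Longrightarrow>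
    card ((\<lambda>A. A * \<pi>) ` S) \<le> 3 ^ (vec.dim (range (app \<pi>)) div 2)"
proof (induction "vec.dim (range (app \<pi>))" arbitrary: \<pi> rule: less_induct)
  case less
  note \<pi> = less.prems
  have fin: "finite S" using S by (simp add: isometries3_def)
  show ?case
  proof (cases "\<pi> = 0")
    case True
    hence "(\<lambda>A. A * \<pi>) ` S \<subseteq> {0}" by auto
    from card_mono[OF _ this] have "card ((\<lambda>A. A * \<pi>) ` S) \<le> 1" by simp
    thus ?thesis by (rule order_trans) simp
  next
    case False
    have S': "\<forall>A\<in>S. A ^ 3 = 1" "\<forall>A\<in>S. \<forall>B\<in>S. A * B = B * A" using S by (simp_all add: isometries3_def)
    obtain v where v: "v \<noteq> 0" "app \<pi> v = v" "\<forall>A\<in>S. \<exists>a. a ^ 3 = 1 \<and> app A v = a *s v"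
      using common_eigenvector[OF fin S' \<pi>(3,1) False] by blast
    then obtain a where a: "\<forall>A\<in>S. a A ^ 3 = 1 \<and> app A v = a A *s v" by metis
    obtain w where w: "form v w = 1" "app \<pi> w = w" "\<forall>A\<in>S. app A w = (a A * a A) *s w"
      using dual_eigenvector[OF S \<pi>(3,1,2) v(1,2) a] by blast
    have w': "form w v = 1" using w(1) by (simp add: form_sym)
    define \<pi>1 where "\<pi>1 = rk v w + rk w v"
    define \<pi>' where "\<pi>' = \<pi> + \<pi>1"
    have 1: "\<pi>1 * \<pi>1 = \<pi>1" "star \<pi>1 = \<pi>1" "\<pi> * \<pi>1 = \<pi>1" "\<pi>1 * \<pi> = \<pi>1"
      by (simp_all add: \<pi>1_def distrib_left distrib_right rk_mult_rk w(1) w' mult_rk v(2) w(2) \<pi>(2) add.commute)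
    have A1: "A * \<pi>1 = cst (a A) * rk v w + cst (a A * a A) * rk w v" "A * \<pi>1 = \<pi>1 * A" if "A \<in> S" for A
    proof -
      have A: "app A v = a A *s v" "app A w = (a A * a A) *s w" using a w(3) that by auto
      have a3: "a A * (a A * a A) = 1" using a that by (simp add: power3_eq_cube mult.assoc)
      have rk_scale: "rk (c *s x) z = cst c * rk x z" "rk x (c *s z) = cst c * rk x z" for c x and z :: "'k^('n + 'n)"
        by (rule sqm_eqI; simp add: mult.commute)+
      show 1: "A * \<pi>1 = cst (a A) * rk v w + cst (a A * a A) * rk w v"
        by (simp only: \<pi>1_def distrib_left mult_rk A rk_scale)
      have isoA: "star A * A = 1" using S that by (simp add: isometries3_def)
      have sA: "app (star A) w = a A *s w" "app (star A) v = (a A * a A) *s v"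
      proof -
        have "a A *s app (star A) (app A w) = a A *s w" using app_eqD[OF isoA, of w] by simp
        thus "app (star A) w = a A *s w" by (simp add: A(2) a3)
        have "(a A * a A) *s app (star A) (app A v) = (a A * a A) *s v" using app_eqD[OF isoA, of v] by simp
        thus "app (star A) v = (a A * a A) *s v" using a3 by (simp add: A(1) mult.assoc)
      qed
      show "A * \<pi>1 = \<pi>1 * A" unfolding 1 by (simp only: \<pi>1_def distrib_right mult_rk sA rk_scale)
    qed
    have \<pi>': "\<pi>' * \<pi>' = \<pi>'" "star \<pi>' = \<pi>'" "\<forall>A\<in>S. A * \<pi>' = \<pi>' * A"
      using A1(2) \<pi> by (simp_all add: \<pi>'_def distrib_left distrib_right 1)
    have dim: "vec.dim (range (app \<pi>')) + 2 \<le> vec.dim (range (app \<pi>))"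
    proof -
      have "w \<noteq> 0" using w(1) by auto
      have vw: "v \<notin> vec.span {w}"
      proof
        assume "v \<in> vec.span {w}"
        then obtain k where "v = k *s w" by (auto simp: vec.span_singleton)
        thus False using w(1) by simp
      qed
      hence "v \<noteq> w" using vec.span_base by blast
      have ind: "vec.independent {v, w}" using vw \<open>w \<noteq> 0\<close> \<open>v \<noteq> w\<close>
        by (intro vec.independent_insertI) (simp_all add: vec.independent_empty)
      have "vec.dim (vec.span {v, w}) = 2" using \<open>v \<noteq> w\<close> unfolding vec.dim_span_eq_card_independent[OF ind] by simp
      moreover have "vec.dim {x + z |x z. x \<in> range (app \<pi>') \<and> z \<in> vec.span {v, w}} + vec.dim (range (app \<pi>') \<inter> vec.span {v, w})
         = vec.dim (range (app \<pi>')) + vec.dim (vec.span {v, w})"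
        by (rule vec.dim_sums_Int) (auto intro: subspace_range_app vec.subspace_span)
      moreover have "range (app \<pi>') \<inter> vec.span {v, w} \<subseteq> {0}"
      proof
        fix x assume x: "x \<in> range (app \<pi>') \<inter> vec.span {v, w}"
        have p: "app \<pi>' x = x" using x app_eqD[OF \<pi>'(1)] by auto
        have k: "app \<pi>' v = 0" "app \<pi>' w = 0" using v(2) w(2) by (simp_all add: \<pi>'_def \<pi>1_def w(1) w')
        have "app \<pi>' x = 0" if "x \<in> vec.span {v, w}" for x
          using that by (induction rule: vec.span_induct_alt) (auto simp: k)
        thus "x \<in> {0}" using x p by auto
      qed
      hence "vec.dim (range (app \<pi>') \<inter> vec.span {v, w}) = 0" by (simp only: vec.dim_eq_0)
      moreover have "{x + z |x z. x \<in> range (app \<pi>') \<and> z \<in> vec.span {v, w}} \<subseteq> range (app \<pi>)"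
      proof -
        have "app \<pi> x = x" if "x \<in> vec.span {v, w}" for x
          using that by (induction rule: vec.span_induct_alt) (auto simp: v(2) w(2))
        moreover have "\<pi> * \<pi>' = \<pi>'" by (simp add: \<pi>'_def distrib_left \<pi>(1) 1)
        from app_eqD[OF this] have "app \<pi> (app \<pi>' x) = app \<pi>' x" for x by simp
        ultimately have *: "app \<pi> (app \<pi>' x + z) = app \<pi>' x + z" if "z \<in> vec.span {v, w}" for x z
          using that by simp
        show ?thesis
        proof
          fix t assume "t \<in> {x + z |x z. x \<in> range (app \<pi>') \<and> z \<in> vec.span {v, w}}"
          then obtain x z where "t = app \<pi>' x + z" "z \<in> vec.span {v, w}" by blast
          thus "t \<in> range (app \<pi>)" using *[of z x] by (metis rangeI)
        qed
      qed
      hence "vec.dim {x + z |x z. x \<in> range (app \<pi>') \<and> z \<in> vec.span {v, w}} \<le> vec.dim (range (app \<pi>))"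
        by (rule vec.dim_subset)
      ultimately show ?thesis by linarith
    qed
    have IH: "card ((\<lambda>A. A * \<pi>') ` S) \<le> 3 ^ (vec.dim (range (app \<pi>')) div 2)"
      using less.hyps[OF _ \<pi>'] dim by simp
    obtain \<omega> :: 'k where \<omega>: "\<omega> * \<omega> + \<omega> + 1 = 0" by (rule root3_exists)
    let ?g = "\<lambda>(c, B). B + (cst c * rk v w + cst (c * c) * rk w v)"
    have sub: "(\<lambda>A. A * \<pi>) ` S \<subseteq> ?g ` ({1, \<omega>, \<omega> * \<omega>} \<times> (\<lambda>A. A * \<pi>') ` S)"
    proof
      fix B assume "B \<in> (\<lambda>A. A * \<pi>) ` S"
      then obtain A where A: "A \<in> S" "B = A * \<pi>" by blast
      have "\<pi> = \<pi>' + \<pi>1" by (simp add: \<pi>'_def add.assoc)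
      hence "B = A * \<pi>' + A * \<pi>1" using A(2) by (simp add: distrib_left)
      hence "B = ?g (a A, A * \<pi>')" using A1(1)[OF A(1)] by simp
      moreover have "a A \<in> {1, \<omega>, \<omega> * \<omega>}" using cube_root_cases[OF \<omega>] a A(1) by blast
      ultimately show "B \<in> ?g ` ({1, \<omega>, \<omega> * \<omega>} \<times> (\<lambda>A. A * \<pi>') ` S)" using A(1) by blast
    qed
    have f: "finite ({1, \<omega>, \<omega> * \<omega>} \<times> (\<lambda>A. A * \<pi>') ` S)" using fin by simp
    have "card ((\<lambda>A. A * \<pi>) ` S) \<le> card (?g ` ({1, \<omega>, \<omega> * \<omega>} \<times> (\<lambda>A. A * \<pi>') ` S))"
      by (rule card_mono[OF finite_imageI[OF f] sub])
    also have "\<dots> \<le> card ({1, \<omega>, \<omega> * \<omega>} \<times> (\<lambda>A. A * \<pi>') ` S)" by (rule card_image_le[OF f])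
    also have "\<dots> \<le> 3 * card ((\<lambda>A. A * \<pi>') ` S)"
    proof -
      have "card {1, \<omega>, \<omega> * \<omega>} \<le> 3" by (simp add: card_insert_if)
      thus ?thesis by (simp only: card_cartesian_product mult_le_mono1)
    qed
    also have "\<dots> \<le> 3 ^ Suc (vec.dim (range (app \<pi>')) div 2)" using IH by simp
    also have "\<dots> \<le> 3 ^ (vec.dim (range (app \<pi>)) div 2)" using dim by (intro power_increasing) auto
    finally show ?thesis .
  qed
qed

lemma card_isometries3:
  assumes "isometries3 (S :: ('k, 'n::finite + 'n) sqm set)"
  shows "card S \<le> 3 ^ CARD('n)"
proof -
  have "vec.dim (range (app (1 :: ('k, 'n + 'n) sqm))) = 2 * CARD('n)"
    using vec_dim_card[where 'a = 'k and 'n = "'n + 'n"] by (simp add: surj_def)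
  thus ?thesis using card_isometries3_aux[OF assms, of 1] by simp
qed

end

subsection \<open>The Lie algebras of \<open>Sp\<close> and \<open>PSp\<close>\<close>

text \<open>The matrix of \<open>X \<mapsto> A X B\<close> in the basis of matrix units.\<close>

definition tens :: "('k::field, 'i::finite) sqm \<Rightarrow> ('k, 'i) sqm \<Rightarrow> ('k, 'i \<times> 'i) sqm" where
  "tens A B = sqm_of (\<chi> p q. mat_of A $ fst p $ fst q * mat_of B $ snd q $ snd p)"

definition ad :: "('k::field, 'i::finite) sqm \<Rightarrow> ('k, 'i \<times> 'i) sqm" where
  "ad Y = tens Y 1 - tens 1 Y"

lemma mat_of_tens [simp]: "mat_of (tens A B) $ p $ q = mat_of A $ fst p $ fst q * mat_of B $ snd q $ snd p"
  by (simp add: tens_def)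

lemma mat_of_star [simp]: "mat_of (star A) $ i $ j = mat_of A $ sw j $ sw i"
  by (simp add: star_def)

lemma all_sw: "(\<forall>i. P i) \<longleftrightarrow> (\<forall>i. P (sw i))"
  by (metis sw_sw)

lemma matrix_inv_eq: "A ** B = mat 1 \<Longrightarrow> matrix_inv (A :: 'k::field^'m^'m) = B"
proof -
  assume AB: "A ** B = mat 1"
  hence "B ** A = mat 1" by (rule matrix_left_right_inverse1)
  hence "A ** matrix_inv A = mat 1" unfolding matrix_inv_def using AB
    by (rule someI2[of "\<lambda>A'. A ** A' = mat 1 \<and> A' ** A = mat 1" B, OF conjI[rotated]]) simp_all
  thus "matrix_inv A = B" using \<open>B ** A = mat 1\<close> by (metis matrix_mul_assoc matrix_mul_lid matrix_mul_rid)
qed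

lemma sqm_eq_entries: "A = B \<longleftrightarrow> (\<forall>i j. mat_of A $ i $ j = mat_of B $ i $ j)"
  by (simp add: sqm_eq_iff vec_eq_iff)

lemma mat_of_cst_mult_entry [simp]: "mat_of (cst c * A) $ i $ j = c * mat_of A $ i $ j"
  by (simp add: mat_of_cst_mult mat_scale_def)

lemma mat_of_1_entry: "mat_of 1 $ i $ j = (if i = j then 1 else 0)"
  by (simp add: mat_of_simps mat_def)

lemma tens_simps [simp]:
  "tens (A + B) C = tens A C + tens B C" "tens C (A + B) = tens C A + tens C B"
  "tens (cst c * A) B = cst c * tens A B" "tens A (cst c * B) = cst c * tens A B"
  "tens 0 A = 0" "tens A 0 = 0" "tens 1 1 = 1"
  by (simp_all add: sqm_eq_entries mat_of_simps(1,3) algebra_simps mat_of_1_entry prod_eq_iff)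

lemma tens_mult [simp]: "tens A B * tens C D = tens (A * C) (D * B)"
proof (simp add: sqm_eq_entries mat_of_simps matrix_matrix_mult_def, intro allI)
  fix a b c d
  have "(\<Sum>r\<in>UNIV. mat_of A $ a $ fst r * mat_of B $ snd r $ b * (mat_of C $ fst r $ c * mat_of D $ d $ snd r))
    = (\<Sum>r\<in>UNIV. case r of (i, j) \<Rightarrow> (mat_of A $ a $ i * mat_of C $ i $ c) * (mat_of D $ d $ j * mat_of B $ j $ b))"
    by (intro sum.cong) (auto simp: ac_simps)
  also have "\<dots> = (\<Sum>i\<in>UNIV. \<Sum>j\<in>UNIV. (mat_of A $ a $ i * mat_of C $ i $ c) * (mat_of D $ d $ j * mat_of B $ j $ b))"
    by (simp add: sum.cartesian_product)
  also have "\<dots> = (\<Sum>i\<in>UNIV. mat_of A $ a $ i * mat_of C $ i $ c) * (\<Sum>j\<in>UNIV. mat_of D $ d $ j * mat_of B $ j $ b)"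
    by (simp add: sum_product)
  finally show "(\<Sum>r\<in>UNIV. mat_of A $ a $ fst r * mat_of B $ snd r $ b * (mat_of C $ fst r $ c * mat_of D $ d $ snd r))
     = (\<Sum>i\<in>UNIV. mat_of A $ a $ i * mat_of C $ i $ c) * (\<Sum>j\<in>UNIV. mat_of D $ d $ j * mat_of B $ j $ b)" .
qed

lemma ad_linear: "ad (A + B) = ad A + ad B" "ad (cst c * A) = cst c * ad A" "ad 0 = 0"
  by (simp_all add: ad_def algebra_simps)

lemma ad_eq_0: "ad Y = 0 \<longleftrightarrow> (\<exists>c. Y = cst c)"
proof
  assume "ad Y = 0"
  hence "tens Y 1 = tens 1 Y" by (simp add: ad_def)
  hence eq: "mat_of Y $ a $ c * (if d = b then 1 else 0) = (if a = c then 1 else 0) * mat_of Y $ d $ b" for a b c d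
    unfolding sqm_eq_entries by (auto simp: mat_of_1_entry dest: spec[of _ "(a, b)"] dest!: spec[of _ "(c, d)"])
  have "mat_of Y $ a $ c = mat_of (cst (mat_of Y $ undefined $ undefined)) $ a $ c" for a c
    using eq[of a c undefined undefined] by (simp add: mat_of_simps(7) mat_def)
  hence "Y = cst (mat_of Y $ undefined $ undefined)" unfolding sqm_eq_entries by blast
  thus "\<exists>c. Y = cst c" by blast
next
  assume "\<exists>c. Y = cst c"
  then obtain c where "Y = cst c * 1" by auto
  thus "ad Y = 0" by (simp add: ad_def del: mult_1_right)
qed

lemma ad_commute: "ad A * ad B - ad B * ad A = ad (A * B - B * A)"
proof -
  have "tens (A * B - B * A) 1 = tens (A * B) 1 - tens (B * A) 1" "tens 1 (A * B - B * A) = tens 1 (A * B) - tens 1 (B * A)"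
    by (simp_all add: sqm_eq_entries mat_of_simps algebra_simps)
  thus ?thesis by (simp add: ad_def algebra_simps)
qed

lemma tens_ad: "A * B = 1 \<Longrightarrow> B * A = 1 \<Longrightarrow> tens A B * ad Y * tens B A = ad (A * Y * B)"
  by (simp add: ad_def left_diff_distrib right_diff_distrib mult.assoc)

lemma path_D_tens:
  assumes "path_D (\<lambda>t. mat_of (F t)) (mat_of F')" "path_D (\<lambda>t. mat_of (H t)) (mat_of H')"
  shows "path_D (\<lambda>t. mat_of (tens (F t) (H t))) (mat_of (tens F' (H 0) + tens (F 0) H'))"
  using assms by (auto simp: path_D_def mat_of_simps(3) intro: has_D_mult)

lemma path_D_affine: "path_D (\<lambda>t. mat_of (A + cst t * B)) (mat_of B)"
  by (auto simp: path_D_def mat_of_simps(3) intro: has_D_affine)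

text \<open>A function vanishing on \<open>G\<close> vanishes along the curve off the zeros of
  \<open>r\<close>, hence has derivative 0. The polynomial \<open>r\<close> admits rational curves
  that are undefined at some parameters.\<close>

lemma lie_algebra_path:
  fixes G :: "('k::alg_closed_field^'m^'m) set"
  assumes "path_D \<gamma> X" "\<gamma> 0 = mat 1" "poly r 0 \<noteq> 0" "\<And>t. poly r t \<noteq> 0 \<Longrightarrow> \<gamma> t \<in> G"
  shows "X \<in> lie_algebra G"
  unfolding lie_algebra_iff
proof (intro ballI impI)
  fix f :: "'k^'m^'m \<Rightarrow> 'k" assume f: "f \<in> fun_alg mat_entries" "\<forall>A\<in>G. f A = 0"
  have "has_D (\<lambda>t. f (\<gamma> t)) (DD f (\<gamma> 0) X)"
    using f(1) assms(1,2) poly_subset_regular by (intro regular_has_D) auto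
  moreover have "has_D (\<lambda>t. f (\<gamma> t)) 0"
    using f(2) assms(4) by (intro has_D_cong[OF has_D_const assms(3)]) simp
  ultimately show "DD f (mat 1) X = 0" using has_D_unique assms(2) by metis
qed

context char2
begin

definition isometries :: "('k, 'n::finite + 'n) sqm set" where
  "isometries = {A. star A * A = 1}"

lemma Sp_eq: "Sp = mat_of ` (isometries :: ('k, 'n::finite + 'n) sqm set)"
proof -
  have J: "symp_form $ i $ j = (if i = sw j then 1 else 0 :: 'k)" for i j :: "'n + 'n"
    by (auto simp: symp_form_def sw_def split: sum.split)
  have iff: "A \<in> Sp \<longleftrightarrow> star (sqm_of A) * sqm_of A = 1" for A :: "'k^('n + 'n)^('n + 'n)"
  proof -
    have 1: "(transpose A ** symp_form ** A) $ i $ j = (\<Sum>k\<in>UNIV. A $ sw k $ i * A $ k $ j)" for i j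
      by (simp add: matrix_matrix_mult_def transpose_def J if_distrib[of "\<lambda>x. _ * x"] cong: if_cong)
    have 2: "mat_of (star (sqm_of A) * sqm_of A) $ i $ j = (\<Sum>k\<in>UNIV. A $ sw k $ sw i * A $ k $ j)" for i j
      by (simp add: mat_of_simps matrix_matrix_mult_def)
    have "A \<in> Sp \<longleftrightarrow> (\<forall>i j. (\<Sum>k\<in>UNIV. A $ sw k $ i * A $ k $ j) = (if i = sw j then 1 else 0))"
      by (simp add: Sp_def vec_eq_iff 1 J)
    also have "\<dots> \<longleftrightarrow> (\<forall>i j. (\<Sum>k\<in>UNIV. A $ sw k $ sw i * A $ k $ j) = (if sw i = sw j then 1 else 0))"
      by (rule all_sw)
    also have "\<dots> \<longleftrightarrow> star (sqm_of A) * sqm_of A = 1"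
      by (simp add: sqm_eq_entries 2 mat_of_1_entry)
    finally show ?thesis .
  qed
  show ?thesis
  proof (intro set_eqI iffI)
    fix A :: "'k^('n + 'n)^('n + 'n)" assume "A \<in> Sp"
    hence "mat_of (sqm_of A) \<in> mat_of ` isometries" by (intro imageI) (simp add: iff isometries_def)
    thus "A \<in> mat_of ` isometries" by simp
  next
    fix A :: "'k^('n + 'n)^('n + 'n)" assume "A \<in> mat_of ` isometries"
    thus "A \<in> Sp" by (auto simp: iff isometries_def)
  qed
qed

lemma isometry_inverse:
  assumes "A \<in> isometries"
  shows "star A * A = 1" "A * star A = 1" "matrix_inv (mat_of A) = mat_of (star A)" "star A \<in> isometries"
proof -
  show 1: "star A * A = 1" "A * star A = 1" using assms sqm_left_right_inverse by (auto simp: isometries_def)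
  thus "star A \<in> isometries" by (simp add: isometries_def)
  show "matrix_inv (mat_of A) = mat_of (star A)"
    using 1(2) by (intro matrix_inv_eq) (simp add: sqm_eq_iff mat_of_simps)
qed

definition conj_map :: "('k, 'n::finite + 'n) sqm \<Rightarrow> ('k, ('n + 'n) \<times> ('n + 'n)) sqm" where
  "conj_map A = tens A (star A)"

lemma conj_rep_isometry: "A \<in> isometries \<Longrightarrow> conj_rep (mat_of A) = mat_of (conj_map A)"
  by (simp add: conj_rep_def conj_map_def vec_eq_iff isometry_inverse)

lemma PSp_eq: "PSp = mat_of ` conj_map ` (isometries :: ('k, 'n::finite + 'n) sqm set)"
  unfolding PSp_def Sp_eq image_image by (rule image_cong) (simp_all add: conj_rep_isometry)

lemma conj_map_mult: "conj_map (A * B) = conj_map A * conj_map B" and conj_map_1: "conj_map 1 = 1"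
  by (simp_all add: conj_map_def)

text \<open>Symmetric tensors are spanned by squares, because \<open>rk x z + rk z x\<close> is the
  sum of \<open>rk (x + z) (x + z)\<close>, \<open>rk x x\<close> and \<open>rk z z\<close>.
  Tangency statements are thereby reduced to the directions of transvections.\<close>

lemma symmetric_induct [consumes 1, case_names zero add rk]:
  assumes "star X = (X :: ('k, 'n::finite + 'n) sqm)" and "P 0" "\<And>A B. P A \<Longrightarrow> P B \<Longrightarrow> P (A + B)"
    and rk: "\<And>c w. P (cst c * rk w w)"
  shows "P X"
proof -
  define s where "s i j = mat_of X $ i $ sw j" for i j
  have s: "s i j = s j i" for i j
    using assms(1) unfolding sqm_eq_entries s_def by (metis mat_of_star sw_sw)
  have two: "P (cst c * rk x z + cst c * rk z x)" for c x z
  proof -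
    have "rk (x + z) (x + z) = rk x x + rk z z + (rk x z + rk z x)"
      by (rule sqm_eqI) (simp add: vec.scale_left_distrib vec.scale_right_distrib ac_simps)
    hence "cst c * rk (x + z) (x + z) + (cst c * rk x x + cst c * rk z z) = cst c * rk x z + cst c * rk z x"
      by (simp add: distrib_left ac_simps)
    thus ?thesis using assms(3)[OF rk assms(3)[OF rk rk]] by metis
  qed
  define R where "R i j = cst (s i j) * rk (axis i 1) (axis j (1 :: 'k))" for i j
  have sum: "P (sum f I)" if "\<And>i. i \<in> I \<Longrightarrow> P (f i)" for f and I :: "('n + 'n) set"
    using that by (induction I rule: infinite_finite_induct) (auto intro: assms(2,3))
  have "P (\<Sum>i\<in>I. \<Sum>j\<in>I. R i j)" if "finite I" for I
    using that
  proof (induction I rule: finite_induct)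
    case (insert a I)
    have "(\<Sum>i\<in>insert a I. \<Sum>j\<in>insert a I. R i j) = R a a + (\<Sum>i\<in>I. R a i + R i a) + (\<Sum>i\<in>I. \<Sum>j\<in>I. R i j)"
      using insert.hyps by (simp add: sum.distrib ac_simps)
    moreover have "P (R a a)" by (simp add: R_def rk)
    moreover have "P (\<Sum>i\<in>I. R a i + R i a)" using two by (intro sum) (simp add: R_def s[of _ a])
    ultimately show ?case using insert.IH assms(3) by simp
  qed (simp add: assms(2))
  from this[OF finite] have "P (\<Sum>i\<in>UNIV. \<Sum>j\<in>UNIV. R i j)" .
  also have "(\<Sum>i\<in>UNIV. \<Sum>j\<in>UNIV. R i j) = X"
  proof -
    have m: "mat_of (sum f I) $ a $ b = (\<Sum>i\<in>I. mat_of (f i) $ a $ b)" for f :: "'n + 'n \<Rightarrow> ('k, 'n + 'n) sqm" and I a b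
      by (induction I rule: infinite_finite_induct) (simp_all add: mat_of_simps)
    have "mat_of (\<Sum>i\<in>UNIV. \<Sum>j\<in>UNIV. R i j) $ a $ b = mat_of X $ a $ b" for a b
    proof -
      have "mat_of (\<Sum>i\<in>UNIV. \<Sum>j\<in>UNIV. R i j) $ a $ b = (\<Sum>i\<in>UNIV. \<Sum>j\<in>UNIV. if i = a then if j = sw b then s i j else 0 else 0)"
        unfolding m by (intro sum.cong refl) (auto simp: R_def rk_def axis_def)
      also have "\<dots> = (\<Sum>i\<in>UNIV. if i = a then \<Sum>j\<in>UNIV. if j = sw b then s i j else 0 else 0)"
        by (intro sum.cong refl) simp
      finally show ?thesis by (simp add: s_def)
    qed
    thus ?thesis by (simp add: sqm_eq_entries)
  qed
  finally show ?thesis .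
qed

lemma transvection:
  fixes w :: "'k^('n::finite + 'n)"
  shows "1 + cst t * (cst c * rk w w) \<in> isometries" "star (1 + cst t * (cst c * rk w w)) = 1 + cst t * (cst c * rk w w)"
proof -
  define R where "R = cst c * rk w w"
  have R: "star R = R" "R * R = 0"
    unfolding R_def by (simp only: star_simps star_rk cst_commute, simp add: mult.assoc cst_left rk_mult_rk)
  show s: "star (1 + cst t * (cst c * rk w w)) = 1 + cst t * (cst c * rk w w)"
    unfolding R_def[symmetric] by (simp only: star_simps R cst_commute[of t])
  have "(cst t * R) * (cst t * R) = 0" by (simp only: mult.assoc cst_left R mult_zero_right)
  thus "1 + cst t * (cst c * rk w w) \<in> isometries"
    unfolding isometries_def mem_Collect_eq s unfolding R_def[symmetric]
    by (simp only: distrib_left distrib_right mult_1_left mult_1_right add.assoc add_self_left add_0_right add_self)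
qed

text \<open>Differentiating the entries of \<open>star A * A = 1\<close> gives self-adjointness;
  conversely each \<open>cst c * rk w w\<close> is tangent to a line of transvections inside
  \<open>Sp\<close>.\<close>

lemma lie_algebra_Sp: "lie_algebra Sp = mat_of ` {X :: ('k, 'n::finite + 'n) sqm. star X = X}"
proof (intro set_eqI iffI)
  fix Z :: "'k^('n + 'n)^('n + 'n)"
  assume Z: "Z \<in> lie_algebra Sp"
  have "Z $ i $ j = Z $ sw j $ sw i" for i j
  proof -
    let ?f = "\<lambda>A. (\<Sum>k\<in>UNIV. A $ sw k $ sw i * A $ k $ j) - (if i = j then 1 else 0) :: 'k"
    have r: "(\<lambda>A. \<Sum>k\<in>UNIV. A $ sw k $ sw i * A $ k $ j) \<in> GL_regular" by (intro regular_sum regular_intros) simp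
    have f: "?f \<in> fun_alg mat_entries"
      by (intro fun_alg_diff fun_alg_sum fun_alg.mult fun_alg.const entry_in_poly) simp
    have "?f A = 0" if "A \<in> Sp" for A
    proof -
      obtain B where B: "star B * B = 1" "A = mat_of B" using \<open>A \<in> Sp\<close> unfolding Sp_eq isometries_def by blast
      hence "mat_of (star B * B) $ i $ j = mat_of 1 $ i $ j" by simp
      thus ?thesis by (simp add: B(2) mat_of_simps(6) matrix_matrix_mult_def mat_of_1_entry)
    qed
    hence "DD ?f (mat 1) Z = 0" using Z f by (simp add: lie_algebra_iff)
    also have "DD ?f (mat 1) Z = (\<Sum>k\<in>UNIV. Z $ sw k $ sw i * mat 1 $ k $ j + mat 1 $ sw k $ sw i * Z $ k $ j)"
      by (simp only: DD_diff[OF GL_1 r regular_intros(6)] DD_const[OF GL_1] DD_sum[OF GL_1] regular_intros DD_mult[OF GL_1] DD_entry[OF GL_1])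
        (simp add: DD_sum[OF GL_1] regular_intros DD_mult[OF GL_1] DD_entry[OF GL_1])
    also have "\<dots> = Z $ sw j $ sw i + Z $ i $ j"
      by (simp add: sum.distrib mat_def if_distrib[of "\<lambda>x. _ * x"] if_distrib[of "\<lambda>x. x * _"] cong: if_cong)
    finally show ?thesis by simp
  qed
  hence "star (sqm_of Z) = sqm_of Z" by (simp add: sqm_eq_entries)
  thus "Z \<in> mat_of ` {X. star X = X}" by (metis (mono_tags) mem_Collect_eq imageI mat_of_sqm_of)
next
  fix Z :: "'k^('n + 'n)^('n + 'n)" assume "Z \<in> mat_of ` {X. star X = X}"
  then obtain X where X: "star X = X" "Z = mat_of X" by blast
  have "mat_of X \<in> lie_algebra Sp" using X(1)
  proof (induction rule: symmetric_induct)
    case zero show ?case by (simp add: mat_of_simps mat_space.subspace_0[OF lie_algebra_subspace])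
  next
    case (add A B) thus ?case by (simp add: mat_of_simps mat_space.subspace_add[OF lie_algebra_subspace])
  next
    case (rk c w)
    show ?case
    proof (rule lie_algebra_path[where r = 1 and \<gamma> = "\<lambda>t. mat_of (1 + cst t * (cst c * rk w w))"])
      show "mat_of (1 + cst t * (cst c * rk w w)) \<in> Sp" for t
        unfolding Sp_eq by (rule imageI) (rule transvection)
    qed (simp_all add: path_D_affine mat_of_simps(2) del: cst_simps(2))
  qed
  thus "Z \<in> lie_algebra Sp" using X(2) by simp
qed

lemma ad_symmetric_in_lie_algebra:
  assumes "star X = (X :: ('k, 'n::finite + 'n) sqm)" shows "mat_of (ad X) \<in> lie_algebra PSp"
  using assms
proof (induction rule: symmetric_induct)
  case zero show ?case by (simp add: ad_linear mat_of_simps mat_space.subspace_0[OF lie_algebra_subspace])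
next
  case (add A B) thus ?case by (simp add: ad_linear mat_of_simps mat_space.subspace_add[OF lie_algebra_subspace])
next
  case (rk c w)
  let ?F = "\<lambda>t. 1 + cst t * (cst c * rk w w)"
  have "ad (cst c * rk w w) = tens (cst c * rk w w) (?F 0) + tens (?F 0) (cst c * rk w w)" by (simp add: ad_def)
  moreover have "mat_of (tens (?F t) (?F t)) \<in> PSp" for t
    unfolding PSp_eq using transvection[of t c w] by (auto simp: conj_map_def image_iff intro!: bexI[of _ "?F t"])
  moreover have "path_D (\<lambda>t. mat_of (tens (?F t) (?F t))) (mat_of (tens (cst c * rk w w) (?F 0) + tens (?F 0) (cst c * rk w w)))"
    by (rule path_D_tens[OF path_D_affine path_D_affine])
  ultimately show ?case
    by (intro lie_algebra_path[where r = 1 and \<gamma> = "\<lambda>t. mat_of (tens (?F t) (?F t))"]) (simp_all add: mat_of_simps(2))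
qed

lemma star_mult_cst: "star (cst s * A) * (cst s * A) = cst s * (cst s * (star A * A))"
  by (simp only: star_simps(3,4) mult.assoc cst_left[of "star A"])

text \<open>The projection onto a coordinate Lagrangian. It is a similitude with multiplier 1, and
  together with the self-adjoint operators it spans \<open>similitudes\<close>.\<close>

definition half :: "('k, 'n::finite + 'n) sqm" where
  "half = sqm_of (\<chi> i j. if i = j \<and> isl i then 1 else 0)"

lemma half: "half * half = (half :: ('k, 'n::finite + 'n) sqm)" "star half = 1 + (half :: ('k, 'n + 'n) sqm)"
  "star half * (half :: ('k, 'n + 'n) sqm) = 0"
proof -
  have "app half x $ i = (if isl i then x $ i else 0)" for x :: "'k^('n + 'n)" and i
  proof -
    have "app half x $ i = (\<Sum>j\<in>UNIV. if j = i then if isl i then x $ i else 0 else 0)"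
      by (simp only: app_def matrix_vector_mult_def half_def mat_of_sqm_of vec_lambda_beta, intro sum.cong refl) auto
    thus ?thesis by simp
  qed
  hence 1: "half * half = (half :: ('k, 'n + 'n) sqm)" by (intro sqm_eqI) (simp add: vec_eq_iff)
  thus "half * half = (half :: ('k, 'n + 'n) sqm)" .
  show 2: "star half = 1 + (half :: ('k, 'n + 'n) sqm)"
    by (auto simp: sqm_eq_entries mat_of_simps(3) half_def mat_of_1_entry sw_def split: sum.split)
  show "star half * (half :: ('k, 'n + 'n) sqm) = 0" by (simp add: 2 distrib_right 1)
qed

text \<open>\<open>?F t\<close> is a similitude with multiplier \<open>1 + t\<close>; divided by a
  square root of the multiplier it becomes an isometry. The root is not rational in
  \<open>t\<close>, but it cancels in \<open>conj_map\<close>, so the curve in \<open>PSp\<close> is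
  rational.\<close>

lemma ad_half_in_lie_algebra: "mat_of (ad half) \<in> lie_algebra (PSp :: ('k^(('n::finite + 'n) \<times> ('n + 'n))^_) set)"
proof -
  let ?F = "\<lambda>t. 1 + cst t * half :: ('k, 'n + 'n) sqm"
  \<comment> \<open>This is \<open>t / (1 + t)\<close>, so that \<open>?H t\<close> is the inverse
    of \<open>?F t\<close>, \<open>half\<close> being idempotent.\<close>
  let ?g = "\<lambda>t. inverse (1 + t * 1) + 1 :: 'k"
  let ?H = "\<lambda>t. 1 + cst (?g t) * half :: ('k, 'n + 'n) sqm"
  have g: "has_D ?g 1" using has_D_add[OF has_D_inverse[OF has_D_affine[of "1 :: 'k" 1]] has_D_const[of 1]] by simp
  have "path_D (\<lambda>t. mat_of (?H t)) (mat_of half)"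
    unfolding path_D_def mat_of_simps(3) vector_add_component mat_of_cst_mult_entry
  proof (intro allI)
    fix i j :: "'n + 'n"
    show "has_D (\<lambda>t. mat_of 1 $ i $ j + (inverse (1 + t * 1) + 1) * mat_of half $ i $ j) (mat_of half $ i $ j)"
      using has_D_add[OF has_D_const has_D_mult[OF g has_D_const], of "mat_of 1 $ i $ j" "mat_of half $ i $ j"] by simp
  qed
  from path_D_tens[OF path_D_affine this, of 1 half]
  have p: "path_D (\<lambda>t. mat_of (tens (?F t) (?H t))) (mat_of (ad half))" by (simp add: ad_def)
  have "mat_of (tens (?F t) (?H t)) \<in> PSp" if t: "1 + t \<noteq> 0" for t
  proof -
    have "[:inverse (1 + t), 0, 1:] \<noteq> 0" "degree [:inverse (1 + t), 0, 1:] = 2" by simp_all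
    then obtain s where "poly [:inverse (1 + t), 0, 1:] s = 0" using alg_closed_imp_poly_has_root[of "[:inverse (1 + t), 0, 1:]"] by auto
    hence "inverse (1 + t) = s * s" by (simp del: inverse_eq_iff_eq)
    hence s: "s * s = inverse (1 + t)" by (rule sym)
    hence s1: "s * s * (1 + t) = 1" using t by simp
    define A where "A = cst s * ?F t"
    have "star (?F t) = cst (1 + t) * ?H t"
    proof -
      have "(1 + t) * (inverse (1 + t) + 1) = t" using t by (simp add: distrib_left distrib_right) (simp add: field_simps)
      hence "cst (1 + t) * ?H t = cst (1 + t) + cst t * half"
        by (simp only: distrib_left mult_1_right mult.assoc[symmetric] cst_simps(2)[symmetric])
      moreover have "star (?F t) = cst (1 + t) + cst t * half"
        by (simp add: half(2) distrib_left distrib_right cst_commute[of t] add.assoc)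
      ultimately show ?thesis by (simp only:)
    qed
    moreover have "star A = cst s * star (?F t)" by (simp only: A_def star_simps cst_commute[of s])
    ultimately have sA: "star A = cst (s * (1 + t)) * ?H t" by (simp only: cst_simps(2) mult.assoc)
    have "star (?F t) * ?F t = cst (1 + t)"
    proof -
      have 1: "star half * (cst t * half) = (0 :: ('k, 'n + 'n) sqm)" by (simp only: cst_left half(3) mult_zero_right)
      have "star (?F t) = 1 + cst t * star half" by (simp only: star_simps cst_commute[of t])
      hence "star (?F t) * ?F t = 1 + cst t * star half + (cst t * half + cst t * (star half * (cst t * half)))"
        by (simp only: distrib_left distrib_right mult_1_left mult_1_right mult.assoc)
      also have "\<dots> = cst (1 + t)" unfolding 1 unfolding half(2) by (simp add: distrib_left ac_simps)
      finally show ?thesis .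
    qed
    moreover have "star A * A = cst s * (cst s * (star (?F t) * ?F t))"
      unfolding A_def by (rule star_mult_cst)
    ultimately have "star A * A = cst (s * s * (1 + t))" by (simp only: cst_simps(2) mult.assoc)
    hence "A \<in> isometries" by (simp add: isometries_def s1)
    moreover have "conj_map A = tens (?F t) (?H t)"
    proof -
      have "conj_map A = cst s * tens (?F t) (cst (s * (1 + t)) * ?H t)"
        unfolding conj_map_def sA unfolding A_def by (rule tens_simps(3))
      also have "\<dots> = cst (s * s * (1 + t)) * tens (?F t) (?H t)"
        unfolding tens_simps(4) by (simp only: cst_simps(2) mult.assoc)
      finally show ?thesis by (simp only: s1 cst_simps(4) mult_1_left)
    qed
    ultimately show ?thesis unfolding PSp_eq by (metis imageI)
  qed
  hence PS: "mat_of (tens (?F t) (?H t)) \<in> PSp" if "poly [:1, 1:] t \<noteq> 0" for t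
    using \<open>poly [:1, 1:] t \<noteq> 0\<close> by simp
  show ?thesis by (rule lie_algebra_path[OF p, where r = "[:1, 1:]", OF _ _ PS]) (simp_all add: mat_of_simps(2))
qed

definition similitudes :: "('k, 'n::finite + 'n) sqm set" where
  "similitudes = {Y. \<exists>c. Y + star Y = cst c}"

text \<open>Upward, a similitude with multiplier \<open>c\<close> becomes self-adjoint after adding
  \<open>cst c * half\<close>, so both kinds of tangent vectors found above suffice. Downward, two
  families of equations of \<open>PSp\<close> are differentiated.\<close>

lemma lie_algebra_PSp: "lie_algebra PSp = mat_of ` ad ` (similitudes :: ('k, 'n::finite + 'n) sqm set)"
proof (intro set_eqI iffI)
  fix Z :: "'k^(('n + 'n) \<times> ('n + 'n))^(('n + 'n) \<times> ('n + 'n))"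
  assume Z: "Z \<in> lie_algebra PSp"
  define o' :: "'n + 'n" where "o' = undefined"
  define Y where "Y a c = Z $ (a, sw o') $ (c, sw o')" for a c
  define w where "w = Z $ (o', sw o') $ (o', sw o')"
  \<comment> \<open>At a point of \<open>PSp\<close> the entry at \<open>(a, sw a')\<close>,
    \<open>(c, sw c')\<close> is a product of two entries of \<open>A\<close>. The quadratic
    relations satisfied by such arrays, taken relative to the base index \<open>o'\<close>, are
    differentiated at 1.\<close>
  have 1: "Z $ (a, sw a') $ (c, sw c') = Y a c * mat 1 $ a' $ c' + mat 1 $ a $ c * Y a' c' + mat 1 $ a $ c * mat 1 $ a' $ c' * w"
    for a c a' c'
  proof -
    let ?g = "\<lambda>M :: 'k^(('n + 'n) \<times> ('n + 'n))^(('n + 'n) \<times> ('n + 'n)). M $ (a, sw o') $ (c, sw o') * M $ (a', sw o') $ (c', sw o')"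
    let ?h = "\<lambda>M :: 'k^(('n + 'n) \<times> ('n + 'n))^(('n + 'n) \<times> ('n + 'n)). M $ (a, sw a') $ (c, sw c') * M $ (o', sw o') $ (o', sw o')"
    have "(\<lambda>M. ?g M - ?h M) M = 0" if "M \<in> PSp" for M
    proof -
      obtain A where "M = mat_of (tens A (star A))" using \<open>M \<in> PSp\<close> unfolding PSp_eq conj_map_def by blast
      thus ?thesis by (simp add: ac_simps)
    qed
    moreover have "(\<lambda>M. ?g M - ?h M) \<in> fun_alg mat_entries"
      by (intro fun_alg_diff fun_alg.mult entry_in_poly)
    ultimately have "DD (\<lambda>M. ?g M - ?h M) (mat 1) Z = 0" using Z by (simp add: lie_algebra_iff)
    hence "DD ?g (mat 1) Z = DD ?h (mat 1) Z" by (subst (asm) DD_diff) (auto intro: regular_intros)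
    hence "Z $ (a, sw a') $ (c, sw c') * mat 1 $ (o', sw o') $ (o', sw o') + mat 1 $ (a, sw a') $ (c, sw c') * w
      = Y a c * mat 1 $ (a', sw o') $ (c', sw o') + mat 1 $ (a, sw o') $ (c, sw o') * Y a' c'"
      by (simp add: DD_mult[OF GL_1] DD_entry[OF GL_1] regular_intros Y_def w_def)
    hence "Z $ (a, sw a') $ (c, sw c') + mat 1 $ a $ c * mat 1 $ a' $ c' * w = Y a c * mat 1 $ a' $ c' + mat 1 $ a $ c * Y a' c'"
      by (simp add: mat_def split: if_splits)
    moreover have "Z $ (a, sw a') $ (c, sw c') =
      (Z $ (a, sw a') $ (c, sw c') + mat 1 $ a $ c * mat 1 $ a' $ c' * w) + mat 1 $ a $ c * mat 1 $ a' $ c' * w"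
      by (simp add: add.assoc)
    ultimately show ?thesis by (simp only:)
  qed
  \<comment> \<open>The derivative of the contraction expressing
    \<open>star A * A = 1\<close>.\<close>
  have 2: "(\<Sum>a\<in>UNIV. Z $ (a, a) $ (c, d)) = 0" for c d
  proof -
    let ?g = "\<lambda>M :: 'k^(('n + 'n) \<times> ('n + 'n))^(('n + 'n) \<times> ('n + 'n)). \<Sum>a\<in>UNIV. M $ (a, a) $ (c, d)"
    have r: "?g \<in> GL_regular" by (intro regular_sum regular_intros) simp
    have "?g M - mat 1 $ d $ c = 0" if "M \<in> PSp" for M
    proof -
      obtain A where A: "star A * A = 1" "M = mat_of (tens A (star A))"
        using \<open>M \<in> PSp\<close> unfolding PSp_eq conj_map_def isometries_def by blast
      from A(1) have "mat_of (star A * A) $ d $ c = mat_of 1 $ d $ c" by simp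
      thus ?thesis by (simp add: A(2) mat_of_simps matrix_matrix_mult_def mult.commute)
    qed
    moreover have "(\<lambda>M. ?g M - mat 1 $ d $ c) \<in> fun_alg mat_entries"
      by (intro fun_alg_diff fun_alg_sum fun_alg.const entry_in_poly) simp
    ultimately have "DD (\<lambda>M. ?g M - mat 1 $ d $ c) (mat 1) Z = 0" using Z by (simp add: lie_algebra_iff)
    hence "DD ?g (mat 1) Z = 0" using r by (subst (asm) DD_diff) (auto intro: regular_intros simp: DD_const[OF GL_1])
    thus ?thesis by (simp add: DD_sum[OF GL_1] DD_entry[OF GL_1] regular_intros)
  qed
  have 3: "Y d b = Y (sw b) (sw d) + mat 1 $ b $ d * w" for b d
  proof -
    have "(\<Sum>a\<in>UNIV. Z $ (a, sw (sw a)) $ (b, sw (sw d))) = 0" using 2[of b d] by simp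
    hence "(\<Sum>a\<in>UNIV. Y a b * mat 1 $ sw a $ sw d) + (\<Sum>a\<in>UNIV. mat 1 $ a $ b * Y (sw a) (sw d))
       + (\<Sum>a\<in>UNIV. mat 1 $ a $ b * (mat 1 $ sw a $ sw d * w)) = 0"
      unfolding 1 by (simp only: sum.distrib mult.assoc)
    moreover have "(\<Sum>a\<in>UNIV. mat 1 $ a $ b * f a) = f b" for f :: "'n + 'n \<Rightarrow> 'k"
      by (simp add: mat_def if_distrib[of "\<lambda>x. x * _"] cong: if_cong)
    moreover have "(\<Sum>a\<in>UNIV. Y a b * mat 1 $ sw a $ sw d) = Y d b"
      by (simp add: mat_def if_distrib[of "\<lambda>x. _ * x"] cong: if_cong)
    ultimately have "Y d b + Y (sw b) (sw d) + mat 1 $ sw b $ sw d * w = 0" by (simp only:)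
    thus ?thesis by (simp add: mat_def add.assoc)
  qed
  let ?Y = "sqm_of (\<chi> a c. Y a c)"
  have "?Y + star ?Y = cst w"
    unfolding sqm_eq_entries
  proof (intro allI)
    fix i j
    have aux: "x + z + x = z" for x z :: 'k by (simp only: add.commute[of "x + z" x] add_self_left)
    have "mat_of (?Y + star ?Y) $ i $ j = Y i j + Y (sw j) (sw i)" by (simp add: mat_of_simps)
    also have "\<dots> = mat 1 $ j $ i * w" by (subst 3[of i j]) (rule aux)
    finally show "mat_of (?Y + star ?Y) $ i $ j = mat_of (cst w) $ i $ j" by (simp add: mat_of_simps mat_def)
  qed
  moreover have "Z = mat_of (ad ?Y)"
  proof (simp add: vec_eq_iff, intro allI)
    fix a b c d
    show "Z $ (a, b) $ (c, d) = mat_of (ad ?Y) $ (a, b) $ (c, d)"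
      using 1[of a "sw b" c "sw d"] 3[of d b] by (auto simp: ad_def mat_of_simps(3) mat_of_1_entry mat_def)
  qed
  ultimately show "Z \<in> mat_of ` ad ` similitudes" unfolding similitudes_def by blast
next
  fix Z :: "'k^(('n + 'n) \<times> ('n + 'n))^(('n + 'n) \<times> ('n + 'n))"
  assume "Z \<in> mat_of ` ad ` similitudes"
  then obtain Y c where Y: "Y + star Y = cst c" "Z = mat_of (ad Y)" unfolding similitudes_def by blast
  have "star Y = Y + (Y + star Y)" by simp
  hence "star Y = Y + cst c" by (simp only: Y(1))
  hence "star (Y + cst c * half) = Y + cst c * half" by (simp add: cst_commute half(2) distrib_left add.assoc)
  hence "mat_of (ad (Y + cst c * half)) \<in> lie_algebra PSp" by (rule ad_symmetric_in_lie_algebra)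
  hence "mat_of (ad (Y + cst c * half)) - mat_scale c (mat_of (ad half)) \<in> lie_algebra PSp"
    by (intro mat_space.subspace_diff lie_algebra_subspace mat_space.subspace_scale ad_half_in_lie_algebra)
  thus "Z \<in> lie_algebra PSp" by (simp add: Y(2) ad_linear mat_of_simps(3) mat_of_cst_mult)
qed

end

subsection \<open>Centralizers in \<open>Sp\<close> and \<open>PSp\<close>\<close>

text \<open>Iterated squaring, the power with exponent \<open>2 ^ k\<close>. Homomorphisms commute
  with it, and so do differentials in characteristic two.\<close>

definition msq :: "nat \<Rightarrow> 'k::field^'m^'m \<Rightarrow> 'k^'m^'m" where
  "msq k A = ((\<lambda>B. B ** B) ^^ k) A"

lemma msq_simps: "msq 0 A = A" "msq (Suc k) A = msq k A ** msq k A"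
  by (simp_all add: msq_def)

lemma msq_mat_of: "msq k (mat_of A) = mat_of (A ^ 2 ^ k)"
  by (induction k) (simp_all add: msq_simps mat_of_simps mult_2 power_add)

lemma nilpotent_mat_iff: "nilpotent_mat A \<longleftrightarrow> (\<exists>k. msq k A = 0)"
proof -
  have pow: "(((**) A) ^^ n) (mat 1) = mat_of (sqm_of A ^ n)" for n
    by (induction n) (simp_all add: mat_of_simps)
  have sq: "msq k A = mat_of (sqm_of A ^ 2 ^ k)" for k using msq_mat_of[of k "sqm_of A"] by simp
  have "(\<exists>n. sqm_of A ^ n = 0) \<longleftrightarrow> (\<exists>k. sqm_of A ^ 2 ^ k = 0)"
  proof
    assume "\<exists>n. sqm_of A ^ n = 0"
    then obtain n where n: "sqm_of A ^ n = 0" by blast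
    have "sqm_of A ^ 2 ^ n = sqm_of A ^ (2 ^ n - n) * sqm_of A ^ n" using less_exp[of n] by (simp flip: power_add)
    thus "\<exists>k. sqm_of A ^ 2 ^ k = 0" using n by auto
  qed blast
  thus ?thesis by (simp add: nilpotent_mat_def pow sq sqm_eq_iff mat_of_simps)
qed

lemma conj_fix_iff:
  assumes "A ** B = mat (1 :: 'k::field)"
  shows "A ** X ** matrix_inv A = X \<longleftrightarrow> A ** X = X ** A"
proof -
  have 1: "matrix_inv A = B" using assms by (rule matrix_inv_eq)
  have 2: "B ** A = mat 1" using assms by (rule matrix_left_right_inverse1)
  show ?thesis unfolding 1
    by (metis 2 assms matrix_mul_assoc matrix_mul_rid)
qed

lemma pair_mat_regular: "pair_mat C \<in> GL_regular"
  unfolding pair_mat_def[abs_def] by (intro regular_sum regular_intros) simp_all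

text \<open>The kernel of \<open>ad\<close> is the line of scalars, contained in \<open>S\<close> by
  assumption.\<close>

lemma dim_ad:
  assumes S: "sq_subspace (S :: ('k::field, 'i::finite) sqm set)" and cst: "\<And>c. cst c \<in> S"
  shows "mat_space.dim (mat_of ` S) = mat_space.dim (mat_of ` ad ` S) + 1"
proof -
  define f where "f M = mat_of (ad (sqm_of M))" for M :: "'k^'i^'i"
  have eq: "sqm_of (A + B) = sqm_of A + sqm_of B" "sqm_of (mat_scale c A) = cst c * sqm_of A" for A B :: "'k^'i^'i" and c
    by (simp_all add: sqm_eq_iff mat_of_simps(3) mat_of_cst_mult)
  have lin: "Vector_Spaces.linear mat_scale mat_scale f"
    by (rule linear_matI[OF mat_space.vector_space_axioms]) (simp_all add: f_def eq ad_linear mat_of_simps(3) mat_of_cst_mult)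
  have "f ` mat_of ` S = mat_of ` ad ` S" by (simp add: image_image f_def)
  moreover have "{x \<in> mat_of ` S. f x = 0} = mat_space.span {mat 1}"
  proof -
    have "f (mat_of A) = 0 \<longleftrightarrow> (\<exists>c. A = cst c)" for A
      using ad_eq_0[of A] by (simp add: f_def sqm_eq_iff[of "ad A"] mat_of_simps(1))
    hence "{x \<in> mat_of ` S. f x = 0} = range (\<lambda>c. mat_of (cst c))" using cst by auto
    also have "(\<lambda>c. mat_of (cst c)) = (\<lambda>c. mat_scale c (mat 1 :: 'k^'i^'i))"
      by (simp add: fun_eq_iff mat_of_simps mat_scale_def mat_def vec_eq_iff)
    finally show ?thesis by (simp add: mat_space.span_singleton)
  qed
  moreover have "mat_space.dim (mat_space.span {mat 1 :: 'k^'i^'i}) = 1"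
  proof -
    have "mat 1 \<noteq> (0 :: 'k^'i^'i)" by (simp add: mat_def vec_eq_iff)
    hence "mat_space.independent {mat 1 :: 'k^'i^'i}" by (simp add: mat_space.dependent_single)
    thus ?thesis by (subst mat_space.dim_span_eq_card_independent) simp_all
  qed
  ultimately show ?thesis using mat_mat.dim_image_kernel[OF lin subspace_mat_of[OF S]] by simp
qed

context char2
begin

lemma square_add: "A * B = B * A \<Longrightarrow> (A + B) ^ 2 ^ k = (A ^ 2 ^ k + B ^ 2 ^ k :: ('k, 'i::finite) sqm)"
proof (induction k)
  case (Suc k)
  have c: "A ^ 2 ^ k * B ^ 2 ^ k = B ^ 2 ^ k * A ^ 2 ^ k" using Suc.prems by (metis power_commuting_commutes)
  have "(A + B) ^ 2 ^ Suc k = (A ^ 2 ^ k + B ^ 2 ^ k) * (A ^ 2 ^ k + B ^ 2 ^ k)"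
    using Suc by (simp add: mult_2 power_add)
  also have "\<dots> = A ^ 2 ^ Suc k + B ^ 2 ^ Suc k"
    by (simp add: mult_2 power_add distrib_left distrib_right c add.assoc)
  finally show ?case .
qed simp

lemma ad_square: "ad (Y :: ('k, 'i::finite) sqm) * ad Y = ad (Y * Y)"
  by (simp add: ad_def distrib_left distrib_right add.assoc)

lemma ad_power: "ad (Y :: ('k, 'i::finite) sqm) ^ 2 ^ k = ad (Y ^ 2 ^ k)"
  by (induction k) (simp_all add: mult_2 power_add ad_square)

lemma sqrt_exists: "\<exists>s. s * s = (c :: 'k)"
proof -
  obtain s where "poly [:c, 0, 1:] s = 0" using alg_closed_imp_poly_has_root[of "[:c, 0, 1:]"] by auto
  hence "c = s * s" by simp
  thus ?thesis by metis
qed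

lemma sqrt_power_exists: "\<exists>s. s ^ 2 ^ k = (c :: 'k)"
proof (induction k)
  case (Suc k)
  then obtain s t where "s ^ 2 ^ k = c" "t * t = s" using sqrt_exists by metis
  hence "t ^ 2 ^ Suc k = c" by (simp add: power_mult power2_eq_square)
  thus ?case by blast
qed simp

text \<open>The common shape of the families from \<open>fat 1\<close> and
  \<open>nilpotent_fat\<close>, matching the criterion \<open>alg_dim_geI\<close>.\<close>

definition wide :: "('k, 'n::finite + 'n) sqm set \<Rightarrow> bool" where
  "wide X \<longleftrightarrow> (\<exists>\<kappa>. \<forall>c. (\<forall>i<CARD('n) + 1. c i \<noteq> 0) \<longrightarrow>
     (\<exists>A\<in>X. \<forall>i<CARD('n) + 1. pair_mat (\<kappa> i) (mat_of A) = c (i :: nat)))"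

lemma alg_dim_wide:
  assumes "wide (X :: ('k, 'n::finite + 'n) sqm set)"
  shows "enat (CARD('n) + 1) \<le> alg_dim (mat_of ` X)"
proof -
  obtain \<kappa> where \<kappa>: "\<And>c. (\<forall>i<CARD('n) + 1. c i \<noteq> 0) \<Longrightarrow>
     (\<exists>A\<in>X. \<forall>i<CARD('n) + 1. pair_mat (\<kappa> i) (mat_of A) = c (i :: nat))" using assms unfolding wide_def by blast
  show ?thesis
  proof (rule alg_dim_geI)
    show "pair_mat (\<kappa> i) \<in> GL_regular" for i by (rule pair_mat_regular)
    fix c :: "nat \<Rightarrow> 'k" assume "\<And>i. i < CARD('n) + 1 \<Longrightarrow> c i \<noteq> 0"
    thus "\<exists>A\<in>mat_of ` X. \<forall>i<CARD('n) + 1. pair_mat (\<kappa> i) A = c i" using \<kappa>[of c] by blast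
  qed
qed

text \<open>The matrix entries of \<open>A\<close> are no regular functions of \<open>conj_rep A\<close>, but their squares are.\<close>

lemma alg_dim_conj_wide:
  assumes "wide (X :: ('k, 'n::finite + 'n) sqm set)"
  shows "enat (CARD('n) + 1) \<le> alg_dim (mat_of ` conj_map ` X)"
proof -
  obtain \<kappa> where \<kappa>: "\<And>c. (\<forall>i<CARD('n) + 1. c i \<noteq> 0) \<Longrightarrow>
     (\<exists>A\<in>X. \<forall>i<CARD('n) + 1. pair_mat (\<kappa> i) (mat_of A) = c (i :: nat))" using assms unfolding wide_def by blast
  define f where "f i M = (\<Sum>a\<in>UNIV. \<Sum>b\<in>UNIV. (\<kappa> i $ a $ b * \<kappa> i $ a $ b) * M $ (a, sw a) $ (b, sw b))"
    for i :: nat and M :: "'k^(('n + 'n) \<times> ('n + 'n))^(('n + 'n) \<times> ('n + 'n))"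
  \<comment> \<open>Squaring is additive, so the square of a linear functional of \<open>A\<close>
    is a linear functional of the squared entries, which occur in \<open>conj_map A\<close>.\<close>
  have sq: "sum g I * sum g I = (\<Sum>i\<in>I. g i * g i)" for g :: "'n + 'n \<Rightarrow> 'k" and I
    by (induction I rule: infinite_finite_induct) (simp_all add: distrib_left distrib_right ac_simps)
  have f: "f i (mat_of (conj_map A)) = pair_mat (\<kappa> i) (mat_of A) * pair_mat (\<kappa> i) (mat_of A)" for i A
    by (simp add: f_def pair_mat_def sq conj_map_def ac_simps)
  show ?thesis
  proof (rule alg_dim_geI)
    show "f i \<in> GL_regular" for i unfolding f_def[abs_def] by (intro regular_sum regular_intros) simp_all
    fix c :: "nat \<Rightarrow> 'k" assume c: "\<And>i. i < CARD('n) + 1 \<Longrightarrow> c i \<noteq> 0"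
    have "\<forall>i. \<exists>s. s * s = c i" using sqrt_exists by blast
    then obtain s where s: "\<And>i. s i * s i = c i" by metis
    have "\<forall>i<CARD('n) + 1. s i \<noteq> 0" using c s by (metis mult_zero_left)
    from \<kappa>[OF this] obtain A where "A \<in> X" "\<forall>i<CARD('n) + 1. pair_mat (\<kappa> i) (mat_of A) = s i" by blast
    thus "\<exists>A\<in>mat_of ` conj_map ` X. \<forall>i<CARD('n) + 1. f i A = c i"
      using f s by (intro bexI[of _ "mat_of (conj_map A)"]) auto
  qed
qed

lemma Sp_group: "Sp \<subseteq> (GL :: ('k^('n::finite + 'n)^('n + 'n)) set)" "mat 1 \<in> (Sp :: ('k^('n + 'n)^('n + 'n)) set)"
  "A \<in> Sp \<Longrightarrow> B \<in> Sp \<Longrightarrow> A ** B \<in> (Sp :: ('k^('n + 'n)^('n + 'n)) set)"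
  "A \<in> Sp \<Longrightarrow> matrix_inv A \<in> (Sp :: ('k^('n + 'n)^('n + 'n)) set)"
proof -
  have "mat_of A \<in> GL" if "A \<in> isometries" for A :: "('k, 'n + 'n) sqm"
    using isometry_inverse(1,2)[OF that] unfolding sqm_eq_iff mat_of_simps GL_def invertible_def by blast
  thus "Sp \<subseteq> (GL :: ('k^('n::finite + 'n)^('n + 'n)) set)" by (auto simp: Sp_eq)
  have "mat_of (1 :: ('k, 'n + 'n) sqm) \<in> Sp" unfolding Sp_eq by (intro imageI) (simp add: isometries_def)
  thus "mat 1 \<in> (Sp :: ('k^('n + 'n)^('n + 'n)) set)" by (simp add: mat_of_simps)
  assume "A \<in> Sp"
  then obtain A' where A: "A' \<in> isometries" "A = mat_of A'" by (auto simp: Sp_eq)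
  thus "matrix_inv A \<in> Sp" using isometry_inverse(3,4)[OF A(1)] by (simp add: Sp_eq)
  assume "B \<in> Sp"
  then obtain B' where B: "B' \<in> isometries" "B = mat_of B'" by (auto simp: Sp_eq)
  have "star (A' * B') * (A' * B') = star B' * (star A' * A') * B'" by (simp add: mult.assoc)
  hence "A' * B' \<in> isometries" using A(1) B(1) by (simp add: isometries_def)
  from imageI[OF this, of mat_of] show "A ** B \<in> Sp" by (simp add: Sp_eq A(2) B(2) mat_of_simps)
qed

lemma conj_map_inverse:
  assumes "A \<in> isometries"
  shows "mat_of (conj_map A) ** mat_of (conj_map (star A)) = mat 1"
    "matrix_inv (mat_of (conj_map A)) = mat_of (conj_map (star A))"
proof -
  have "conj_map A * conj_map (star A) = 1"
    using isometry_inverse[OF assms] by (simp flip: conj_map_mult add: conj_map_1)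
  thus "mat_of (conj_map A) ** mat_of (conj_map (star A)) = mat 1" by (simp add: sqm_eq_iff mat_of_simps)
  thus "matrix_inv (mat_of (conj_map A)) = mat_of (conj_map (star A))" by (rule matrix_inv_eq)
qed

lemma PSp_group: "PSp \<subseteq> (GL :: ('k^(('n::finite + 'n) \<times> ('n + 'n))^(('n + 'n) \<times> ('n + 'n))) set)"
  "mat 1 \<in> (PSp :: ('k^(('n + 'n) \<times> ('n + 'n))^(('n + 'n) \<times> ('n + 'n))) set)"
  "A \<in> PSp \<Longrightarrow> B \<in> PSp \<Longrightarrow> A ** B \<in> (PSp :: ('k^(('n + 'n) \<times> ('n + 'n))^(('n + 'n) \<times> ('n + 'n))) set)"
  "A \<in> PSp \<Longrightarrow> matrix_inv A \<in> (PSp :: ('k^(('n + 'n) \<times> ('n + 'n))^(('n + 'n) \<times> ('n + 'n))) set)"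
proof -
  show "PSp \<subseteq> (GL :: ('k^(('n::finite + 'n) \<times> ('n + 'n))^(('n + 'n) \<times> ('n + 'n))) set)"
    using conj_map_inverse(1) by (auto simp: PSp_eq GL_def invertible_def intro: matrix_left_right_inverse1)
  have "mat_of (conj_map (1 :: ('k, 'n + 'n) sqm)) \<in> PSp" unfolding PSp_eq by (intro imageI) (simp add: isometries_def)
  thus "mat 1 \<in> (PSp :: ('k^(('n + 'n) \<times> ('n + 'n))^(('n + 'n) \<times> ('n + 'n))) set)" by (simp add: conj_map_1 mat_of_simps)
  assume "A \<in> PSp"
  then obtain A' where A: "A' \<in> isometries" "A = mat_of (conj_map A')" by (auto simp: PSp_eq)
  thus "matrix_inv A \<in> PSp" using conj_map_inverse(2)[OF A(1)] isometry_inverse(4)[OF A(1)] by (simp add: PSp_eq)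
  assume "B \<in> PSp"
  then obtain B' where B: "B' \<in> isometries" "B = mat_of (conj_map B')" by (auto simp: PSp_eq)
  have "star (A' * B') * (A' * B') = star B' * (star A' * A') * B'" by (simp add: mult.assoc)
  hence "A' * B' \<in> isometries" using A(1) B(1) by (simp add: isometries_def)
  from imageI[OF this, of "\<lambda>A. mat_of (conj_map A)"] show "A ** B \<in> PSp"
    by (simp add: PSp_eq A(2) B(2) conj_map_mult mat_of_simps image_image)
qed

lemma scalar_isometry:
  assumes "cst c \<in> (isometries :: ('k, 'n::finite + 'n) sqm set)" shows "c = 1"
proof -
  have "cst (c * c) = (1 :: ('k, 'n + 'n) sqm)" using assms by (simp add: isometries_def)
  hence "mat_of (cst (c * c) :: ('k, 'n + 'n) sqm) $ undefined $ undefined = mat_of (1 :: ('k, 'n + 'n) sqm) $ undefined $ undefined"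
    by (simp only:)
  hence "c * c = 1" by (simp add: mat_of_simps(2,7) mat_def del: cst_simps)
  hence "(c + 1) * (c + 1) = 0" by (simp add: distrib_left distrib_right two)
  thus "c = 1" by simp
qed

text \<open>The kernel consists of scalar isometries, whose square is 1, and in characteristic two
  the only such scalar is 1. So \<open>conj_map\<close> is injective on points.\<close>

lemma conj_map_eq_1:
  assumes A: "A \<in> (isometries :: ('k, 'n::finite + 'n) sqm set)" and eq: "conj_map A = 1"
  shows "A = 1"
proof -
  have "conj_map A * tens 1 A = tens A 1" using isometry_inverse[OF A] by (simp add: conj_map_def)
  hence "ad A = 0" by (simp add: eq ad_def)
  then obtain c where c: "A = cst c" using ad_eq_0 by blast
  have "c = 1" using A unfolding c by (rule scalar_isometry)
  thus ?thesis by (simp add: c)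
qed

lemma isometries_mult: "A \<in> isometries \<Longrightarrow> B \<in> isometries \<Longrightarrow> A * B \<in> (isometries :: ('k, 'n::finite + 'n) sqm set)"
proof -
  assume "A \<in> isometries" "B \<in> isometries"
  moreover have "star (A * B) * (A * B) = star B * (star A * A) * B" by (simp add: mult.assoc)
  ultimately show ?thesis by (simp add: isometries_def)
qed

lemma conj_map_inj:
  assumes A: "A \<in> isometries" and B: "B \<in> isometries" and eq: "conj_map A = conj_map (B :: ('k, 'n::finite + 'n) sqm)"
  shows "A = B"
proof -
  have "conj_map (star B * A) = conj_map (star B * B)" by (simp only: conj_map_mult eq)
  also have "\<dots> = 1" by (simp add: isometry_inverse[OF B] conj_map_1)
  finally have "star B * A = 1" using isometries_mult[OF isometry_inverse(4)[OF B] A] by (intro conj_map_eq_1)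
  hence "B * star B * A = B" by (simp add: mult.assoc)
  thus ?thesis by (simp add: isometry_inverse[OF B])
qed

end

context unip
begin

lemma wide_or_cyclic: "wide {A. A \<in> isometries \<and> A * u = u * A} \<or> (\<exists>v m. cyclic v m)"
proof -
  have "wide {A. A \<in> isometries \<and> A * u = u * A}" if "fat 1 (CARD('n) + 1) 0"
  proof -
    obtain x z where xz: "\<And>c. (\<forall>i<CARD('n) + 1. c i \<noteq> 0) \<Longrightarrow> \<exists>A. star A * A = 1 \<and> A * u = u * A \<and>
        (\<forall>i<CARD('n) + 1. form (app A (x i)) (z i) = c i)" using \<open>fat 1 (CARD('n) + 1) 0\<close> unfolding fat_def by metis
    show ?thesis unfolding wide_def
    proof (rule exI[of _ "\<lambda>i. \<chi> a b. x i $ b * z i $ sw a"], intro allI impI)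
      fix c :: "nat \<Rightarrow> 'k" assume "\<forall>i<CARD('n) + 1. c i \<noteq> 0"
      from xz[OF this] obtain A where "star A * A = 1" "A * u = u * A" "\<forall>i<CARD('n) + 1. form (app A (x i)) (z i) = c i" by blast
      thus "\<exists>A\<in>{A. A \<in> isometries \<and> A * u = u * A}. \<forall>i<CARD('n) + 1. pair_mat (\<chi> a b. x i $ b * z i $ sw a) (mat_of A) = c i"
        by (intro bexI[of _ A]) (simp_all add: isometries_def form_pair_mat)
    qed
  qed
  thus ?thesis using fat_or_cyclic unfolding cyclic_def by blast
qed

lemma sq_subspace_gsp_centralizer: "sq_subspace gsp_centralizer"
  unfolding sq_subspace_def
proof (intro conjI ballI allI)
  show "0 \<in> gsp_centralizer" unfolding gsp_centralizer_def by (auto intro: exI[of _ 0])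
  fix A assume "A \<in> gsp_centralizer"
  then obtain a b where A: "A + star A = cst a" "u * A + A * u = cst b * u" unfolding gsp_centralizer_def by blast
  fix s
  have "cst s * A + star (cst s * A) = cst s * (A + star A)" by (simp only: star_simps cst_commute[of s] distrib_right)
  hence "cst s * A + star (cst s * A) = cst (s * a)" by (simp only: A cst_simps)
  moreover have "u * (cst s * A) + cst s * A * u = cst s * (u * A + A * u)" by (simp only: cst_left[of u] distrib_left mult.assoc)
  hence "u * (cst s * A) + cst s * A * u = cst (s * b) * u" by (simp only: A cst_simps mult.assoc)
  ultimately show "cst s * A \<in> gsp_centralizer" unfolding gsp_centralizer_def by blast
next
  fix A B assume "A \<in> gsp_centralizer" "B \<in> gsp_centralizer"
  then obtain a b c d where A: "A + star A = cst a" "u * A + A * u = cst b * u"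
    and B: "B + star B = cst c" "u * B + B * u = cst d * u" unfolding gsp_centralizer_def by blast
  have "(A + B) + star (A + B) = (A + star A) + (B + star B)" by (simp add: ac_simps)
  hence "(A + B) + star (A + B) = cst (a + c)" by (simp only: A B cst_simps)
  moreover have "u * (A + B) + (A + B) * u = (u * A + A * u) + (u * B + B * u)" by (simp add: distrib_left distrib_right ac_simps)
  hence "u * (A + B) + (A + B) * u = cst (b + d) * u" by (simp only: A B cst_simps distrib_right)
  ultimately show "A + B \<in> gsp_centralizer" unfolding gsp_centralizer_def by blast
qed

lemma cst_in_gsp_centralizer: "cst c \<in> gsp_centralizer"
  unfolding gsp_centralizer_def by (auto simp: cst_commute intro!: exI[of _ 0])

end

context nilp
begin

lemma sq_subspace_gsp_centralizer: "sq_subspace gsp_centralizer"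
  unfolding sq_subspace_def
proof (intro conjI ballI allI)
  show "0 \<in> gsp_centralizer" unfolding gsp_centralizer_def by (auto intro: exI[of _ 0])
  fix A assume "A \<in> gsp_centralizer"
  then obtain a b where A: "A + star A = cst a" "e * A + A * e = cst b" unfolding gsp_centralizer_def by blast
  fix s
  have "cst s * A + star (cst s * A) = cst s * (A + star A)" by (simp only: star_simps cst_commute[of s] distrib_right)
  hence "cst s * A + star (cst s * A) = cst (s * a)" by (simp only: A cst_simps)
  moreover have "e * (cst s * A) + cst s * A * e = cst s * (e * A + A * e)" by (simp only: cst_left[of e] distrib_left mult.assoc)
  hence "e * (cst s * A) + cst s * A * e = cst (s * b)" by (simp only: A cst_simps mult.assoc)
  ultimately show "cst s * A \<in> gsp_centralizer" unfolding gsp_centralizer_def by blast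
next
  fix A B assume "A \<in> gsp_centralizer" "B \<in> gsp_centralizer"
  then obtain a b c d where A: "A + star A = cst a" "e * A + A * e = cst b"
    and B: "B + star B = cst c" "e * B + B * e = cst d" unfolding gsp_centralizer_def by blast
  have "(A + B) + star (A + B) = (A + star A) + (B + star B)" by (simp add: ac_simps)
  hence "(A + B) + star (A + B) = cst (a + c)" by (simp only: A B cst_simps)
  moreover have "e * (A + B) + (A + B) * e = (e * A + A * e) + (e * B + B * e)" by (simp add: distrib_left distrib_right ac_simps)
  hence "e * (A + B) + (A + B) * e = cst (b + d)" by (simp only: A B cst_simps distrib_right)
  ultimately show "A + B \<in> gsp_centralizer" unfolding gsp_centralizer_def by blast
qed

lemma cst_in_gsp_centralizer: "cst c \<in> gsp_centralizer"
  unfolding gsp_centralizer_def by (auto simp: cst_commute intro!: exI[of _ 0])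

lemma wide_or_cyclic:
  "wide {A. A \<in> isometries \<and> A * e = e * A} \<or> (\<exists>v. app (e ^ (2 * CARD('n) - 1)) v \<noteq> 0)"
proof (cases "e = 0")
  case True
  \<comment> \<open>The centralizer of 0 is the whole group, which is also that of the unipotent
    element 1; the latter is not cyclic because its \<open>N\<close>, hence every
    \<open>Q i\<close>, is zero.\<close>
  interpret u: unip K "1 :: ('k, 'n + 'n) sqm" by unfold_locales (auto intro: exI[of _ 1])
  have "\<not> u.cyclic v m" for v m
  proof
    assume c: "u.cyclic v m"
    have "u.N = 0" by (simp add: u.N_def)
    thus False using u.cycD(3)[OF c] by (simp add: u.Q_def)
  qed
  thus ?thesis using u.wide_or_cyclic True by auto
next
  case False
  show ?thesis
  proof (cases "vec.dim {x. app e x = 0} \<ge> 2")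
    case True
    from nilpotent_fat[OF False True] obtain \<kappa> where "\<And>c :: nat \<Rightarrow> 'k. \<exists>A. star A * A = 1 \<and> A * e = e * A \<and>
      (\<forall>i<CARD('n) + 1. pair_mat (\<kappa> i) (mat_of A) = c i)" by blast
    hence "wide {A. A \<in> isometries \<and> A * e = e * A}" unfolding wide_def isometries_def by (intro exI[of _ \<kappa>]) blast
    thus ?thesis by blast
  next
    case False
    hence "vec.dim {x. app e x = 0} \<le> 1" by simp
    thus ?thesis using cyclic_vector by blast
  qed
qed

end

lemma centralizerI:
  assumes "mat_of B \<in> H" "B * C = 1" "B * Z = Z * B"
  shows "mat_of B \<in> centralizer H (mat_of Z)"
proof -
  have "mat_of B ** mat_of C = mat 1" "mat_of B ** mat_of Z = mat_of Z ** mat_of B"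
    using assms(2,3) by (simp_all add: sqm_eq_iff mat_of_simps)
  hence "mat_of B ** mat_of Z ** matrix_inv (mat_of B) = mat_of Z" using conj_fix_iff by blast
  thus ?thesis using assms(1) by (simp add: centralizer_def)
qed

lemma fixed_mat_of:
  assumes "A * C = 1"
  shows "{X \<in> mat_of ` L. mat_of A ** X ** matrix_inv (mat_of A) = X} = mat_of ` {X \<in> L. A * X = X * A}"
proof -
  have "mat_of A ** mat_of C = mat 1" using assms by (simp add: sqm_eq_iff mat_of_simps)
  hence "mat_of A ** mat_of X ** matrix_inv (mat_of A) = mat_of X \<longleftrightarrow> A * X = X * A" for X
    by (simp add: conj_fix_iff sqm_eq_iff[of "A * X"] mat_of_simps)
  thus ?thesis by auto
qed

lemma annihilated_mat_of:
  "{X \<in> mat_of ` L. mat_of A ** X - X ** mat_of A = 0} = mat_of ` {X \<in> L. A * X = X * A}"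
  by (auto simp: sqm_eq_iff mat_of_simps)

section \<open>The four dimension formulas in Sp and PSp\<close>

context char2
begin

lemma unip_isometry:
  fixes A :: "('k, 'n::finite + 'n) sqm"
  assumes "A \<in> isometries" "A ^ 2 ^ k = 1" shows "unip A"
proof
  have "(A + 1) ^ 2 ^ k = 0" using square_add[of A 1 k] assms(2) by simp
  thus "\<exists>r. (A + 1) ^ r = 0" by blast
qed (use assms(1) in \<open>simp add: isometries_def\<close>)

lemma conj_map_isometry: "A \<in> isometries \<Longrightarrow> conj_map A * conj_map (star A) = 1"
  by (simp add: isometry_inverse conj_map_1 flip: conj_map_mult)

lemma conj_map_power: "conj_map A ^ n = conj_map (A ^ n)"
  by (induction n) (simp_all add: conj_map_1 conj_map_mult)

text \<open>Conjugation sends \<open>ad Y\<close> to \<open>ad (A * Y * star A)\<close>, and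
  \<open>ad\<close> is injective modulo scalars.\<close>

lemma conj_map_ad_commute:
  assumes A: "A \<in> isometries"
  shows "conj_map A * ad Y = ad Y * conj_map A \<longleftrightarrow> (\<exists>d. A * Y + Y * A = cst d * A)"
proof -
  have "conj_map A * ad Y = ad Y * conj_map A \<longleftrightarrow> conj_map A * ad Y * conj_map (star A) = ad Y"
  proof
    assume "conj_map A * ad Y = ad Y * conj_map A"
    thus "conj_map A * ad Y * conj_map (star A) = ad Y" by (simp add: mult.assoc conj_map_isometry[OF A])
  next
    assume "conj_map A * ad Y * conj_map (star A) = ad Y"
    hence "ad Y * conj_map A = conj_map A * ad Y * (conj_map (star A) * conj_map A)" by (metis mult.assoc)
    also have "conj_map (star A) * conj_map A = 1" using conj_map_isometry[OF isometry_inverse(4)[OF A]] by simp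
    finally show "conj_map A * ad Y = ad Y * conj_map A" by simp
  qed
  also have "conj_map A * ad Y * conj_map (star A) = ad (A * Y * star A)"
    using tens_ad[of A "star A" Y] isometry_inverse[OF A] by (simp add: conj_map_def)
  also have "ad (A * Y * star A) = ad Y \<longleftrightarrow> ad (A * Y * star A + Y) = 0" by (simp add: ad_linear)
  also have "\<dots> \<longleftrightarrow> (\<exists>d. A * Y * star A + Y = cst d)" by (rule ad_eq_0)
  also have "\<dots> \<longleftrightarrow> (\<exists>d. A * Y + Y * A = cst d * A)"
  proof (rule ex_cong1)
    fix d
    have 1: "(A * Y * star A + Y) * A = A * Y + Y * A" using isometry_inverse[OF A] by (simp add: distrib_right mult.assoc)
    have 2: "(A * Y + Y * A) * star A = A * Y * star A + Y" "cst d * A * star A = cst d"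
      using isometry_inverse[OF A] by (simp_all add: distrib_right mult.assoc)
    show "A * Y * star A + Y = cst d \<longleftrightarrow> A * Y + Y * A = cst d * A" using 1 2 by metis
  qed
  finally show ?thesis .
qed

lemma dim_fixed_Sp:
  fixes h :: "'k^('n::finite + 'n)^('n + 'n)"
  assumes h: "h \<in> Sp" "msq k h = mat 1" and reg: "\<not> enat (CARD('n) + 1) \<le> alg_dim (centralizer Sp h)"
  shows "mat_space.dim {X \<in> lie_algebra Sp. h ** X ** matrix_inv h = X} = CARD('n) + 1"
proof -
  obtain A where A: "A \<in> isometries" "h = mat_of A" using h(1) unfolding Sp_eq by blast
  have "A ^ 2 ^ k = 1" using h(2) by (simp add: A(2) msq_mat_of sqm_eq_iff mat_of_simps)
  then interpret unip K A using A(1) by (intro unip_isometry)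
  have "mat_of ` {B. B \<in> isometries \<and> B * A = A * B} \<subseteq> centralizer Sp h"
    unfolding A(2) by (auto intro!: centralizerI isometry_inverse(2) simp: Sp_eq)
  hence "\<not> wide {B. B \<in> isometries \<and> B * A = A * B}"
    using reg alg_dim_wide alg_dim_mono order_trans by blast
  then obtain v m where "cyclic v m" using wide_or_cyclic by blast
  from dim_centralizer_unipotent[OF this] show ?thesis
    unfolding A(2) lie_algebra_Sp fixed_mat_of[OF isometry_inverse(2)[OF A(1)]] by (simp add: conj_commute eq_commute)
qed

lemma dim_fixed_PSp:
  fixes h :: "'k^(('n::finite + 'n) \<times> ('n + 'n))^(('n + 'n) \<times> ('n + 'n))"
  assumes h: "h \<in> PSp" "msq k h = mat 1" and reg: "\<not> enat (CARD('n) + 1) \<le> alg_dim (centralizer PSp h)"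
  shows "mat_space.dim {X \<in> lie_algebra PSp. h ** X ** matrix_inv h = X} = CARD('n) + 1"
proof -
  obtain A :: "('k, 'n + 'n) sqm" where A: "A \<in> isometries" "h = mat_of (conj_map A)" using h(1) unfolding PSp_eq by blast
  \<comment> \<open>Unipotency is lifted from \<open>PSp\<close> to \<open>Sp\<close> as the
    condition of having 2-power order, by injectivity of \<open>conj_map\<close>.\<close>
  have "conj_map (A ^ 2 ^ k) = 1" using h(2) by (simp add: A(2) msq_mat_of sqm_eq_iff mat_of_simps conj_map_power)
  moreover have "A ^ n \<in> isometries" for n
    by (induction n) (simp_all add: isometries_mult A(1), simp add: isometries_def)
  ultimately have "A ^ 2 ^ k = 1" by (intro conj_map_eq_1)
  then interpret unip K A using A(1) by (intro unip_isometry)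
  have "mat_of ` conj_map ` {B. B \<in> isometries \<and> B * A = A * B} \<subseteq> centralizer PSp h"
  proof
    fix Z assume "Z \<in> mat_of ` conj_map ` {B. B \<in> isometries \<and> B * A = A * B}"
    then obtain B where B: "B \<in> isometries" "B * A = A * B" "Z = mat_of (conj_map B)" by blast
    have "conj_map B * conj_map A = conj_map A * conj_map B" using B(2) by (simp flip: conj_map_mult)
    moreover have "mat_of (conj_map B) \<in> PSp" using B(1) by (auto simp: PSp_eq)
    ultimately show "Z \<in> centralizer PSp h"
      unfolding A(2) B(3) using conj_map_isometry[OF B(1)] by (intro centralizerI)
  qed
  hence "\<not> wide {B. B \<in> isometries \<and> B * A = A * B}"
    using reg alg_dim_conj_wide alg_dim_mono order_trans by blast
  then obtain v m where cyc: "cyclic v m" using wide_or_cyclic by blast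
  have "{X \<in> ad ` similitudes. conj_map A * X = X * conj_map A} = ad ` gsp_centralizer"
    using conj_map_ad_commute[OF A(1)] by (auto simp: similitudes_def gsp_centralizer_def)
  hence "{X \<in> lie_algebra PSp. h ** X ** matrix_inv h = X} = mat_of ` ad ` gsp_centralizer"
    unfolding A(2) lie_algebra_PSp fixed_mat_of[OF conj_map_isometry[OF A(1)]] by simp
  thus ?thesis using dim_gsp_centralizer_unipotent[OF cyc] dim_ad[OF sq_subspace_gsp_centralizer cst_in_gsp_centralizer] by simp
qed

lemma dim_annihilated_Sp:
  fixes z :: "'k^('n::finite + 'n)^('n + 'n)"
  assumes z: "z \<in> lie_algebra Sp" "msq k z = 0" and reg: "\<not> enat (CARD('n) + 1) \<le> alg_dim (centralizer Sp z)"
  shows "mat_space.dim {X \<in> lie_algebra Sp. z ** X - X ** z = 0} = 2 * CARD('n)"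
proof -
  obtain e where e: "star e = e" "z = mat_of e" using z(1) unfolding lie_algebra_Sp by blast
  have "e ^ 2 ^ k = 0" using z(2) by (simp add: e(2) msq_mat_of sqm_eq_iff mat_of_simps)
  then interpret nilp K e using e(1) by unfold_locales blast+
  have "mat_of ` {B. B \<in> isometries \<and> B * e = e * B} \<subseteq> centralizer Sp z"
    unfolding e(2) by (auto intro!: centralizerI isometry_inverse(2) simp: Sp_eq)
  hence "\<not> wide {B. B \<in> isometries \<and> B * e = e * B}"
    using reg alg_dim_wide alg_dim_mono order_trans by blast
  then obtain v where "app (e ^ (2 * CARD('n) - 1)) v \<noteq> 0" using wide_or_cyclic by blast
  from dim_centralizer_nilpotent[OF this] show ?thesis
    unfolding e(2) lie_algebra_Sp annihilated_mat_of by (simp add: conj_commute eq_commute)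
qed

lemma dim_annihilated_PSp:
  fixes z :: "'k^(('n::finite + 'n) \<times> ('n + 'n))^(('n + 'n) \<times> ('n + 'n))"
  assumes z: "z \<in> lie_algebra PSp" "msq k z = 0" and reg: "\<not> enat (CARD('n) + 1) \<le> alg_dim (centralizer PSp z)"
  shows "mat_space.dim {X \<in> lie_algebra PSp. z ** X - X ** z = 0} = 2 * CARD('n)"
proof -
  obtain Y :: "('k, 'n + 'n) sqm" and c where Y: "Y + star Y = cst c" "z = mat_of (ad Y)"
    using z(1) unfolding lie_algebra_PSp similitudes_def by blast
  have "ad (Y ^ 2 ^ k) = 0" using z(2) by (simp add: Y(2) msq_mat_of sqm_eq_iff mat_of_simps ad_power[symmetric])
  then obtain b where b: "Y ^ 2 ^ k = cst b" using ad_eq_0 by blast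
  \<comment> \<open>\<open>Y\<close> is determined only up to scalars, and nilpotency of
    \<open>ad Y\<close> makes one of its powers a scalar \<open>b\<close>. Subtracting a root of
    \<open>b\<close> yields a nilpotent representative.\<close>
  obtain s where s: "s ^ 2 ^ k = b" using sqrt_power_exists by blast
  define e where "e = Y + cst s"
  have ek: "e ^ 2 ^ k = 0"
    unfolding e_def using square_add[of Y "cst s" k] by (simp add: cst_commute b s cst_power[symmetric])
  have ze: "z = mat_of (ad e)" 
  proof -
    have "ad (cst s :: ('k, 'n + 'n) sqm) = 0" using ad_eq_0 by blast
    thus ?thesis by (simp add: Y(2) e_def ad_linear)
  qed
  have "star e = Y + (Y + star Y) + cst s" by (simp add: e_def)
  hence se: "star e = e + cst c" by (simp add: Y(1) e_def ac_simps)
  \<comment> \<open>\<open>e\<close> and its adjoint are both nilpotent and differ by the scalar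
    \<open>c\<close>, so \<open>c\<close> is zero: the representative lies in the Lie algebra of
    \<open>Sp\<close>.\<close>
  have "star e ^ 2 ^ k = 0" using ek by (simp flip: star_power)
  hence "cst (c ^ 2 ^ k) = (0 :: ('k, 'n + 'n) sqm)"
    using square_add[of e "cst c" k] by (simp add: se cst_commute ek cst_power)
  hence "mat_of (cst (c ^ 2 ^ k) :: ('k, 'n + 'n) sqm) $ undefined $ undefined = 0" by (simp add: mat_of_simps(1))
  hence "c = 0" by (simp add: mat_of_simps(7) mat_def)
  hence "star e = e" by (simp add: se)
  then interpret nilp K e using ek by unfold_locales blast+
  have "mat_of ` conj_map ` {B. B \<in> isometries \<and> B * e = e * B} \<subseteq> centralizer PSp z"
  proof
    fix Z assume "Z \<in> mat_of ` conj_map ` {B. B \<in> isometries \<and> B * e = e * B}"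
    then obtain B where B: "B \<in> isometries" "B * e = e * B" "Z = mat_of (conj_map B)" by blast
    have "B * e + e * B = cst 0 * B" by (simp add: B(2))
    hence "conj_map B * ad e = ad e * conj_map B" using conj_map_ad_commute[OF B(1), of e] by blast
    moreover have "mat_of (conj_map B) \<in> PSp" using B(1) by (auto simp: PSp_eq)
    ultimately show "Z \<in> centralizer PSp z"
      unfolding ze B(3) using conj_map_isometry[OF B(1)] by (intro centralizerI)
  qed
  hence "\<not> wide {B. B \<in> isometries \<and> B * e = e * B}"
    using reg alg_dim_conj_wide alg_dim_mono order_trans by blast
  then obtain v where v: "app (e ^ (2 * CARD('n) - 1)) v \<noteq> 0" using wide_or_cyclic by blast
  have "ad e * ad X = ad X * ad e \<longleftrightarrow> (\<exists>d. e * X + X * e = cst d)" for X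
    using ad_commute[of e X] ad_eq_0[of "e * X - X * e"] by (metis add_eq_0(3) diff_eq_add(3))
  hence "{X \<in> ad ` similitudes. ad e * X = X * ad e} = ad ` gsp_centralizer"
    by (auto simp: similitudes_def gsp_centralizer_def)
  hence "{X \<in> lie_algebra PSp. z ** X - X ** z = 0} = mat_of ` ad ` gsp_centralizer"
    unfolding ze lie_algebra_PSp annihilated_mat_of by simp
  thus ?thesis using dim_gsp_centralizer_nilpotent[OF v] dim_ad[OF sq_subspace_gsp_centralizer cst_in_gsp_centralizer] by simp
qed

subsection \<open>Ranks\<close>

text \<open>For \<open>PSp\<close> the map \<open>f\<close> back to the isometries is only an
  injective homomorphism of abstract groups. The count of elements of exponent three is compatible
  with such a map.\<close>

lemma torus_rank_le:
  fixes f :: "'k^'m^'m \<Rightarrow> ('k, 'n::finite + 'n) sqm" and G :: "('k^'m^'m) set"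
  assumes T: "torus r T" "T \<subseteq> G"
    and f: "\<And>A. A \<in> G \<Longrightarrow> f A \<in> isometries" "\<And>A B. A \<in> G \<Longrightarrow> B \<in> G \<Longrightarrow> f (A ** B) = f A * f B" "inj_on f G"
  shows "r \<le> CARD('n)"
proof -
  from T(1)[unfolded torus_def group_var_iso_def]
  obtain \<theta> :: "(nat \<Rightarrow> 'k) \<Rightarrow> 'k^'m^'m" and \<eta> where
    *: "regular_map (Gm_regular r) (Gm_pow r) GL_regular T \<theta>" and inv: "\<forall>x\<in>Gm_pow r. \<eta> (\<theta> x) = x"
    and hom: "\<forall>x\<in>Gm_pow r. \<forall>y\<in>Gm_pow r. \<theta> (\<lambda>i. x i * y i) = \<theta> x ** \<theta> y"
    by (elim conjE exE) (rule that)
  have \<theta>: "\<theta> ` Gm_pow r \<subseteq> T" "\<And>x. x \<in> Gm_pow r \<Longrightarrow> \<eta> (\<theta> x) = x"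
    "\<And>x y. x \<in> Gm_pow r \<Longrightarrow> y \<in> Gm_pow r \<Longrightarrow> \<theta> (\<lambda>i. x i * y i) = \<theta> x ** \<theta> y"
    using * inv hom by (simp_all add: regular_map_def)
  obtain \<omega> :: 'k where w: "\<omega> * \<omega> + \<omega> + 1 = 0" "\<omega> ^ 3 = 1" "\<omega> \<noteq> 1" by (rule root3_exists)
  define W where "W = {1, \<omega>, \<omega> * \<omega>}"
  have W3: "a ^ 3 = 1" if "a \<in> W" for a using that w(2) by (auto simp: W_def power_mult_distrib)
  have W0: "a \<noteq> 0" if "a \<in> W" for a using W3[OF that] by auto
  have cW: "card W = 3"
  proof -
    have "\<omega> \<noteq> 0" using w(2) by auto
    hence "\<omega> * \<omega> \<noteq> \<omega>" using w(3) by simp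
    moreover have "\<omega> * \<omega> \<noteq> 1" using w(1) \<open>\<omega> \<noteq> 0\<close> by (metis add.commute add.right_neutral add_self(1) add_self_left(1))
    ultimately have "1 \<noteq> \<omega>" "1 \<noteq> \<omega> * \<omega>" "\<omega> \<noteq> \<omega> * \<omega>" using w(3) by (metis, metis, metis)
    thus ?thesis by (simp add: W_def)
  qed
  define P where "P = (\<Pi>\<^sub>E i\<in>{..<r}. W)"
  \<comment> \<open>Members of \<open>P\<close> are undefined from \<open>r\<close> on;
    \<open>Gm_pow\<close> wants the value 1 there.\<close>
  define g where "g p = (\<lambda>i. if i < r then p i else 1)" for p :: "nat \<Rightarrow> 'k"
  have g: "g p \<in> Gm_pow r" if "p \<in> P" for p using that W0 by (auto simp: g_def P_def Gm_pow_def PiE_iff)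
  have g3: "(\<lambda>i. g p i * g p i * g p i) = (\<lambda>_. 1)" if "p \<in> P" for p
  proof
    fix i show "g p i * g p i * g p i = 1" using that W3[of "p i"] by (auto simp: g_def P_def PiE_iff power3_eq_cube)
  qed
  have one: "(\<lambda>_. 1) \<in> Gm_pow r" by (simp add: Gm_pow_def)
  have GG: "\<theta> x \<in> G" if "x \<in> Gm_pow r" for x using that \<theta>(1) T(2) by blast
  define F where "F x = f (\<theta> x)" for x
  have F: "F (\<lambda>i. x i * y i) = F x * F y" if "x \<in> Gm_pow r" "y \<in> Gm_pow r" for x y
    using that by (simp add: F_def \<theta>(3) f(2) GG)
  have Fi: "F x \<in> isometries" if "x \<in> Gm_pow r" for x using that by (simp add: F_def f(1) GG)
  have F1: "F (\<lambda>_. 1) = 1"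
  proof -
    have "F (\<lambda>_. 1) * F (\<lambda>_. 1) = F (\<lambda>_. 1)" using F[OF one one] by simp
    hence "star (F (\<lambda>_. 1)) * F (\<lambda>_. 1) * F (\<lambda>_. 1) = star (F (\<lambda>_. 1)) * F (\<lambda>_. 1)" by (simp add: mult.assoc)
    thus ?thesis using isometry_inverse(1)[OF Fi[OF one]] by simp
  qed
  have mulG: "(\<lambda>i. x i * y i) \<in> Gm_pow r" if "x \<in> Gm_pow r" "y \<in> Gm_pow r" for x y :: "nat \<Rightarrow> 'k"
    using that by (simp add: Gm_pow_def)
  have "isometries3 (F ` g ` P)"
    unfolding isometries3_def
  proof (intro conjI ballI)
    have "finite P" unfolding P_def W_def by (intro finite_PiE) auto
    thus "finite (F ` g ` P)" by simp
    fix A assume "A \<in> F ` g ` P"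
    then obtain p where p: "p \<in> P" "A = F (g p)" by blast
    show "star A * A = 1" using isometry_inverse(1)[OF Fi[OF g[OF p(1)]]] p(2) by simp
    have "A ^ 3 = F (\<lambda>i. g p i * g p i * g p i)"
      using F[OF mulG[OF g[OF p(1)] g[OF p(1)]] g[OF p(1)]] F[OF g[OF p(1)] g[OF p(1)]] by (simp add: p(2) power3_eq_cube)
    thus "A ^ 3 = 1" using g3[OF p(1)] F1 by simp
    fix B assume "B \<in> F ` g ` P"
    then obtain q where q: "q \<in> P" "B = F (g q)" by blast
    show "A * B = B * A" using F[OF g[OF p(1)] g[OF q(1)]] F[OF g[OF q(1)] g[OF p(1)]]
      by (simp add: p(2) q(2) mult.commute)
  qed
  hence "card (F ` g ` P) \<le> 3 ^ CARD('n)" by (rule card_isometries3)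
  moreover have "card (F ` g ` P) = 3 ^ r"
  proof -
    have "inj_on g P"
    proof (rule inj_onI)
      fix p q assume pq: "p \<in> P" "q \<in> P" "g p = g q"
      show "p = q"
      proof (rule PiE_ext[of _ "{..<r}" "\<lambda>_. W"])
        show "p i = q i" if "i \<in> {..<r}" for i using fun_cong[OF pq(3), of i] that by (simp add: g_def)
      qed (use pq in \<open>simp_all add: P_def\<close>)
    qed
    moreover have "inj_on F (g ` P)"
    proof (rule inj_onI)
      fix x y assume xy: "x \<in> g ` P" "y \<in> g ` P" "F x = F y"
      have m: "x \<in> Gm_pow r" "y \<in> Gm_pow r" using xy g by auto
      have "\<theta> x = \<theta> y" using xy(3) GG m inj_onD[OF f(3)] by (auto simp: F_def)
      thus "x = y" using \<theta>(2) m by metis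
    qed
    ultimately have "card (F ` g ` P) = card P" by (simp add: card_image)
    also have "card P = 3 ^ r" by (simp add: P_def card_PiE cW)
    finally show ?thesis .
  qed
  ultimately have "(3::nat) ^ r \<le> 3 ^ CARD('n)" by simp
  thus ?thesis by (rule power_le_imp_le_exp[rotated]) simp
qed

end

subsection \<open>Transport along isomorphisms\<close>

context group_morphism
begin

lemma msq_image: "A \<in> G \<Longrightarrow> msq k A \<in> G \<and> \<phi> (msq k A) = msq k (\<phi> A)"
  by (induction k) (simp_all add: msq_simps G_mult hom)

lemma msq_d\<phi>:
  assumes "(2 :: 'k) = 0" and X: "X \<in> lie_algebra G"
  shows "msq k X \<in> lie_algebra G \<and> d\<phi> (msq k X) = msq k (d\<phi> X)"
  using X by (induction k) (simp_all add: msq_simps d\<phi>_square[OF assms(1)])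

lemma d\<phi>_0: "d\<phi> 0 = 0"
  using d\<phi>_linear(2)[of 0 0] by simp

text \<open>Polarisation of \<open>d\<phi>_square\<close> at \<open>X + Y\<close>: the mixed terms
  cancel on the side of \<open>G\<close>, hence also on the side of \<open>H\<close>.\<close>

lemma d\<phi>_commute:
  assumes two: "(2 :: 'k) = 0" and X: "X \<in> lie_algebra G" and Y: "Y \<in> lie_algebra G" and XY: "X ** Y = Y ** X"
  shows "d\<phi> X ** d\<phi> Y = d\<phi> Y ** d\<phi> X"
proof -
  have add_self: "A + A = 0" for A :: "'k^'i^'j" using two by (simp add: vec_eq_iff)
  have "X + Y \<in> lie_algebra G" using X Y by (intro mat_space.subspace_add lie_algebra_subspace)
  hence "d\<phi> ((X + Y) ** (X + Y)) = (d\<phi> X + d\<phi> Y) ** (d\<phi> X + d\<phi> Y)" by (simp add: d\<phi>_square[OF two] d\<phi>_linear)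
  also have "(X + Y) ** (X + Y) = (X ** X + Y ** Y) + (X ** Y + X ** Y)"
    by (simp add: matrix_add_ldistrib matrix_add_rdistrib XY ac_simps)
  also have "\<dots> = X ** X + Y ** Y" by (simp add: add_self)
  finally have "d\<phi> X ** d\<phi> X + d\<phi> Y ** d\<phi> Y = d\<phi> X ** d\<phi> X + d\<phi> Y ** d\<phi> Y + (d\<phi> X ** d\<phi> Y + d\<phi> Y ** d\<phi> X)"
    by (simp add: d\<phi>_linear d\<phi>_square[OF two] X Y matrix_add_ldistrib matrix_add_rdistrib ac_simps)
  hence "d\<phi> X ** d\<phi> Y + d\<phi> Y ** d\<phi> X = 0" by simp
  hence "(d\<phi> X ** d\<phi> Y + d\<phi> Y ** d\<phi> X) + d\<phi> Y ** d\<phi> X = d\<phi> Y ** d\<phi> X" by simp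
  thus ?thesis by (simp add: add.assoc add_self)
qed

end

locale group_isomorphism = p: group_morphism G H \<phi> \<Phi> + q: group_morphism H G \<psi> \<Psi>
  for G :: "('k::alg_closed_field^'m^'m) set" and H :: "('k^'n^'n) set" and \<phi> \<Phi> \<psi> \<Psi> +
  assumes \<psi>\<phi>: "\<And>A. A \<in> G \<Longrightarrow> \<psi> (\<phi> A) = A" and \<phi>\<psi>: "\<And>B. B \<in> H \<Longrightarrow> \<phi> (\<psi> B) = B"
    and inv_G: "\<And>A. A \<in> G \<Longrightarrow> matrix_inv A \<in> G" and inv_H: "\<And>B. B \<in> H \<Longrightarrow> matrix_inv B \<in> H"
    and two: "(2 :: 'k) = 0"
begin

lemma d_inverse: "X \<in> lie_algebra G \<Longrightarrow> q.d\<phi> (p.d\<phi> X) = X" "Z \<in> lie_algebra H \<Longrightarrow> p.d\<phi> (q.d\<phi> Z) = Z"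
  using group_morphism_inverse[OF p.group_morphism_axioms q.group_morphism_axioms \<psi>\<phi>]
    group_morphism_inverse[OF q.group_morphism_axioms p.group_morphism_axioms \<phi>\<psi>] by blast+

lemma inv_mult: "A \<in> GL \<Longrightarrow> A ** matrix_inv A = mat (1 :: 'k)"
  by (metis GL_def invertible_def matrix_inv_eq mem_Collect_eq)

lemma \<phi>_inv: "A \<in> G \<Longrightarrow> \<phi> (matrix_inv A) = matrix_inv (\<phi> A)"
proof -
  assume A: "A \<in> G"
  have "\<phi> A ** \<phi> (matrix_inv A) = \<phi> (A ** matrix_inv A)" by (rule p.hom[OF A inv_G[OF A], symmetric])
  also have "A ** matrix_inv A = mat 1" using A p.G(1) by (intro inv_mult) blast
  finally show ?thesis using p.\<phi>_1 by (simp add: matrix_inv_eq)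
qed

lemma dim_image_d\<phi>:
  assumes "S \<subseteq> lie_algebra G" shows "mat_space.dim (p.d\<phi> ` S) = mat_space.dim S"
proof (rule mat_mat.dim_image_eq)
  show "Vector_Spaces.linear mat_scale mat_scale p.d\<phi>"
    by (rule linear_matI[OF mat_space.vector_space_axioms]) (simp_all add: p.d\<phi>_linear)
  have "mat_space.span S \<subseteq> lie_algebra G" using assms lie_algebra_subspace by (rule mat_space.span_minimal)
  thus "inj_on p.d\<phi> (mat_space.span S)" by (intro inj_on_inverseI[of _ q.d\<phi>]) (auto simp: d_inverse)
qed

lemma image_fixed:
  assumes u: "u \<in> G"
  shows "p.d\<phi> ` {X \<in> lie_algebra G. u ** X ** matrix_inv u = X} = {Z \<in> lie_algebra H. \<phi> u ** Z ** matrix_inv (\<phi> u) = Z}"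
proof (intro set_eqI iffI)
  have uu: "u ** matrix_inv u = mat 1" using u p.G(1) by (intro inv_mult) blast
  fix Z assume "Z \<in> p.d\<phi> ` {X \<in> lie_algebra G. u ** X ** matrix_inv u = X}"
  then obtain X where X: "X \<in> lie_algebra G" "u ** X ** matrix_inv u = X" "Z = p.d\<phi> X" by blast
  show "Z \<in> {Z \<in> lie_algebra H. \<phi> u ** Z ** matrix_inv (\<phi> u) = Z}"
    using p.d\<phi>_conj[OF u inv_G[OF u] uu X(1)] X p.d\<phi>_lie_algebra[OF X(1)] by (simp add: \<phi>_inv[OF u])
next
  fix Z assume Z: "Z \<in> {Z \<in> lie_algebra H. \<phi> u ** Z ** matrix_inv (\<phi> u) = Z}"
  have h: "\<phi> u \<in> H" using u by (rule p.image)
  have hh: "\<phi> u ** matrix_inv (\<phi> u) = mat 1" using h q.G(1) by (intro inv_mult) blast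
  have "q.d\<phi> Z = u ** q.d\<phi> Z ** matrix_inv u"
    using q.d\<phi>_conj[OF h inv_H[OF h] hh, of Z] Z by (simp add: \<psi>\<phi>[OF u] \<phi>_inv[OF u, symmetric] \<psi>\<phi>[OF inv_G[OF u]])
  hence "q.d\<phi> Z \<in> {X \<in> lie_algebra G. u ** X ** matrix_inv u = X}" using Z q.d\<phi>_lie_algebra by simp
  moreover have "Z = p.d\<phi> (q.d\<phi> Z)" using Z d_inverse by simp
  ultimately show "Z \<in> p.d\<phi> ` {X \<in> lie_algebra G. u ** X ** matrix_inv u = X}" by blast
qed

lemma image_annihilated:
  assumes e: "e \<in> lie_algebra G"
  shows "p.d\<phi> ` {X \<in> lie_algebra G. e ** X - X ** e = 0} = {Z \<in> lie_algebra H. p.d\<phi> e ** Z - Z ** p.d\<phi> e = 0}"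
proof (intro set_eqI iffI)
  fix Z assume "Z \<in> p.d\<phi> ` {X \<in> lie_algebra G. e ** X - X ** e = 0}"
  then obtain X where X: "X \<in> lie_algebra G" "e ** X = X ** e" "Z = p.d\<phi> X" by auto
  show "Z \<in> {Z \<in> lie_algebra H. p.d\<phi> e ** Z - Z ** p.d\<phi> e = 0}"
    using p.d\<phi>_commute[OF two e X(1,2)] X p.d\<phi>_lie_algebra by simp
next
  fix Z assume "Z \<in> {Z \<in> lie_algebra H. p.d\<phi> e ** Z - Z ** p.d\<phi> e = 0}"
  hence Z: "Z \<in> lie_algebra H" "p.d\<phi> e ** Z = Z ** p.d\<phi> e" by simp_all
  have "q.d\<phi> Z \<in> {X \<in> lie_algebra G. e ** X - X ** e = 0}"
    using q.d\<phi>_commute[OF two p.d\<phi>_lie_algebra[OF e] Z] q.d\<phi>_lie_algebra[OF Z(1)] by (simp add: d_inverse e)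
  moreover have "Z = p.d\<phi> (q.d\<phi> Z)" using Z d_inverse by simp
  ultimately show "Z \<in> p.d\<phi> ` {X \<in> lie_algebra G. e ** X - X ** e = 0}" by blast
qed

lemma centralizer_fixed:
  assumes u: "u \<in> G" shows "centralizer H (\<phi> u) \<subseteq> \<phi> ` centralizer G u"
proof
  fix B assume "B \<in> centralizer H (\<phi> u)"
  hence B: "B \<in> H" "B ** \<phi> u ** matrix_inv B = \<phi> u" by (simp_all add: centralizer_def)
  have BB: "B ** matrix_inv B = mat 1" "\<psi> B ** matrix_inv (\<psi> B) = mat 1"
    using B(1) q.G(1) q.image[OF B(1)] p.G(1) by (auto intro: inv_mult)
  have "B ** \<phi> u = \<phi> u ** B" using B(2) conj_fix_iff[OF BB(1)] by blast
  hence "\<psi> B ** u = u ** \<psi> B" using q.hom[OF B(1) p.image[OF u]] q.hom[OF p.image[OF u] B(1)] by (simp add: \<psi>\<phi>[OF u])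
  hence "\<psi> B ** u ** matrix_inv (\<psi> B) = u" using conj_fix_iff[OF BB(2)] by blast
  hence "\<psi> B \<in> centralizer G u" using q.image[OF B(1)] by (simp add: centralizer_def)
  thus "B \<in> \<phi> ` centralizer G u" using \<phi>\<psi>[OF B(1)] by (metis imageI)
qed

lemma centralizer_lie:
  assumes e: "e \<in> lie_algebra G" shows "centralizer H (p.d\<phi> e) \<subseteq> \<phi> ` centralizer G e"
proof
  fix B assume "B \<in> centralizer H (p.d\<phi> e)"
  hence B: "B \<in> H" "B ** p.d\<phi> e ** matrix_inv B = p.d\<phi> e" by (simp_all add: centralizer_def)
  have BB: "B ** matrix_inv B = mat 1" using B(1) q.G(1) by (auto intro: inv_mult)
  have "\<psi> B ** \<psi> (matrix_inv B) = \<psi> (mat 1)" using q.hom[OF B(1) inv_H[OF B(1)]] BB by simp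
  hence inv: "matrix_inv (\<psi> B) = \<psi> (matrix_inv B)" using q.\<phi>_1 by (simp add: matrix_inv_eq)
  have "\<psi> B ** e ** matrix_inv (\<psi> B) = e"
    using q.d\<phi>_conj[OF B(1) inv_H[OF B(1)] BB p.d\<phi>_lie_algebra[OF e]] by (simp add: B(2) d_inverse e inv)
  hence "\<psi> B \<in> centralizer G e" using q.image[OF B(1)] by (simp add: centralizer_def)
  thus "B \<in> \<phi> ` centralizer G e" using \<phi>\<psi>[OF B(1)] by (metis imageI)
qed

lemma alg_dim_centralizer: "alg_dim (\<phi> ` centralizer G x) \<le> alg_dim (centralizer G x)"
  by (rule p.alg_dim_image_ge) (auto simp: centralizer_def)

lemma transport_unipotent:
  assumes dim: "\<And>h k. h \<in> H \<Longrightarrow> msq k h = mat 1 \<Longrightarrow> \<not> d \<le> alg_dim (centralizer H h) \<Longrightarrow>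
      mat_space.dim {Z \<in> lie_algebra H. h ** Z ** matrix_inv h = Z} = a"
    and u: "u \<in> G" "unipotent_mat u" and reg: "\<not> d \<le> alg_dim (centralizer G u)"
  shows "mat_space.dim {X \<in> lie_algebra G. u ** X ** matrix_inv u = X} = a"
proof -
  interpret char2 "TYPE('k)" by unfold_locales (rule two)
  \<comment> \<open>In characteristic two a unipotent element has 2-power order, a condition that
    every group isomorphism preserves.\<close>
  obtain k where "msq k (u - mat 1) = 0" using u(2) by (auto simp: unipotent_mat_def nilpotent_mat_iff)
  moreover have "u - mat 1 = mat_of (sqm_of u - 1)" by (simp only: mat_of_simps mat_of_sqm_of)
  ultimately have "mat_of ((sqm_of u - 1) ^ 2 ^ k) = mat_of 0" by (simp only: msq_mat_of mat_of_simps(1))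
  hence "(sqm_of u + 1) ^ 2 ^ k = 0" by (simp add: sqm_eq_iff)
  hence "sqm_of u ^ 2 ^ k = 1" using square_add[of "sqm_of u" 1 k] by simp
  hence "msq k u = mat 1" using msq_mat_of[of k "sqm_of u"] by (simp add: mat_of_simps)
  hence "msq k (\<phi> u) = mat 1" using p.msq_image[OF u(1), of k] p.\<phi>_1 by simp
  moreover have "\<not> d \<le> alg_dim (centralizer H (\<phi> u))"
    using reg alg_dim_mono[OF centralizer_fixed[OF u(1)]] alg_dim_centralizer[of u] by (meson order_trans)
  ultimately have "mat_space.dim {Z \<in> lie_algebra H. \<phi> u ** Z ** matrix_inv (\<phi> u) = Z} = a"
    by (intro dim p.image u(1))
  thus ?thesis unfolding image_fixed[OF u(1), symmetric] by (subst (asm) dim_image_d\<phi>) auto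
qed

lemma transport_nilpotent:
  assumes dim: "\<And>z k. z \<in> lie_algebra H \<Longrightarrow> msq k z = 0 \<Longrightarrow> \<not> d \<le> alg_dim (centralizer H z) \<Longrightarrow>
      mat_space.dim {Z \<in> lie_algebra H. z ** Z - Z ** z = 0} = a"
    and e: "e \<in> lie_algebra G" "nilpotent_mat e" and reg: "\<not> d \<le> alg_dim (centralizer G e)"
  shows "mat_space.dim {X \<in> lie_algebra G. e ** X - X ** e = 0} = a"
proof -
  obtain k where "msq k e = 0" using e(2) by (auto simp: nilpotent_mat_iff)
  hence "msq k (p.d\<phi> e) = 0" using p.msq_d\<phi>[OF two e(1), of k] p.d\<phi>_0 by simp
  moreover have "\<not> d \<le> alg_dim (centralizer H (p.d\<phi> e))"
    using reg alg_dim_mono[OF centralizer_lie[OF e(1)]] alg_dim_centralizer[of e] by (meson order_trans)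
  ultimately have "mat_space.dim {Z \<in> lie_algebra H. p.d\<phi> e ** Z - Z ** p.d\<phi> e = 0} = a"
    by (intro dim p.d\<phi>_lie_algebra e(1))
  thus ?thesis unfolding image_annihilated[OF e(1), symmetric] by (subst (asm) dim_image_d\<phi>) auto
qed

end

lemma regular_map_entries:
  fixes \<phi> :: "'x \<Rightarrow> 'k::field^'n^'n"
  assumes "regular_map R X GL_regular Y \<phi>"
  shows "\<exists>\<Phi>. \<forall>i j. \<Phi> i j \<in> R \<and> (\<forall>x\<in>X. \<Phi> i j x = \<phi> x $ i $ j)"
proof -
  define \<Phi> where "\<Phi> i j = (SOME f. f \<in> R \<and> (\<forall>x\<in>X. \<phi> x $ i $ j = f x))" for i j
  have "\<Phi> i j \<in> R \<and> (\<forall>x\<in>X. \<phi> x $ i $ j = \<Phi> i j x)" for i j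
  proof -
    have "\<forall>g\<in>GL_regular. \<exists>f\<in>R. \<forall>x\<in>X. g (\<phi> x) = f x" using assms by (simp add: regular_map_def)
    from bspec[OF this, of "\<lambda>B. B $ i $ j"] have "\<exists>f. f \<in> R \<and> (\<forall>x\<in>X. \<phi> x $ i $ j = f x)"
      by (auto intro: regular_intros)
    from someI_ex[OF this] show ?thesis unfolding \<Phi>_def .
  qed
  thus ?thesis by (intro exI[of _ \<Phi>]) simp
qed

lemma group_isomorphism_exists:
  fixes G :: "('k::alg_closed_field^'m^'m) set" and H :: "('k^'n^'n) set"
  assumes "alg_group_iso G H" and G: "algebraic_group G" and two: "(2 :: 'k) = 0"
    and H: "H \<subseteq> GL" "mat 1 \<in> H" "\<And>A B. A \<in> H \<Longrightarrow> B \<in> H \<Longrightarrow> A ** B \<in> H" "\<And>A. A \<in> H \<Longrightarrow> matrix_inv A \<in> H"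
  shows "\<exists>\<phi> \<Phi> \<psi> \<Psi>. group_isomorphism G H \<phi> \<Phi> \<psi> \<Psi>"
proof -
  obtain \<phi> \<psi> where r: "regular_map GL_regular G GL_regular H \<phi>" "regular_map GL_regular H GL_regular G \<psi>"
    and inv: "\<forall>x\<in>G. \<psi> (\<phi> x) = x" "\<forall>y\<in>H. \<phi> (\<psi> y) = y" and hom: "\<forall>x\<in>G. \<forall>x'\<in>G. \<phi> (x ** x') = \<phi> x ** \<phi> x'"
    using assms(1) unfolding alg_group_iso_def group_var_iso_def by blast
  have GG: "G \<subseteq> GL" "mat 1 \<in> G" "\<And>A B. A \<in> G \<Longrightarrow> B \<in> G \<Longrightarrow> A ** B \<in> G" "\<And>A. A \<in> G \<Longrightarrow> matrix_inv A \<in> G"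
    using G by (auto simp: algebraic_group_def zariski_closed_def)
  obtain \<Phi> where \<Phi>: "\<And>i j. \<Phi> i j \<in> GL_regular" "\<And>i j x. x \<in> G \<Longrightarrow> \<Phi> i j x = \<phi> x $ i $ j"
    using regular_map_entries[OF r(1)] by blast
  obtain \<Psi> where \<Psi>: "\<And>i j. \<Psi> i j \<in> GL_regular" "\<And>i j x. x \<in> H \<Longrightarrow> \<Psi> i j x = \<psi> x $ i $ j"
    using regular_map_entries[OF r(2)] by blast
  have im: "\<psi> y \<in> G" if "y \<in> H" for y using r(2) that by (auto simp: regular_map_def)
  \<comment> \<open>\<open>group_var_iso\<close> states multiplicativity for the forward map; the
    inverse inherits it because \<open>\<phi>\<close> is injective on \<open>G\<close>.\<close>
  have "\<psi> (y ** y') = \<psi> y ** \<psi> y'" if "y \<in> H" "y' \<in> H" for y y'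
  proof -
    have "\<phi> (\<psi> y ** \<psi> y') = y ** y'" using hom im that inv(2) by simp
    thus ?thesis using inv(1) GG(3)[OF im im] that by metis
  qed
  hence "group_isomorphism G H \<phi> \<Phi> \<psi> \<Psi>"
    by unfold_locales (use r inv hom GG H \<Phi> \<Psi> two in auto)
  thus ?thesis by blast
qed

theorem corollary1p8:
  fixes G :: "('k::alg_closed_field ^ 'm::finite ^ 'm) set"
    and u e :: "'k ^ 'm ^ 'm"
    and l :: nat
  assumes "CHAR('k) = 2"
    and "CARD('n::finite) = l"
    and "simply_connected_type_C TYPE('n) G \<or> adjoint_type_C TYPE('n) G"
    and "u \<in> G" and "unipotent_mat u" and "regular_element G u"
    and "e \<in> lie_algebra G" and "nilpotent_mat e" and "regular_element G e"
  shows "mat_space.dim {X \<in> lie_algebra G. u ** X ** matrix_inv u = X} = l + 1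
       \<and> mat_space.dim {X \<in> lie_algebra G. e ** X - X ** e = 0} = 2 * l"
proof -
  have two: "(2 :: 'k) = 0" using of_nat_CHAR[where 'a = 'k] by (simp add: assms(1))
  interpret char2 "TYPE('k)" by unfold_locales (rule two)
  \<comment> \<open>Regularity enters as an upper bound: the centralizer has the dimension of a
    maximal torus, and every torus of \<open>G\<close> has rank at most
    \<open>CARD('n)\<close>.\<close>
  have reg: "\<not> enat (CARD('n) + 1) \<le> alg_dim (centralizer G x)"
    if f: "\<And>A. A \<in> G \<Longrightarrow> f A \<in> isometries" "\<And>A B. A \<in> G \<Longrightarrow> B \<in> G \<Longrightarrow> f (A ** B) = f A * f B" "inj_on f G"
      and x: "regular_element G x" for x and f :: "'k^'m^'m \<Rightarrow> ('k, 'n + 'n) sqm"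
  proof -
    have "alg_rank G \<le> enat (CARD('n))" unfolding alg_rank_def
      by (rule Sup_least) (use torus_rank_le[OF _ _ f] in auto)
    hence "enat (CARD('n) + 1) \<le> enat (CARD('n))" if "enat (CARD('n) + 1) \<le> alg_dim (centralizer G x)"
      using \<open>enat (CARD('n) + 1) \<le> alg_dim (centralizer G x)\<close> x by (simp only: regular_element_def)
    thus ?thesis by (metis enat_ord_simps(1) Suc_eq_plus1 not_less_eq_eq order_refl)
  qed
  show ?thesis
  proof (cases "simply_connected_type_C TYPE('n) G")
    case True
    hence "alg_group_iso G (Sp :: ('k^('n + 'n)^('n + 'n)) set)" "algebraic_group G"
      by (simp_all add: simply_connected_type_C_def simple_algebraic_group_def)
    from group_isomorphism_exists[OF this two Sp_group] obtain \<phi> \<Phi> \<psi> \<Psi>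
      where "group_isomorphism G (Sp :: ('k^('n + 'n)^('n + 'n)) set) \<phi> \<Phi> \<psi> \<Psi>" by blast
    then interpret group_isomorphism G "Sp :: ('k^('n + 'n)^('n + 'n)) set" \<phi> \<Phi> \<psi> \<Psi> .
    define f where "f A = sqm_of (\<phi> A)" for A
    have "f A \<in> isometries" if "A \<in> G" for A
      using p.image[OF \<open>A \<in> G\<close>] unfolding f_def Sp_eq by auto
    moreover have "f (A ** B) = f A * f B" if "A \<in> G" "B \<in> G" for A B
      using p.hom[OF \<open>A \<in> G\<close> \<open>B \<in> G\<close>] by (simp add: f_def sqm_eq_iff mat_of_simps)
    moreover have "inj_on f G" by (intro inj_on_inverseI[of _ "\<lambda>A. \<psi> (mat_of A)"]) (simp add: f_def \<psi>\<phi>)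
    ultimately have reg': "\<not> enat (CARD('n) + 1) \<le> alg_dim (centralizer G x)" if "regular_element G x" for x
      using reg[of f x] that by blast
    show ?thesis
      using transport_unipotent[OF dim_fixed_Sp assms(4,5) reg'[OF assms(6)]]
        transport_nilpotent[OF dim_annihilated_Sp assms(7,8) reg'[OF assms(9)]] assms(2) by simp
  next
    case False
    hence "alg_group_iso G (PSp :: ('k^(('n + 'n) \<times> ('n + 'n))^(('n + 'n) \<times> ('n + 'n))) set)" "algebraic_group G"
      using assms(3) by (simp_all add: adjoint_type_C_def simple_algebraic_group_def)
    from group_isomorphism_exists[OF this two PSp_group] obtain \<phi> \<Phi> \<psi> \<Psi>
      where "group_isomorphism G (PSp :: ('k^(('n + 'n) \<times> ('n + 'n))^(('n + 'n) \<times> ('n + 'n))) set) \<phi> \<Phi> \<psi> \<Psi>" by blast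
    then interpret group_isomorphism G "PSp :: ('k^(('n + 'n) \<times> ('n + 'n))^(('n + 'n) \<times> ('n + 'n))) set" \<phi> \<Phi> \<psi> \<Psi> .
    \<comment> \<open>The lift from \<open>PSp\<close> to \<open>Sp\<close> is chosen pointwise; it
      is unique by \<open>conj_map_inj\<close>, which makes \<open>f\<close> multiplicative.\<close>
    define f :: "'k^'m^'m \<Rightarrow> ('k, 'n + 'n) sqm"
      where "f A = (SOME B. B \<in> isometries \<and> \<phi> A = mat_of (conj_map B))" for A
    have f: "f A \<in> isometries" "\<phi> A = mat_of (conj_map (f A))" if "A \<in> G" for A
    proof -
      have "\<exists>B. B \<in> (isometries :: ('k, 'n + 'n) sqm set) \<and> \<phi> A = mat_of (conj_map B)"
        using p.image[OF \<open>A \<in> G\<close>] unfolding PSp_eq by blast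
      from someI_ex[OF this] show "f A \<in> isometries" "\<phi> A = mat_of (conj_map (f A))" by (simp_all add: f_def)
    qed
    have "f (A ** B) = f A * f B" if AB: "A \<in> G" "B \<in> G" for A B
    proof (rule conj_map_inj)
      have "mat_of (conj_map (f (A ** B))) = mat_of (conj_map (f A)) ** mat_of (conj_map (f B))"
        using p.hom[OF AB] f(2) p.G_mult AB by simp
      thus "conj_map (f (A ** B)) = conj_map (f A * f B)" by (simp add: sqm_eq_iff mat_of_simps conj_map_mult)
      show "f (A ** B) \<in> isometries" by (intro f(1) p.G_mult AB)
      show "f A * f B \<in> isometries" by (intro isometries_mult f(1) AB)
    qed
    moreover have "inj_on f G" using f(2) by (intro inj_on_inverseI[of _ "\<lambda>A. \<psi> (mat_of (conj_map A))"]) (metis \<psi>\<phi>)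
    ultimately have reg': "\<not> enat (CARD('n) + 1) \<le> alg_dim (centralizer G x)" if "regular_element G x" for x
      using reg[of f x] f(1) that by blast
    show ?thesis
      using transport_unipotent[OF dim_fixed_PSp assms(4,5) reg'[OF assms(6)]]
        transport_nilpotent[OF dim_annihilated_PSp assms(7,8) reg'[OF assms(9)]] assms(2) by simp
  qed
qed

end
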